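(* Suppose that (i) $F$ is uniformly bounded from below, $F(x)>-A$ for all $x\in(-\infty,\infty)$; (ii) $F\in C^3(-\infty,\infty)$; and (iii) the exact solution $(\phi,w,U)$ on $[0,T]$ of $$\phi_t-M\Delta w=0,\qquad w=-\epsilon^2\Delta\phi+H(\phi)U,\qquad U_t=\tfrac12H(\phi)\phi_t,$$ with $\phi|_{t=0}=\phi_0$, $U|_{t=0}=\sqrt{F(\phi_0)+B}$ and periodic boundary conditions, satisfies $$\begin{cases}\phi\in L^\infty(0,T;H^2(\Omega))\cap L^\infty(0,T;W^{1,\infty}(\Omega)),\\ U\in L^\infty(0,T;W^{1,\infty}(\Omega)),\\ w\in L^\infty(0,T;H^1(\Omega)),\\ \phi_t\in L^2(0,T;H^1(\Omega))\cap L^\infty(0,T;L^\infty(\Omega)),\quad \phi_{tt},U_{tt}\in L^2(0,T;L^2(\Omega)).\end{cases}$$ Then there exist constants $s_0>0$ and $C>0$, independent of $\delta t$ and of $m$, such that whenever $\delta t\le s_0$, the solution $(\phi^n,w^n,U^n)$ of the scheme $$\frac{\phi^{n+1}-\phi^n}{\delta t}-M\Delta w^{n+1}=0,\qquad w^{n+1}=-\epsilon^2\Delta\phi^{n+1}+H(\phi^n)U^{n+1},\qquad U^{n+1}-U^n=\tfrac12H(\phi^n)(\phi^{n+1}-\phi^n)$$ satisfies, for $0\le m\le\frac{T}{\delta t}-1$, $$\|e_\phi^{m+1}\|^2+\|\nabla e_\phi^{m+1}\|^2+\|e_u^{m+1}\|^2+\delta t\sum_{n=0}^m\big(\|e_w^{n+1}\|^2+\|\nabla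 e_w^{n+1}\|^2\big)\le C\,\delta t^2 ,$$ where $e_\phi^n=\phi(t_n)-\phi^n$, $e_w^n=w(t_n)-w^n$, $e_u^n=U(t_n)-U^n$.
   Context: $\Omega\subset\mathbb R^d$ ($d=2,3$) is a rectangular box and all functions $\phi,w,\phi^n,w^n$ are periodic. $\|\cdot\|$ is the $L^2(\Omega)$ norm. $M>0$, $\epsilon>0$, $A>0$ and $B>A$ are constants. $f=F'$ and $H(\phi)=f(\phi)/\sqrt{F(\phi)+B}$. $T>0$ is fixed, $\delta t>0$ is the time step with $T=N\delta t$, $N\in\mathbb N$, and $t_n=n\delta t$ for $0\le n\le N$. The scheme starts from $\phi^0=\phi_0$, $U^0=\sqrt{F(\phi_0)+B}$; its solutions satisfy $\phi^n,w^n\in H^2(\Omega)$, $U^n\in L^2(\Omega)$, and the equations hold in $L^2(\Omega)$. *)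

theory Defs
  imports "HOL-Analysis.Analysis" "HOL-Probability.Essential_Supremum"
begin

text \<open>
  Functions on the box \<open>box a b\<close> are represented by functions \<open>'a \<Rightarrow> real\<close> (not by equivalence
  classes), so equations between elements of \<open>L\<^sup>2\<close> are almost-everywhere equations.
  A function space is a pair of its set of functions and its (semi)norm.
\<close>

type_synonym 'a fspace = "('a \<Rightarrow> real) set \<times> (('a \<Rightarrow> real) \<Rightarrow> real)"

section \<open>Classical smoothness\<close>

definition C_k :: "nat \<Rightarrow> (real \<Rightarrow> real) \<Rightarrow> bool" where
  "C_k k g \<longleftrightarrow> (\<forall>j<k. (deriv ^^ j) g differentiable_on UNIV) \<and> continuous_on UNIV ((deriv ^^ k) g)"

definition partial :: "'a list \<Rightarrow> ('a::euclidean_space \<Rightarrow> real) \<Rightarrow> 'a \<Rightarrow> real" where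
  "partial is g = foldr (\<lambda>i h x. frechet_derivative h (at x) i) is g"

definition smooth :: "('a::euclidean_space \<Rightarrow> real) \<Rightarrow> bool" where
  "smooth g \<longleftrightarrow> (\<forall>is \<in> lists Basis. partial is g differentiable_on UNIV)"

definition periodic :: "'a \<Rightarrow> 'a \<Rightarrow> ('a::euclidean_space \<Rightarrow> real) \<Rightarrow> bool" where
  "periodic a b u \<longleftrightarrow> (\<forall>x. \<forall>i\<in>Basis. u (x + ((b - a) \<bullet> i) *\<^sub>R i) = u x)"

section \<open>Lebesgue and periodic Sobolev spaces on the box\<close>

definition L2 :: "'a \<Rightarrow> 'a \<Rightarrow> 'a::euclidean_space fspace" where
  "L2 a b =
    ({u. u \<in> borel_measurable (lebesgue_on (box a b)) \<and>
         integrable (lebesgue_on (box a b)) (\<lambda>x. (u x)\<^sup>2)},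
     \<lambda>u. sqrt (LINT x|lebesgue_on (box a b). (u x)\<^sup>2))"

definition Linf :: "'a \<Rightarrow> 'a \<Rightarrow> 'a::euclidean_space fspace" where
  "Linf a b =
    ({u. u \<in> borel_measurable (lebesgue_on (box a b)) \<and>
         esssup (lebesgue_on (box a b)) (\<lambda>x. ereal \<bar>u x\<bar>) < \<infinity>},
     \<lambda>u. real_of_ereal (esssup (lebesgue_on (box a b)) (\<lambda>x. ereal \<bar>u x\<bar>)))"

text \<open>
  Weak derivatives are tested against smooth periodic functions, not only against those with
  compact support in the box: this is the distributional derivative on the torus and so
  incorporates the periodic boundary conditions (no jump of \<open>u\<close>, respectively of its
  derivatives, across opposite faces). A list of basis vectors plays the role of a multi-index.
\<close>

definition weak_deriv :: "'a \<Rightarrow> 'a \<Rightarrow> 'a list \<Rightarrow> ('a::euclidean_space \<Rightarrow> real) \<Rightarrow> ('a \<Rightarrow> real) \<Rightarrow> bool" where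
  "weak_deriv a b is u g \<longleftrightarrow>
     integrable (lebesgue_on (box a b)) u \<and> integrable (lebesgue_on (box a b)) g \<and>
     (\<forall>\<psi>. smooth \<psi> \<and> periodic a b \<psi> \<longrightarrow>
        (LINT x|lebesgue_on (box a b). u x * partial is \<psi> x) =
        (-1) ^ length is * (LINT x|lebesgue_on (box a b). g x * \<psi> x))"

text \<open>The weak derivative, unique up to null sets if it exists (arbitrary otherwise).\<close>

definition wderiv :: "'a \<Rightarrow> 'a \<Rightarrow> 'a list \<Rightarrow> ('a::euclidean_space \<Rightarrow> real) \<Rightarrow> 'a \<Rightarrow> real" where
  "wderiv a b is u = (SOME g. weak_deriv a b is u g)"

text \<open>
  For smooth periodic \<open>\<psi>\<close>, \<open>\<integral> u \<Delta>\<psi> = \<integral> g \<psi>\<close>. The individual second derivatives of \<open>u\<close> are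
  not required to exist a priori.
\<close>

definition weak_laplacian :: "'a \<Rightarrow> 'a \<Rightarrow> ('a::euclidean_space \<Rightarrow> real) \<Rightarrow> ('a \<Rightarrow> real) \<Rightarrow> bool" where
  "weak_laplacian a b u g \<longleftrightarrow>
     integrable (lebesgue_on (box a b)) u \<and> integrable (lebesgue_on (box a b)) g \<and>
     (\<forall>\<psi>. smooth \<psi> \<and> periodic a b \<psi> \<longrightarrow>
        (LINT x|lebesgue_on (box a b). u x * (\<Sum>i\<in>Basis. partial [i, i] \<psi> x)) =
        (LINT x|lebesgue_on (box a b). g x * \<psi> x))"

text \<open>
  \<open>sobolev a b k X\<close>: the periodic functions all of whose weak derivatives up to order \<open>k\<close> lie
  in \<open>X\<close>. Mixed derivatives occur in the norm once for each order of differentiation, which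
  gives an equivalent norm.
\<close>

definition sobolev :: "'a \<Rightarrow> 'a \<Rightarrow> nat \<Rightarrow> 'a::euclidean_space fspace \<Rightarrow> 'a fspace" where
  "sobolev a b k X =
    ({u. periodic a b u \<and>
         (\<forall>is. set is \<subseteq> Basis \<and> length is \<le> k \<longrightarrow> (\<exists>g \<in> fst X. weak_deriv a b is u g))},
     \<lambda>u. \<Sum>is | set is \<subseteq> Basis \<and> length is \<le> k. snd X (wderiv a b is u))"

abbreviation Hk :: "'a \<Rightarrow> 'a \<Rightarrow> nat \<Rightarrow> 'a::euclidean_space fspace" where
  "Hk a b k \<equiv> sobolev a b k (L2 a b)"

abbreviation Wkinf :: "'a \<Rightarrow> 'a \<Rightarrow> nat \<Rightarrow> 'a::euclidean_space fspace" where
  "Wkinf a b k \<equiv> sobolev a b k (Linf a b)"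

abbreviation norm2 :: "'a \<Rightarrow> 'a \<Rightarrow> ('a::euclidean_space \<Rightarrow> real) \<Rightarrow> real" where
  "norm2 a b u \<equiv> snd (L2 a b) u"

definition grad_norm2 :: "'a \<Rightarrow> 'a \<Rightarrow> ('a::euclidean_space \<Rightarrow> real) \<Rightarrow> real" where
  "grad_norm2 a b u =
     sqrt (LINT x|lebesgue_on (box a b). (\<Sum>i\<in>Basis. (wderiv a b [i] u x)\<^sup>2))"

section \<open>Functions of time with values in a function space\<close>

text \<open>Strong (Bochner) measurability of \<open>u : (0,T) \<rightarrow> L\<^sup>2\<close>.\<close>

definition strongly_measurable :: "'a \<Rightarrow> 'a \<Rightarrow> real \<Rightarrow> (real \<Rightarrow> 'a::euclidean_space \<Rightarrow> real) \<Rightarrow> bool" where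
  "strongly_measurable a b T u \<longleftrightarrow>
     (\<exists>s :: nat \<Rightarrow> real \<Rightarrow> 'a \<Rightarrow> real.
        (\<forall>k. simple_function (lebesgue_on {0<..<T}) (s k)) \<and>
        (\<forall>k. \<forall>t\<in>{0<..<T}. s k t \<in> fst (L2 a b)) \<and>
        (AE t in lebesgue_on {0<..<T}. u t \<in> fst (L2 a b) \<and>
           (\<lambda>k. norm2 a b (\<lambda>x. s k t x - u t x)) \<longlonglongrightarrow> 0))"

text \<open>
  The spaces \<open>L\<^sup>r(0,T;X)\<close> and \<open>L\<^sup>\<infinity>(0,T;X)\<close>. Measurability is required with respect to the \<open>L\<^sup>2\<close>
  norm. If \<open>X\<close> is \<open>L\<^sup>2\<close> or \<open>H\<^sup>k\<close>, this is Bochner measurability in \<open>X\<close>, by Pettis' theorem. If \<open>X\<close> is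
  the nonseparable \<open>L\<^sup>\<infinity>\<close> or \<open>W\<^sup>k\<^sup>,\<^sup>\<infinity>\<close>, it is the usual weak-* measurability, which is implied by
  strong measurability in \<open>X\<close>.
\<close>

definition time_Lp :: "'a \<Rightarrow> 'a \<Rightarrow> real \<Rightarrow> nat \<Rightarrow> 'a::euclidean_space fspace \<Rightarrow> (real \<Rightarrow> 'a \<Rightarrow> real) set" where
  "time_Lp a b T r X =
     {u. strongly_measurable a b T u \<and>
         (AE t in lebesgue_on {0<..<T}. u t \<in> fst X) \<and>
         integrable (lebesgue_on {0<..<T}) (\<lambda>t. snd X (u t) ^ r)}"

definition time_Linf :: "'a \<Rightarrow> 'a \<Rightarrow> real \<Rightarrow> 'a::euclidean_space fspace \<Rightarrow> (real \<Rightarrow> 'a \<Rightarrow> real) set" where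
  "time_Linf a b T X =
     {u. strongly_measurable a b T u \<and>
         (AE t in lebesgue_on {0<..<T}. u t \<in> fst X) \<and>
         (\<exists>K. AE t in lebesgue_on {0<..<T}. snd X (u t) \<le> K)}"

text \<open>
  \<open>g\<close> is the weak time derivative of \<open>u\<close>, i.e. \<open>\<integral> \<eta>' u dt = - \<integral> \<eta> g dt\<close> in \<open>L\<^sup>2\<close> for all test
  functions \<open>\<eta>\<close> on \<open>(0,T)\<close>; the two \<open>L\<^sup>2\<close>-valued integrals are identified by their inner
  products with all \<open>v\<close> in \<open>L\<^sup>2\<close>.
\<close>

definition weak_time_deriv ::
  "'a \<Rightarrow> 'a \<Rightarrow> real \<Rightarrow> (real \<Rightarrow> 'a::euclidean_space \<Rightarrow> real) \<Rightarrow> (real \<Rightarrow> 'a \<Rightarrow> real) \<Rightarrow> bool" where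
  "weak_time_deriv a b T u g \<longleftrightarrow>
     u \<in> time_Lp a b T 1 (L2 a b) \<and> g \<in> time_Lp a b T 1 (L2 a b) \<and>
     (\<forall>\<eta>. (\<forall>k. C_k k \<eta>) \<and> (\<exists>c d. 0 < c \<and> d < T \<and> (\<forall>t. t \<notin> {c..d} \<longrightarrow> \<eta> t = 0)) \<longrightarrow>
        (\<forall>v \<in> fst (L2 a b).
          (LINT t|lebesgue_on {0<..<T}. deriv \<eta> t * (LINT x|lebesgue_on (box a b). u t x * v x)) =
          - (LINT t|lebesgue_on {0<..<T}. \<eta> t * (LINT x|lebesgue_on (box a b). g t x * v x))))"

definition time_continuous :: "'a \<Rightarrow> 'a \<Rightarrow> real \<Rightarrow> (real \<Rightarrow> 'a::euclidean_space \<Rightarrow> real) \<Rightarrow> bool" where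
  "time_continuous a b T u \<longleftrightarrow>
     (\<forall>t\<in>{0..T}. u t \<in> fst (L2 a b) \<and>
        ((\<lambda>s. norm2 a b (\<lambda>x. u s x - u t x)) \<longlongrightarrow> 0) (at t within {0..T}))"

section \<open>The equations and the scheme\<close>

definition Hfun :: "(real \<Rightarrow> real) \<Rightarrow> real \<Rightarrow> real \<Rightarrow> real" where
  "Hfun F B s = deriv F s / sqrt (F s + B)"

text \<open>
  \<open>\<phi>t\<close> and \<open>Ut\<close> are the time derivatives of \<open>\<phi>\<close> and \<open>U\<close>. Continuity in time selects the
  representatives of \<open>\<phi>\<close>, \<open>w\<close>, \<open>U\<close> for which values at single times are meaningful.
\<close>

definition exact_solution ::
  "'a \<Rightarrow> 'a \<Rightarrow> real \<Rightarrow> real \<Rightarrow> real \<Rightarrow> real \<Rightarrow> (real \<Rightarrow> real) \<Rightarrow> ('a::euclidean_space \<Rightarrow> real) \<Rightarrow>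
   (real \<Rightarrow> 'a \<Rightarrow> real) \<Rightarrow> (real \<Rightarrow> 'a \<Rightarrow> real) \<Rightarrow> (real \<Rightarrow> 'a \<Rightarrow> real) \<Rightarrow>
   (real \<Rightarrow> 'a \<Rightarrow> real) \<Rightarrow> (real \<Rightarrow> 'a \<Rightarrow> real) \<Rightarrow> bool" where
  "exact_solution a b M \<epsilon> B T F \<phi>0 \<phi> w U \<phi>t Ut \<longleftrightarrow>
     time_continuous a b T \<phi> \<and> time_continuous a b T w \<and> time_continuous a b T U \<and>
     (\<forall>t\<in>{0..T}. periodic a b (\<phi> t) \<and> periodic a b (w t) \<and> periodic a b (U t)) \<and>
     weak_time_deriv a b T \<phi> \<phi>t \<and> weak_time_deriv a b T U Ut \<and>
     (AE t in lebesgue_on {0<..<T}. \<exists>\<Delta>w \<Delta>\<phi>.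
        weak_laplacian a b (w t) \<Delta>w \<and> weak_laplacian a b (\<phi> t) \<Delta>\<phi> \<and>
        (AE x in lebesgue_on (box a b).
           \<phi>t t x - M * \<Delta>w x = 0 \<and>
           w t x = - \<epsilon>\<^sup>2 * \<Delta>\<phi> x + Hfun F B (\<phi> t x) * U t x \<and>
           Ut t x = 1/2 * Hfun F B (\<phi> t x) * \<phi>t t x)) \<and>
     (AE x in lebesgue_on (box a b). \<phi> 0 x = \<phi>0 x \<and> U 0 x = sqrt (F (\<phi>0 x) + B))"

definition scheme_solution ::
  "'a \<Rightarrow> 'a \<Rightarrow> real \<Rightarrow> real \<Rightarrow> real \<Rightarrow> (real \<Rightarrow> real) \<Rightarrow> ('a::euclidean_space \<Rightarrow> real) \<Rightarrow>
   real \<Rightarrow> nat \<Rightarrow> (nat \<Rightarrow> 'a \<Rightarrow> real) \<Rightarrow> (nat \<Rightarrow> 'a \<Rightarrow> real) \<Rightarrow> (nat \<Rightarrow> 'a \<Rightarrow> real) \<Rightarrow> bool" where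
  "scheme_solution a b M \<epsilon> B F \<phi>0 dt N \<phi>s ws Us \<longleftrightarrow>
     (AE x in lebesgue_on (box a b). \<phi>s 0 x = \<phi>0 x \<and> Us 0 x = sqrt (F (\<phi>0 x) + B)) \<and>
     (\<forall>n\<le>N. \<phi>s n \<in> fst (Hk a b 2) \<and> Us n \<in> fst (L2 a b)) \<and>
     (\<forall>n. 1 \<le> n \<and> n \<le> N \<longrightarrow> ws n \<in> fst (Hk a b 2)) \<and>
     (\<forall>n<N. \<exists>\<Delta>w \<Delta>\<phi>.
        weak_laplacian a b (ws (n+1)) \<Delta>w \<and> weak_laplacian a b (\<phi>s (n+1)) \<Delta>\<phi> \<and>
        (AE x in lebesgue_on (box a b).
           (\<phi>s (n+1) x - \<phi>s n x) / dt - M * \<Delta>w x = 0 \<and>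
           ws (n+1) x = - \<epsilon>\<^sup>2 * \<Delta>\<phi> x + Hfun F B (\<phi>s n x) * Us (n+1) x \<and>
           Us (n+1) x - Us n x = 1/2 * Hfun F B (\<phi>s n x) * (\<phi>s (n+1) x - \<phi>s n x)))"

end

theory Submission
  imports Defs
begin

text \<open>
  Why the scheme is first order. Subtract the scheme from the exact equations at the new time and
  write \<open>E\<close>, \<open>W\<close>, \<open>Y\<close> for the errors in \<open>\<phi>\<close>, \<open>w\<close>, \<open>U\<close>. Testing the first error equation with
  \<open>W\<close>, the second with the increment of \<open>E\<close> and the third with \<open>2 Y\<close>, the terms that couple \<open>E\<close>
  and \<open>Y\<close> through \<open>H(\<phi>\<^sup>n)\<close> cancel, which is what the auxiliary variable \<open>U\<close> is for. What remains is
  an energy \<open>\<epsilon>\<^sup>2/2 |grad E|\<^sup>2 + |Y|\<^sup>2\<close> with dissipation \<open>M |grad W|\<^sup>2\<close>, driven by consistency errors of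
  first order and by the scalar product of \<open>D = (H(\<phi>(t\<^sub>n\<^sub>+\<^sub>1)) - H(\<phi>\<^sup>n)) U(t\<^sub>n\<^sub>+\<^sub>1)\<close> with the increment of \<open>E\<close>.
  The first equation turns that increment into \<open>dt M Laplace W\<close>, so \<open>D\<close> has to be small in \<open>H\<^sup>1\<close>;
  this is where the Lipschitz regularity of \<open>\<phi>\<close> and \<open>U\<close> and three derivatives of \<open>F\<close> enter
  (\<open>gsum_nonlinear_difference\<close>). A discrete Gronwall inequality closes the estimate.

  The function \<open>H\<close> is only locally Lipschitz, so the estimate needs a sup bound on \<open>\<phi>\<^sup>n\<close>. It is obtained
  by induction on \<open>n\<close>: the energy estimate up to step \<open>n + 1\<close> uses the sup bound up to step \<open>n\<close> only,
  and it gives \<open>|W|\<^sup>2 = O(dt)\<close> at step \<open>n + 1\<close>, hence \<open>|Laplace E|\<^sup>2 = O(dt)\<close> by the second equation.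
  In dimension at most three \<open>H\<^sup>2\<close> embeds into the bounded functions, so
  \<open>E\<close> is uniformly \<open>O(sqrt dt)\<close> and the sup bound persists with a margin independent of \<open>n\<close>
  (\<open>E_sup_bound\<close>, \<open>bounded_at_all\<close>).

  All function spaces are handled through Fourier coefficients. On the lattice of frequencies \<open>k\<close> of the
  box, the functions \<open>cos (k x) + sin (k x)\<close> form a real orthogonal basis (the Hartley basis), and they
  diagonalise the Laplacian: weak derivatives, \<open>H\<^sup>1\<close> norms and the equations become statements about
  coefficients, the energy argument is an inequality for each frequency that is then summed
  (\<open>mode_energy_inequality\<close>, \<open>energy_step\<close>), and the embedding of \<open>H\<^sup>2\<close> is the summability of
  \<open>(1 + |k|\<^sup>2)\<^sup>-\<^sup>2\<close> (\<open>sup_bound_H2\<close>). Completeness of the basis follows from the Stone-Weierstrass theorem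
  (\<open>coef_zero_imp_AE_zero\<close>); Riesz-Fischer and Parseval follow.

  The exact solution is given by weak derivatives in time and by equations at almost every time, while
  the scheme looks at the particular times \<open>t\<^sub>n\<close>. The bridge is that a continuous function of time is the
  integral of its weak derivative (\<open>weak_derivative_increment\<close>). Applied to the coefficients of
  \<open>\<phi>\<close>, and once more to those of \<open>M Laplace w\<close>, which are the continuous version of those of
  \<open>\<phi>t\<close>, it gives the consistency estimates for every pair of times.
\<close>

section \<open>Square integrable functions\<close>

text \<open>
  The set of \<open>L2\<close> for an arbitrary measure, so that the same facts serve the box and the time interval.
\<close>

definition sqint :: "'b measure \<Rightarrow> ('b \<Rightarrow> real) \<Rightarrow> bool" where
  "sqint M u \<longleftrightarrow> u \<in> borel_measurable M \<and> integrable M (\<lambda>x. (u x)\<^sup>2)"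

lemma sqintD:
  assumes "sqint M u"
  shows "u \<in> borel_measurable M" "integrable M (\<lambda>x. (u x)\<^sup>2)"
  using assms by (auto simp: sqint_def)

lemma sqint_mult_integrable:
  assumes "sqint M u" "sqint M v"
  shows "integrable M (\<lambda>x. u x * v x)"
proof (rule Bochner_Integration.integrable_bound)
  show "integrable M (\<lambda>x. (u x)\<^sup>2 + (v x)\<^sup>2)"
    using assms by (auto simp: sqint_def)
  show "(\<lambda>x. u x * v x) \<in> borel_measurable M"
    using assms by (auto simp: sqint_def)
  have "\<bar>p * q\<bar> \<le> p\<^sup>2 + q\<^sup>2" for p q :: real
  proof -
    have "2 * \<bar>p * q\<bar> \<le> p\<^sup>2 + q\<^sup>2"
      using sum_squares_bound[of "\<bar>p\<bar>" "\<bar>q\<bar>"] by (simp add: abs_mult)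
    moreover have "0 \<le> \<bar>p * q\<bar>" by simp
    ultimately show ?thesis by linarith
  qed
  then show "AE x in M. norm (u x * v x) \<le> norm ((u x)\<^sup>2 + (v x)\<^sup>2)"
    by (auto intro!: AE_I2 order_trans[OF _ abs_ge_self])
qed

lemma sqint_cmult [intro]: "sqint M u \<Longrightarrow> sqint M (\<lambda>x. c * u x)"
  by (auto simp: sqint_def power_mult_distrib)

lemma sqint_add [intro]:
  assumes "sqint M u" "sqint M v" shows "sqint M (\<lambda>x. u x + v x)"
  unfolding sqint_def power2_sum
  using assms sqint_mult_integrable[OF assms]
  by (auto simp: sqint_def mult.assoc intro!: Bochner_Integration.integrable_add)

lemma sqint_diff [intro]:
  assumes "sqint M u" "sqint M v" shows "sqint M (\<lambda>x. u x - v x)"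
  using sqint_add[OF assms(1) sqint_cmult[OF assms(2), of "-1"]] by simp

lemma sqint_uminus [intro]: "sqint M u \<Longrightarrow> sqint M (\<lambda>x. - u x)"
  using sqint_cmult[of M u "-1"] by simp

lemma sqint_zero [simp]: "sqint M (\<lambda>x. 0)"
  by (simp add: sqint_def)

lemma sqint_abs [intro]: "sqint M u \<Longrightarrow> sqint M (\<lambda>x. \<bar>u x\<bar>)"
  by (auto simp: sqint_def)

lemma sqint_dominated:
  assumes "sqint M v" "u \<in> borel_measurable M" "AE x in M. \<bar>u x\<bar> \<le> \<bar>v x\<bar>"
  shows "sqint M u"
  unfolding sqint_def
proof
  show "integrable M (\<lambda>x. (u x)\<^sup>2)"
  proof (rule Bochner_Integration.integrable_bound)
    show "integrable M (\<lambda>x. (v x)\<^sup>2)" "(\<lambda>x. (u x)\<^sup>2) \<in> borel_measurable M"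
      using assms by (auto simp: sqint_def)
    show "AE x in M. norm ((u x)\<^sup>2) \<le> norm ((v x)\<^sup>2)"
      using assms(3) by eventually_elim (simp add: abs_le_square_iff)
  qed
qed (use assms in auto)

lemma sqint_bounded_mult:
  assumes "sqint M u" "h \<in> borel_measurable M" "AE x in M. \<bar>h x\<bar> \<le> C"
  shows "sqint M (\<lambda>x. h x * u x)"
proof (rule sqint_dominated)
  show "sqint M (\<lambda>x. C * u x)" using assms by auto
  show "AE x in M. \<bar>h x * u x\<bar> \<le> \<bar>C * u x\<bar>"
    using assms(3) by eventually_elim (auto simp: abs_mult intro!: mult_right_mono)
qed (use assms in \<open>auto simp: sqint_def\<close>)

lemma (in finite_measure) sqint_bounded:
  assumes "u \<in> borel_measurable M" "AE x in M. \<bar>u x\<bar> \<le> C"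
  shows "sqint M u"
  by (rule sqint_dominated[of _ "\<lambda>_. C"]) (use assms in \<open>auto simp: sqint_def elim: eventually_mono\<close>)

lemma (in finite_measure) sqint_integrable:
  assumes "sqint M u" shows "integrable M u"
proof -
  have "sqint M (\<lambda>_. 1)" by (simp add: sqint_def)
  from sqint_mult_integrable[OF assms this] show ?thesis by simp
qed

lemma sqint_cong_AE:
  assumes "sqint M u" "v \<in> borel_measurable M" "AE x in M. u x = v x"
  shows "sqint M v"
  by (rule sqint_dominated[OF assms(1,2)]) (use assms(3) in \<open>auto elim: eventually_mono\<close>)

lemma integral_Cauchy_Schwarz:
  assumes u: "sqint M u" and v: "sqint M v"
  shows "(LINT x|M. u x * v x)\<^sup>2 \<le> (LINT x|M. (u x)\<^sup>2) * (LINT x|M. (v x)\<^sup>2)"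
proof -
  define A where "A = (LINT x|M. (u x)\<^sup>2)"
  define C where "C = (LINT x|M. (v x)\<^sup>2)"
  define P where "P = (LINT x|M. u x * v x)"
  \<comment> \<open>a nonnegative quadratic form has a nonnegative discriminant\<close>
  have quad: "0 \<le> A * s\<^sup>2 + 2 * P * s * t + C * t\<^sup>2" for s t
  proof -
    have "0 \<le> (LINT x|M. (s * u x + t * v x)\<^sup>2)" by simp
    also have "\<dots> = (LINT x|M. s\<^sup>2 * (u x)\<^sup>2 + (2 * s * t) * (u x * v x) + t\<^sup>2 * (v x)\<^sup>2)"
      by (rule Bochner_Integration.integral_cong) (auto simp: power2_eq_square algebra_simps)
    also have "\<dots> = s\<^sup>2 * A + (2 * s * t) * P + t\<^sup>2 * C"
      using u v sqint_mult_integrable[OF u v] by (simp add: A_def C_def P_def sqint_def)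
    finally show ?thesis by (simp add: algebra_simps)
  qed
  have "0 \<le> A" "0 \<le> C" by (simp_all add: A_def C_def)
  show ?thesis
  proof (cases "C = 0")
    case False
    have "0 \<le> A * C\<^sup>2 + 2 * P * C * (-P) + C * (-P)\<^sup>2" by (rule quad)
    also have "\<dots> = C * (A * C - P\<^sup>2)" by (simp add: power2_eq_square algebra_simps)
    finally have "0 \<le> A * C - P\<^sup>2" using \<open>0 \<le> C\<close> False
      by (simp add: zero_le_mult_iff)
    then show ?thesis by (simp add: A_def C_def P_def)
  next
    case True
    have "P = 0"
    proof (rule ccontr)
      assume "P \<noteq> 0"
      have "0 \<le> A * 1\<^sup>2 + 2 * P * 1 * (-(A+1) / P) + C * (-(A+1) / P)\<^sup>2" by (rule quad)
      then show False using True \<open>P \<noteq> 0\<close> \<open>0 \<le> A\<close> by simp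
    qed
    then show ?thesis using \<open>0 \<le> A\<close> True by (simp add: A_def C_def P_def)
  qed
qed

lemma integral_Cauchy_Schwarz_abs:
  assumes u: "sqint M u" and v: "sqint M v"
  shows "\<bar>LINT x|M. u x * v x\<bar> \<le> sqrt (LINT x|M. (u x)\<^sup>2) * sqrt (LINT x|M. (v x)\<^sup>2)"
  using real_sqrt_le_mono[OF integral_Cauchy_Schwarz[OF assms]] by (simp add: real_sqrt_mult)

lemma power2_sum_le: "(p + q)\<^sup>2 \<le> 2 * p\<^sup>2 + 2 * (q::real)\<^sup>2"
  using sum_squares_bound[of p q] by (simp add: power2_eq_square algebra_simps)

lemma integral_square_add_le:
  assumes "sqint M u" "sqint M v"
  shows "(LINT x|M. (u x + v x)\<^sup>2) \<le> 2 * (LINT x|M. (u x)\<^sup>2) + 2 * (LINT x|M. (v x)\<^sup>2)"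
proof -
  have "(LINT x|M. (u x + v x)\<^sup>2) \<le> (LINT x|M. 2 * (u x)\<^sup>2 + 2 * (v x)\<^sup>2)"
    using assms sqint_add[OF assms] by (intro integral_mono) (auto simp: sqint_def power2_sum_le)
  also have "\<dots> = 2 * (LINT x|M. (u x)\<^sup>2) + 2 * (LINT x|M. (v x)\<^sup>2)"
    using assms by (simp add: sqint_def)
  finally show ?thesis .
qed

lemma integral_square_bounded_mult_le:
  assumes "sqint M u" "h \<in> borel_measurable M" "AE x in M. \<bar>h x\<bar> \<le> C"
  shows "(LINT x|M. (h x * u x)\<^sup>2) \<le> C\<^sup>2 * (LINT x|M. (u x)\<^sup>2)"
proof -
  have "(LINT x|M. (h x * u x)\<^sup>2) \<le> (LINT x|M. C\<^sup>2 * (u x)\<^sup>2)"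
  proof (rule integral_mono_AE)
    show "AE x in M. (h x * u x)\<^sup>2 \<le> C\<^sup>2 * (u x)\<^sup>2"
      using assms(3) by eventually_elim
        (simp add: power_mult_distrib mult_right_mono abs_le_square_iff power2_le_iff_abs_le)
  qed (use sqint_bounded_mult[OF assms] assms(1) in \<open>auto simp: sqint_def\<close>)
  then show ?thesis by simp
qed

lemma integral_square_mono:
  assumes "sqint M u" "sqint M v" "AE x in M. \<bar>u x\<bar> \<le> \<bar>v x\<bar>"
  shows "(LINT x|M. (u x)\<^sup>2) \<le> (LINT x|M. (v x)\<^sup>2)"
  using assms(3) by (intro integral_mono_AE)
    (use assms in \<open>auto simp: sqint_def abs_le_square_iff elim: eventually_mono\<close>)

text \<open>Testing with the function itself turns a bound on a functional into a bound on the norm.\<close>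

lemma integral_square_le_by_duality:
  assumes "sqint M u" "c \<ge> 0"
    and "\<And>v. sqint M v \<Longrightarrow> (LINT x|M. u x * v x) \<le> c * sqrt (LINT x|M. (v x)\<^sup>2)"
  shows "(LINT x|M. (u x)\<^sup>2) \<le> c\<^sup>2"
proof -
  define A where "A = (LINT x|M. (u x)\<^sup>2)"
  have "0 \<le> A" by (simp add: A_def)
  have "A \<le> c * sqrt A" using assms(3)[OF assms(1)] by (simp add: A_def power2_eq_square)
  then have "sqrt A * sqrt A \<le> c * sqrt A" using \<open>0 \<le> A\<close> by simp
  then have "sqrt A \<le> c" using \<open>0 \<le> A\<close> \<open>c \<ge> 0\<close>
    by (cases "A = 0") (auto simp: mult_le_cancel_right simp del: real_sqrt_mult_self)
  then show ?thesis using \<open>0 \<le> A\<close> unfolding A_def[symmetric] by (metis real_sqrt_le_iff real_sqrt_abs2 power2_eq_square abs_of_nonneg real_sqrt_ge_zero order_trans assms(2))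
qed

lemma L2_tendsto_imp_weak:
  assumes "\<And>j. sqint M (u j)" "sqint M v" "sqint M w"
    and "((\<lambda>j. LINT x|M. (u j x - v x)\<^sup>2) \<longlongrightarrow> 0) F"
  shows "((\<lambda>j. LINT x|M. u j x * w x) \<longlongrightarrow> (LINT x|M. v x * w x)) F"
proof -
  have "((\<lambda>j. (LINT x|M. u j x * w x) - (LINT x|M. v x * w x)) \<longlongrightarrow> 0) F"
  proof (rule Lim_null_comparison)
    have "norm ((LINT x|M. u j x * w x) - (LINT x|M. v x * w x))
        \<le> sqrt (LINT x|M. (u j x - v x)\<^sup>2) * sqrt (LINT x|M. (w x)\<^sup>2)" for j
    proof -
      have "(LINT x|M. u j x * w x) - (LINT x|M. v x * w x) = (LINT x|M. (u j x - v x) * w x)"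
        using assms by (simp add: left_diff_distrib sqint_mult_integrable)
      then show ?thesis using integral_Cauchy_Schwarz_abs[of M "\<lambda>x. u j x - v x" w] assms by auto
    qed
    then show "\<forall>\<^sub>F j in F. norm ((LINT x|M. u j x * w x) - (LINT x|M. v x * w x))
        \<le> sqrt (LINT x|M. (u j x - v x)\<^sup>2) * sqrt (LINT x|M. (w x)\<^sup>2)" by simp
    show "((\<lambda>j. sqrt (LINT x|M. (u j x - v x)\<^sup>2) * sqrt (LINT x|M. (w x)\<^sup>2)) \<longlongrightarrow> 0) F"
      using tendsto_mult[OF tendsto_real_sqrt[OF assms(4)] tendsto_const] by simp
  qed
  then show ?thesis by (simp add: Lim_null[symmetric])
qed

text \<open>
  The excess of \<open>|v|\<close> over \<open>K\<close> is dominated by the distance of \<open>v\<close> to any function bounded by \<open>K\<close>.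
  Only frequently many members of the family have to be bounded, because bounds on the exact solution
  are known at almost every time only.
\<close>

lemma AE_bound_closed_L2:
  assumes "\<exists>\<^sub>F j in F. sqint M (u j) \<and> (AE x in M. \<bar>u j x\<bar> \<le> K)" "sqint M v"
    and "((\<lambda>j. LINT x|M. (u j x - v x)\<^sup>2) \<longlongrightarrow> 0) F"
  shows "AE x in M. \<bar>v x\<bar> \<le> K"
proof -
  \<comment> \<open>the excess, which has to vanish\<close>
  define e where "e = (\<lambda>x. max 0 (\<bar>v x\<bar> - K))"
  have e: "0 \<le> e x" "\<bar>e x\<bar> \<le> \<bar>v x\<bar> + \<bar>K\<bar>" for x by (auto simp: e_def)
  have em: "e \<in> borel_measurable M" using assms(2) by (auto simp: sqint_def e_def)
  have *: "integrable M (\<lambda>x. (e x)\<^sup>2) \<and> (LINT x|M. (e x)\<^sup>2) \<le> (LINT x|M. (u j x - v x)\<^sup>2)"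
    if j: "sqint M (u j)" "AE x in M. \<bar>u j x\<bar> \<le> K" for j
  proof -
    have d: "sqint M (\<lambda>x. u j x - v x)" using j assms(2) by auto
    have le: "AE x in M. \<bar>e x\<bar> \<le> \<bar>u j x - v x\<bar>"
      using j(2) by eventually_elim (auto simp: e_def)
    have "sqint M e" by (rule sqint_dominated[OF d em le])
    then show ?thesis using integral_square_mono[OF _ d le] by (auto simp: sqint_def)
  qed
  have int: "integrable M (\<lambda>x. (e x)\<^sup>2)" using frequently_ex[OF assms(1)] * by blast
  have "(LINT x|M. (e x)\<^sup>2) \<le> 0"
  proof (rule ccontr)
    assume "\<not> ?thesis"
    then have "\<forall>\<^sub>F j in F. (LINT x|M. (u j x - v x)\<^sup>2) < (LINT x|M. (e x)\<^sup>2)"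
      using order_tendstoD(2)[OF assms(3)] by simp
    then have "\<forall>\<^sub>F j in F. \<not> (sqint M (u j) \<and> (AE x in M. \<bar>u j x\<bar> \<le> K))"
      by eventually_elim (use * in fastforce)
    then show False using assms(1) by (simp add: frequently_def)
  qed
  then have "(LINT x|M. (e x)\<^sup>2) = 0" by (simp add: order_antisym)
  then have "AE x in M. (e x)\<^sup>2 = 0"
    using integral_nonneg_eq_0_iff_AE[OF int] by simp
  then show ?thesis by eventually_elim (auto simp: e_def max_def split: if_splits)
qed

lemma L2_tendsto_imp_weak_eventually:
  assumes "\<forall>\<^sub>F j in F. sqint M (u j)" "sqint M v" "sqint M w"
    and "((\<lambda>j. LINT x|M. (u j x - v x)\<^sup>2) \<longlongrightarrow> 0) F"
  shows "((\<lambda>j. LINT x|M. u j x * w x) \<longlongrightarrow> (LINT x|M. v x * w x)) F"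
proof -
  define u' where "u' = (\<lambda>j. if sqint M (u j) then u j else v)"
  have ev: "\<forall>\<^sub>F j in F. u' j = u j" using assms(1) by eventually_elim (simp add: u'_def)
  have "((\<lambda>j. LINT x|M. (u' j x - v x)\<^sup>2) \<longlongrightarrow> 0) F"
    by (rule Lim_transform_eventually[OF assms(4)]) (use ev in eventually_elim, simp)
  then have "((\<lambda>j. LINT x|M. u' j x * w x) \<longlongrightarrow> (LINT x|M. v x * w x)) F"
    by (intro L2_tendsto_imp_weak) (use assms in \<open>auto simp: u'_def\<close>)
  then show ?thesis
    by (rule Lim_transform_eventually) (use ev in eventually_elim, simp)
qed

text \<open>
  Expand around the limits; the product of the two deviations is estimated by Cauchy-Schwarz.
\<close>

lemma L2_tendsto_product:
  assumes u: "\<And>j. sqint M (u j)" "sqint M u0" "((\<lambda>j. LINT x|M. (u j x - u0 x)\<^sup>2) \<longlongrightarrow> 0) F"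
    and v: "\<And>j. sqint M (v j)" "sqint M v0" "((\<lambda>j. LINT x|M. (v j x - v0 x)\<^sup>2) \<longlongrightarrow> 0) F"
  shows "((\<lambda>j. LINT x|M. u j x * v j x) \<longlongrightarrow> (LINT x|M. u0 x * v0 x)) F"
proof -
  have c: "((\<lambda>j. LINT x|M. (u j x - u0 x) * (v j x - v0 x)) \<longlongrightarrow> 0) F"
  proof (rule Lim_null_comparison)
    show "\<forall>\<^sub>F j in F. norm (LINT x|M. (u j x - u0 x) * (v j x - v0 x))
        \<le> sqrt (LINT x|M. (u j x - u0 x)\<^sup>2) * sqrt (LINT x|M. (v j x - v0 x)\<^sup>2)"
      using u v integral_Cauchy_Schwarz_abs[OF sqint_diff[OF u(1,2)] sqint_diff[OF v(1,2)]] by simp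
    show "((\<lambda>j. sqrt (LINT x|M. (u j x - u0 x)\<^sup>2) * sqrt (LINT x|M. (v j x - v0 x)\<^sup>2)) \<longlongrightarrow> 0) F"
      using tendsto_mult[OF tendsto_real_sqrt[OF u(3)] tendsto_real_sqrt[OF v(3)]] by simp
  qed
  have "(LINT x|M. u j x * v j x) = (LINT x|M. (u j x - u0 x) * (v j x - v0 x))
      + (LINT x|M. u j x * v0 x) + (LINT x|M. v j x * u0 x) - (LINT x|M. u0 x * v0 x)" for j
    using u v by (simp add: algebra_simps sqint_mult_integrable)
  moreover have "((\<lambda>j. (LINT x|M. (u j x - u0 x) * (v j x - v0 x))
      + (LINT x|M. u j x * v0 x) + (LINT x|M. v j x * u0 x) - (LINT x|M. u0 x * v0 x)) \<longlongrightarrow>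
      0 + (LINT x|M. u0 x * v0 x) + (LINT x|M. v0 x * u0 x) - (LINT x|M. u0 x * v0 x)) F"
    by (intro tendsto_intros c L2_tendsto_imp_weak u v)
  ultimately show ?thesis by (simp add: mult.commute)
qed

lemma L2_tendsto_bounded_mult:
  assumes u: "\<And>j. sqint M (u j)" "sqint M u0" "((\<lambda>j. LINT x|M. (u j x - u0 x)\<^sup>2) \<longlongrightarrow> 0) F"
    and m: "m \<in> borel_measurable M" "AE x in M. \<bar>m x\<bar> \<le> C"
  shows "((\<lambda>j. LINT x|M. (m x * u j x - m x * u0 x)\<^sup>2) \<longlongrightarrow> 0) F"
proof (rule Lim_null_comparison)
  show "\<forall>\<^sub>F j in F. norm (LINT x|M. (m x * u j x - m x * u0 x)\<^sup>2) \<le> C\<^sup>2 * (LINT x|M. (u j x - u0 x)\<^sup>2)"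
    using integral_square_bounded_mult_le[OF sqint_diff[OF u(1,2)] m] by (simp add: right_diff_distrib)
  show "((\<lambda>j. C\<^sup>2 * (LINT x|M. (u j x - u0 x)\<^sup>2)) \<longlongrightarrow> 0) F"
    using tendsto_mult[OF tendsto_const u(3), of "C\<^sup>2"] by simp
qed

lemma Lipschitz_integral_square:
  fixes h :: "real \<Rightarrow> real"
  assumes h: "\<And>p q. \<bar>h p - h q\<bar> \<le> C * \<bar>p - q\<bar>" and m: "h \<in> borel_measurable borel"
    and u: "sqint M u" "sqint M v"
  shows "sqint M (\<lambda>x. h (u x) - h (v x))"
    "(LINT x|M. (h (u x) - h (v x))\<^sup>2) \<le> C\<^sup>2 * (LINT x|M. (u x - v x)\<^sup>2)"
proof -
  have d: "sqint M (\<lambda>x. C * (u x - v x))" using u by auto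
  have C: "C \<ge> 0" using h[of 1 0] by simp
  have le: "AE x in M. \<bar>h (u x) - h (v x)\<bar> \<le> \<bar>C * (u x - v x)\<bar>"
    using h C by (intro AE_I2) (simp add: abs_mult)
  have meas: "(\<lambda>x. h (u x) - h (v x)) \<in> borel_measurable M"
    using u m by (auto simp: sqint_def)
  show s: "sqint M (\<lambda>x. h (u x) - h (v x))" by (rule sqint_dominated[OF d meas le])
  from integral_square_mono[OF s d le]
  show "(LINT x|M. (h (u x) - h (v x))\<^sup>2) \<le> C\<^sup>2 * (LINT x|M. (u x - v x)\<^sup>2)"
    by (simp add: power_mult_distrib)
qed

lemma Lipschitz_borel_measurable:
  fixes h :: "real \<Rightarrow> real"
  assumes h: "\<And>p q. \<bar>h p - h q\<bar> \<le> C * \<bar>p - q\<bar>"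
  shows "continuous_on UNIV h" "h \<in> borel_measurable borel"
proof -
  have C: "C \<ge> 0" using h[of 1 0] by simp
  have "C-lipschitz_on UNIV h"
    by (rule lipschitz_onI) (use h C in \<open>auto simp: dist_real_def\<close>)
  then show "continuous_on UNIV h" by (rule lipschitz_on_continuous_on)
  then show "h \<in> borel_measurable borel" by (rule borel_measurable_continuous_onI)
qed

text \<open>
  Test with the sign of \<open>d\<close> times the excess of \<open>|d|\<close> over \<open>c\<close>.
\<close>

lemma (in finite_measure) AE_bound_by_duality:
  assumes d: "sqint M d" and c: "0 \<le> c"
    and dual: "\<And>v. sqint M v \<Longrightarrow> (LINT x|M. d x * v x) \<le> c * (LINT x|M. \<bar>v x\<bar>)"
  shows "AE x in M. \<bar>d x\<bar> \<le> c"
proof -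
  define e where "e = (\<lambda>x. max 0 (\<bar>d x\<bar> - c))"
  define v where "v = (\<lambda>x. sgn (d x) * e x)"
  have dm: "d \<in> borel_measurable M" using d by (simp add: sqint_def)
  have em: "e \<in> borel_measurable M" unfolding e_def using dm by auto
  have es: "sqint M e"
    by (rule sqint_dominated[OF d em]) (use c in \<open>auto simp: e_def\<close>)
  have vs: "sqint M v"
    by (rule sqint_dominated[OF es]) (use dm em in \<open>auto simp: v_def abs_mult abs_sgn_eq\<close>)
  have "\<bar>v x\<bar> = e x" "d x * v x = \<bar>d x\<bar> * e x" for x
    using c by (auto simp: v_def e_def abs_mult abs_sgn_eq sgn_if)
  then have "(LINT x|M. \<bar>d x\<bar> * e x) \<le> c * (LINT x|M. e x)" using dual[OF vs] by simp
  moreover have "(LINT x|M. (e x)\<^sup>2) = (LINT x|M. \<bar>d x\<bar> * e x - c * e x)"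
    by (rule Bochner_Integration.integral_cong) (auto simp: e_def power2_eq_square max_def algebra_simps)
  ultimately have "(LINT x|M. (e x)\<^sup>2) \<le> 0"
    using sqint_mult_integrable[OF sqint_abs[OF d] es] sqint_integrable[OF es] by simp
  then have "(LINT x|M. (e x)\<^sup>2) = 0" by (simp add: order_antisym)
  then have "AE x in M. (e x)\<^sup>2 = 0"
    using integral_nonneg_eq_0_iff_AE[OF sqintD(2)[OF es]] by simp
  then show ?thesis by eventually_elim (auto simp: e_def max_def split: if_splits)
qed

section \<open>Directional derivatives and integration by parts over a period\<close>

text \<open>
  Differentiability along one direction is all that integration by parts in that direction needs, and
  it is stable under the chain rule with a function of one variable.
\<close>

definition dir_deriv :: "'a::real_normed_vector \<Rightarrow> ('a \<Rightarrow> real) \<Rightarrow> ('a \<Rightarrow> real) \<Rightarrow> bool" where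
  "dir_deriv i g g' \<longleftrightarrow> (\<forall>x s. ((\<lambda>s. g (x + s *\<^sub>R i)) has_real_derivative g' (x + s *\<^sub>R i)) (at s))"

lemma dir_deriv_mult:
  assumes "dir_deriv i f f'" "dir_deriv i g g'"
  shows "dir_deriv i (\<lambda>x. f x * g x) (\<lambda>x. f' x * g x + f x * g' x)"
  using assms unfolding dir_deriv_def by (auto intro!: derivative_eq_intros)

lemma dir_deriv_cmult: "dir_deriv i f f' \<Longrightarrow> dir_deriv i (\<lambda>x. c * f x) (\<lambda>x. c * f' x)"
  unfolding dir_deriv_def by (auto intro!: derivative_eq_intros)

lemma dir_deriv_sum:
  assumes "\<And>k. k \<in> S \<Longrightarrow> dir_deriv i (f k) (f' k)"
  shows "dir_deriv i (\<lambda>x. \<Sum>k\<in>S. f k x) (\<lambda>x. \<Sum>k\<in>S. f' k x)"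
  using assms unfolding dir_deriv_def by (auto intro!: DERIV_sum)

lemma dir_deriv_chain:
  assumes "dir_deriv i f f'" "\<And>y. (h has_real_derivative h' y) (at y)"
  shows "dir_deriv i (\<lambda>x. h (f x)) (\<lambda>x. h' (f x) * f' x)"
  unfolding dir_deriv_def
proof (intro allI)
  fix x s
  show "((\<lambda>s. h (f (x + s *\<^sub>R i))) has_real_derivative h' (f (x + s *\<^sub>R i)) * f' (x + s *\<^sub>R i)) (at s)"
    by (rule DERIV_chain2[OF assms(2)]) (use assms(1) in \<open>simp add: dir_deriv_def\<close>)
qed

lemma has_derivative_imp_dir_deriv:
  assumes "\<And>x. (g has_derivative D x) (at x)"
  shows "dir_deriv i g (\<lambda>x. D x i)"
  unfolding dir_deriv_def
proof (intro allI)
  fix x s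
  have "((\<lambda>s. x + s *\<^sub>R i) has_derivative (\<lambda>t. t *\<^sub>R i)) (at s)"
    by (auto intro!: derivative_eq_intros)
  from has_derivative_compose[OF this assms]
  have d: "((\<lambda>s. g (x + s *\<^sub>R i)) has_derivative (\<lambda>t. D (x + s *\<^sub>R i) (t *\<^sub>R i))) (at s)" .
  have "linear (D (x + s *\<^sub>R i))" using assms has_derivative_linear by blast
  then have "(\<lambda>t. D (x + s *\<^sub>R i) (t *\<^sub>R i)) = (*) (D (x + s *\<^sub>R i) i)"
    by (auto simp: linear_scale)
  with d show "((\<lambda>s. g (x + s *\<^sub>R i)) has_real_derivative D (x + s *\<^sub>R i) i) (at s)"
    by (simp add: has_field_derivative_def)
qed

lemma differentiable_imp_dir_deriv:
  assumes "g differentiable_on UNIV"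
  shows "dir_deriv i g (partial [i] g)"
proof -
  have "(g has_derivative frechet_derivative g (at x)) (at x)" for x
    using assms by (simp add: differentiable_on_def frechet_derivative_works[symmetric])
  from has_derivative_imp_dir_deriv[of g "\<lambda>x. frechet_derivative g (at x)", OF this]
  show ?thesis by (simp add: partial_def)
qed

locale periodic_box =
  fixes a b :: "'a::euclidean_space"
  assumes box_ne: "box a b \<noteq> {}"
begin

abbreviation \<mu> :: "'a measure" where "\<mu> \<equiv> lebesgue_on (box a b)"

definition side :: "'a \<Rightarrow> real" where "side i = (b - a) \<bullet> i"

definition vol :: real where "vol = measure lebesgue (box a b)"

lemma side_pos: "i \<in> Basis \<Longrightarrow> side i > 0"
  using box_ne by (auto simp: side_def box_ne_empty inner_diff_left)

lemma vol_pos: "vol > 0"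
  using box_ne by (simp add: vol_def box_ne_empty prod_pos inner_diff_left less_imp_le)

sublocale finite_measure \<mu>
  by (rule finite_measure_lebesgue_on) simp

lemma measure_box_total: "measure \<mu> (space \<mu>) = vol"
  by (simp add: vol_def measure_restrict_space)

lemma continuous_measurable_box:
  fixes g :: "'a \<Rightarrow> real"
  assumes "continuous_on UNIV g" shows "g \<in> borel_measurable \<mu>"
  using assms by (intro continuous_imp_measurable_on_sets_lebesgue) (auto intro: continuous_on_subset)

lemma continuous_bounded_box:
  fixes g :: "'a \<Rightarrow> real"
  assumes "continuous_on UNIV g"
  obtains C where "C > 0" "\<And>x. x \<in> box a b \<Longrightarrow> \<bar>g x\<bar> \<le> C"
proof -
  have "compact (g ` cbox a b)"
    by (rule compact_continuous_image) (use assms continuous_on_subset in auto)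
  then obtain C where "C > 0" "\<forall>y\<in>g ` cbox a b. norm y \<le> C"
    using compact_imp_bounded bounded_pos by metis
  then show ?thesis using that box_subset_cbox[of a b] by auto
qed

lemma continuous_sqint_box:
  fixes g :: "'a \<Rightarrow> real"
  assumes "continuous_on UNIV g" shows "sqint \<mu> g"
proof -
  obtain C where "\<And>x. x \<in> box a b \<Longrightarrow> \<bar>g x\<bar> \<le> C" using continuous_bounded_box[OF assms] by blast
  then show ?thesis
    by (intro sqint_bounded[of _ C] continuous_measurable_box[OF assms] AE_I2) auto
qed

lemma continuous_integrable_box:
  fixes g :: "'a \<Rightarrow> real"
  assumes "continuous_on UNIV g" shows "integrable \<mu> g"
  by (rule sqint_integrable[OF continuous_sqint_box[OF assms]])

lemma integrable_mult_continuous: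
  fixes g :: "'a \<Rightarrow> real"
  assumes "continuous_on UNIV g" "integrable \<mu> u" shows "integrable \<mu> (\<lambda>x. u x * g x)"
proof -
  obtain C where C: "C > 0" "\<And>x. x \<in> box a b \<Longrightarrow> \<bar>g x\<bar> \<le> C" using continuous_bounded_box[OF assms(1)] by blast
  show ?thesis
  proof (rule Bochner_Integration.integrable_bound)
    show "integrable \<mu> (\<lambda>x. C * u x)" using assms by auto
    show "(\<lambda>x. u x * g x) \<in> borel_measurable \<mu>"
      using continuous_measurable_box[OF assms(1)] assms(2) by auto
    show "AE x in \<mu>. norm (u x * g x) \<le> norm (C * u x)"
    proof (rule AE_I2)
      fix x assume "x \<in> space \<mu>"
      then have "\<bar>u x\<bar> * \<bar>g x\<bar> \<le> \<bar>u x\<bar> * C" using C(2)[of x] by (intro mult_left_mono) auto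
      then show "norm (u x * g x) \<le> norm (C * u x)" using C(1) by (simp add: abs_mult mult.commute)
    qed
  qed
qed

lemma integral_box_eq_cbox:
  fixes g :: "'a \<Rightarrow> real"
  assumes "continuous_on UNIV g" shows "(LINT x|\<mu>. g x) = integral (cbox a b) g"
  using lebesgue_integral_eq_integral[OF continuous_integrable_box[OF assms]]
  by (simp add: integral_open_interval)

text \<open>The integral over one period does not depend on where the period starts.\<close>

lemma integral_periodic_shift:
  fixes g :: "'a \<Rightarrow> real"
  assumes i: "i \<in> Basis" and g: "continuous_on UNIV g"
    and per: "\<And>x. g (x + side i *\<^sub>R i) = g x" and h: "0 \<le> h" "h \<le> side i"
  shows "integral (cbox a b) (\<lambda>x. g (x + h *\<^sub>R i)) = integral (cbox a b) g"
proof -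
  define c where "c = h *\<^sub>R i"
  define L where "L = side i *\<^sub>R i"
  have int: "g integrable_on cbox p q" for p q
    by (rule integrable_continuous) (use g continuous_on_subset in auto)
  have ab: "a \<bullet> i < b \<bullet> i" using box_ne i by (auto simp: box_ne_empty)
  have s: "side i = b \<bullet> i - a \<bullet> i" by (simp add: side_def inner_diff_left)
  have ci: "c \<bullet> i = h" "L \<bullet> i = side i" using i by (auto simp: c_def L_def)
  have cj: "c \<bullet> j = 0" "L \<bullet> j = 0" if "j \<in> Basis - {i}" for j
    using that i by (auto simp: c_def L_def inner_Basis)
  have mem: "x \<in> cbox p q \<longleftrightarrow> (p \<bullet> i \<le> x \<bullet> i \<and> x \<bullet> i \<le> q \<bullet> i)
      \<and> (\<forall>j\<in>Basis - {i}. p \<bullet> j \<le> x \<bullet> j \<and> x \<bullet> j \<le> q \<bullet> j)" for x p q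
    using i by (auto simp: mem_box)
  note sm = set_eq_iff Int_iff mem_Collect_eq mem inner_add_left inner_diff_left ci
  \<comment> \<open>the part of the shifted box that sticks out is moved back by one period\<close>
  have e1: "cbox (a + c) (b + c) \<inter> {x. x \<bullet> i \<le> b \<bullet> i} = cbox (a + c) b"
    unfolding sm using h cj by simp linarith
  have e2: "cbox (a + c) (b + c) \<inter> {x. x \<bullet> i \<ge> b \<bullet> i} = cbox (a + L) (b + c - L + L)"
    unfolding sm using h cj s by simp linarith
  have e3: "cbox a b \<inter> {x. x \<bullet> i \<le> a \<bullet> i + h} = cbox a (b + c - L)"
    unfolding sm using h cj s by simp linarith
  have e4: "cbox a b \<inter> {x. x \<bullet> i \<ge> a \<bullet> i + h} = cbox (a + c) b"
    unfolding sm using h cj s by simp linarith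
  have shift: "integral (cbox (p + v) (q + v)) g = integral (cbox p q) (\<lambda>x. g (x + v))" for p q v
    using integral_shift_cbox_plus[of p q g v] by (simp add: o_def add.commute)
  have "integral (cbox a b) (\<lambda>x. g (x + c)) = integral (cbox (a + c) (b + c)) g"
    by (rule shift[symmetric])
  also have "\<dots> = integral (cbox (a + c) b) g + integral (cbox (a + L) (b + c - L + L)) g"
    using integral_split[OF int i, of "a + c" "b + c" "b \<bullet> i"] unfolding e1 e2 .
  also have "integral (cbox (a + L) (b + c - L + L)) g = integral (cbox a (b + c - L)) (\<lambda>x. g (x + L))"
    by (rule shift)
  also have "(\<lambda>x. g (x + L)) = g" using per by (auto simp: L_def)
  also have "integral (cbox (a + c) b) g + integral (cbox a (b + c - L)) g = integral (cbox a b) g"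
    using integral_split[OF int i, of a b "a \<bullet> i + h"] unfolding e3 e4 by simp
  finally show ?thesis by (simp add: c_def)
qed

text \<open>
  The integral of a shifted periodic function does not depend on the shift; differentiate in the shift.
\<close>

lemma integral_dir_deriv_periodic:
  fixes g g' :: "'a \<Rightarrow> real"
  assumes i: "i \<in> Basis" and d: "dir_deriv i g g'"
    and g: "continuous_on UNIV g" and g': "continuous_on UNIV g'"
    and per: "\<And>x. g (x + side i *\<^sub>R i) = g x"
  shows "(LINT x|\<mu>. g' x) = 0"
proof -
  define J where "J = (\<lambda>h. integral (cbox a b) (\<lambda>x. g (x + h *\<^sub>R i)))"
  have L: "0 < side i" by (rule side_pos[OF i])
  have d1: "(J has_field_derivative integral (cbox a b) (\<lambda>x. g' (x + 0 *\<^sub>R i))) (at 0 within {0..side i})"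
    unfolding J_def
  proof (rule leibniz_rule_field_derivative)
    show "((\<lambda>h. g (x + h *\<^sub>R i)) has_real_derivative g' (x + h *\<^sub>R i)) (at h within {0..side i})" for h x
      using d unfolding dir_deriv_def by (blast intro: has_field_derivative_at_within)
    show "(\<lambda>x. g (x + h *\<^sub>R i)) integrable_on cbox a b" for h
      by (intro integrable_continuous continuous_on_compose2[OF g] continuous_intros) auto
    show "continuous_on ({0..side i} \<times> cbox a b) (\<lambda>(h, x). g' (x + h *\<^sub>R i))"
      unfolding split_beta by (intro continuous_on_compose2[OF g'] continuous_intros) auto
  qed (use L in auto)
  have J: "J h = integral (cbox a b) g" if "h \<in> {0..side i}" for h
    unfolding J_def by (rule integral_periodic_shift[OF i g per]) (use that in auto)
  have d2: "(J has_field_derivative 0) (at 0 within {0..side i})"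
  proof (rule has_field_derivative_transform_within)
    show "((\<lambda>_. integral (cbox a b) g) has_field_derivative 0) (at 0 within {0..side i})"
      by (rule DERIV_const)
  qed (use J L in auto)
  have "at 0 within {0..side i} \<noteq> bot"
    using L by (simp add: at_within_Icc_at_right)
  from has_field_derivative_unique[OF d1 d2 this]
  show ?thesis using integral_box_eq_cbox[OF g'] by simp
qed

section \<open>The Hartley basis\<close>

text \<open>
  The frequencies are kept as vectors of the ambient space, so that the eigenvalue of the Laplacian is
  \<open>k \<bullet> k\<close> and no dual lattice of integer indices has to be carried along.
\<close>

definition freqs :: "'a set" where
  "freqs = {k. \<forall>i\<in>Basis. \<exists>n::int. (k \<bullet> i) * side i = 2 * pi * of_int n}"

definition mode :: "'a \<Rightarrow> 'a \<Rightarrow> real" where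
  "mode k x = (cos (k \<bullet> x) + sin (k \<bullet> x)) / sqrt vol"

definition coef :: "('a \<Rightarrow> real) \<Rightarrow> 'a \<Rightarrow> real" where
  "coef u k = (LINT x|\<mu>. u x * mode k x)"

lemma zero_in_freqs [simp]: "0 \<in> freqs"
  unfolding freqs_def by (auto intro: exI[of _ 0])

lemma freqs_uminus [simp]: "- k \<in> freqs \<longleftrightarrow> k \<in> freqs"
proof -
  have "- k \<in> freqs" if k: "k \<in> freqs" for k
    unfolding freqs_def
  proof (clarify)
    fix i :: 'a assume "i \<in> Basis"
    then obtain n :: int where "(k \<bullet> i) * side i = 2 * pi * of_int n" using k by (auto simp: freqs_def)
    then show "\<exists>n::int. (- k \<bullet> i) * side i = 2 * pi * of_int n" by (intro exI[of _ "-n"]) auto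
  qed
  from this[of k] this[of "-k"] show ?thesis by auto
qed

lemma freqs_add: assumes "k \<in> freqs" "l \<in> freqs" shows "k + l \<in> freqs"
  unfolding freqs_def
proof (clarify)
  fix i :: 'a assume i: "i \<in> Basis"
  obtain n m :: int where "(k \<bullet> i) * side i = 2 * pi * of_int n" "(l \<bullet> i) * side i = 2 * pi * of_int m"
    using assms i unfolding freqs_def by blast
  then show "\<exists>n::int. ((k + l) \<bullet> i) * side i = 2 * pi * of_int n"
    by (intro exI[of _ "n + m"]) (auto simp: algebra_simps)
qed

lemma freqs_diff: "k \<in> freqs \<Longrightarrow> l \<in> freqs \<Longrightarrow> k - l \<in> freqs"
  using freqs_add[of k "-l"] by simp

lemma freqs_shift:
  assumes "k \<in> freqs" "i \<in> Basis"
  shows "cos (k \<bullet> (x + side i *\<^sub>R i)) = cos (k \<bullet> x)" "sin (k \<bullet> (x + side i *\<^sub>R i)) = sin (k \<bullet> x)"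
proof -
  obtain n :: int where n: "(k \<bullet> i) * side i = 2 * pi * of_int n" using assms by (auto simp: freqs_def)
  have e: "k \<bullet> (x + side i *\<^sub>R i) = k \<bullet> x + 2 * pi * of_int n"
    using n by (simp add: inner_add_right mult.commute)
  show "cos (k \<bullet> (x + side i *\<^sub>R i)) = cos (k \<bullet> x)" "sin (k \<bullet> (x + side i *\<^sub>R i)) = sin (k \<bullet> x)"
    unfolding e by (simp_all add: cos_add sin_add)
qed

lemma mode_shift: "k \<in> freqs \<Longrightarrow> i \<in> Basis \<Longrightarrow> mode k (x + side i *\<^sub>R i) = mode k x"
  by (simp add: mode_def freqs_shift)

lemma continuous_mode [continuous_intros]: "continuous_on S (mode k)"
  unfolding mode_def by (intro continuous_intros) (use vol_pos in auto)

lemma mode_bound: "\<bar>mode k x\<bar> \<le> 2 / sqrt vol"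
proof -
  have "\<bar>cos (k \<bullet> x) + sin (k \<bullet> x)\<bar> \<le> 1 + 1"
    by (rule order_trans[OF abs_triangle_ineq]) (intro add_mono abs_cos_le_one abs_sin_le_one)
  then show ?thesis using vol_pos by (simp add: mode_def abs_div divide_right_mono)
qed

lemma mode_sqint [simp]: "sqint \<mu> (mode k)"
  by (rule continuous_sqint_box[OF continuous_mode])

lemma has_derivative_mode:
  "(mode k has_derivative (\<lambda>v. (k \<bullet> v) * mode (- k) x)) (at x)"
proof -
  have "((\<lambda>x. cos (k \<bullet> x) + sin (k \<bullet> x)) has_derivative
      (\<lambda>v. (k \<bullet> v) * (cos (- k \<bullet> x) + sin (- k \<bullet> x)))) (at x)"
    by (auto intro!: derivative_eq_intros simp: algebra_simps)
  from bounded_linear.has_derivative[OF bounded_linear_divide this, of "sqrt vol"]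
  show ?thesis by (simp add: mode_def[abs_def])
qed

lemma dir_deriv_mode: "dir_deriv i (mode k) (\<lambda>x. (k \<bullet> i) * mode (- k) x)"
  by (rule has_derivative_imp_dir_deriv[OF has_derivative_mode])

lemma partial_mode_form: "\<exists>c. \<exists>l\<in>{k, -k}. partial is (mode k) = (\<lambda>x. c * mode l x)"
proof (induction "is")
  case Nil
  show ?case by (rule exI[of _ 1]) (auto simp: partial_def)
next
  case (Cons i "is")
  then obtain c l where l: "l \<in> {k, -k}" and e: "partial is (mode k) = (\<lambda>x. c * mode l x)" by blast
  have "frechet_derivative (\<lambda>x. c * mode l x) (at x) = (\<lambda>v. c * ((l \<bullet> v) * mode (- l) x))" for x
    by (rule frechet_derivative_at[symmetric]) (auto intro!: derivative_eq_intros has_derivative_mode)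
  then have "partial (i # is) (mode k) = (\<lambda>x. (c * (l \<bullet> i)) * mode (- l) x)"
    using e by (simp add: partial_def mult.assoc)
  then show ?case using l by (intro exI[of _ "c * (l \<bullet> i)"] bexI[of _ "-l"]) auto
qed

lemma smooth_mode: "smooth (mode k)"
  unfolding smooth_def
proof
  fix "is" :: "'a list"
  obtain c l where e: "partial is (mode k) = (\<lambda>x. c * mode l x)" using partial_mode_form[of k "is"] by blast
  have "(\<lambda>x. c * mode l x) differentiable at x" for x
    unfolding differentiable_def by (rule exI) (auto intro!: derivative_eq_intros has_derivative_mode)
  then show "partial is (mode k) differentiable_on UNIV"
    unfolding e by (simp add: differentiable_on_def)
qed

lemma periodic_mode: "k \<in> freqs \<Longrightarrow> periodic a b (mode k)"
  by (simp add: periodic_def mode_shift side_def[symmetric])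

lemma partial_one_mode: "partial [i] (mode k) = (\<lambda>x. (k \<bullet> i) * mode (- k) x)"
proof -
  have "frechet_derivative (mode k) (at x) = (\<lambda>v. (k \<bullet> v) * mode (- k) x)" for x
    by (rule frechet_derivative_at[OF has_derivative_mode, symmetric])
  then show ?thesis by (simp add: partial_def)
qed

lemma partial_two_mode: "partial [i, i] (mode k) x = - (k \<bullet> i)\<^sup>2 * mode k x"
proof -
  have "frechet_derivative (\<lambda>x. (k \<bullet> i) * mode (- k) x) (at x) = (\<lambda>v. (k \<bullet> i) * ((- k \<bullet> v) * mode k x))" for x
    by (rule frechet_derivative_at[symmetric])
      (use has_derivative_mode[of "-k"] in \<open>auto intro!: derivative_eq_intros\<close>)
  moreover have "partial [i, i] (mode k) x = frechet_derivative (partial [i] (mode k)) (at x) i"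
    by (simp add: partial_def)
  ultimately show ?thesis by (simp add: partial_one_mode power2_eq_square)
qed

lemma laplacian_mode: "(\<Sum>i\<in>Basis. partial [i, i] (mode k) x) = - (k \<bullet> k) * mode k x"
proof -
  have "(\<Sum>i\<in>Basis. (k \<bullet> i)\<^sup>2) = k \<bullet> k"
    by (subst euclidean_inner[of k k]) (simp add: power2_eq_square)
  then show ?thesis by (simp add: partial_two_mode sum_negf sum_distrib_right[symmetric])
qed

lemma integral_trig_freqs:
  assumes k: "k \<in> freqs"
  shows "(LINT x|\<mu>. sin (k \<bullet> x)) = 0" "k \<noteq> 0 \<Longrightarrow> (LINT x|\<mu>. cos (k \<bullet> x)) = 0"
proof -
  have nz: "\<exists>i\<in>Basis. k \<bullet> i \<noteq> 0" if "k \<noteq> 0" using that by (meson euclidean_all_zero_iff)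
  have co: "continuous_on UNIV (\<lambda>x. c * sin (k \<bullet> x))" "continuous_on UNIV (\<lambda>x. c * cos (k \<bullet> x))" for c
    by (intro continuous_intros)+
  have ds: "dir_deriv i (\<lambda>x. sin (k \<bullet> x)) (\<lambda>x. (k \<bullet> i) * cos (k \<bullet> x))"
    and dc: "dir_deriv i (\<lambda>x. - cos (k \<bullet> x)) (\<lambda>x. (k \<bullet> i) * sin (k \<bullet> x))" for i
    unfolding dir_deriv_def
    by (auto intro!: derivative_eq_intros simp: inner_add_right)
  {
    assume "k \<noteq> 0"
    then obtain i where i: "i \<in> Basis" "k \<bullet> i \<noteq> 0" using nz by blast
    have "(LINT x|\<mu>. (k \<bullet> i) * cos (k \<bullet> x)) = 0"
      by (rule integral_dir_deriv_periodic[OF i(1) ds _ co(2)])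
        (use freqs_shift[OF k i(1)] co(1)[of 1] in auto)
    then show "(LINT x|\<mu>. cos (k \<bullet> x)) = 0" using i by simp
  }
  show "(LINT x|\<mu>. sin (k \<bullet> x)) = 0"
  proof (cases "k = 0")
    case False
    then obtain i where i: "i \<in> Basis" "k \<bullet> i \<noteq> 0" using nz by blast
    have "(LINT x|\<mu>. (k \<bullet> i) * sin (k \<bullet> x)) = 0"
      by (rule integral_dir_deriv_periodic[OF i(1) dc _ co(1)])
        (use freqs_shift[OF k i(1)] co(2)[of "-1"] in auto)
    then show ?thesis using i by simp
  qed simp
qed

text \<open>
  The product of two modes is \<open>cos ((k - l) x) + sin ((k + l) x)\<close>, and a sine never has a mean.
  This makes the functions \<open>cos + sin\<close> a real orthonormal system indexed by the whole lattice of
  frequencies.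
\<close>

lemma mode_mult: "mode k x * mode l x = (cos ((k - l) \<bullet> x) + sin ((k + l) \<bullet> x)) / vol"
  using vol_pos by (simp add: mode_def inner_diff_left inner_add_left cos_diff sin_add algebra_simps
      add_divide_distrib[symmetric])

lemma coef_mode:
  assumes "k \<in> freqs" "l \<in> freqs"
  shows "coef (mode l) k = (if k = l then 1 else 0)"
proof -
  have int: "integrable \<mu> (\<lambda>x. cos ((l - k) \<bullet> x))" "integrable \<mu> (\<lambda>x. sin ((l + k) \<bullet> x))"
    by (intro continuous_integrable_box continuous_intros)+
  have "coef (mode l) k = ((LINT x|\<mu>. cos ((l - k) \<bullet> x)) + (LINT x|\<mu>. sin ((l + k) \<bullet> x))) / vol"
    unfolding coef_def mode_mult using int by simp
  also have "(LINT x|\<mu>. sin ((l + k) \<bullet> x)) = 0"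
    using integral_trig_freqs(1)[OF freqs_add] assms by blast
  also have "(LINT x|\<mu>. cos ((l - k) \<bullet> x)) = (if k = l then vol else 0)"
    using integral_trig_freqs(2)[OF freqs_diff, of l k] assms measure_box_total by auto
  finally show ?thesis using vol_pos by simp
qed

section \<open>Completeness of the Hartley basis\<close>

text \<open>
  Trigonometric polynomials; they form an algebra because a product of two modes is again a sum of
  modes.
\<close>

inductive trig :: "('a \<Rightarrow> real) \<Rightarrow> bool" where
  trig_mode: "k \<in> freqs \<Longrightarrow> trig (\<lambda>x. c * mode k x)"
| trig_add: "trig f \<Longrightarrow> trig g \<Longrightarrow> trig (\<lambda>x. f x + g x)"

lemma trig_cmult: "trig f \<Longrightarrow> trig (\<lambda>x. c * f x)"
proof (induction rule: trig.induct)
  case (trig_mode k d) then show ?case using trig.trig_mode[of k "c * d"] by (simp add: mult.assoc)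
next
  case (trig_add f g) then show ?case using trig.trig_add by (simp add: distrib_left)
qed

lemma mode_cos_sin:
  "cos (k \<bullet> x) = sqrt vol / 2 * mode k x + sqrt vol / 2 * mode (- k) x"
  "sin (k \<bullet> x) = sqrt vol / 2 * mode k x + - (sqrt vol / 2) * mode (- k) x"
  using vol_pos by (simp_all add: mode_def field_simps)

lemma trig_cos_sin:
  assumes "k \<in> freqs"
  shows "trig (\<lambda>x. c * cos (k \<bullet> x))" "trig (\<lambda>x. c * sin (k \<bullet> x))"
  unfolding mode_cos_sin using assms
  by (intro trig_cmult trig_add trig_mode; simp)+

lemma trig_const: "trig (\<lambda>x. c)"
  using trig_cos_sin(1)[OF zero_in_freqs, of c] by simp

lemma trig_sum: "finite S \<Longrightarrow> (\<And>i. i \<in> S \<Longrightarrow> trig (f i)) \<Longrightarrow> trig (\<lambda>x. \<Sum>i\<in>S. f i x)"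
  by (induction S rule: finite_induct) (auto intro: trig_const trig_add)

lemma trig_mult_mode: "trig f \<Longrightarrow> l \<in> freqs \<Longrightarrow> trig (\<lambda>x. f x * mode l x)"
proof (induction rule: trig.induct)
  case (trig_mode k c)
  have "(\<lambda>x. c * mode k x * mode l x)
      = (\<lambda>x. (c / vol) * cos ((k - l) \<bullet> x) + (c / vol) * sin ((k + l) \<bullet> x))"
    by (auto simp: mult.assoc mode_mult add_divide_distrib distrib_left)
  then show ?case
    using trig_add[OF trig_cos_sin(1)[OF freqs_diff] trig_cos_sin(2)[OF freqs_add]] trig_mode by metis
next
  case (trig_add f g) then show ?case using trig.trig_add by (simp add: distrib_right)
qed

lemma trig_mult:
  assumes "trig f" "trig g" shows "trig (\<lambda>x. f x * g x)"
  using assms(2)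
proof (induction rule: trig.induct)
  case (trig_mode k c)
  show ?case using trig_cmult[OF trig_mult_mode[OF assms(1) trig_mode], of c] by (simp add: ac_simps)
next
  case (trig_add f' g') then show ?case using trig.trig_add by (simp add: distrib_left)
qed

lemma trig_continuous: "trig f \<Longrightarrow> continuous_on UNIV f"
  by (induction rule: trig.induct) (auto intro!: continuous_intros)

lemma trig_orthogonal:
  assumes "trig g" "integrable \<mu> u" "\<And>k. k \<in> freqs \<Longrightarrow> coef u k = 0"
  shows "(LINT x|\<mu>. u x * g x) = 0"
  using assms(1)
proof (induction rule: trig.induct)
  case (trig_mode k c)
  have "(LINT x|\<mu>. u x * (c * mode k x)) = c * coef u k"
    by (simp add: coef_def mult.left_commute)
  then show ?case using assms(3) trig_mode by simp
next
  case (trig_add f g)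
  have "integrable \<mu> (\<lambda>x. u x * f x)" "integrable \<mu> (\<lambda>x. u x * g x)"
    using trig_add assms(2) by (auto intro!: integrable_mult_continuous trig_continuous)
  then show ?case using trig_add by (simp add: distrib_left)
qed

text \<open>
  The box with opposite faces identified, embedded in a product of circles. Polynomials of the
  embedding are trigonometric polynomials, so the Stone-Weierstrass theorem applies on its
  compact range.
\<close>

definition base_freq :: "'a \<Rightarrow> 'a" where "base_freq i = (2 * pi / side i) *\<^sub>R i"

lemma base_freq_in_freqs: "i \<in> Basis \<Longrightarrow> base_freq i \<in> freqs"
  using side_pos unfolding freqs_def base_freq_def
  by (auto simp: inner_Basis intro: exI[of _ 0] exI[of _ 1])

definition circles :: "'a \<Rightarrow> 'a \<times> 'a" where
  "circles x = (\<Sum>i\<in>Basis. cos (base_freq i \<bullet> x) *\<^sub>R (i, 0) + sin (base_freq i \<bullet> x) *\<^sub>R (0, i))"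

lemma circles_continuous: "continuous_on S circles"
  unfolding circles_def by (intro continuous_intros)

lemma circles_inner:
  assumes "i \<in> Basis"
  shows "fst (circles x) \<bullet> i = cos (base_freq i \<bullet> x)" "snd (circles x) \<bullet> i = sin (base_freq i \<bullet> x)"
  using assms by (simp_all add: circles_def fst_sum snd_sum inner_sum_left inner_Basis if_distrib cong: if_cong)

lemma polynomial_circles_trig: "real_polynomial_function p \<Longrightarrow> trig (\<lambda>x. p (circles x))"
proof (induction rule: real_polynomial_function.induct)
  case (linear f)
  interpret f: bounded_linear f by (rule linear)
  have e: "(\<lambda>x. f (circles x))
      = (\<lambda>x. \<Sum>i\<in>Basis. f (i, 0) * cos (base_freq i \<bullet> x) + f (0, i) * sin (base_freq i \<bullet> x))"
    by (auto simp: circles_def f.sum f.add f.scaleR mult.commute simp del: scaleR_Pair)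
  show ?case unfolding e
  proof (rule trig_sum[OF finite_Basis])
    fix i :: 'a assume "i \<in> Basis"
    note i = base_freq_in_freqs[OF this]
    show "trig (\<lambda>x. f (i, 0) * cos (base_freq i \<bullet> x) + f (0, i) * sin (base_freq i \<bullet> x))"
      by (rule trig_add[OF trig_cos_sin(1)[OF i] trig_cos_sin(2)[OF i]])
  qed
next
  case (const c) show ?case by (rule trig_const)
next
  case (add f g) from trig_add[OF add.IH] show ?case .
next
  case (mult f g) from trig_mult[OF mult.IH] show ?case .
qed

text \<open>
  A function with vanishing coefficients is orthogonal to all trigonometric polynomials, hence to
  everything they approximate uniformly.
\<close>

lemma continuous_circles_orthogonal:
  fixes f :: "'a \<times> 'a \<Rightarrow> real"
  assumes f: "continuous_on UNIV f" and u: "integrable \<mu> u" and z: "\<And>k. k \<in> freqs \<Longrightarrow> coef u k = 0"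
  shows "(LINT x|\<mu>. u x * f (circles x)) = 0"
proof -
  have fc: "continuous_on UNIV (\<lambda>x. f (circles x))"
    by (rule continuous_on_compose2[OF f circles_continuous]) auto
  define N where "N = (LINT x|\<mu>. \<bar>u x\<bar>)"
  have N0: "N \<ge> 0" by (simp add: N_def)
  have bnd: "\<bar>LINT x|\<mu>. u x * f (circles x)\<bar> \<le> e * N" if "e > 0" for e
  proof -
    have "compact (circles ` cbox a b)" by (rule compact_continuous_image[OF circles_continuous]) auto
    moreover have "continuous_on (circles ` cbox a b) f" using f continuous_on_subset by blast
    ultimately obtain p where p: "real_polynomial_function p"
      and close: "\<And>y. y \<in> circles ` cbox a b \<Longrightarrow> \<bar>f y - p y\<bar> < e"
      using Stone_Weierstrass_real_polynomial_function[OF _ _ \<open>e > 0\<close>] by metis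
    have pc: "continuous_on UNIV (\<lambda>x. p (circles x))"
      using trig_continuous[OF polynomial_circles_trig[OF p]] .
    have "(LINT x|\<mu>. u x * f (circles x)) = (LINT x|\<mu>. u x * f (circles x)) - (LINT x|\<mu>. u x * p (circles x))"
      using trig_orthogonal[OF polynomial_circles_trig[OF p] u z] by simp
    also have "\<dots> = (LINT x|\<mu>. u x * (f (circles x) - p (circles x)))"
      using integrable_mult_continuous[OF fc u] integrable_mult_continuous[OF pc u]
      by (simp add: right_diff_distrib)
    also have "\<bar>\<dots>\<bar> \<le> (LINT x|\<mu>. e * \<bar>u x\<bar>)"
    proof (rule order_trans[OF integral_abs_bound], rule integral_mono)
      show "integrable \<mu> (\<lambda>x. \<bar>u x * (f (circles x) - p (circles x))\<bar>)"
        using integrable_mult_continuous[OF continuous_on_diff[OF fc pc] u] by simp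
      show "integrable \<mu> (\<lambda>x. e * \<bar>u x\<bar>)" using u by simp
      fix x assume "x \<in> space \<mu>"
      then have "\<bar>f (circles x) - p (circles x)\<bar> \<le> e"
        using close[of "circles x"] box_subset_cbox[of a b] by (auto simp: less_imp_le)
      then show "\<bar>u x * (f (circles x) - p (circles x))\<bar> \<le> e * \<bar>u x\<bar>"
        using mult_left_mono[OF _ abs_ge_zero[of "u x"]] by (simp add: abs_mult mult.commute[of e])
    qed
    finally show ?thesis by (simp add: N_def)
  qed
  have "\<bar>LINT x|\<mu>. u x * f (circles x)\<bar> \<le> 0 + e" if "e > 0" for e
  proof -
    have "\<bar>LINT x|\<mu>. u x * f (circles x)\<bar> \<le> (e / (N + 1)) * N"
      by (rule bnd) (use that N0 in simp)
    also have "\<dots> \<le> e" using that N0 by (simp add: field_simps)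
    finally show ?thesis by simp
  qed
  then have "\<bar>LINT x|\<mu>. u x * f (circles x)\<bar> \<le> 0" by (rule field_le_epsilon)
  then show ?thesis by simp
qed

end

text \<open>
  On a circle of length \<open>B - A\<close> the arc between \<open>c\<close> and \<open>d\<close> is cut out by one inequality for
  the cosine of the angle to its midpoint.
\<close>

lemma cos_arc_iff:
  fixes A B c d x :: real
  assumes "A \<le> c" "c < d" "d \<le> B" "A < x" "x < B"
  defines "\<omega> \<equiv> 2 * pi / (B - A)"
  shows "cos (\<omega> * ((d - c) / 2)) < cos (\<omega> * (x - (c + d) / 2)) \<longleftrightarrow> c < x \<and> x < d"
proof -
  define y where "y = \<bar>x - (c + d) / 2\<bar>"
  define r where "r = (d - c) / 2"
  have L: "B - A > 0" using assms by simp
  have w: "\<omega> > 0" using L by (simp add: \<omega>_def)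
  have wL: "\<omega> * (B - A) = 2 * pi" using L by (simp add: \<omega>_def)
  have r: "0 < r" "2 * r \<le> B - A" using assms by (auto simp: r_def)
  have "\<omega> * (2 * r) \<le> \<omega> * (B - A)" using r w by (intro mult_left_mono) auto
  then have wr: "0 \<le> \<omega> * r" "\<omega> * r \<le> pi" using wL w r by auto
  have "y \<ge> 0" by (simp add: y_def)
  have cy: "cos (\<omega> * (x - (c + d) / 2)) = cos (\<omega> * y)"
    unfolding y_def using w by (metis cos_abs_real abs_mult abs_of_pos)
  have iff: "c < x \<and> x < d \<longleftrightarrow> y < r"
    by (auto simp: y_def r_def abs_less_iff field_simps)
  show ?thesis
  proof (cases "\<omega> * y \<le> pi")
    case True
    have "cos (\<omega> * r) < cos (\<omega> * y) \<longleftrightarrow> \<omega> * y < \<omega> * r"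
      using True wr w \<open>y \<ge> 0\<close> by (intro cos_mono_less_eq) auto
    then show ?thesis using cy iff w by (simp add: r_def)
  next
    case False
    have yr: "\<not> y < r" using False wr(2) w by (smt (verit) mult_strict_left_mono)
    have "y + r < B - A" using assms by (auto simp: y_def r_def abs_if field_simps)
    then have "\<omega> * (y + r) < \<omega> * (B - A)" using w by (intro mult_strict_left_mono) auto
    then have s: "\<omega> * r < 2 * pi - \<omega> * y" using wL by (simp add: algebra_simps)
    have "cos (2 * pi - \<omega> * y) < cos (\<omega> * r)"
      using s wr False by (intro cos_monotone_0_pi) auto
    moreover have "cos (2 * pi - \<omega> * y) = cos (\<omega> * y)"
      by (simp add: cos_diff)
    ultimately show ?thesis using cy iff yr by (simp add: r_def)
  qed
qed

context periodic_box
begin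

text \<open>
  The indicator of a sub-box is a bounded pointwise limit of continuous functions on the product of
  circles, since each of its sides is an arc.
\<close>

lemma integral_subbox_zero:
  fixes c d :: 'a
  assumes u: "integrable \<mu> u" and z: "\<And>k. k \<in> freqs \<Longrightarrow> coef u k = 0"
    and cd: "\<And>i. i \<in> Basis \<Longrightarrow> a \<bullet> i \<le> c \<bullet> i \<and> c \<bullet> i < d \<bullet> i \<and> d \<bullet> i \<le> b \<bullet> i"
  shows "(LINT x|\<mu>. u x * indicator (box c d) x) = 0"
proof -
  define \<omega> where "\<omega> = (\<lambda>i. 2 * pi / side i)"
  define m where "m = (\<lambda>i. (c \<bullet> i + d \<bullet> i) / 2)"
  define r where "r = (\<lambda>i. (d \<bullet> i - c \<bullet> i) / 2)"
  define q :: "'a \<Rightarrow> 'a \<times> 'a \<Rightarrow> real" where "q = (\<lambda>i y. (fst y \<bullet> i) * cos (\<omega> i * m i) + (snd y \<bullet> i) * sin (\<omega> i * m i) - cos (\<omega> i * r i))"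
  \<comment> \<open>truncated multiples of the positive part of \<open>q\<close>; they increase to the indicator of \<open>q > 0\<close>\<close>
  define f where "f = (\<lambda>(n::nat) y. \<Prod>i\<in>Basis. min 1 (real n * max 0 (q i y)))"
  have fc: "continuous_on UNIV (f n)" for n
    unfolding f_def q_def by (intro continuous_intros)
  have fb: "0 \<le> f n y" "f n y \<le> 1" for n y
    unfolding f_def by (auto intro!: prod_nonneg prod_le_1)
  have qc: "q i (circles x) = cos (\<omega> i * (x \<bullet> i - m i)) - cos (\<omega> i * r i)" if "i \<in> Basis" for i x
  proof -
    have "base_freq i \<bullet> x = \<omega> i * (x \<bullet> i)" by (simp add: base_freq_def \<omega>_def inner_commute)
    then show ?thesis using that by (simp add: q_def circles_inner right_diff_distrib cos_diff)
  qed
  have qpos: "0 < q i (circles x) \<longleftrightarrow> c \<bullet> i < x \<bullet> i \<and> x \<bullet> i < d \<bullet> i" if i: "i \<in> Basis" and x: "x \<in> box a b" for i x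
    using cos_arc_iff[of "a \<bullet> i" "c \<bullet> i" "d \<bullet> i" "b \<bullet> i" "x \<bullet> i"] cd[OF i] x i
    by (simp add: qc \<omega>_def m_def r_def side_def inner_diff_left mem_box)
  have lim: "(\<lambda>n. f n (circles x)) \<longlonglongrightarrow> indicator (box c d) x" if x: "x \<in> box a b" for x
  proof -
    have "(\<lambda>n. min 1 (real n * max 0 (q i (circles x)))) \<longlonglongrightarrow> (if c \<bullet> i < x \<bullet> i \<and> x \<bullet> i < d \<bullet> i then 1 else 0)"
      if i: "i \<in> Basis" for i
    proof (cases "0 < q i (circles x)")
      case True
      obtain n0 :: nat where "1 / q i (circles x) < real n0" using reals_Archimedean2 by blast
      then have "1 \<le> real n * max 0 (q i (circles x))" if "n \<ge> n0" for n
      proof -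
        have "1 < real n0 * q i (circles x)" using True \<open>1 / q i (circles x) < real n0\<close> by (simp add: field_simps)
        also have "\<dots> \<le> real n * q i (circles x)" using True that by (intro mult_right_mono) auto
        finally show ?thesis using True by simp
      qed
      then have "\<forall>\<^sub>F n in sequentially. min 1 (real n * max 0 (q i (circles x))) = 1"
        by (auto simp: eventually_sequentially intro!: exI[of _ n0])
      then show ?thesis using True qpos[OF i x] by (simp add: tendsto_eventually)
    next
      case False
      then have "max 0 (q i (circles x)) = 0" "\<not> (c \<bullet> i < x \<bullet> i \<and> x \<bullet> i < d \<bullet> i)"
        using qpos[OF i x] by auto
      then show ?thesis by (simp only: if_False) simp
    qed
    then have "(\<lambda>n. f n (circles x)) \<longlonglongrightarrow> (\<Prod>i\<in>Basis. if c \<bullet> i < x \<bullet> i \<and> x \<bullet> i < d \<bullet> i then 1 else 0)"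
      unfolding f_def by (intro tendsto_prod) auto
    also have "(\<Prod>i\<in>Basis. if c \<bullet> i < x \<bullet> i \<and> x \<bullet> i < d \<bullet> i then 1 else 0) = (indicator (box c d) x :: real)"
    proof (cases "x \<in> box c d")
      case True then show ?thesis by (simp add: mem_box)
    next
      case False
      then obtain i where "i \<in> Basis" "\<not> (c \<bullet> i < x \<bullet> i \<and> x \<bullet> i < d \<bullet> i)" by (auto simp: mem_box)
      then show ?thesis using False by (auto intro!: prod_zero bexI[of _ i])
    qed
    finally show ?thesis .
  qed
  have "(\<lambda>n. LINT x|\<mu>. u x * f n (circles x)) \<longlonglongrightarrow> (LINT x|\<mu>. u x * indicator (box c d) x)"
  proof (rule integral_dominated_convergence[where w="\<lambda>x. \<bar>u x\<bar>"])
    show "AE x in \<mu>. (\<lambda>n. u x * f n (circles x)) \<longlonglongrightarrow> u x * indicator (box c d) x"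
      by (rule AE_I2) (auto intro!: tendsto_mult lim)
    show "AE x in \<mu>. norm (u x * f n (circles x)) \<le> \<bar>u x\<bar>" for n
    proof (rule AE_I2)
      fix x
      show "norm (u x * f n (circles x)) \<le> \<bar>u x\<bar>"
        using fb[of n "circles x"] by (simp add: abs_mult mult_left_le)
    qed
    show "(\<lambda>x. u x * f n (circles x)) \<in> borel_measurable \<mu>" for n
      using continuous_measurable_box[OF continuous_on_compose2[OF fc circles_continuous]] u by auto
    have "box c d \<inter> box a b \<in> sets \<mu>" by (simp add: sets_restrict_space_iff lmeasurable_iff_integrable)
    then have "(indicator (box c d \<inter> box a b) :: 'a \<Rightarrow> real) \<in> borel_measurable \<mu>" by (rule borel_measurable_indicator)
    then have "(indicator (box c d) :: 'a \<Rightarrow> real) \<in> borel_measurable \<mu>"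
      by (rule measurable_cong[THEN iffD1, rotated]) (auto simp: indicator_def)
    then show "(\<lambda>x. u x * indicator (box c d) x) \<in> borel_measurable \<mu>"
      using u by auto
  qed (use u in auto)
  then show ?thesis
    using continuous_circles_orthogonal[OF fc u z] by (simp add: LIMSEQ_const_iff)
qed

lemma borel_in_sets_box: "A \<in> sets borel \<Longrightarrow> A \<inter> box a b \<in> sets \<mu>"
  by (simp add: sets_restrict_space_iff)

lemma indicator_borel_measurable_box:
  assumes "A \<in> sets borel" shows "(indicator A :: 'a \<Rightarrow> real) \<in> borel_measurable \<mu>"
proof -
  have "(indicator (A \<inter> box a b) :: 'a \<Rightarrow> real) \<in> borel_measurable \<mu>"
    by (rule borel_measurable_indicator[OF borel_in_sets_box[OF assms]])
  then show ?thesis by (rule measurable_cong[THEN iffD1, rotated]) (auto simp: indicator_def)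
qed

lemma integral_borel_zero:
  assumes u: "integrable \<mu> u" and z: "\<And>k. k \<in> freqs \<Longrightarrow> coef u k = 0" and A: "A \<in> sets borel"
  shows "(LINT x|\<mu>. u x * indicator A x) = 0"
proof -
  have int: "integrable \<mu> (\<lambda>x. u x * indicator A x)" if "A \<in> sets borel" for A
  proof (rule Bochner_Integration.integrable_bound[OF u])
    show "(\<lambda>x. u x * indicator A x) \<in> borel_measurable \<mu>"
      using u indicator_borel_measurable_box[OF that] by auto
  qed (auto simp: indicator_def)
  have "Int_stable (range (\<lambda>(a, b). box a b :: 'a set))"
    by (auto simp: Int_stable_def box_Int_box)
  moreover have "range (\<lambda>(a, b). box a b :: 'a set) \<subseteq> Pow UNIV" by simp
  moreover have "A \<in> sigma_sets UNIV (range (\<lambda>(a, b). box a b :: 'a set))"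
    using A by (simp add: borel_eq_box)
  ultimately show ?thesis
  proof (induction rule: sigma_sets_induct_disjoint)
    case (basic A)
    then obtain c d where A: "A = box c d" by auto
    obtain c' d' where cd': "box c d \<inter> box a b = box c' d'" using box_Int_box by blast
    have e: "(LINT x|\<mu>. u x * indicator A x) = (LINT x|\<mu>. u x * indicator (box c' d') x)"
      by (rule Bochner_Integration.integral_cong) (auto simp: A cd'[symmetric] indicator_def)
    show ?case
    proof (cases "box c' d' = {}")
      case True then show ?thesis by (simp add: e)
    next
      case False
      have "box c' d' \<subseteq> box a b" using cd' by auto
      then have "a \<bullet> i \<le> c' \<bullet> i \<and> c' \<bullet> i < d' \<bullet> i \<and> d' \<bullet> i \<le> b \<bullet> i" if "i \<in> Basis" for i
        using False that by (auto simp: box_ne_empty subset_box)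
      then show ?thesis unfolding e by (intro integral_subbox_zero[OF u z])
    qed
  next
    case empty show ?case by simp
  next
    case (compl A)
    have A: "A \<in> sets borel" using compl(1) by (simp add: borel_eq_box)
    have "coef u 0 = 0" using z by simp
    then have "(LINT x|\<mu>. u x) = 0" using vol_pos by (simp add: coef_def mode_def)
    moreover have "(LINT x|\<mu>. u x * indicator (UNIV - A) x) = (LINT x|\<mu>. u x - u x * indicator A x)"
      by (rule Bochner_Integration.integral_cong) (auto simp: indicator_def)
    ultimately show ?case using compl u int[OF A] by simp
  next
    case (union A)
    have A: "A i \<in> sets borel" for i using union(2) by (auto simp: borel_eq_box)
    have "(\<lambda>n. LINT x|\<mu>. u x * indicator (\<Union>i<n. A i) x) \<longlonglongrightarrow> (LINT x|\<mu>. u x * indicator (\<Union>i. A i) x)"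
    proof (rule integral_dominated_convergence[where w="\<lambda>x. \<bar>u x\<bar>"])
      show "AE x in \<mu>. (\<lambda>n. u x * indicator (\<Union>i<n. A i) x) \<longlonglongrightarrow> u x * indicator (\<Union>i. A i) x"
        by (intro AE_I2 tendsto_mult tendsto_const LIMSEQ_indicator_UN)
      show "(\<lambda>x. u x * indicator (\<Union>i. A i) x) \<in> borel_measurable \<mu>"
        "(\<lambda>x. u x * indicator (\<Union>i<n. A i) x) \<in> borel_measurable \<mu>" for n
        using u A by (intro borel_measurable_times indicator_borel_measurable_box sets.countable_UN sets.finite_UN; auto)+
      show "AE x in \<mu>. norm (u x * indicator (\<Union>i<n. A i) x) \<le> \<bar>u x\<bar>" for n
        by (rule AE_I2) (simp add: indicator_def)
    qed (use u in auto)
    moreover have "(LINT x|\<mu>. u x * indicator (\<Union>i<n. A i) x) = 0" for n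
    proof -
      have "(LINT x|\<mu>. u x * indicator (\<Union>i<n. A i) x) = (LINT x|\<mu>. (\<Sum>i<n. u x * indicator (A i) x))"
        using union(1) by (intro Bochner_Integration.integral_cong)
          (auto simp: sum_distrib_left[symmetric] indicator_UN_disjoint disjoint_family_on_def)
      also have "\<dots> = (\<Sum>i<n. LINT x|\<mu>. u x * indicator (A i) x)"
        by (rule Bochner_Integration.integral_sum) (rule int[OF A])
      finally show ?thesis using union(3) by simp
    qed
    ultimately show ?case by (simp add: LIMSEQ_const_iff)
  qed
qed

text \<open>
  Sub-boxes generate the Borel sets, so all integrals of \<open>u\<close> over measurable sets vanish. Integrability
  suffices here; weak derivatives and weak Laplacians are not known to be square integrable a priori.
\<close>

theorem coef_zero_imp_AE_zero:
  assumes u: "integrable \<mu> u" and z: "\<And>k. k \<in> freqs \<Longrightarrow> coef u k = 0"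
  shows "AE x in \<mu>. u x = 0"
proof (rule density_zero[OF u])
  fix A assume "A \<in> sets \<mu>"
  then have "A \<in> sets lebesgue" by (simp add: sets_restrict_space_iff)
  then obtain S N N' where S: "A = S \<union> N" "N \<subseteq> N'" "N' \<in> null_sets lborel" "S \<in> sets lborel"
    by (metis sets_completionE)
  have "N' \<in> null_sets lebesgue" using S(3) by (simp add: null_sets_completionI)
  then have "AE x in lebesgue. x \<notin> N'" by (rule AE_not_in)
  then have "AE x in \<mu>. x \<notin> N'" by (auto simp: AE_restrict_space_iff elim: eventually_mono)
  then have "AE x in \<mu>. indicator A x * u x = u x * indicator S x"
    by eventually_elim (use S in \<open>auto simp: indicator_def\<close>)
  then have "(LINT x|\<mu>. indicator A x * u x) = (LINT x|\<mu>. u x * indicator S x)"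
    using \<open>A \<in> sets \<mu>\<close> u S indicator_borel_measurable_box[of S]
    by (intro integral_cong_AE borel_measurable_times) auto
  then show "set_lebesgue_integral \<mu> A u = 0"
    using integral_borel_zero[OF u z] S by (simp add: set_lebesgue_integral_def)
qed

end

section \<open>Riesz-Fischer and Parseval\<close>

lemma Fatou_integral_le:
  fixes f :: "nat \<Rightarrow> 'b \<Rightarrow> real"
  assumes f: "\<And>i. integrable M (f i)" "\<And>i x. 0 \<le> f i x" and g: "g \<in> borel_measurable M"
    and lim: "AE x in M. (\<lambda>i. f i x) \<longlonglongrightarrow> g x" and le: "\<forall>\<^sub>F i in sequentially. integral\<^sup>L M (f i) \<le> C"
  shows "integrable M g" "integral\<^sup>L M g \<le> C"
proof -
  have g0: "AE x in M. 0 \<le> g x"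
    using lim by eventually_elim (rule LIMSEQ_le_const, auto intro: f(2))
  have C0: "0 \<le> C"
  proof -
    obtain i where "integral\<^sup>L M (f i) \<le> C" using eventually_happens[OF le] by auto
    moreover have "0 \<le> integral\<^sup>L M (f i)" by (rule Bochner_Integration.integral_nonneg) (rule f(2))
    ultimately show ?thesis by linarith
  qed
  have "(\<integral>\<^sup>+x. ennreal (g x) \<partial>M) = (\<integral>\<^sup>+x. liminf (\<lambda>i. ennreal (f i x)) \<partial>M)"
  proof (rule nn_integral_cong_AE)
    show "AE x in M. ennreal (g x) = liminf (\<lambda>i. ennreal (f i x))"
      using lim by eventually_elim (metis lim_imp_Liminf sequentially_bot tendsto_ennrealI)
  qed
  also have "\<dots> \<le> liminf (\<lambda>i. \<integral>\<^sup>+x. ennreal (f i x) \<partial>M)"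
    by (rule nn_integral_liminf) (use f(1) in auto)
  also have "\<dots> = liminf (\<lambda>i. ennreal (integral\<^sup>L M (f i)))"
    using f by (simp add: nn_integral_eq_integral)
  also have "\<dots> \<le> ennreal C"
    using le by (intro Liminf_le) (auto elim!: eventually_mono intro: ennreal_leI)
  finally have *: "(\<integral>\<^sup>+x. ennreal (g x) \<partial>M) \<le> ennreal C" .
  show "integrable M g"
    by (rule integrableI_nonneg[OF g g0 le_less_trans[OF * ennreal_less_top, folded infinity_ennreal_def]])
  from nn_integral_eq_integral[OF this g0] * show "integral\<^sup>L M g \<le> C"
    using C0 by (simp add: ennreal_le_iff)
qed

context periodic_box
begin

lemma coef_integrable: "integrable \<mu> u \<Longrightarrow> integrable \<mu> (\<lambda>x. u x * mode k x)"
  by (rule integrable_mult_continuous[OF continuous_mode])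

lemma coef_add:
  "integrable \<mu> u \<Longrightarrow> integrable \<mu> v \<Longrightarrow> coef (\<lambda>x. u x + v x) k = coef u k + coef v k"
  unfolding coef_def distrib_right
  by (rule Bochner_Integration.integral_add) (auto intro: coef_integrable)

lemma coef_diff:
  "integrable \<mu> u \<Longrightarrow> integrable \<mu> v \<Longrightarrow> coef (\<lambda>x. u x - v x) k = coef u k - coef v k"
  unfolding coef_def left_diff_distrib
  by (rule Bochner_Integration.integral_diff) (auto intro: coef_integrable)

lemma coef_cmult: "coef (\<lambda>x. c * u x) k = c * coef u k"
  by (simp add: coef_def mult.assoc)

lemma coef_sum:
  "(\<And>i. i \<in> S \<Longrightarrow> integrable \<mu> (f i)) \<Longrightarrow> coef (\<lambda>x. \<Sum>i\<in>S. f i x) k = (\<Sum>i\<in>S. coef (f i) k)"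
  unfolding coef_def sum_distrib_right
  by (rule Bochner_Integration.integral_sum) (auto intro: coef_integrable)

lemma coef_cong_AE:
  assumes "u \<in> borel_measurable \<mu>" "v \<in> borel_measurable \<mu>" "AE x in \<mu>. u x = v x"
  shows "coef u k = coef v k"
  unfolding coef_def using assms continuous_measurable_box[OF continuous_mode]
  by (intro integral_cong_AE) auto

lemma coef_eq_imp_AE_eq:
  assumes "integrable \<mu> u" "integrable \<mu> v" "\<And>k. k \<in> freqs \<Longrightarrow> coef u k = coef v k"
  shows "AE x in \<mu>. u x = v x"
proof -
  have "AE x in \<mu>. u x - v x = 0"
    using assms by (intro coef_zero_imp_AE_zero) (auto simp: coef_diff)
  then show ?thesis by eventually_elim simp
qed

text \<open>
  The parametrisation of the frequencies by integers, for counting arguments.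
\<close>

definition lattice_point :: "('a \<Rightarrow> int) \<Rightarrow> 'a" where
  "lattice_point f = (\<Sum>i\<in>Basis. (2 * pi * of_int (f i) / side i) *\<^sub>R i)"

lemma lattice_point_inner: "i \<in> Basis \<Longrightarrow> lattice_point f \<bullet> i = 2 * pi * of_int (f i) / side i"
  by (simp add: lattice_point_def inner_sum_left inner_Basis if_distrib cong: if_cong)

lemma freqs_lattice_point:
  assumes "k \<in> freqs" obtains f where "f \<in> extensional Basis" "k = lattice_point f"
proof -
  have "\<forall>i\<in>Basis. \<exists>n::int. (k \<bullet> i) * side i = 2 * pi * of_int n" using assms by (simp add: freqs_def)
  then obtain n :: "'a \<Rightarrow> int" where n: "\<forall>i\<in>Basis. (k \<bullet> i) * side i = 2 * pi * of_int (n i)" by metis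
  have "k = lattice_point (restrict n Basis)"
  proof (rule euclidean_eqI)
    fix i :: 'a assume i: "i \<in> Basis"
    show "k \<bullet> i = lattice_point (restrict n Basis) \<bullet> i"
      using bspec[OF n i] side_pos[OF i] i by (simp add: lattice_point_inner eq_divide_eq)
  qed
  then show ?thesis using that by (metis restrict_extensional)
qed

text \<open>Symmetric truncation keeps \<open>- k\<close> together with \<open>k\<close>, so it commutes with differentiation.\<close>

definition blk :: "nat \<Rightarrow> 'a set" where "blk j = freqs \<inter> cball 0 (real j)"

lemma finite_blk [simp]: "finite (blk j)"
proof -
  obtain N :: nat where N: "\<forall>i\<in>Basis. real j * side i / (2 * pi) \<le> real N"
  proof -
    have "bdd_above ((\<lambda>i. real j * side i / (2 * pi)) ` Basis)" by (intro bdd_above_finite) auto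
    then obtain c where "\<forall>i\<in>Basis. real j * side i / (2 * pi) \<le> c" by (auto simp: bdd_above_def)
    moreover obtain N :: nat where "c \<le> real N" using real_arch_simple by blast
    ultimately show ?thesis using that order_trans by blast
  qed
  have "blk j \<subseteq> lattice_point ` (PiE Basis (\<lambda>_. {- int N..int N}))"
  proof
    fix k assume k: "k \<in> blk j"
    then obtain f where f: "f \<in> extensional Basis" "k = lattice_point f"
      using freqs_lattice_point by (auto simp: blk_def)
    have "\<bar>f i\<bar> \<le> int N" if i: "i \<in> Basis" for i
    proof -
      have "\<bar>k \<bullet> i\<bar> \<le> real j" using k Basis_le_norm[OF i, of k] by (auto simp: blk_def)
      then have "2 * pi * \<bar>of_int (f i)\<bar> / side i \<le> real j"
        using side_pos[OF i] by (simp add: f(2) lattice_point_inner[OF i] abs_mult)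
      then have "\<bar>of_int (f i)\<bar> \<le> real j * side i / (2 * pi)" using side_pos[OF i] by (simp add: field_simps)
      also have "\<dots> \<le> real N" using N i by blast
      finally show ?thesis by linarith
    qed
    then have "f \<in> PiE Basis (\<lambda>_. {- int N..int N})" using f(1) by (auto simp: PiE_iff abs_le_iff minus_le_iff)
    then show "k \<in> lattice_point ` (PiE Basis (\<lambda>_. {- int N..int N}))" using f(2) by blast
  qed
  moreover have "finite (PiE Basis (\<lambda>_::'a. {- int N..int N}))" by (intro finite_PiE) auto
  ultimately show ?thesis using finite_surj by blast
qed

lemma blk_subset: "blk j \<subseteq> freqs" by (simp add: blk_def)

lemma blk_in_freqs: "k \<in> blk j \<Longrightarrow> k \<in> freqs" by (simp add: blk_def)

lemma blk_mono: "i \<le> j \<Longrightarrow> blk i \<subseteq> blk j" by (auto simp: blk_def)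

lemma uminus_blk: "uminus ` blk j = blk j"
proof -
  have "uminus ` blk j \<subseteq> blk j" by (auto simp: blk_def)
  moreover have "k \<in> uminus ` blk j" if "k \<in> blk j" for k
    using that by (intro image_eqI[of _ _ "- k"]) (auto simp: blk_def)
  ultimately show ?thesis by blast
qed

lemma sum_blk_uminus: "(\<Sum>k\<in>blk j. f (- k)) = (\<Sum>k\<in>blk j. f k)"
  using sum.reindex[of uminus "blk j" f] by (simp add: uminus_blk)

lemma eventually_blk: "k \<in> freqs \<Longrightarrow> \<forall>\<^sub>F j in sequentially. k \<in> blk j"
proof -
  assume k: "k \<in> freqs"
  obtain N :: nat where "norm k \<le> real N" using real_arch_simple by blast
  then show ?thesis using k by (auto simp: blk_def eventually_sequentially intro!: exI[of _ N])
qed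

lemma coef_mode_sum:
  assumes "finite S" "S \<subseteq> freqs" "k \<in> freqs"
  shows "coef (\<lambda>x. \<Sum>l\<in>S. c l * mode l x) k = (if k \<in> S then c k else 0)"
proof -
  have "coef (\<lambda>x. \<Sum>l\<in>S. c l * mode l x) k = (\<Sum>l\<in>S. c l * coef (mode l) k)"
    by (subst coef_sum) (auto simp: coef_cmult intro!: continuous_integrable_box continuous_intros)
  also have "\<dots> = (\<Sum>l\<in>S. if k = l then c l else 0)"
    using assms by (intro sum.cong) (auto simp: coef_mode)
  finally show ?thesis using assms by simp
qed

lemma continuous_mode_sum [continuous_intros]: "continuous_on T (\<lambda>x. \<Sum>l\<in>S. c l * mode l x)"
  by (intro continuous_intros)

lemma sqint_mode_sum [simp]: "sqint \<mu> (\<lambda>x. \<Sum>l\<in>S. c l * mode l x)"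
  by (rule continuous_sqint_box[OF continuous_mode_sum])

lemma integral_mult_mode_sum:
  assumes "integrable \<mu> u"
  shows "(LINT x|\<mu>. u x * (\<Sum>l\<in>S. c l * mode l x)) = (\<Sum>l\<in>S. c l * coef u l)"
proof -
  have "(LINT x|\<mu>. u x * (\<Sum>l\<in>S. c l * mode l x)) = (LINT x|\<mu>. (\<Sum>l\<in>S. c l * (u x * mode l x)))"
    by (rule Bochner_Integration.integral_cong) (auto simp: sum_distrib_left mult.left_commute)
  also have "\<dots> = (\<Sum>l\<in>S. c l * coef u l)"
    using coef_integrable[OF assms] by (subst Bochner_Integration.integral_sum) (auto simp: coef_def)
  finally show ?thesis .
qed

lemma integral_mode_sum_square:
  assumes "finite S" "S \<subseteq> freqs"
  shows "(LINT x|\<mu>. (\<Sum>l\<in>S. c l * mode l x)\<^sup>2) = (\<Sum>l\<in>S. (c l)\<^sup>2)"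
proof -
  have "(LINT x|\<mu>. (\<Sum>l\<in>S. c l * mode l x)\<^sup>2) = (\<Sum>l\<in>S. c l * coef (\<lambda>x. \<Sum>l\<in>S. c l * mode l x) l)"
    unfolding power2_eq_square by (rule integral_mult_mode_sum) (rule sqint_integrable, simp)
  also have "\<dots> = (\<Sum>l\<in>S. c l * c l)"
    using assms by (intro sum.cong) (simp_all add: coef_mode_sum subsetD)
  finally show ?thesis by (simp add: power2_eq_square)
qed

lemma Bessel:
  assumes u: "sqint \<mu> u" and S: "finite S" "S \<subseteq> freqs"
  shows "(\<Sum>k\<in>S. (coef u k)\<^sup>2) \<le> (LINT x|\<mu>. (u x)\<^sup>2)"
proof -
  let ?P = "\<lambda>x. \<Sum>l\<in>S. coef u l * mode l x"
  have i: "integrable \<mu> (\<lambda>x. (u x)\<^sup>2)" "integrable \<mu> (\<lambda>x. u x * ?P x)" "integrable \<mu> (\<lambda>x. (?P x)\<^sup>2)"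
    using u sqint_mult_integrable[OF u sqint_mode_sum[of "coef u" S]] sqint_mode_sum[of "coef u" S] by (auto simp: sqint_def)
  have "0 \<le> (LINT x|\<mu>. (u x - ?P x)\<^sup>2)" by simp
  also have "\<dots> = (LINT x|\<mu>. (u x)\<^sup>2 + (?P x)\<^sup>2 - 2 * (u x * ?P x))"
    by (rule Bochner_Integration.integral_cong) (auto simp: power2_diff)
  also have "\<dots> = (LINT x|\<mu>. (u x)\<^sup>2) + (LINT x|\<mu>. (?P x)\<^sup>2) - 2 * (LINT x|\<mu>. u x * ?P x)"
    using i by simp
  also have "\<dots> = (LINT x|\<mu>. (u x)\<^sup>2) - (\<Sum>k\<in>S. (coef u k)\<^sup>2)"
    unfolding integral_mode_sum_square[OF S] integral_mult_mode_sum[OF sqint_integrable[OF u]]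
    by (simp add: power2_eq_square)
  finally show ?thesis by simp
qed

text \<open>
  The partial sums are Cauchy in \<open>L\<^sup>2\<close>, hence in \<open>L\<^sup>1\<close>, so a subsequence converges almost everywhere;
  by Fatou's lemma its limit is also the limit in \<open>L\<^sup>2\<close>.
\<close>

theorem Riesz_Fischer:
  assumes bnd: "\<And>j. (\<Sum>k\<in>blk j. (c k)\<^sup>2) \<le> Q"
  obtains u where "sqint \<mu> u" "\<And>k. k \<in> freqs \<Longrightarrow> coef u k = c k"
    "(\<lambda>j. LINT x|\<mu>. ((\<Sum>k\<in>blk j. c k * mode k x) - u x)\<^sup>2) \<longlonglongrightarrow> 0"
proof -
  define P where "P = (\<lambda>j x. \<Sum>k\<in>blk j. c k * mode k x)"
  define s where "s = (\<lambda>j. \<Sum>k\<in>blk j. (c k)\<^sup>2)"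
  have Psq: "sqint \<mu> (P j)" for j unfolding P_def by simp
  have smono: "s i \<le> s j" if "i \<le> j" for i j
    unfolding s_def by (intro sum_mono2 blk_mono that) auto
  then have "incseq s" by (simp add: incseq_def)
  moreover have "\<forall>j. s j \<le> Q" using bnd by (simp add: s_def)
  ultimately obtain L where L: "s \<longlonglongrightarrow> L" "\<forall>j. s j \<le> L" using incseq_convergent by metis
  have dist: "(LINT x|\<mu>. (P j x - P i x)\<^sup>2) = s j - s i" if "i \<le> j" for i j
  proof -
    have sub: "blk i \<subseteq> blk j" using blk_mono that by blast
    have "P j x - P i x = (\<Sum>k\<in>blk j - blk i. c k * mode k x)" for x
      unfolding P_def by (simp add: sum_diff[OF finite_blk sub])
    then have "(LINT x|\<mu>. (P j x - P i x)\<^sup>2) = (\<Sum>k\<in>blk j - blk i. (c k)\<^sup>2)"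
      using integral_mode_sum_square[of "blk j - blk i" c] blk_subset by (auto simp: subset_iff)
    then show ?thesis by (simp add: s_def sum_diff[OF finite_blk sub])
  qed
  have dist_le: "(LINT x|\<mu>. (P j x - P i x)\<^sup>2) \<le> L - s (min i j)" for i j
  proof (cases "i \<le> j")
    case True then show ?thesis using dist[OF True] L(2) by (simp add: min_def)
  next
    case False
    then have "j \<le> i" by simp
    then show ?thesis using dist[OF \<open>j \<le> i\<close>] L(2) by (simp add: min_def power2_commute)
  qed
  have "\<exists>N. \<forall>i\<ge>N. \<forall>j\<ge>N. (LINT x|\<mu>. norm (P i x - P j x)) < e" if "e > 0" for e
  proof -
    have "(\<lambda>n. sqrt (L - s n) * sqrt vol) \<longlonglongrightarrow> sqrt (L - L) * sqrt vol"
      by (intro tendsto_intros L)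
    then have "\<forall>\<^sub>F n in sequentially. sqrt (L - s n) * sqrt vol < e"
      using order_tendstoD(2)[of _ 0 sequentially e] that by simp
    then obtain N where N: "\<And>n. n \<ge> N \<Longrightarrow> sqrt (L - s n) * sqrt vol < e" by (auto simp: eventually_sequentially)
    have "(LINT x|\<mu>. norm (P i x - P j x)) < e" if "i \<ge> N" "j \<ge> N" for i j
    proof -
      have d: "sqint \<mu> (\<lambda>x. \<bar>P i x - P j x\<bar>)" by (intro sqint_abs sqint_diff Psq)
      have o: "sqint \<mu> (\<lambda>_. 1)" by (simp add: sqint_def)
      have "(LINT x|\<mu>. norm (P i x - P j x)) = (LINT x|\<mu>. \<bar>P i x - P j x\<bar> * 1)" by simp
      also have "\<dots> \<le> sqrt (LINT x|\<mu>. (\<bar>P i x - P j x\<bar>)\<^sup>2) * sqrt (LINT x|\<mu>. 1\<^sup>2)"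
        using integral_Cauchy_Schwarz_abs[OF d o] by linarith
      also have "\<dots> \<le> sqrt (L - s (min j i)) * sqrt vol"
        using dist_le[of i j] measure_box_total by (intro mult_mono real_sqrt_le_mono) (use L(2) vol_pos in \<open>auto simp: min.commute less_imp_le\<close>)
      also have "\<dots> < e" by (rule N) (use that in auto)
      finally show ?thesis .
    qed
    then show ?thesis by blast
  qed
  from cauchy_L1_AE_cauchy_subseq[OF sqint_integrable[OF Psq] this]
  obtain r where r: "strict_mono r" "AE x in \<mu>. Cauchy (\<lambda>i. P (r i) x)" by blast
  define u where "u = (\<lambda>x. lim (\<lambda>i. P (r i) x))"
  have um: "u \<in> borel_measurable \<mu>"
    unfolding u_def by (rule borel_measurable_lim_metric) (rule sqintD(1)[OF Psq])
  have ulim: "AE x in \<mu>. (\<lambda>i. P (r i) x) \<longlonglongrightarrow> u x"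
    using r(2) by eventually_elim (simp add: u_def convergent_LIMSEQ_iff[symmetric] Cauchy_convergent)
  have F: "integrable \<mu> (\<lambda>x. (P j x - u x)\<^sup>2)" "(LINT x|\<mu>. (P j x - u x)\<^sup>2) \<le> L - s j" for j
  proof -
    have 1: "integrable \<mu> (\<lambda>x. (P j x - P (r i) x)\<^sup>2)" for i
      using sqint_diff[OF Psq Psq] by (simp add: sqint_def)
    have 2: "(\<lambda>x. (P j x - u x)\<^sup>2) \<in> borel_measurable \<mu>" using um sqintD(1)[OF Psq] by auto
    have 3: "AE x in \<mu>. (\<lambda>i. (P j x - P (r i) x)\<^sup>2) \<longlonglongrightarrow> (P j x - u x)\<^sup>2"
      using ulim by eventually_elim (intro tendsto_intros)
    have 4: "\<forall>\<^sub>F i in sequentially. (LINT x|\<mu>. (P j x - P (r i) x)\<^sup>2) \<le> L - s j"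
      using eventually_ge_at_top[of j]
    proof eventually_elim
      case (elim i)
      then have "j \<le> r i" using seq_suble[OF r(1), of i] by simp
      then show ?case using dist_le[of j "r i"] by (simp add: min_absorb2)
    qed
    show "integrable \<mu> (\<lambda>x. (P j x - u x)\<^sup>2)" "(LINT x|\<mu>. (P j x - u x)\<^sup>2) \<le> L - s j"
      using Fatou_integral_le[OF 1 _ 2 3 4] by auto
  qed
  have "sqint \<mu> (\<lambda>x. P 0 x - u x)" using F(1) um sqintD(1)[OF Psq] by (auto simp: sqint_def)
  from sqint_diff[OF Psq[of 0] this] have usq: "sqint \<mu> u" by simp
  have lim: "(\<lambda>j. LINT x|\<mu>. (P j x - u x)\<^sup>2) \<longlonglongrightarrow> 0"
  proof (rule real_tendsto_sandwich[where f="\<lambda>_. 0" and h="\<lambda>j. L - s j"])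
    show "(\<lambda>j. L - s j) \<longlonglongrightarrow> 0" using tendsto_diff[OF tendsto_const L(1), of L] by simp
  qed (use F(2) in auto)
  have "coef u k = c k" if k: "k \<in> freqs" for k
  proof -
    have "(\<lambda>j. coef (P j) k) \<longlonglongrightarrow> coef u k"
      unfolding coef_def by (rule L2_tendsto_imp_weak[OF Psq usq mode_sqint lim])
    moreover have "\<forall>\<^sub>F j in sequentially. coef (P j) k = c k"
      using eventually_blk[OF k]
      by eventually_elim (use k in \<open>simp add: P_def coef_mode_sum blk_subset\<close>)
    ultimately show ?thesis by (metis LIMSEQ_unique tendsto_eventually)
  qed
  then show ?thesis using that usq lim by (simp add: P_def)
qed

definition psum :: "('a \<Rightarrow> real) \<Rightarrow> nat \<Rightarrow> 'a \<Rightarrow> real" where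
  "psum u j x = (\<Sum>k\<in>blk j. coef u k * mode k x)"

lemma sqint_psum [simp]: "sqint \<mu> (psum u j)"
  unfolding psum_def by simp

lemma continuous_psum [continuous_intros]: "continuous_on T (psum u j)"
  unfolding psum_def by (rule continuous_mode_sum)

text \<open>
  The function that Riesz-Fischer builds from the coefficients of \<open>u\<close> has the same coefficients as
  \<open>u\<close>, so it is \<open>u\<close> by completeness.
\<close>

theorem psum_tendsto_L2:
  assumes u: "sqint \<mu> u"
  shows "(\<lambda>j. LINT x|\<mu>. (psum u j x - u x)\<^sup>2) \<longlonglongrightarrow> 0"
proof -
  obtain v where v: "sqint \<mu> v" "\<And>k. k \<in> freqs \<Longrightarrow> coef v k = coef u k"
    "(\<lambda>j. LINT x|\<mu>. ((\<Sum>k\<in>blk j. coef u k * mode k x) - v x)\<^sup>2) \<longlonglongrightarrow> 0"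
    using Riesz_Fischer[of "coef u", OF Bessel[OF u finite_blk blk_subset]] by blast
  have ae: "AE x in \<mu>. v x = u x"
    using coef_eq_imp_AE_eq[OF sqint_integrable[OF v(1)] sqint_integrable[OF u] v(2)] .
  have "(LINT x|\<mu>. (psum u j x - u x)\<^sup>2) = (LINT x|\<mu>. (psum u j x - v x)\<^sup>2)" for j
  proof (rule integral_cong_AE)
    show "AE x in \<mu>. (psum u j x - u x)\<^sup>2 = (psum u j x - v x)\<^sup>2"
      using ae by eventually_elim simp
  qed (use u v(1) sqint_psum[of u j] in \<open>auto simp: sqint_def\<close>)
  then show ?thesis using v(3) by (simp add: psum_def)
qed

theorem Parseval:
  assumes u: "sqint \<mu> u" and v: "sqint \<mu> v"
  shows "(\<lambda>j. \<Sum>k\<in>blk j. coef u k * coef v k) \<longlonglongrightarrow> (LINT x|\<mu>. u x * v x)"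
proof -
  have "(LINT x|\<mu>. psum u j x * v x) = (\<Sum>k\<in>blk j. coef u k * coef v k)" for j
    using integral_mult_mode_sum[OF sqint_integrable[OF v], of "coef u" "blk j"]
    by (simp add: psum_def mult.commute)
  then show ?thesis
    using L2_tendsto_imp_weak[OF sqint_psum u v psum_tendsto_L2[OF u]] by simp
qed

lemma Parseval_square:
  assumes "sqint \<mu> u"
  shows "(\<lambda>j. \<Sum>k\<in>blk j. (coef u k)\<^sup>2) \<longlonglongrightarrow> (LINT x|\<mu>. (u x)\<^sup>2)"
  using Parseval[OF assms assms] by (simp add: power2_eq_square)

section \<open>Weak derivatives in terms of coefficients\<close>

text \<open>
  The weak derivative tested with the modes only. The derivative of a mode is a multiple of the mode
  with the opposite frequency, whence the sign and the argument \<open>- k\<close>.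
\<close>

definition wgrad :: "'a \<Rightarrow> ('a \<Rightarrow> real) \<Rightarrow> ('a \<Rightarrow> real) \<Rightarrow> bool" where
  "wgrad i u g \<longleftrightarrow> integrable \<mu> u \<and> integrable \<mu> g \<and> (\<forall>k\<in>freqs. coef g k = - (k \<bullet> i) * coef u (- k))"

text \<open>
  Partial sums of the squared \<open>L\<^sup>2\<close> norm of the gradient.
\<close>

definition gsum :: "('a \<Rightarrow> real) \<Rightarrow> nat \<Rightarrow> real" where
  "gsum u j = (\<Sum>k\<in>blk j. (k \<bullet> k) * (coef u k)\<^sup>2)"

lemma integral_mult_cmult_mode: "(LINT x|\<mu>. u x * (c * mode k x)) = c * coef u k"
proof -
  have "(\<lambda>x. u x * (c * mode k x)) = (\<lambda>x. c * (u x * mode k x))" by (auto simp: ac_simps)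
  then show ?thesis by (simp add: coef_def)
qed

lemma weak_deriv_imp_wgrad:
  assumes "weak_deriv a b [i] u g" shows "wgrad i u g"
  unfolding wgrad_def
proof (intro conjI ballI)
  show "integrable \<mu> u" "integrable \<mu> g" using assms by (auto simp: weak_deriv_def)
  fix k assume k: "k \<in> freqs"
  have "(LINT x|\<mu>. u x * partial [i] (mode k) x) = (-1) ^ length [i] * (LINT x|\<mu>. g x * mode k x)"
    using assms smooth_mode periodic_mode[OF k] unfolding weak_deriv_def by blast
  then have "(k \<bullet> i) * coef u (- k) = - coef g k"
    by (simp add: partial_one_mode integral_mult_cmult_mode coef_def[symmetric])
  then show "coef g k = - (k \<bullet> i) * coef u (- k)" by simp
qed

lemma smooth_continuous:
  assumes "smooth \<psi>"
  shows "continuous_on UNIV \<psi>" "dir_deriv i \<psi> (partial [i] \<psi>)" "i \<in> Basis \<Longrightarrow> continuous_on UNIV (partial [i] \<psi>)"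
proof -
  have "partial [] \<psi> differentiable_on UNIV" using assms unfolding smooth_def by blast
  then have d: "\<psi> differentiable_on UNIV" by (simp add: partial_def)
  then show "continuous_on UNIV \<psi>" by (rule differentiable_imp_continuous_on)
  show "dir_deriv i \<psi> (partial [i] \<psi>)" by (rule differentiable_imp_dir_deriv[OF d])
  assume "i \<in> Basis"
  then have "[i] \<in> lists Basis" by simp
  then have "partial [i] \<psi> differentiable_on UNIV" using assms unfolding smooth_def by blast
  then show "continuous_on UNIV (partial [i] \<psi>)" by (rule differentiable_imp_continuous_on)
qed

text \<open>Integration by parts; there are no boundary terms because the product with a mode is periodic.\<close>

lemma coef_dir_deriv:
  assumes i: "i \<in> Basis" and k: "k \<in> freqs" and d: "dir_deriv i g g'"
    and g: "continuous_on UNIV g" "continuous_on UNIV g'" and per: "\<And>x. g (x + side i *\<^sub>R i) = g x"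
  shows "coef g' k = - (k \<bullet> i) * coef g (- k)"
proof -
  have "(LINT x|\<mu>. g' x * mode k x + g x * ((k \<bullet> i) * mode (- k) x)) = 0"
    by (rule integral_dir_deriv_periodic[OF i dir_deriv_mult[OF d dir_deriv_mode]])
      (auto intro!: continuous_intros g simp: per mode_shift[OF k i])
  moreover have "integrable \<mu> (\<lambda>x. g' x * mode k x)" "integrable \<mu> (\<lambda>x. g x * ((k \<bullet> i) * mode (- k) x))"
    by (intro continuous_integrable_box continuous_intros g)+
  ultimately have "coef g' k + (LINT x|\<mu>. g x * ((k \<bullet> i) * mode (- k) x)) = 0"
    by (simp add: coef_def)
  moreover have "(LINT x|\<mu>. g x * ((k \<bullet> i) * mode (- k) x)) = (k \<bullet> i) * coef g (- k)"
    by (rule integral_mult_cmult_mode)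
  ultimately show ?thesis by simp
qed

text \<open>
  Conversely, testing with the modes suffices: expand the test function, using Parseval on both sides.
\<close>

lemma wgrad_imp_weak_deriv:
  assumes i: "i \<in> Basis" and w: "wgrad i u g" and u: "sqint \<mu> u" and g: "sqint \<mu> g"
  shows "weak_deriv a b [i] u g"
  unfolding weak_deriv_def
proof (intro conjI allI impI)
  show "integrable \<mu> u" "integrable \<mu> g" using w by (auto simp: wgrad_def)
  fix \<psi> :: "'a \<Rightarrow> real" assume \<psi>: "smooth \<psi> \<and> periodic a b \<psi>"
  note sm = smooth_continuous[OF conjunct1[OF \<psi>]]
  have per: "\<psi> (x + side i *\<^sub>R i) = \<psi> x" for x
    using \<psi> i by (simp add: periodic_def side_def)
  have c: "coef (partial [i] \<psi>) k = - (k \<bullet> i) * coef \<psi> (- k)" if "k \<in> freqs" for k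
    by (rule coef_dir_deriv[OF i that sm(2) sm(1) sm(3)[OF i] per])
  have "(\<Sum>k\<in>blk j. coef u k * coef (partial [i] \<psi>) k) = - (\<Sum>k\<in>blk j. coef g k * coef \<psi> k)" for j
  proof -
    have "(\<Sum>k\<in>blk j. coef u k * coef (partial [i] \<psi>) k)
        = (\<Sum>k\<in>blk j. coef u (- k) * coef (partial [i] \<psi>) (- k))"
      using sum_blk_uminus[of "\<lambda>k. coef u k * coef (partial [i] \<psi>) k" j] by simp
    also have "\<dots> = (\<Sum>k\<in>blk j. - (coef g k * coef \<psi> k))"
      using w by (intro sum.cong) (auto simp: c wgrad_def blk_in_freqs)
    finally show ?thesis by (simp add: sum_negf)
  qed
  then have "(\<lambda>j. - (\<Sum>k\<in>blk j. coef g k * coef \<psi> k)) \<longlonglongrightarrow> (LINT x|\<mu>. u x * partial [i] \<psi> x)"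
    using Parseval[OF u continuous_sqint_box[OF sm(3)[OF i]]] by simp
  moreover have "(\<lambda>j. - (\<Sum>k\<in>blk j. coef g k * coef \<psi> k)) \<longlonglongrightarrow> - (LINT x|\<mu>. g x * \<psi> x)"
    by (intro tendsto_minus Parseval g continuous_sqint_box sm)
  ultimately show "(LINT x|\<mu>. u x * partial [i] \<psi> x) = (-1) ^ length [i] * (LINT x|\<mu>. g x * \<psi> x)"
    using LIMSEQ_unique by fastforce
qed

lemma weak_deriv_Nil_AE:
  assumes "weak_deriv a b [] u g" shows "AE x in \<mu>. u x = g x"
proof (rule coef_eq_imp_AE_eq)
  show "integrable \<mu> u" "integrable \<mu> g" using assms by (auto simp: weak_deriv_def)
  fix k assume "k \<in> freqs"
  then show "coef u k = coef g k"
    using assms smooth_mode periodic_mode unfolding weak_deriv_def coef_def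
    by (auto simp: partial_def)
qed

lemma weak_laplacian_coef:
  assumes "weak_laplacian a b u g" "k \<in> freqs" shows "coef g k = - (k \<bullet> k) * coef u k"
proof -
  have "(LINT x|\<mu>. u x * (\<Sum>i\<in>Basis. partial [i, i] (mode k) x)) = (LINT x|\<mu>. g x * mode k x)"
    using assms(1) smooth_mode periodic_mode[OF assms(2)] unfolding weak_laplacian_def by blast
  then show ?thesis unfolding laplacian_mode integral_mult_cmult_mode coef_def[symmetric] by simp
qed

lemma sum_Basis_square: "(\<Sum>i\<in>Basis. (k \<bullet> i)\<^sup>2) = k \<bullet> (k::'a)"
  by (subst euclidean_inner[of k k]) (simp add: power2_eq_square)

lemma wgrad_square_sum:
  assumes "wgrad i u g"
  shows "(\<Sum>k\<in>blk j. (coef g k)\<^sup>2) = (\<Sum>k\<in>blk j. (k \<bullet> i)\<^sup>2 * (coef u k)\<^sup>2)"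
proof -
  have "(\<Sum>k\<in>blk j. (coef g k)\<^sup>2) = (\<Sum>k\<in>blk j. (- k \<bullet> i)\<^sup>2 * (coef u (- k))\<^sup>2)"
    using assms by (intro sum.cong) (auto simp: wgrad_def blk_in_freqs power_mult_distrib)
  also have "\<dots> = (\<Sum>k\<in>blk j. (k \<bullet> i)\<^sup>2 * (coef u k)\<^sup>2)"
    using sum_blk_uminus[of "\<lambda>k. (k \<bullet> i)\<^sup>2 * (coef u k)\<^sup>2" j] by simp
  finally show ?thesis .
qed

lemma gsum_wgrad:
  assumes "\<And>i. i \<in> Basis \<Longrightarrow> wgrad i u (g i)"
  shows "gsum u j = (\<Sum>i\<in>Basis. \<Sum>k\<in>blk j. (coef (g i) k)\<^sup>2)"
proof -
  have "(\<Sum>i\<in>Basis. \<Sum>k\<in>blk j. (coef (g i) k)\<^sup>2) = (\<Sum>i\<in>Basis. \<Sum>k\<in>blk j. (k \<bullet> i)\<^sup>2 * (coef u k)\<^sup>2)"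
    using assms by (intro sum.cong refl wgrad_square_sum) auto
  also have "\<dots> = (\<Sum>k\<in>blk j. (\<Sum>i\<in>Basis. (k \<bullet> i)\<^sup>2) * (coef u k)\<^sup>2)"
    by (subst sum.swap) (simp add: sum_distrib_right)
  finally show ?thesis by (simp add: gsum_def sum_Basis_square)
qed

lemma gsum_le:
  assumes "\<And>i. i \<in> Basis \<Longrightarrow> wgrad i u (g i)" "\<And>i. i \<in> Basis \<Longrightarrow> sqint \<mu> (g i)"
  shows "gsum u j \<le> (\<Sum>i\<in>Basis. LINT x|\<mu>. (g i x)\<^sup>2)"
proof -
  have "gsum u j = (\<Sum>i\<in>Basis. \<Sum>k\<in>blk j. (coef (g i) k)\<^sup>2)" by (rule gsum_wgrad) (rule assms(1))
  also have "\<dots> \<le> (\<Sum>i\<in>Basis. LINT x|\<mu>. (g i x)\<^sup>2)"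
    by (intro sum_mono Bessel assms(2) finite_blk blk_subset)
  finally show ?thesis .
qed

lemma gsum_tendsto:
  assumes "\<And>i. i \<in> Basis \<Longrightarrow> wgrad i u (g i)" "\<And>i. i \<in> Basis \<Longrightarrow> sqint \<mu> (g i)"
  shows "gsum u \<longlonglongrightarrow> (\<Sum>i\<in>Basis. LINT x|\<mu>. (g i x)\<^sup>2)"
proof -
  have "(\<lambda>j. \<Sum>i\<in>Basis. \<Sum>k\<in>blk j. (coef (g i) k)\<^sup>2) \<longlonglongrightarrow> (\<Sum>i\<in>Basis. LINT x|\<mu>. (g i x)\<^sup>2)"
    by (intro tendsto_sum Parseval_square assms(2))
  moreover have "gsum u = (\<lambda>j. \<Sum>i\<in>Basis. \<Sum>k\<in>blk j. (coef (g i) k)\<^sup>2)"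
    using gsum_wgrad[OF assms(1)] by auto
  ultimately show ?thesis by simp
qed

text \<open>
  This supplies weak derivatives at times at which only a limit of gradient bounds is known.
\<close>

lemma gsum_bounded_imp_wgrad:
  assumes u: "sqint \<mu> u" and Q: "\<And>j. gsum u j \<le> Q" and i: "i \<in> Basis"
  obtains g where "sqint \<mu> g" "wgrad i u g"
proof -
  have "(\<Sum>k\<in>blk j. (- (k \<bullet> i) * coef u (- k))\<^sup>2) \<le> Q" for j
  proof -
    have "(\<Sum>k\<in>blk j. (- (k \<bullet> i) * coef u (- k))\<^sup>2) = (\<Sum>k\<in>blk j. (k \<bullet> i)\<^sup>2 * (coef u k)\<^sup>2)"
      using sum_blk_uminus[of "\<lambda>k. (k \<bullet> i)\<^sup>2 * (coef u k)\<^sup>2" j] by (simp add: power_mult_distrib)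
    also have "\<dots> \<le> gsum u j"
      unfolding gsum_def
    proof (intro sum_mono mult_right_mono)
      fix k
      have "(k \<bullet> i)\<^sup>2 \<le> (\<Sum>i\<in>Basis. (k \<bullet> i)\<^sup>2)" using i by (intro member_le_sum) auto
      then show "(k \<bullet> i)\<^sup>2 \<le> k \<bullet> k" by (simp add: sum_Basis_square)
    qed auto
    finally show ?thesis using Q[of j] by simp
  qed
  from Riesz_Fischer[of "\<lambda>k. - (k \<bullet> i) * coef u (- k)", OF this]
  obtain g where "sqint \<mu> g" "\<And>k. k \<in> freqs \<Longrightarrow> coef g k = - (k \<bullet> i) * coef u (- k)" by blast
  then show ?thesis using that u by (auto simp: wgrad_def intro: sqint_integrable)
qed

lemma wgrad_unique:
  assumes "wgrad i u g" "wgrad i u h" shows "AE x in \<mu>. g x = h x"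
  using assms by (intro coef_eq_imp_AE_eq) (auto simp: wgrad_def)

lemma wderiv_sqint:
  assumes i: "i \<in> Basis" and u: "sqint \<mu> u" and g: "sqint \<mu> g" "wgrad i u g"
  shows "sqint \<mu> (wderiv a b [i] u)" "wgrad i u (wderiv a b [i] u)"
proof -
  have "weak_deriv a b [i] u (wderiv a b [i] u)"
    unfolding wderiv_def by (rule someI[where P="weak_deriv a b [i] u", OF wgrad_imp_weak_deriv[OF i g(2) u g(1)]])
  then show w: "wgrad i u (wderiv a b [i] u)" by (rule weak_deriv_imp_wgrad)
  show "sqint \<mu> (wderiv a b [i] u)"
    by (rule sqint_cong_AE[OF g(1) _ wgrad_unique[OF g(2) w]]) (use w in \<open>auto simp: wgrad_def\<close>)
qed

text \<open>
  The gradient norm is defined through a choice of weak derivatives. A bound on the sums provides a square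
  integrable weak derivative, and by uniqueness the chosen one agrees with it almost everywhere.
\<close>

theorem gsum_tendsto_grad_norm2:
  assumes u: "sqint \<mu> u" and Q: "\<And>j. gsum u j \<le> Q"
  shows "gsum u \<longlonglongrightarrow> (grad_norm2 a b u)\<^sup>2"
proof -
  have w: "sqint \<mu> (wderiv a b [i] u)" "wgrad i u (wderiv a b [i] u)" if "i \<in> Basis" for i
    using gsum_bounded_imp_wgrad[OF u Q that] wderiv_sqint[OF that u] by metis+
  have "(grad_norm2 a b u)\<^sup>2 = (LINT x|\<mu>. (\<Sum>i\<in>Basis. (wderiv a b [i] u x)\<^sup>2))"
    by (simp add: grad_norm2_def sum_nonneg)
  also have "\<dots> = (\<Sum>i\<in>Basis. LINT x|\<mu>. (wderiv a b [i] u x)\<^sup>2)"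
    by (rule Bochner_Integration.integral_sum) (use w in \<open>auto simp: sqint_def\<close>)
  finally show ?thesis using gsum_tendsto[of u "\<lambda>i. wderiv a b [i] u"] w by simp
qed

lemma gsum_mono: "i \<le> j \<Longrightarrow> gsum u i \<le> gsum u j"
  unfolding gsum_def by (intro sum_mono2 blk_mono) auto

lemma gsum_le_grad_norm2:
  assumes "sqint \<mu> u" "\<And>j. gsum u j \<le> Q"
  shows "gsum u j \<le> (grad_norm2 a b u)\<^sup>2"
  using gsum_tendsto_grad_norm2[OF assms] incseq_le[of "gsum u"] gsum_mono by (auto simp: incseq_def)

section \<open>Chain and product rules\<close>

lemma psum_dir_deriv:
  assumes "wgrad i u g" shows "dir_deriv i (psum u j) (psum g j)"
proof -
  have "dir_deriv i (\<lambda>x. \<Sum>k\<in>blk j. coef u k * mode k x) (\<lambda>x. \<Sum>k\<in>blk j. coef u k * ((k \<bullet> i) * mode (- k) x))"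
    by (intro dir_deriv_sum dir_deriv_cmult dir_deriv_mode)
  moreover have "(\<Sum>k\<in>blk j. coef u k * ((k \<bullet> i) * mode (- k) x)) = psum g j x" for x
  proof -
    have "psum g j x = (\<Sum>k\<in>blk j. coef u (- k) * ((- k \<bullet> i) * mode (- (- k)) x))"
      using assms unfolding psum_def by (intro sum.cong) (auto simp: wgrad_def blk_in_freqs)
    then show ?thesis using sum_blk_uminus[of "\<lambda>k. coef u k * ((k \<bullet> i) * mode (- k) x)" j] by simp
  qed
  ultimately show ?thesis by (simp add: psum_def[abs_def])
qed

lemma psum_shift: "i \<in> Basis \<Longrightarrow> psum u j (x + side i *\<^sub>R i) = psum u j x"
  unfolding psum_def by (intro sum.cong) (auto simp: mode_shift blk_in_freqs)

lemma mode_AE_bound: "AE x in \<mu>. \<bar>mode k x\<bar> \<le> 2 / sqrt vol"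
  by (rule AE_I2) (rule mode_bound)

lemma mode_measurable: "mode k \<in> borel_measurable \<mu>"
  by (rule continuous_measurable_box[OF continuous_mode])

text \<open>
  Products of \<open>L\<^sup>2\<close>-convergent sequences converge when tested with a mode; with partial sums as
  the approximating sequences this carries integration by parts over from smooth functions.
\<close>

lemma coef_product_tendsto:
  assumes u: "\<And>j. sqint \<mu> (u j)" "sqint \<mu> u0" "(\<lambda>j. LINT x|\<mu>. (u j x - u0 x)\<^sup>2) \<longlonglongrightarrow> 0"
    and v: "\<And>j. sqint \<mu> (v j)" "sqint \<mu> v0" "(\<lambda>j. LINT x|\<mu>. (v j x - v0 x)\<^sup>2) \<longlonglongrightarrow> 0"
  shows "(\<lambda>j. coef (\<lambda>x. u j x * v j x) k) \<longlonglongrightarrow> coef (\<lambda>x. u0 x * v0 x) k"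
proof -
  have "(\<lambda>j. LINT x|\<mu>. u j x * (mode k x * v j x)) \<longlonglongrightarrow> (LINT x|\<mu>. u0 x * (mode k x * v0 x))"
    using v by (intro L2_tendsto_product u sqint_bounded_mult[OF _ mode_measurable mode_AE_bound]
        L2_tendsto_bounded_mult[OF _ _ _ mode_measurable mode_AE_bound])
  then show ?thesis by (simp add: coef_def ac_simps)
qed

text \<open>
  For partial sums this is classical. In the limit the Lipschitz bounds on \<open>h\<close> and \<open>h'\<close> carry the \<open>L\<^sup>2\<close>
  convergence through the compositions.
\<close>

lemma wgrad_chain:
  assumes i: "i \<in> Basis" and u: "sqint \<mu> u" and g: "sqint \<mu> g" and w: "wgrad i u g"
    and h: "\<And>y. (h has_real_derivative h' y) (at y)" and h'b: "\<And>y. \<bar>h' y\<bar> \<le> C"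
    and h'L: "\<And>p q. \<bar>h' p - h' q\<bar> \<le> L * \<bar>p - q\<bar>"
  shows "wgrad i (\<lambda>x. h (u x)) (\<lambda>x. h' (u x) * g x)" "sqint \<mu> (\<lambda>x. h (u x))" "sqint \<mu> (\<lambda>x. h' (u x) * g x)"
proof -
  have hL: "\<bar>h p - h q\<bar> \<le> C * \<bar>p - q\<bar>" for p q
    using field_differentiable_bound[of UNIV h h' C p q] h h'b
    by (auto simp: has_field_derivative_at_within)
  have hm: "continuous_on UNIV h" "h \<in> borel_measurable borel" by (rule Lipschitz_borel_measurable[OF hL])+
  have h'm: "continuous_on UNIV h'" "h' \<in> borel_measurable borel" by (rule Lipschitz_borel_measurable[OF h'L])+
  have sq: "sqint \<mu> (\<lambda>x. h (v x))" "sqint \<mu> (\<lambda>x. h' (v x))" if "sqint \<mu> v" for v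
  proof -
    have z: "sqint \<mu> (\<lambda>x. 0)" and c: "sqint \<mu> (\<lambda>x. c)" for c by (simp_all add: sqint_def)
    from sqint_add[OF Lipschitz_integral_square(1)[OF hL hm(2) that z] c[of "h 0"]]
    show "sqint \<mu> (\<lambda>x. h (v x))" by simp
    from sqint_add[OF Lipschitz_integral_square(1)[OF h'L h'm(2) that z] c[of "h' 0"]]
    show "sqint \<mu> (\<lambda>x. h' (v x))" by simp
  qed
  have lim: "(\<lambda>j. LINT x|\<mu>. (H (psum u j x) - H (u x))\<^sup>2) \<longlonglongrightarrow> 0"
    if "\<And>p q. \<bar>H p - H q\<bar> \<le> D * \<bar>p - q\<bar>" for H D
  proof (rule Lim_null_comparison)
    show "\<forall>\<^sub>F j in sequentially. norm (LINT x|\<mu>. (H (psum u j x) - H (u x))\<^sup>2) \<le> D\<^sup>2 * (LINT x|\<mu>. (psum u j x - u x)\<^sup>2)"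
      using Lipschitz_integral_square(2)[OF that Lipschitz_borel_measurable(2)[OF that] sqint_psum u] by simp
    show "(\<lambda>j. D\<^sup>2 * (LINT x|\<mu>. (psum u j x - u x)\<^sup>2)) \<longlonglongrightarrow> 0"
      using tendsto_mult[OF tendsto_const psum_tendsto_L2[OF u], of "D\<^sup>2"] by simp
  qed
  show s1: "sqint \<mu> (\<lambda>x. h (u x))" by (rule sq(1)[OF u])
  show s2: "sqint \<mu> (\<lambda>x. h' (u x) * g x)"
    by (rule sqint_bounded_mult[OF g sqintD(1)[OF sq(2)[OF u]]]) (use h'b in auto)
  have "coef (\<lambda>x. h' (u x) * g x) k = - (k \<bullet> i) * coef (\<lambda>x. h (u x)) (- k)" if k: "k \<in> freqs" for k
  proof -
    have "coef (\<lambda>x. h' (psum u j x) * psum g j x) k = - (k \<bullet> i) * coef (\<lambda>x. h (psum u j x)) (- k)" for j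
      by (rule coef_dir_deriv[OF i k dir_deriv_chain[OF psum_dir_deriv[OF w] h]])
        (auto intro!: continuous_intros continuous_on_compose2[OF hm(1)] continuous_on_compose2[OF h'm(1)] simp: psum_shift[OF i])
    moreover have "(\<lambda>j. coef (\<lambda>x. h' (psum u j x) * psum g j x) k) \<longlonglongrightarrow> coef (\<lambda>x. h' (u x) * g x) k"
      by (intro coef_product_tendsto sq u g sqint_psum lim[OF h'L] psum_tendsto_L2)
    moreover have "(\<lambda>j. - (k \<bullet> i) * coef (\<lambda>x. h (psum u j x)) (- k)) \<longlonglongrightarrow> - (k \<bullet> i) * coef (\<lambda>x. h (u x)) (- k)"
      unfolding coef_def
      by (intro tendsto_mult tendsto_const L2_tendsto_imp_weak sq u sqint_psum mode_sqint lim[OF hL])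
    ultimately show ?thesis using LIMSEQ_unique by fastforce
  qed
  then show "wgrad i (\<lambda>x. h (u x)) (\<lambda>x. h' (u x) * g x)"
    using s1 s2 by (auto simp: wgrad_def intro: sqint_integrable)
qed

lemma wgrad_product:
  assumes i: "i \<in> Basis" and u: "sqint \<mu> u" "sqint \<mu> gu" "wgrad i u gu"
    and v: "sqint \<mu> v" "sqint \<mu> gv" "wgrad i v gv"
  shows "wgrad i (\<lambda>x. u x * v x) (\<lambda>x. gu x * v x + u x * gv x)"
  unfolding wgrad_def
proof (intro conjI ballI)
  have int: "integrable \<mu> (\<lambda>x. gu x * v x)" "integrable \<mu> (\<lambda>x. u x * gv x)"
    using u v by (auto intro: sqint_mult_integrable)
  show "integrable \<mu> (\<lambda>x. u x * v x)" "integrable \<mu> (\<lambda>x. gu x * v x + u x * gv x)"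
    using u v by (auto intro!: sqint_mult_integrable Bochner_Integration.integrable_add)
  fix k assume k: "k \<in> freqs"
  have int': "integrable \<mu> (\<lambda>x. psum gu j x * psum v j x)" "integrable \<mu> (\<lambda>x. psum u j x * psum gv j x)" for j
    by (auto intro: sqint_mult_integrable)
  have "coef (\<lambda>x. psum gu j x * psum v j x) k + coef (\<lambda>x. psum u j x * psum gv j x) k
      = - (k \<bullet> i) * coef (\<lambda>x. psum u j x * psum v j x) (- k)" for j
    unfolding coef_add[OF int', symmetric]
    by (rule coef_dir_deriv[OF i k dir_deriv_mult[OF psum_dir_deriv[OF u(3)] psum_dir_deriv[OF v(3)]]])
      (auto intro!: continuous_intros simp: psum_shift[OF i])
  moreover have "(\<lambda>j. coef (\<lambda>x. psum gu j x * psum v j x) k + coef (\<lambda>x. psum u j x * psum gv j x) k)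
      \<longlonglongrightarrow> coef (\<lambda>x. gu x * v x) k + coef (\<lambda>x. u x * gv x) k"
    by (intro tendsto_add coef_product_tendsto sqint_psum u v psum_tendsto_L2)
  moreover have "(\<lambda>j. - (k \<bullet> i) * coef (\<lambda>x. psum u j x * psum v j x) (- k))
      \<longlonglongrightarrow> - (k \<bullet> i) * coef (\<lambda>x. u x * v x) (- k)"
    by (intro tendsto_mult tendsto_const coef_product_tendsto sqint_psum u v psum_tendsto_L2)
  ultimately have "coef (\<lambda>x. gu x * v x) k + coef (\<lambda>x. u x * gv x) k = - (k \<bullet> i) * coef (\<lambda>x. u x * v x) (- k)"
    using LIMSEQ_unique by fastforce
  then show "coef (\<lambda>x. gu x * v x + u x * gv x) k = - (k \<bullet> i) * coef (\<lambda>x. u x * v x) (- k)"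
    using coef_add[OF int] by simp
qed

lemma wgrad_diff:
  assumes "wgrad i u gu" "wgrad i v gv" shows "wgrad i (\<lambda>x. u x - v x) (\<lambda>x. gu x - gv x)"
  using assms by (auto simp: wgrad_def coef_diff algebra_simps)

text \<open>
  The gradient of \<open>(h x - h y) * U\<close> is small together with \<open>x - y\<close> and its gradient; apart from
  the gradient of \<open>x - y\<close> only the bounded gradients of \<open>x\<close> and \<open>U\<close> occur.
\<close>

lemma gsum_nonlinear_difference:
  fixes x y :: "'a \<Rightarrow> real"
  assumes x: "sqint \<mu> x" "\<And>i. i \<in> Basis \<Longrightarrow> wgrad i x (gx i)" "\<And>i. i \<in> Basis \<Longrightarrow> gx i \<in> borel_measurable \<mu>"
      "\<And>i. i \<in> Basis \<Longrightarrow> AE z in \<mu>. \<bar>gx i z\<bar> \<le> K"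
    and y: "sqint \<mu> y" "\<And>i. i \<in> Basis \<Longrightarrow> wgrad i y (gy i)" "\<And>i. i \<in> Basis \<Longrightarrow> sqint \<mu> (gy i)"
    and U: "U \<in> borel_measurable \<mu>" "AE z in \<mu>. \<bar>U z\<bar> \<le> K" "\<And>i. i \<in> Basis \<Longrightarrow> wgrad i U (gU i)"
      "\<And>i. i \<in> Basis \<Longrightarrow> gU i \<in> borel_measurable \<mu>" "\<And>i. i \<in> Basis \<Longrightarrow> AE z in \<mu>. \<bar>gU i z\<bar> \<le> K"
    and h: "\<And>y. (h has_real_derivative h' y) (at y)" "\<And>y. \<bar>h' y\<bar> \<le> C" "\<And>p q. \<bar>h' p - h' q\<bar> \<le> L * \<bar>p - q\<bar>"
    and G: "\<And>j. gsum (\<lambda>z. x z - y z) j \<le> G"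
  shows "gsum (\<lambda>z. (h (x z) - h (y z)) * U z) j
    \<le> 2 * (K\<^sup>2 * L + C * K)\<^sup>2 * DIM('a) * (LINT z|\<mu>. (x z - y z)\<^sup>2) + 2 * (K * C)\<^sup>2 * G"
proof -
  let ?A = "K\<^sup>2 * L + C * K" and ?B = "K * C"
  have C: "C \<ge> 0" using h(2)[of 0] by simp
  have L: "L \<ge> 0" using h(3)[of 1 0] by simp
  have hL: "\<bar>h p - h q\<bar> \<le> C * \<bar>p - q\<bar>" for p q
    using field_differentiable_bound[of UNIV h h' C p q] h
    by (auto simp: has_field_derivative_at_within)
  have gx: "sqint \<mu> (gx i)" and gU: "sqint \<mu> (gU i)" if "i \<in> Basis" for i
    using x(3,4)[OF that] U(4,5)[OF that] by (auto intro: sqint_bounded)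
  have Us: "sqint \<mu> U" using U(1,2) by (rule sqint_bounded)
  define g where "g = (\<lambda>i z. (h' (x z) * gx i z - h' (y z) * gy i z) * U z + (h (x z) - h (y z)) * gU i z)"
  have wg: "wgrad i (\<lambda>z. (h (x z) - h (y z)) * U z) (g i)" if i: "i \<in> Basis" for i
  proof -
    note cx = wgrad_chain[OF i x(1) gx[OF i] x(2)[OF i] h]
    note cy = wgrad_chain[OF i y(1) y(3)[OF i] y(2)[OF i] h]
    show ?thesis unfolding g_def
      by (rule wgrad_product[OF i sqint_diff[OF cx(2) cy(2)] sqint_diff[OF cx(3) cy(3)] wgrad_diff[OF cx(1) cy(1)]
            Us gU[OF i] U(3)[OF i]])
  qed
  have gb: "sqint \<mu> (g i) \<and> (LINT z|\<mu>. (g i z)\<^sup>2) \<le> 2 * ?A\<^sup>2 * (LINT z|\<mu>. (x z - y z)\<^sup>2) + 2 * ?B\<^sup>2 * (LINT z|\<mu>. (gx i z - gy i z)\<^sup>2)"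
    if i: "i \<in> Basis" for i
  proof -
    let ?m = "\<lambda>z. \<bar>?A * (x z - y z)\<bar> + \<bar>?B * (gx i z - gy i z)\<bar>"
    have s1: "sqint \<mu> (\<lambda>z. \<bar>?A * (x z - y z)\<bar>)" and s2: "sqint \<mu> (\<lambda>z. \<bar>?B * (gx i z - gy i z)\<bar>)"
      using x(1) y(1) gx[OF i] y(3)[OF i] by (auto intro!: sqint_abs sqint_cmult sqint_diff)
    have le: "AE z in \<mu>. \<bar>g i z\<bar> \<le> \<bar>?m z\<bar>"
      using x(4)[OF i] U(2) U(5)[OF i]
    proof eventually_elim
      case (elim z)
      have K: "K \<ge> 0" using elim(1) by linarith
      let ?d = "\<bar>x z - y z\<bar>" and ?e = "\<bar>gx i z - gy i z\<bar>"
      have "h' (x z) * gx i z - h' (y z) * gy i z = (h' (x z) - h' (y z)) * gx i z + h' (y z) * (gx i z - gy i z)"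
        by (simp add: algebra_simps)
      then have "\<bar>h' (x z) * gx i z - h' (y z) * gy i z\<bar> \<le> \<bar>h' (x z) - h' (y z)\<bar> * \<bar>gx i z\<bar> + \<bar>h' (y z)\<bar> * ?e"
        by (metis abs_mult abs_triangle_ineq)
      also have "\<dots> \<le> (L * ?d) * K + C * ?e"
        using elim h L C by (intro add_mono mult_mono) auto
      finally have 1: "\<bar>h' (x z) * gx i z - h' (y z) * gy i z\<bar> * \<bar>U z\<bar> \<le> (L * ?d * K + C * ?e) * K"
        using elim by (intro mult_mono) (use L C K in auto)
      have 2: "\<bar>h (x z) - h (y z)\<bar> * \<bar>gU i z\<bar> \<le> (C * ?d) * K"
        using elim hL C by (intro mult_mono) auto
      have "\<bar>g i z\<bar> \<le> \<bar>h' (x z) * gx i z - h' (y z) * gy i z\<bar> * \<bar>U z\<bar> + \<bar>h (x z) - h (y z)\<bar> * \<bar>gU i z\<bar>"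
        unfolding g_def by (metis abs_mult abs_triangle_ineq)
      also have "\<dots> \<le> (L * ?d * K + C * ?e) * K + (C * ?d) * K" using 1 2 by linarith
      also have "\<dots> = ?A * ?d + ?B * ?e" by (simp add: algebra_simps power2_eq_square)
      also have "\<dots> = ?m z" using K L C by (simp add: abs_mult)
      finally show ?case by simp
    qed
    have "g i \<in> borel_measurable \<mu>" using wg[OF i] by (auto simp: wgrad_def)
    then have sg: "sqint \<mu> (g i)" using sqint_dominated[OF sqint_add[OF s1 s2] _ le] by blast
    have "(LINT z|\<mu>. (g i z)\<^sup>2) \<le> (LINT z|\<mu>. (?m z)\<^sup>2)"
      by (rule integral_square_mono[OF sg sqint_add[OF s1 s2] le])
    also have "\<dots> \<le> 2 * (LINT z|\<mu>. (\<bar>?A * (x z - y z)\<bar>)\<^sup>2) + 2 * (LINT z|\<mu>. (\<bar>?B * (gx i z - gy i z)\<bar>)\<^sup>2)"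
      by (rule integral_square_add_le[OF s1 s2])
    finally show ?thesis using sg by (simp add: power_mult_distrib mult.assoc)
  qed
  have "gsum (\<lambda>z. (h (x z) - h (y z)) * U z) j \<le> (\<Sum>i\<in>Basis. LINT z|\<mu>. (g i z)\<^sup>2)"
    by (rule gsum_le) (use wg gb in auto)
  also have "\<dots> \<le> (\<Sum>i\<in>Basis. 2 * ?A\<^sup>2 * (LINT z|\<mu>. (x z - y z)\<^sup>2) + 2 * ?B\<^sup>2 * (LINT z|\<mu>. (gx i z - gy i z)\<^sup>2))"
    by (intro sum_mono) (use gb in auto)
  also have "\<dots> = 2 * ?A\<^sup>2 * DIM('a) * (LINT z|\<mu>. (x z - y z)\<^sup>2) + 2 * ?B\<^sup>2 * (\<Sum>i\<in>Basis. LINT z|\<mu>. (gx i z - gy i z)\<^sup>2)"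
    by (simp add: sum.distrib sum_distrib_left mult.assoc)
  also have "(\<Sum>i\<in>Basis. LINT z|\<mu>. (gx i z - gy i z)\<^sup>2) \<le> G"
  proof (rule LIMSEQ_le_const2)
    show "gsum (\<lambda>z. x z - y z) \<longlonglongrightarrow> (\<Sum>i\<in>Basis. LINT z|\<mu>. (gx i z - gy i z)\<^sup>2)"
      by (rule gsum_tendsto) (use x y gx in \<open>auto intro: wgrad_diff\<close>)
  qed (use G in auto)
  finally show ?thesis by (simp add: mult_left_mono)
qed

end

section \<open>Spectral gap and sup bound\<close>

lemma summable_weight:
  fixes c :: real assumes "c > 0"
  shows "summable (\<lambda>n. (1 + (c * real n)\<^sup>2) powr (- (2/3)))"
proof (rule summable_comparison_test_ev)
  have "\<forall>\<^sub>F n in sequentially. (1 + (c * real n)\<^sup>2) powr (- (2/3)) \<le> c powr (- (4/3)) * real n powr (- (4/3))"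
    using eventually_gt_at_top[of 0]
  proof eventually_elim
    case (elim n)
    have p: "0 < c * real n" using assms elim by simp
    have "(1 + (c * real n)\<^sup>2) powr (- (2/3)) \<le> ((c * real n)\<^sup>2) powr (- (2/3))"
      using p elim by (intro powr_mono2') auto
    also have "((c * real n)\<^sup>2) powr (- (2/3)) = ((c * real n) powr 2) powr (- (2/3))"
      using p by (simp only: powr_numeral)
    also have "\<dots> = (c * real n) powr (2 * (- (2/3)))" by (rule powr_powr)
    also have "\<dots> = c powr (- (4/3)) * real n powr (- (4/3))"
      using assms elim by (simp add: powr_mult)
    finally show ?case .
  qed
  then show "\<forall>\<^sub>F n in sequentially. norm ((1 + (c * real n)\<^sup>2) powr (- (2/3))) \<le> c powr (- (4/3)) * real n powr (- (4/3))"
    by simp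
  show "summable (\<lambda>n. c powr (- (4/3)) * real n powr (- (4/3)))"
    by (intro summable_mult) (simp add: summable_real_powr_iff)
qed

lemma sum_int_symmetric_le:
  fixes g :: "int \<Rightarrow> real"
  assumes g: "\<And>n. 0 \<le> g n" "\<And>n. g (- n) = g n" and s: "summable (\<lambda>n. g (int n))"
  shows "(\<Sum>n\<in>{- int N..int N}. g n) \<le> 2 * (\<Sum>n. g (int n))"
proof -
  have le: "(\<Sum>n\<le>N. g (int n)) \<le> (\<Sum>n. g (int n))"
    by (rule sum_le_suminf[OF s]) (use g in auto)
  have sub: "{- int N..int N} \<subseteq> int ` {..N} \<union> (\<lambda>n. - int n) ` {..N}"
  proof
    fix n assume n: "n \<in> {- int N..int N}"
    show "n \<in> int ` {..N} \<union> (\<lambda>n. - int n) ` {..N}"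
    proof (cases "n \<ge> 0")
      case True then show ?thesis using n by (intro UnI1 image_eqI[of _ _ "nat n"]) auto
    next
      case False then show ?thesis using n by (intro UnI2 image_eqI[of _ _ "nat (- n)"]) auto
    qed
  qed
  have "(\<Sum>n\<in>{- int N..int N}. g n) \<le> (\<Sum>n\<in>int ` {..N} \<union> (\<lambda>n. - int n) ` {..N}. g n)"
    by (rule sum_mono2) (use sub g in auto)
  also have "\<dots> \<le> (\<Sum>n\<in>int ` {..N}. g n) + (\<Sum>n\<in>(\<lambda>n. - int n) ` {..N}. g n)"
    using sum_Un_nat g by (subst sum_Un) (auto intro!: sum_nonneg)
  also have "(\<Sum>n\<in>int ` {..N}. g n) = (\<Sum>n\<le>N. g (int n))"
    by (subst sum.reindex) auto
  also have "(\<Sum>n\<in>(\<lambda>n. - int n) ` {..N}. g n) = (\<Sum>n\<le>N. g (int n))"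
    by (subst sum.reindex) (auto simp: inj_on_def g)
  finally show ?thesis using le by simp
qed

context periodic_box
begin

text \<open>
  A nonzero frequency has a coordinate that is a nonzero multiple of \<open>2 pi / side i\<close>. This is the
  Poincare inequality in terms of coefficients.
\<close>

lemma spectral_gap:
  obtains c where "c > 0" "\<And>k. k \<in> freqs \<Longrightarrow> k \<noteq> 0 \<Longrightarrow> c \<le> k \<bullet> k"
proof -
  define m where "m = Min ((\<lambda>i. 2 * pi / side i) ` Basis)"
  have m: "m > 0" using side_pos by (simp add: m_def)
  have "m\<^sup>2 \<le> k \<bullet> k" if k: "k \<in> freqs" "k \<noteq> 0" for k
  proof -
    obtain i where i: "i \<in> Basis" "k \<bullet> i \<noteq> 0" using k(2) by (meson euclidean_all_zero_iff)
    obtain n :: int where n: "(k \<bullet> i) * side i = 2 * pi * of_int n" using k(1) i(1) by (auto simp: freqs_def)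
    then have "n \<noteq> 0" using i side_pos[OF i(1)] by auto
    then have "1 \<le> \<bar>real_of_int n\<bar>" by linarith
    have "k \<bullet> i = 2 * pi * of_int n / side i" using n side_pos[OF i(1)] by (simp add: field_simps)
    then have "\<bar>k \<bullet> i\<bar> = 2 * pi / side i * \<bar>of_int n\<bar>" using side_pos[OF i(1)] by (simp add: abs_mult)
    also have "\<dots> \<ge> 2 * pi / side i * 1"
      using \<open>1 \<le> \<bar>real_of_int n\<bar>\<close> side_pos[OF i(1)] by (intro mult_left_mono) auto
    finally have "2 * pi / side i \<le> \<bar>k \<bullet> i\<bar>" by simp
    moreover have "m \<le> 2 * pi / side i" unfolding m_def using i by (intro Min_le) auto
    ultimately have "m \<le> \<bar>k \<bullet> i\<bar>" by simp
    then have "m\<^sup>2 \<le> (k \<bullet> i)\<^sup>2" using m power_mono[of m "\<bar>k \<bullet> i\<bar>" 2] by simp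
    also have "\<dots> \<le> (\<Sum>i\<in>Basis. (k \<bullet> i)\<^sup>2)" using i by (intro member_le_sum) auto
    finally show ?thesis by (simp add: sum_Basis_square)
  qed
  then show ?thesis using that[of "m\<^sup>2"] m by auto
qed

text \<open>
  In dimension at most three \<open>(1 + |k|\<^sup>2)\<^sup>-\<^sup>2\<close> is dominated by the product over the coordinates of
  \<open>(1 + k\<^sub>i\<^sup>2)\<close> to the power \<open>-2/3\<close>, and \<open>n\<close> to the power \<open>-4/3\<close> is summable.
\<close>

lemma sum_blk_weight_bounded:
  assumes d: "DIM('a) \<le> 3"
  obtains S where "S > 0" "\<And>j. (\<Sum>k\<in>blk j. 1 / (1 + k \<bullet> k)\<^sup>2) \<le> S"
proof -
  define w where "w = (\<lambda>i (n::int). (1 + (2 * pi / side i * of_int n)\<^sup>2) powr (- (2/3)))"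
  define W where "W = (\<lambda>i. 2 * (\<Sum>n. w i (int n)))"
  have w0: "0 < w i n" for i n
    unfolding w_def by (simp add: add_pos_nonneg order_less_imp_not_eq2)
  have Ws: "(\<Sum>n\<in>{- int N..int N}. w i n) \<le> W i" if "i \<in> Basis" for i N
    unfolding W_def
  proof (rule sum_int_symmetric_le)
    show "summable (\<lambda>n. w i (int n))"
      unfolding w_def using summable_weight[of "2 * pi / side i"] side_pos[OF that] by simp
  qed (use w0 in \<open>auto simp: less_imp_le w_def\<close>)
  have le: "1 / (1 + lattice_point f \<bullet> lattice_point f)\<^sup>2 \<le> (\<Prod>i\<in>Basis. w i (f i))" for f
  proof -
    let ?k = "lattice_point f"
    have k1: "1 \<le> 1 + ?k \<bullet> ?k" by simp
    have "1 / (1 + ?k \<bullet> ?k)\<^sup>2 = (1 + ?k \<bullet> ?k) powr (- 2)"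
      using k1 by (simp add: powr_minus powr_numeral divide_inverse)
    \<comment> \<open>here the dimension is at most three\<close>
    also have "\<dots> \<le> (1 + ?k \<bullet> ?k) powr (- (2/3) * DIM('a))"
      by (rule powr_mono) (use d k1 in auto)
    also have "\<dots> = ((1 + ?k \<bullet> ?k) powr (- (2/3))) powr real DIM('a)" by (simp only: powr_powr)
    also have "\<dots> = ((1 + ?k \<bullet> ?k) powr (- (2/3))) ^ DIM('a)"
      by (intro powr_realpow powr_gt_zero[THEN iffD2]) (use k1 in linarith)
    also have "\<dots> = (\<Prod>i\<in>(Basis::'a set). (1 + ?k \<bullet> ?k) powr (- (2/3)))" by simp
    also have "\<dots> \<le> (\<Prod>i\<in>Basis. w i (f i))"
    proof (rule prod_mono, intro conjI)
      fix i :: 'a assume i: "i \<in> Basis"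
      have "(?k \<bullet> i)\<^sup>2 \<le> (\<Sum>i\<in>Basis. (?k \<bullet> i)\<^sup>2)" using i by (intro member_le_sum) auto
      then have "(2 * pi / side i * of_int (f i))\<^sup>2 \<le> ?k \<bullet> ?k"
        using lattice_point_inner[OF i, of f] by (simp add: sum_Basis_square)
      then show "(1 + ?k \<bullet> ?k) powr (- (2/3)) \<le> w i (f i)"
        unfolding w_def by (intro powr_mono2') (auto intro: add_pos_nonneg)
    qed auto
    finally show ?thesis .
  qed
  have "(\<Sum>k\<in>blk j. 1 / (1 + k \<bullet> k)\<^sup>2) \<le> (\<Prod>i\<in>Basis. W i)" for j
  proof -
    define R where "R = (\<lambda>k. SOME f. f \<in> extensional Basis \<and> k = lattice_point f)"
    have R: "R k \<in> extensional Basis" "k = lattice_point (R k)" if "k \<in> blk j" for k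
      using someI_ex[of "\<lambda>f. f \<in> extensional Basis \<and> k = lattice_point f"]
        freqs_lattice_point[OF blk_in_freqs[OF that]] unfolding R_def by metis+
    have inj: "inj_on R (blk j)" by (rule inj_onI) (metis R(2))
    have fin: "finite (R ` blk j)" by simp
    define N where "N = nat (Max (insert 0 ((\<lambda>(f, i). \<bar>f i\<bar>) ` (R ` blk j \<times> Basis))))"
    have fN: "\<bar>f i\<bar> \<le> int N" if "f \<in> R ` blk j" "i \<in> Basis" for f i
    proof -
      have "\<bar>f i\<bar> \<le> Max (insert 0 ((\<lambda>(f, i). \<bar>f i\<bar>) ` (R ` blk j \<times> Basis)))"
        using that fin by (intro Max_ge) force+
      then show ?thesis unfolding N_def by linarith
    qed
    have sub: "R ` blk j \<subseteq> PiE Basis (\<lambda>_. {- int N..int N})"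
    proof (intro subsetI)
      fix f assume f: "f \<in> R ` blk j"
      then have "f \<in> extensional Basis" using R(1) by blast
      moreover have "f i \<in> {- int N..int N}" if "i \<in> Basis" for i
        using fN[OF f that] by auto
      ultimately show "f \<in> PiE Basis (\<lambda>_. {- int N..int N})" by (simp add: PiE_iff)
    qed
    have "(\<Sum>k\<in>blk j. 1 / (1 + k \<bullet> k)\<^sup>2) \<le> (\<Sum>k\<in>blk j. \<Prod>i\<in>Basis. w i (R k i))"
      by (intro sum_mono) (metis le R(2))
    also have "\<dots> = (\<Sum>f\<in>R ` blk j. \<Prod>i\<in>Basis. w i (f i))"
      by (simp add: sum.reindex[OF inj])
    also have "\<dots> \<le> (\<Sum>f\<in>PiE Basis (\<lambda>_. {- int N..int N}). \<Prod>i\<in>Basis. w i (f i))"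
      by (intro sum_mono2 finite_PiE sub prod_nonneg) (auto intro: less_imp_le w0)
    also have "\<dots> = (\<Prod>i\<in>Basis. \<Sum>n\<in>{- int N..int N}. w i n)"
      by (rule prod_sum_PiE[symmetric]) auto
    also have "\<dots> \<le> (\<Prod>i\<in>Basis. W i)"
      by (intro prod_mono conjI sum_nonneg Ws) (auto intro: less_imp_le w0)
    finally show ?thesis .
  qed
  then show ?thesis using that[of "max 1 (\<Prod>i\<in>Basis. W i)"] by (meson le_max_iff_disj less_max_iff_disj zero_less_one)
qed

text \<open>
  Cauchy-Schwarz for the Fourier series, with the weights \<open>1 + |k|\<^sup>2\<close> and their inverses.
\<close>

theorem sup_bound_H2:
  assumes d: "DIM('a) \<le> 3"
  obtains C where "C > 0" "\<And>u Q. sqint \<mu> u \<Longrightarrow> (\<And>j. (\<Sum>k\<in>blk j. ((1 + k \<bullet> k) * coef u k)\<^sup>2) \<le> Q) \<Longrightarrow>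
    AE x in \<mu>. \<bar>u x\<bar> \<le> C * sqrt Q"
proof -
  obtain S where S: "S > 0" "\<And>j. (\<Sum>k\<in>blk j. 1 / (1 + k \<bullet> k)\<^sup>2) \<le> S"
    using sum_blk_weight_bounded[OF d] by blast
  define C where "C = 2 / sqrt vol * sqrt S"
  have "AE x in \<mu>. \<bar>u x\<bar> \<le> C * sqrt Q"
    if u: "sqint \<mu> u" and Q: "\<And>j. (\<Sum>k\<in>blk j. ((1 + k \<bullet> k) * coef u k)\<^sup>2) \<le> Q" for u Q
  proof (rule AE_bound_closed_L2[OF _ u psum_tendsto_L2[OF u]])
    have "\<bar>psum u j x\<bar> \<le> C * sqrt Q" for j x
    proof -
      let ?t = "\<Sum>k\<in>blk j. \<bar>(1 + k \<bullet> k) * coef u k\<bar> * (1 / (1 + k \<bullet> k))"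
      have "\<bar>psum u j x\<bar> \<le> (\<Sum>k\<in>blk j. \<bar>coef u k\<bar> * (2 / sqrt vol))"
        unfolding psum_def
        by (rule order_trans[OF sum_abs], rule sum_mono, simp only: abs_mult)
          (intro mult_left_mono mode_bound abs_ge_zero)
      moreover have "(\<Sum>k\<in>blk j. \<bar>coef u k\<bar> * (2 / sqrt vol)) = 2 / sqrt vol * ?t"
      proof -
        have "\<bar>(1 + k \<bullet> k) * coef u k\<bar> * (1 / (1 + k \<bullet> k)) = \<bar>coef u k\<bar>" for k
        proof -
          have "1 + k \<bullet> k > 0" by (simp add: add_pos_nonneg)
          then show ?thesis by (simp add: abs_mult)
        qed
        then show ?thesis by (simp add: sum_distrib_left mult.commute)
      qed
      moreover have "?t \<le> sqrt Q * sqrt S"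
      proof -
        have "?t\<^sup>2 \<le> (\<Sum>k\<in>blk j. (\<bar>(1 + k \<bullet> k) * coef u k\<bar>)\<^sup>2) * (\<Sum>k\<in>blk j. (1 / (1 + k \<bullet> k))\<^sup>2)"
          by (rule Cauchy_Schwarz_ineq_sum)
        also have "\<dots> \<le> Q * S"
          using Q[of j] S(2)[of j] order_trans[OF sum_nonneg Q[of j]]
          by (intro mult_mono) (auto simp: power_divide intro: sum_nonneg)
        finally have "?t \<le> sqrt (Q * S)" by (rule real_le_rsqrt)
        then show ?thesis by (simp only: real_sqrt_mult)
      qed
      then have "2 / sqrt vol * ?t \<le> 2 / sqrt vol * (sqrt Q * sqrt S)"
        using vol_pos by (intro mult_left_mono) auto
      ultimately show ?thesis by (simp add: C_def mult_ac)
    qed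
    then show "\<exists>\<^sub>F j in sequentially. sqint \<mu> (psum u j) \<and> (AE x in \<mu>. \<bar>psum u j x\<bar> \<le> C * sqrt Q)"
      by (auto intro!: eventually_frequently always_eventually)
  qed
  moreover have "C > 0" using S(1) vol_pos by (simp add: C_def)
  ultimately show ?thesis using that by blast
qed

end

section \<open>Test functions in time\<close>

text \<open>
  Differentiability to a given order, handing over one derivative at a time; this makes the closure
  properties simple inductions.
\<close>

fun smooth_upto :: "nat \<Rightarrow> (real \<Rightarrow> real) \<Rightarrow> bool" where
  "smooth_upto 0 f \<longleftrightarrow> continuous_on UNIV f"
| "smooth_upto (Suc k) f \<longleftrightarrow> (\<exists>f'. (\<forall>x. (f has_real_derivative f' x) (at x)) \<and> smooth_upto k f')"

lemma smooth_upto_continuous: "smooth_upto k f \<Longrightarrow> continuous_on UNIV f"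
proof (cases k)
  case (Suc j)
  assume "smooth_upto k f"
  then obtain f' where "\<And>x. (f has_real_derivative f' x) (at x)" unfolding Suc smooth_upto.simps by blast
  then show ?thesis using DERIV_isCont by (metis continuous_at_imp_continuous_on)
qed simp

lemma smooth_upto_mono: "smooth_upto (Suc k) f \<Longrightarrow> smooth_upto k f"
proof (induction k arbitrary: f)
  case 0 show ?case using smooth_upto_continuous[OF 0] by simp
next
  case (Suc k)
  obtain f' where "\<forall>x. (f has_real_derivative f' x) (at x)" "smooth_upto (Suc k) f'"
    using Suc.prems unfolding smooth_upto.simps(2)[of "Suc k"] by blast
  then show ?case using Suc.IH unfolding smooth_upto.simps(2)[of k] by blast
qed

lemma smooth_upto_add: "smooth_upto k f \<Longrightarrow> smooth_upto k g \<Longrightarrow> smooth_upto k (\<lambda>x. f x + g x)"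
proof (induction k arbitrary: f g)
  case 0 then show ?case by (auto intro: continuous_intros)
next
  case (Suc k)
  then obtain f' g' where "\<And>x. (f has_real_derivative f' x) (at x)" "smooth_upto k f'"
    "\<And>x. (g has_real_derivative g' x) (at x)" "smooth_upto k g'" by auto
  then show ?case using Suc.IH by (auto intro!: exI[of _ "\<lambda>x. f' x + g' x"] derivative_intros)
qed

lemma smooth_upto_mult: "smooth_upto k f \<Longrightarrow> smooth_upto k g \<Longrightarrow> smooth_upto k (\<lambda>x. f x * g x)"
proof (induction k arbitrary: f g)
  case 0 then show ?case by (auto intro: continuous_intros)
next
  case (Suc k)
  then obtain f' g' where d: "\<And>x. (f has_real_derivative f' x) (at x)" "smooth_upto k f'"
    "\<And>x. (g has_real_derivative g' x) (at x)" "smooth_upto k g'" by auto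
  have "smooth_upto k f" "smooth_upto k g" using Suc.prems smooth_upto_mono by blast+
  then have "smooth_upto k (\<lambda>x. f' x * g x + g' x * f x)"
    using d by (intro smooth_upto_add Suc.IH)
  then show ?case unfolding smooth_upto.simps
    by (intro exI[of _ "\<lambda>x. f' x * g x + g' x * f x"] conjI allI DERIV_mult[OF d(1,3)])
qed

lemma smooth_upto_const: "smooth_upto k (\<lambda>x. c)"
proof (induction k arbitrary: c)
  case (Suc k) then show ?case by (auto intro!: exI[of _ "\<lambda>x. 0"])
qed auto

lemma smooth_upto_affine: "smooth_upto k f \<Longrightarrow> smooth_upto k (\<lambda>x. f (p * x + q))"
proof (induction k arbitrary: f)
  case 0
  then have "continuous_on UNIV f" by simp
  then have "continuous_on UNIV (\<lambda>x. f (p * x + q))"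
    by (rule continuous_on_compose2) (auto intro!: continuous_intros)
  then show ?case by simp
next
  case (Suc k)
  then obtain f' where d: "\<And>x. (f has_real_derivative f' x) (at x)" "smooth_upto k f'" by auto
  have "((\<lambda>x. f (p * x + q)) has_real_derivative f' (p * x + q) * p) (at x)" for x
    by (rule DERIV_chain2[OF d(1)]) (auto intro!: derivative_eq_intros)
  moreover have "smooth_upto k (\<lambda>x. f' (p * x + q) * p)"
    by (intro smooth_upto_mult smooth_upto_const Suc.IH d)
  ultimately show ?case unfolding smooth_upto.simps
    by (intro exI[of _ "\<lambda>x. f' (p * x + q) * p"] conjI allI)
qed

lemma smooth_upto_imp_C_k: "smooth_upto k f \<Longrightarrow> C_k k f"
proof (induction k arbitrary: f)
  case 0 then show ?case by (simp add: C_k_def)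
next
  case (Suc k)
  then obtain f' where d: "\<And>x. (f has_real_derivative f' x) (at x)" "smooth_upto k f'" by auto
  have e: "deriv f = f'" using d(1) DERIV_imp_deriv by blast
  have "f differentiable_on UNIV"
    using d(1) by (auto simp: differentiable_on_def real_differentiable_def)
  moreover have "C_k k f'" using Suc.IH d by blast
  ultimately show ?case
    by (auto simp: C_k_def e funpow_Suc_right less_Suc_eq_0_disj simp del: funpow.simps)
qed

text \<open>
  The function \<open>exp (- 1 / x)\<close>, continued by zero, times a polynomial in \<open>1 / x\<close>. This family is closed
  under differentiation and contains the building block of a smooth bump.
\<close>

definition exp_inv :: "real poly \<Rightarrow> real \<Rightarrow> real" where
  "exp_inv p x = (if x > 0 then poly p (1 / x) * exp (- (1 / x)) else 0)"

lemma exp_inv_tendsto: "((\<lambda>x. exp_inv p x) \<longlongrightarrow> 0) (at_right 0)"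
proof -
  have "((\<lambda>y. poly p y * exp (- y)) \<longlongrightarrow> 0) at_top"
  proof -
    have "((\<lambda>y. \<Sum>i\<le>degree p. coeff p i * (y ^ i / exp y)) \<longlongrightarrow> (\<Sum>i\<le>degree p. coeff p i * 0)) at_top"
      by (intro tendsto_sum tendsto_mult tendsto_const tendsto_power_div_exp_0)
    then show ?thesis
      by (simp add: poly_altdef exp_minus divide_inverse sum_distrib_right mult.assoc)
  qed
  then have "((\<lambda>x. poly p (inverse x) * exp (- inverse x)) \<longlongrightarrow> 0) (at_right 0)"
    by (rule filterlim_compose[OF _ filterlim_inverse_at_top_right])
  moreover have "\<forall>\<^sub>F x in at_right 0. poly p (inverse x) * exp (- inverse x) = exp_inv p x"
    by (auto simp: eventually_at_right_less exp_inv_def inverse_eq_divide intro: eventually_mono[OF eventually_at_right_less])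
  ultimately show ?thesis using filterlim_cong[OF refl refl] by fastforce
qed

text \<open>
  At zero, the difference quotient is again a function of this form and tends to zero.
\<close>

lemma exp_inv_derivative:
  "(exp_inv p has_real_derivative exp_inv (monom 1 2 * (p - pderiv p)) x) (at x)"
proof (cases "x = 0")
  case False
  show ?thesis
  proof (cases "x > 0")
    case True
    have "((\<lambda>x. poly p (1 / x) * exp (- (1 / x))) has_real_derivative exp_inv (monom 1 2 * (p - pderiv p)) x) (at x)"
    proof -
      have 1: "((\<lambda>x. 1 / x) has_real_derivative - (1 / x\<^sup>2)) (at x)"
        using True by (auto intro!: derivative_eq_intros simp: power2_eq_square)
      have 2: "((\<lambda>x. poly p (1 / x)) has_real_derivative poly (pderiv p) (1 / x) * - (1 / x\<^sup>2)) (at x)"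
        by (rule DERIV_chain2[OF poly_DERIV 1])
      have 3: "((\<lambda>x. exp (- (1 / x))) has_real_derivative exp (- (1 / x)) * (1 / x\<^sup>2)) (at x)"
        using DERIV_chain2[OF DERIV_exp DERIV_minus[OF 1]] by simp
      show ?thesis
        by (rule DERIV_cong[OF DERIV_mult[OF 2 3]])
          (use True in \<open>simp add: exp_inv_def poly_monom algebra_simps power_one_over\<close>)
    qed
    moreover have "\<forall>\<^sub>F y in nhds x. exp_inv p y = poly p (1 / y) * exp (- (1 / y))"
      using True by (auto simp: exp_inv_def eventually_nhds intro!: exI[of _ "{0<..}"])
    ultimately show ?thesis by (subst DERIV_cong_ev[OF refl _ refl])
  next
    case neg: False
    have "((\<lambda>x. 0) has_real_derivative 0) (at x)" by simp
    moreover have "\<forall>\<^sub>F y in nhds x. exp_inv p y = 0"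
      using neg False by (auto simp: exp_inv_def eventually_nhds intro!: exI[of _ "{..<0}"])
    moreover have "exp_inv (monom 1 2 * (p - pderiv p)) x = 0" using neg by (simp add: exp_inv_def)
    ultimately show ?thesis using DERIV_cong_ev[OF refl _ refl, of "exp_inv p" "\<lambda>_. 0" x 0] by simp
  qed
next
  case True
  have "((\<lambda>y. (exp_inv p y - exp_inv p 0) / (y - 0)) \<longlongrightarrow> 0) (at 0)"
  proof (rule filterlim_split_at)
    have "\<forall>\<^sub>F y in at_left 0. (exp_inv p y - exp_inv p 0) / (y - 0) = 0"
      using eventually_at_left_real[of "-1" 0] by (auto simp: exp_inv_def elim: eventually_mono)
    then show "((\<lambda>y. (exp_inv p y - exp_inv p 0) / (y - 0)) \<longlongrightarrow> 0) (at_left 0)" by (rule tendsto_eventually)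
    have "\<forall>\<^sub>F y in at_right 0. exp_inv (monom 1 1 * p) y = (exp_inv p y - exp_inv p 0) / (y - 0)"
      using eventually_at_right_real[of 0 1] by (auto simp: exp_inv_def poly_monom elim: eventually_mono)
    with exp_inv_tendsto[of "monom 1 1 * p"]
    show "((\<lambda>y. (exp_inv p y - exp_inv p 0) / (y - 0)) \<longlongrightarrow> 0) (at_right 0)"
      by (rule Lim_transform_eventually)
  qed
  then show ?thesis using True by (simp add: has_field_derivative_iff exp_inv_def)
qed

lemma exp_inv_smooth: "smooth_upto k (exp_inv p)"
proof (induction k arbitrary: p)
  case 0
  have "isCont (exp_inv p) x" for x using exp_inv_derivative by (rule DERIV_isCont)
  then show ?case by (simp add: continuous_at_imp_continuous_on)
next
  case (Suc k) then show ?case unfolding smooth_upto.simps using exp_inv_derivative by blast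
qed

text \<open>Rescaled and translated, such steps approximate the indicators of time intervals by test functions.\<close>

lemma smooth_step_exists:
  obtains S \<rho> :: "real \<Rightarrow> real" where "\<And>x. (S has_real_derivative \<rho> x) (at x)"
    "\<And>k. smooth_upto k S" "\<And>x. x \<le> 0 \<Longrightarrow> S x = 0" "\<And>x. x \<ge> 1 \<Longrightarrow> S x = 1"
    "\<And>x. 0 \<le> S x \<and> S x \<le> 1" "\<And>x. 0 \<le> \<rho> x" "\<And>x. x \<notin> {0..1} \<Longrightarrow> \<rho> x = 0" "continuous_on UNIV \<rho>"
proof -
  define r where "r = (\<lambda>x. exp_inv 1 x * exp_inv 1 (- 1 * x + 1))"
  have rs: "smooth_upto k r" for k
    unfolding r_def by (intro smooth_upto_mult smooth_upto_affine exp_inv_smooth)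
  have rc: "continuous_on UNIV r" using smooth_upto_continuous[OF rs] .
  have r0: "0 \<le> r x" for x by (simp add: r_def exp_inv_def)
  have rz: "r x = 0" if "x \<notin> {0<..<1}" for x using that by (auto simp: r_def exp_inv_def)
  have rp: "r x > 0" if "x \<in> {0<..<1}" for x using that by (auto simp: r_def exp_inv_def)
  have "\<exists>R. \<forall>x :: real. - \<infinity> < ereal x \<longrightarrow> ereal x < \<infinity> \<longrightarrow> (R has_vector_derivative r x) (at x)"
    by (rule einterval_antiderivative) (use rc in \<open>auto simp: continuous_on_eq_continuous_at\<close>)
  then obtain R where R: "\<And>x. (R has_real_derivative r x) (at x)"
    by (auto simp: has_real_derivative_iff_has_vector_derivative)
  have mono: "R x \<le> R y" if "x \<le> y" for x y
    using DERIV_nonneg_imp_nondecreasing[OF that] R r0 by blast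
  have lt: "R 0 < R 1"
  proof -
    have "R (1/4) < R (3/4)"
      by (rule DERIV_pos_imp_increasing) (use R rp in \<open>auto intro!: exI[of _ "r _"]\<close>)
    then show ?thesis using mono[of 0 "1/4"] mono[of "3/4" 1] by simp
  qed
  define c where "c = 1 / (R 1 - R 0)"
  have c: "c > 0" using lt by (simp add: c_def)
  define S where "S = (\<lambda>x. c * (R x - R 0))"
  define \<rho> where "\<rho> = (\<lambda>x. c * r x)"
  have S': "(S has_real_derivative \<rho> x) (at x)" for x
    unfolding S_def \<rho>_def by (auto intro!: derivative_eq_intros R)
  have const: "R x = R y" if "x \<le> y" "\<And>z. x < z \<Longrightarrow> z < y \<Longrightarrow> r z = 0" for x y
  proof (cases "x = y")
    case False
    then show ?thesis
      using DERIV_isconst2[of x y R y] that R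
      by (metis DERIV_isCont continuous_at_imp_continuous_on less_eq_real_def order_refl)
  qed simp
  have S0: "S x = 0" if "x \<le> 0" for x using const[of x 0] that rz by (simp add: S_def)
  have S1: "S x = 1" if "x \<ge> 1" for x using const[of 1 x] that rz lt by (simp add: S_def c_def)
  have Smono: "S x \<le> S y" if "x \<le> y" for x y using mono[OF that] c by (simp add: S_def mult_left_mono)
  have Sb: "0 \<le> S x \<and> S x \<le> 1" for x
    using Smono[of "min x 0" x] Smono[of x "max x 1"] S0[of "min x 0"] S1[of "max x 1"] by simp
  have Sk: "smooth_upto k S" for k
  proof (cases k)
    case 0
    have "isCont S x" for x using S' by (rule DERIV_isCont)
    then show ?thesis using 0 by (simp add: continuous_at_imp_continuous_on)
  next
    case (Suc j)
    have "smooth_upto j \<rho>" unfolding \<rho>_def by (intro smooth_upto_mult smooth_upto_const rs)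
    then show ?thesis using S' unfolding Suc smooth_upto.simps by blast
  qed
  show ?thesis
    by (rule that[OF S' Sk S0 S1 Sb]) (use c r0 rz rc in \<open>auto simp: \<rho>_def intro!: continuous_intros\<close>)
qed

section \<open>Functions of time\<close>

text \<open>
  The integral over the half-open interval from \<open>r\<close> to \<open>t\<close>, so that the intervals of consecutive
  time steps are disjoint and their integrals add up to at most the integral over the whole interval.
\<close>

definition tint :: "real \<Rightarrow> real \<Rightarrow> real \<Rightarrow> (real \<Rightarrow> real) \<Rightarrow> real" where
  "tint T r t f = (LINT s|lebesgue_on {0<..<T}. indicator {r<..t} s * f s)"

lemma finite_measure_time: "finite_measure (lebesgue_on {0<..<T::real})"
  using finite_measure_lebesgue_on[OF lmeasurable_box, of 0 T] by simp

lemma indicator_time_measurable: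
  "(indicator {r<..t} :: real \<Rightarrow> real) \<in> borel_measurable (lebesgue_on {0<..<T})"
  by (intro measurable_restrict_space1 borel_measurable_indicator) auto

lemma tint_integrable:
  fixes T :: real and f :: "real \<Rightarrow> real"
  assumes "integrable (lebesgue_on {0<..<T}) f"
  shows "integrable (lebesgue_on {0<..<T}) (\<lambda>s. indicator {r<..t} s * f s)"
proof (rule Bochner_Integration.integrable_bound[OF assms])
  show "(\<lambda>s. indicator {r<..t} s * f s) \<in> borel_measurable (lebesgue_on {0<..<T})"
    using indicator_time_measurable assms by (intro borel_measurable_times) auto
qed (auto simp: indicator_def)

lemma tint_mono:
  fixes T :: real and f g :: "real \<Rightarrow> real"
  assumes "integrable (lebesgue_on {0<..<T}) f" "integrable (lebesgue_on {0<..<T}) g"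
    and "AE s in lebesgue_on {0<..<T}. s \<in> {r<..t} \<longrightarrow> f s \<le> g s"
  shows "tint T r t f \<le> tint T r t g"
  unfolding tint_def
  by (rule integral_mono_AE[OF tint_integrable[OF assms(1)] tint_integrable[OF assms(2)]])
    (use assms(3) in \<open>auto simp: indicator_def elim!: eventually_mono\<close>)

lemma tint_abs_le:
  fixes T :: real and f g :: "real \<Rightarrow> real"
  assumes "integrable (lebesgue_on {0<..<T}) f" "integrable (lebesgue_on {0<..<T}) g"
    and "AE s in lebesgue_on {0<..<T}. s \<in> {r<..t} \<longrightarrow> \<bar>f s\<bar> \<le> g s"
  shows "\<bar>tint T r t f\<bar> \<le> tint T r t g"
proof -
  have "tint T r t f \<le> tint T r t g"
    by (rule tint_mono[OF assms(1,2)]) (use assms(3) in \<open>auto elim: eventually_mono\<close>)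
  moreover have "tint T r t (\<lambda>s. - f s) \<le> tint T r t g"
    by (rule tint_mono) (use assms in \<open>auto elim: eventually_mono\<close>)
  moreover have "tint T r t (\<lambda>s. - f s) = - tint T r t f" by (simp add: tint_def)
  ultimately show ?thesis by linarith
qed

lemma tint_diff:
  fixes T :: real and f g :: "real \<Rightarrow> real"
  assumes "integrable (lebesgue_on {0<..<T}) f" "integrable (lebesgue_on {0<..<T}) g"
  shows "tint T r t (\<lambda>s. f s - g s) = tint T r t f - tint T r t g"
  unfolding tint_def using tint_integrable[OF assms(1)] tint_integrable[OF assms(2)]
  by (simp add: right_diff_distrib)

lemma tint_cmult: "tint T r t (\<lambda>s. c * f s) = c * tint T r t f"
  by (simp add: tint_def mult.left_commute)

lemma tint_sum:
  fixes T :: real and f :: "'i \<Rightarrow> real \<Rightarrow> real"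
  assumes "\<And>i. i \<in> S \<Longrightarrow> integrable (lebesgue_on {0<..<T}) (f i)"
  shows "tint T r t (\<lambda>s. \<Sum>i\<in>S. f i s) = (\<Sum>i\<in>S. tint T r t (f i))"
  unfolding tint_def sum_distrib_left
  by (rule Bochner_Integration.integral_sum) (rule tint_integrable[OF assms])

lemma tint_const:
  assumes "0 \<le> r" "r \<le> t" "t \<le> T" shows "tint T r t (\<lambda>_. c) = (t - r) * c"
proof -
  have "tint T r t (\<lambda>_. c) = measure (lebesgue_on {0<..<T}) ({r<..t} \<inter> {0<..<T}) * c"
    by (simp add: tint_def)
  also have "measure (lebesgue_on {0<..<T}) ({r<..t} \<inter> {0<..<T}) = measure lebesgue ({r<..t} \<inter> {0<..<T})"
    by (simp add: measure_restrict_space)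
  also have "\<dots> = t - r"
  proof (cases "t = T")
    case True
    then have "{r<..t} \<inter> {0<..<T} = {r<..<t}" using assms by auto
    then show ?thesis using assms by simp
  next
    case False
    then have "{r<..t} \<inter> {0<..<T} = {r<..t}" using assms by auto
    then show ?thesis using assms by simp
  qed
  finally show ?thesis .
qed

lemma tint_nonneg: "(\<And>s. 0 \<le> f s) \<Longrightarrow> 0 \<le> tint T r t f"
  unfolding tint_def by (rule Bochner_Integration.integral_nonneg) simp

lemma tint_square_le:
  assumes "0 \<le> r" "r \<le> t" "t \<le> T" and f: "sqint (lebesgue_on {0<..<T}) f"
  shows "(tint T r t f)\<^sup>2 \<le> (t - r) * tint T r t (\<lambda>s. (f s)\<^sup>2)"
proof -
  let ?M = "lebesgue_on {0<..<T}"
  interpret finite_measure ?M by (rule finite_measure_time)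
  have i: "sqint ?M (indicator {r<..t})"
    by (rule sqint_bounded[of _ 1, OF indicator_time_measurable]) (auto simp: indicator_def)
  have j: "sqint ?M (\<lambda>s. indicator {r<..t} s * f s)"
    by (rule sqint_bounded_mult[OF f indicator_time_measurable, of _ _ 1]) (auto simp: indicator_def)
  have "(LINT s|?M. indicator {r<..t} s * (indicator {r<..t} s * f s))\<^sup>2
      \<le> (LINT s|?M. (indicator {r<..t} s)\<^sup>2) * (LINT s|?M. (indicator {r<..t} s * f s)\<^sup>2)"
    by (rule integral_Cauchy_Schwarz[OF i j])
  moreover have "(\<lambda>s. indicator {r<..t} s * (indicator {r<..t} s * f s)) = (\<lambda>s. indicator {r<..t} s * f s)"
    "(\<lambda>s. (indicator {r<..t} s)\<^sup>2) = (\<lambda>s. indicator {r<..t} s * (1::real))"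
    "(\<lambda>s. (indicator {r<..t} s * f s)\<^sup>2) = (\<lambda>s. indicator {r<..t} s * (f s)\<^sup>2)"
    by (auto simp: indicator_def)
  ultimately have "(tint T r t f)\<^sup>2 \<le> tint T r t (\<lambda>_. 1) * tint T r t (\<lambda>s. (f s)\<^sup>2)"
    unfolding tint_def by metis
  then show ?thesis using tint_const[OF assms(1-3), of 1] by simp
qed

lemma sum_tint_le:
  assumes f: "integrable (lebesgue_on {0<..<T}) f" "\<And>s. 0 \<le> f s" and "dt > 0"
  shows "(\<Sum>n<N. tint T (real n * dt) (real (Suc n) * dt) f) \<le> (LINT s|lebesgue_on {0<..<T}. f s)"
proof -
  have le1: "(\<Sum>n<N. indicator {real n * dt<..real (Suc n) * dt} s) \<le> (1::real)" for s
  proof -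
    have "(\<Sum>n<N. indicator {real n * dt<..real (Suc n) * dt} s) = (indicator {0<..real N * dt} s :: real)"
    proof (induction N)
      case (Suc N)
      have split: "(indicator {0<..p} s + indicator {p<..q} s :: real) = indicator {0<..q} s" if "0 \<le> p" "p \<le> q" for p q :: real
        using that by (auto simp: indicator_def)
      show ?case unfolding sum.lessThan_Suc Suc
        by (rule split) (use \<open>dt > 0\<close> in \<open>auto intro!: mult_right_mono\<close>)
    qed simp
    then show ?thesis by (simp add: indicator_def)
  qed
  have "(\<Sum>n<N. tint T (real n * dt) (real (Suc n) * dt) f)
      = (LINT s|lebesgue_on {0<..<T}. (\<Sum>n<N. indicator {real n * dt<..real (Suc n) * dt} s * f s))"
    unfolding tint_def by (rule Bochner_Integration.integral_sum[symmetric]) (rule tint_integrable[OF f(1)])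
  also have "\<dots> \<le> (LINT s|lebesgue_on {0<..<T}. f s)"
  proof (rule integral_mono)
    show "integrable (lebesgue_on {0<..<T}) (\<lambda>s. \<Sum>n<N. indicator {real n * dt<..real (Suc n) * dt} s * f s)"
      by (intro Bochner_Integration.integrable_sum tint_integrable f)
    show "(\<Sum>n<N. indicator {real n * dt<..real (Suc n) * dt} s * f s) \<le> f s" for s
      using mult_right_mono[OF le1[of s] f(2)[of s]] by (simp add: sum_distrib_right)
  qed (rule f)
  finally show ?thesis .
qed

lemma continuous_time_measurable:
  fixes g :: "real \<Rightarrow> real"
  assumes "continuous_on {0..T} g" shows "g \<in> borel_measurable (lebesgue_on {0<..<T})"
proof (rule continuous_imp_measurable_on_sets_lebesgue)
  have "{0<..<T} \<subseteq> {0..T}" by auto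
  then show "continuous_on {0<..<T} g" by (rule continuous_on_subset[OF assms])
qed simp

lemma continuous_time_bounded:
  fixes g :: "real \<Rightarrow> real"
  assumes "continuous_on {0..T} g" obtains C where "C > 0" "\<And>t. t \<in> {0..T} \<Longrightarrow> \<bar>g t\<bar> \<le> C"
proof -
  have "bounded (g ` {0..T})"
    by (rule compact_imp_bounded[OF compact_continuous_image[OF assms]]) simp
  then obtain C where "C > 0" "\<forall>y\<in>g ` {0..T}. norm y \<le> C" using bounded_pos by blast
  then show ?thesis using that by auto
qed

lemma continuous_time_sqint:
  fixes g :: "real \<Rightarrow> real"
  assumes "continuous_on {0..T} g"
  shows "sqint (lebesgue_on {0<..<T}) g" "integrable (lebesgue_on {0<..<T}) g"
proof -
  interpret finite_measure "lebesgue_on {0<..<T}" by (rule finite_measure_time)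
  obtain C where "\<And>t. t \<in> {0..T} \<Longrightarrow> \<bar>g t\<bar> \<le> C" using continuous_time_bounded[OF assms] by blast
  then show "sqint (lebesgue_on {0<..<T}) g"
    by (intro sqint_bounded[of _ C] continuous_time_measurable[OF assms] AE_I2) auto
  then show "integrable (lebesgue_on {0<..<T}) g" by (rule sqint_integrable)
qed

definition time_test :: "real \<Rightarrow> (real \<Rightarrow> real) \<Rightarrow> bool" where
  "time_test T \<eta> \<longleftrightarrow> (\<forall>k. C_k k \<eta>) \<and> (\<exists>c d. 0 < c \<and> d < T \<and> (\<forall>t. t \<notin> {c..d} \<longrightarrow> \<eta> t = 0))"

text \<open>
  Rescalings of the bump have integral one and concentrate at \<open>r\<close>.
\<close>

lemma integral_concentrating:
  fixes g :: "real \<Rightarrow> real"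
  assumes S: "\<And>x. (S has_real_derivative \<rho> x) (at x)" "\<And>x. x \<le> 0 \<Longrightarrow> S x = 0" "\<And>x. x \<ge> 1 \<Longrightarrow> S x = 1"
    "\<And>x. 0 \<le> \<rho> x" "\<And>x. x \<notin> {0..1} \<Longrightarrow> \<rho> x = 0" "continuous_on UNIV \<rho>"
    and g: "continuous_on {0..T} g" and r: "0 < r" "r < T"
    and d: "\<And>n::nat. 0 < d n" "\<And>n. r + d n \<le> T" "d \<longlonglongrightarrow> 0"
  shows "(\<lambda>n. LINT x|lebesgue_on {0<..<T}. \<rho> ((x - r) / d n) / d n * g x) \<longlonglongrightarrow> g r"
    "integrable (lebesgue_on {0<..<T}) (\<lambda>x. \<rho> ((x - r) / d n) / d n * g x)"
proof -
  let ?M = "lebesgue_on {0<..<T}"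
  define w where "w = (\<lambda>n x. \<rho> ((x - r) / d n) / d n)"
  have wc: "continuous_on A (w n)" for n A
    unfolding w_def by (intro continuous_intros continuous_on_compose2[OF S(6)]) (use d(1)[of n] in auto)
  have w0: "0 \<le> w n x" for n x using S(4) d(1)[of n] by (simp add: w_def less_imp_le)
  have wz: "w n x = 0" if "x \<notin> {r..r + d n}" for n x
    using that S(5)[of "(x - r) / d n"] d(1)[of n] by (auto simp: w_def field_simps)
  have int: "integrable ?M (\<lambda>x. w n x * g x)" "integrable ?M (w n)" for n
    using g wc by (auto intro!: continuous_time_sqint continuous_intros)
  show "integrable ?M (\<lambda>x. \<rho> ((x - r) / d n) / d n * g x)" using int(1)[of n] by (simp add: w_def)
  have w1: "(LINT x|?M. w n x) = 1" for n
  proof -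
    have "((\<lambda>x. S ((x - r) / d n)) has_vector_derivative w n x) (at x within {0..T})" for x
    proof -
      have "((\<lambda>x. S ((x - r) / d n)) has_real_derivative \<rho> ((x - r) / d n) * (1 / d n)) (at x)"
        by (rule DERIV_chain2[OF S(1)]) (use d(1)[of n] in \<open>auto intro!: derivative_eq_intros\<close>)
      then show ?thesis
        by (simp add: w_def has_real_derivative_iff_has_vector_derivative has_vector_derivative_at_within)
    qed
    then have "(w n has_integral S ((T - r) / d n) - S ((0 - r) / d n)) {0..T}"
      using r by (intro fundamental_theorem_of_calculus) auto
    moreover have "S ((T - r) / d n) = 1" "S ((0 - r) / d n) = 0"
      using S(2,3) d(1,2)[of n] r by (auto simp: field_simps)
    ultimately have "integral {0..T} (w n) = 1" by (simp add: integral_unique)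
    then show ?thesis
      using lebesgue_integral_eq_integral[OF int(2)] by (simp add: integral_open_interval_real)
  qed
  show "(\<lambda>n. LINT x|?M. \<rho> ((x - r) / d n) / d n * g x) \<longlonglongrightarrow> g r"
    unfolding w_def[symmetric, THEN fun_cong, THEN fun_cong]
  proof (rule LIMSEQ_I)
    fix e :: real assume "e > 0"
    then have "e / 2 > 0" by simp
    moreover have "r \<in> {0..T}" using r by auto
    ultimately obtain \<delta> where \<delta>: "\<delta> > 0" "\<And>x. x \<in> {0..T} \<Longrightarrow> dist x r < \<delta> \<Longrightarrow> dist (g x) (g r) < e / 2"
      using g unfolding continuous_on_iff by metis
    obtain n0 where n0: "\<And>n. n \<ge> n0 \<Longrightarrow> norm (d n - 0) < \<delta>" using LIMSEQ_D[OF d(3) \<delta>(1)] by blast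
    have "norm ((LINT x|?M. w n x * g x) - g r) < e" if "n \<ge> n0" for n
    proof -
      have "(LINT x|?M. w n x * g x) - g r = (LINT x|?M. w n x * g x) - (LINT x|?M. w n x) * g r"
        by (simp add: w1)
      also have "\<dots> = (LINT x|?M. w n x * (g x - g r))"
        using int[of n] by (simp add: right_diff_distrib)
      also have "norm \<dots> \<le> (LINT x|?M. w n x * (e / 2))"
      proof (rule order_trans[OF integral_norm_bound integral_mono])
        show "integrable ?M (\<lambda>x. norm (w n x * (g x - g r)))" using Bochner_Integration.integrable_diff[OF int(1)[of n] integrable_mult_left[OF int(2)[of n], of "g r"]]
          by (intro integrable_norm) (simp add: right_diff_distrib)
        show "integrable ?M (\<lambda>x. w n x * (e / 2))" using int(2)[of n] by simp
        fix x assume x: "x \<in> space ?M"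
        show "norm (w n x * (g x - g r)) \<le> w n x * (e / 2)"
        proof (cases "x \<in> {r..r + d n}")
          case True
          then have "dist x r < \<delta>" using n0[OF that] d(1)[of n] by (auto simp: dist_real_def)
          then have "\<bar>g x - g r\<bar> \<le> e / 2" using \<delta>(2)[of x] x by (auto simp: dist_real_def)
          then show ?thesis using w0[of n x] by (simp only: real_norm_def abs_mult abs_of_nonneg) (rule mult_left_mono)
        qed (simp add: wz)
      qed
      also have "\<dots> = e / 2" using w1[of n] by simp
      finally show ?thesis using \<open>e > 0\<close> by simp
    qed
    then show "\<exists>no. \<forall>n\<ge>no. norm ((LINT x|?M. w n x * g x) - g r) < e" by blast
  qed
qed

text \<open>
  A continuous function is the integral of its weak derivative: test with smooth approximations
  of the indicator of \<open>[r, t]\<close>, whose derivatives concentrate at the two ends.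
\<close>

lemma weak_derivative_increment_interior:
  fixes g f :: "real \<Rightarrow> real"
  assumes g: "continuous_on {0..T} g" and f: "integrable (lebesgue_on {0<..<T}) f"
    and test: "\<And>\<eta>. time_test T \<eta> \<Longrightarrow> (LINT t|lebesgue_on {0<..<T}. deriv \<eta> t * g t) = - (LINT t|lebesgue_on {0<..<T}. \<eta> t * f t)"
    and rt: "0 < r" "r < t" "t < T"
  shows "g t - g r = tint T r t f"
proof -
  let ?M = "lebesgue_on {0<..<T}"
  obtain S \<rho> where S: "\<And>x. (S has_real_derivative \<rho> x) (at x)"
    "\<And>k. smooth_upto k S" "\<And>x. x \<le> 0 \<Longrightarrow> S x = 0" "\<And>x. x \<ge> 1 \<Longrightarrow> S x = 1"
    "\<And>x. 0 \<le> S x \<and> S x \<le> 1" "\<And>x. 0 \<le> \<rho> x" "\<And>x. x \<notin> {0..1} \<Longrightarrow> \<rho> x = 0" "continuous_on UNIV \<rho>"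
    using smooth_step_exists by metis
  define d where "d = (\<lambda>n::nat. (T - t) / (2 * real (Suc n)))"
  have d0: "0 < d n" for n using rt by (simp add: d_def)
  have dT: "t + d n < T" for n
  proof -
    have "d n \<le> (T - t) / 2" unfolding d_def using rt by (intro divide_left_mono) auto
    then show ?thesis using rt by (simp add: field_simps)
  qed
  have "d = (\<lambda>n. (T - t) / 2 * inverse (real (Suc n)))"
    unfolding d_def by (rule ext) (simp only: divide_inverse inverse_mult_distrib mult.assoc)
  moreover have "(\<lambda>n. (T - t) / 2 * inverse (real (Suc n))) \<longlonglongrightarrow> (T - t) / 2 * 0"
    by (intro tendsto_mult tendsto_const LIMSEQ_inverse_real_of_nat)
  ultimately have dlim: "d \<longlonglongrightarrow> 0" by (simp only: mult_zero_right)
  \<comment> \<open>one step up at \<open>r\<close> and one step down at \<open>t\<close>\<close>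
  define \<eta> where "\<eta> = (\<lambda>n x. S ((x - r) / d n) - S ((x - t) / d n))"
  have \<eta>smooth: "smooth_upto k (\<eta> n)" for k n
  proof -
    have aff: "smooth_upto k (\<lambda>x. S ((x - c) / d n))" for c
    proof -
      have "(\<lambda>x. S ((x - c) / d n)) = (\<lambda>x. S ((1 / d n) * x + (- c / d n)))"
        by (rule ext) (simp add: diff_divide_distrib)
      then show ?thesis using smooth_upto_affine[OF S(2), of k "1 / d n" "- c / d n"] by simp
    qed
    have "smooth_upto k (\<lambda>x. S ((x - r) / d n) + (- 1) * S ((x - t) / d n))"
      by (rule smooth_upto_add[OF aff smooth_upto_mult[OF smooth_upto_const aff]])
    then show ?thesis by (simp add: \<eta>_def)
  qed
  have supp: "\<eta> n x = 0" if "x \<notin> {r..t + d n}" for n x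
  proof (cases "x < r")
    case True
    then have "(x - r) / d n \<le> 0" "(x - t) / d n \<le> 0" using d0[of n] rt by (auto simp: divide_le_0_iff)
    then show ?thesis by (simp add: \<eta>_def S)
  next
    case False
    then have "x > t + d n" using that by auto
    then have "(x - r) / d n \<ge> 1" "(x - t) / d n \<ge> 1" using d0[of n] rt by (auto simp: field_simps)
    then show ?thesis by (simp add: \<eta>_def S)
  qed
  have tt: "time_test T (\<eta> n)" for n
    unfolding time_test_def using smooth_upto_imp_C_k[OF \<eta>smooth] supp rt(1) dT[of n] by blast
  have der: "deriv (\<eta> n) x = \<rho> ((x - r) / d n) / d n - \<rho> ((x - t) / d n) / d n" for n x
  proof (rule DERIV_imp_deriv)
    have "((\<lambda>x. S ((x - c) / d n)) has_real_derivative \<rho> ((x - c) / d n) * (1 / d n)) (at x)" for c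
      by (rule DERIV_chain2[OF S(1)]) (use d0[of n] in \<open>auto intro!: derivative_eq_intros\<close>)
    from DERIV_diff[OF this this] show "(\<eta> n has_real_derivative \<rho> ((x - r) / d n) / d n - \<rho> ((x - t) / d n) / d n) (at x)"
      by (simp add: \<eta>_def[abs_def])
  qed
  have dr: "r + d n \<le> T" "t + d n \<le> T" for n using dT[of n] rt by auto
  have r': "r < T" "0 < t" using rt by auto
  have Cr: "(\<lambda>n. LINT x|?M. \<rho> ((x - r) / d n) / d n * g x) \<longlonglongrightarrow> g r"
    "integrable ?M (\<lambda>x. \<rho> ((x - r) / d n) / d n * g x)" for n
    by (rule integral_concentrating[where S=S and \<rho>=\<rho> and T=T]; fact)+
  have Ct: "(\<lambda>n. LINT x|?M. \<rho> ((x - t) / d n) / d n * g x) \<longlonglongrightarrow> g t"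
    "integrable ?M (\<lambda>x. \<rho> ((x - t) / d n) / d n * g x)" for n
    by (rule integral_concentrating[where S=S and \<rho>=\<rho> and T=T]; fact)+
  have L: "(LINT x|?M. deriv (\<eta> n) x * g x) =
      (LINT x|?M. \<rho> ((x - r) / d n) / d n * g x) - (LINT x|?M. \<rho> ((x - t) / d n) / d n * g x)" for n
    unfolding der left_diff_distrib
    by (rule Bochner_Integration.integral_diff[OF Cr(2) Ct(2)])
  have lim1: "(\<lambda>n. LINT x|?M. deriv (\<eta> n) x * g x) \<longlonglongrightarrow> g r - g t"
    unfolding L by (rule tendsto_diff[OF Cr(1) Ct(1)])
  have lim2: "(\<lambda>n. LINT x|?M. \<eta> n x * f x) \<longlonglongrightarrow> (LINT x|?M. indicator {r<..t} x * f x)"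
  proof (rule integral_dominated_convergence[where w="\<lambda>x. \<bar>f x\<bar>"])
    show "(\<lambda>x. indicator {r<..t} x * f x) \<in> borel_measurable ?M" using tint_integrable[OF f] by auto
    show "integrable ?M (\<lambda>x. \<bar>f x\<bar>)" using f by simp
    have "\<eta> n \<in> borel_measurable ?M" for n
      using continuous_time_measurable[OF continuous_on_subset[OF smooth_upto_continuous[OF \<eta>smooth]]] by auto
    then show "(\<lambda>x. \<eta> n x * f x) \<in> borel_measurable ?M" for n using f by auto
    have "\<bar>\<eta> n x\<bar> \<le> 1" for n x using S(5)[of "(x - r) / d n"] S(5)[of "(x - t) / d n"] by (auto simp: \<eta>_def)
    then show "AE x in ?M. norm (\<eta> n x * f x) \<le> \<bar>f x\<bar>" for n
      by (auto simp: abs_mult intro!: AE_I2 mult_left_le_one_le)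
    have ev: "\<forall>\<^sub>F n in sequentially. S ((x - c) / d n) = (if c < x then 1 else 0)" for x c
    proof (cases "c < x")
      case True
      then have "\<forall>\<^sub>F n in sequentially. d n < x - c" using order_tendstoD(2)[OF dlim] by simp
      then show ?thesis
      proof eventually_elim
        case (elim n)
        then have "(x - c) / d n \<ge> 1" using d0[of n] by (simp add: field_simps)
        then show ?case using True S by simp
      qed
    next
      case False
      then have "(x - c) / d n \<le> 0" for n using d0[of n] by (simp add: divide_le_0_iff)
      then show ?thesis using False S by simp
    qed
    have "(\<lambda>n. \<eta> n x * f x) \<longlonglongrightarrow> indicator {r<..t} x * f x" for x
    proof (rule tendsto_eventually)
      show "\<forall>\<^sub>F n in sequentially. \<eta> n x * f x = indicator {r<..t} x * f x"
        using ev[of x r] ev[of x t] by eventually_elim (use rt in \<open>auto simp: \<eta>_def indicator_def\<close>)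
    qed
    then show "AE x in ?M. (\<lambda>n. \<eta> n x * f x) \<longlonglongrightarrow> indicator {r<..t} x * f x" by simp
  qed
  have "(\<lambda>n. LINT x|?M. deriv (\<eta> n) x * g x) \<longlonglongrightarrow> - (LINT x|?M. indicator {r<..t} x * f x)"
    unfolding test[OF tt] by (rule tendsto_minus[OF lim2])
  from LIMSEQ_unique[OF lim1 this] show ?thesis by (simp add: tint_def)
qed

text \<open>
  At the end points of the time interval, approximate by interior times.
\<close>

lemma weak_derivative_increment:
  fixes g f :: "real \<Rightarrow> real"
  assumes g: "continuous_on {0..T} g" and f: "integrable (lebesgue_on {0<..<T}) f"
    and test: "\<And>\<eta>. time_test T \<eta> \<Longrightarrow> (LINT t|lebesgue_on {0<..<T}. deriv \<eta> t * g t) = - (LINT t|lebesgue_on {0<..<T}. \<eta> t * f t)"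
    and rt: "0 \<le> r" "r \<le> t" "t \<le> T"
  shows "g t - g r = tint T r t f"
proof (cases "r = t")
  case True then show ?thesis by (simp add: tint_def)
next
  case False
  then have T: "0 < T" "r < t" using rt by auto
  define e where "e = (\<lambda>n::nat. T * inverse (real (Suc n)))"
  have e0: "0 < e n" for n using T by (simp add: e_def)
  have "(\<lambda>n. T * inverse (real (Suc n))) \<longlonglongrightarrow> T * 0"
    by (intro tendsto_mult tendsto_const LIMSEQ_inverse_real_of_nat)
  then have elim: "e \<longlonglongrightarrow> 0" unfolding e_def by (simp only: mult_zero_right)
  define r' where "r' = (\<lambda>n. max r (e n))"
  define t' where "t' = (\<lambda>n. min t (T - e n))"
  have "r' \<longlonglongrightarrow> max r 0" "t' \<longlonglongrightarrow> min t (T - 0)"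
    unfolding r'_def t'_def by (intro tendsto_intros elim)+
  then have lim: "r' \<longlonglongrightarrow> r" "t' \<longlonglongrightarrow> t" using rt by auto
  have "\<forall>\<^sub>F n in sequentially. r' n < (r + t) / 2" "\<forall>\<^sub>F n in sequentially. t' n > (r + t) / 2"
    by (rule order_tendstoD(2)[OF lim(1)] order_tendstoD(1)[OF lim(2)], use T in simp)+
  then have eq: "\<forall>\<^sub>F n in sequentially. g (t' n) - g (r' n) = tint T (r' n) (t' n) f"
  proof eventually_elim
    case (elim n)
    show ?case
      by (rule weak_derivative_increment_interior[OF g f test]) (use elim e0[of n] T in \<open>auto simp: r'_def t'_def\<close>)
  qed
  have in0: "\<forall>\<^sub>F n in sequentially. r' n \<in> {0..T}" "\<forall>\<^sub>F n in sequentially. t' n \<in> {0..T}"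
  proof -
    have "\<forall>\<^sub>F n in sequentially. e n < T" using order_tendstoD(2)[OF elim] T by simp
    then show "\<forall>\<^sub>F n in sequentially. r' n \<in> {0..T}" "\<forall>\<^sub>F n in sequentially. t' n \<in> {0..T}"
      by (eventually_elim, use rt e0 in \<open>auto simp: r'_def t'_def less_imp_le\<close>)+
  qed
  have l1: "(\<lambda>n. g (t' n) - g (r' n)) \<longlonglongrightarrow> g t - g r"
    by (intro tendsto_diff continuous_on_tendsto_compose[OF g] lim in0) (use rt in auto)
  have l2: "(\<lambda>n. tint T (r' n) (t' n) f) \<longlonglongrightarrow> tint T r t f"
    unfolding tint_def
  proof (rule integral_dominated_convergence[where w="\<lambda>x. \<bar>f x\<bar>"])
    show "integrable (lebesgue_on {0<..<T}) (\<lambda>x. \<bar>f x\<bar>)" using f by simp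
    show "AE x in lebesgue_on {0<..<T}. (\<lambda>n. indicator {r' n<..t' n} x * f x) \<longlonglongrightarrow> indicator {r<..t} x * f x"
    proof (rule AE_I2)
      fix x assume x: "x \<in> space (lebesgue_on {0<..<T})"
      have "\<forall>\<^sub>F n in sequentially. e n < x" "\<forall>\<^sub>F n in sequentially. e n < T - x"
        using order_tendstoD(2)[OF elim] x by auto
      then have "\<forall>\<^sub>F n in sequentially. indicator {r' n<..t' n} x * f x = indicator {r<..t} x * f x"
        by eventually_elim (auto simp: indicator_def r'_def t'_def)
      then show "(\<lambda>n. indicator {r' n<..t' n} x * f x) \<longlonglongrightarrow> indicator {r<..t} x * f x"
        by (rule tendsto_eventually)
    qed
  qed (use tint_integrable[OF f] in \<open>auto simp: indicator_def\<close>)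
  show ?thesis by (rule LIMSEQ_unique[OF Lim_transform_eventually[OF l1 eq] l2])
qed

text \<open>Statements valid for almost all times extend by continuity to all times.\<close>

lemma AE_time_frequently:
  fixes T t :: real
  assumes P: "AE s in lebesgue_on {0<..<T}. P s" and t: "t \<in> {0..T}" and T: "T > 0"
  shows "\<exists>\<^sub>F s in at t within {0..T}. s \<in> {0<..<T} \<and> P s"
proof (rule ccontr)
  assume "\<not> ?thesis"
  then have "\<forall>\<^sub>F s in at t within {0..T}. \<not> (s \<in> {0<..<T} \<and> P s)" by (simp add: frequently_def)
  then obtain d where d: "d > 0" "\<And>s. s \<in> {0..T} \<Longrightarrow> s \<noteq> t \<Longrightarrow> dist s t < d \<Longrightarrow> \<not> (s \<in> {0<..<T} \<and> P s)"
    unfolding eventually_at by blast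
  obtain u v where uv: "u < v" "{u<..<v} \<subseteq> {0<..<T}" "\<And>s. s \<in> {u<..<v} \<Longrightarrow> s \<noteq> t \<and> dist s t < d"
  proof (cases "t = T")
    case True
    have "{max 0 (t - d)<..<t} \<subseteq> {0<..<T}" using True by auto
    then show ?thesis using that[of "max 0 (t - d)" t] T d(1) True by (auto simp: dist_real_def)
  next
    case False
    have "{t<..<min T (t + d)} \<subseteq> {0<..<T}" using t by auto
    then show ?thesis using False that[of t "min T (t + d)"] t d(1) by (auto simp: dist_real_def)
  qed
  have "AE s in lebesgue. s \<in> {0<..<T} \<longrightarrow> P s" using P by (simp add: AE_restrict_space_iff)
  then have "AE s in lebesgue. s \<notin> {u<..<v}"
  proof eventually_elim
    case (elim s)
    show ?case
    proof
      assume s: "s \<in> {u<..<v}"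
      then have "s \<in> {0<..<T}" using uv(2) by blast
      then show False using elim d(2)[of s] uv(3)[OF s] by auto
    qed
  qed
  then have "{u<..<v} \<in> null_sets lebesgue" by (subst (asm) AE_iff_null_sets[symmetric]) auto
  then show False using uv(1) by (auto simp: null_sets_def)
qed

lemma continuous_AE_le:
  fixes g :: "real \<Rightarrow> real"
  assumes g: "continuous_on {0..T} g" and ae: "AE s in lebesgue_on {0<..<T}. g s \<le> K"
    and t: "t \<in> {0..T}" and T: "T > 0"
  shows "g t \<le> K"
proof (rule ccontr)
  assume "\<not> ?thesis"
  moreover have "(g \<longlongrightarrow> g t) (at t within {0..T})" using g t by (simp add: continuous_on_def)
  ultimately have "\<forall>\<^sub>F s in at t within {0..T}. K < g s" using order_tendstoD(1) by fastforce
  then have "\<forall>\<^sub>F s in at t within {0..T}. \<not> (s \<in> {0<..<T} \<and> g s \<le> K)"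
    by eventually_elim auto
  then show False using AE_time_frequently[OF ae t T] by (simp add: frequently_def)
qed

lemma continuous_AE_eq:
  fixes g h :: "real \<Rightarrow> real"
  assumes g: "continuous_on {0..T} g" "continuous_on {0..T} h" and ae: "AE s in lebesgue_on {0<..<T}. g s = h s"
    and t: "t \<in> {0..T}" and T: "T > 0"
  shows "g t = h t"
proof -
  have "g t - h t \<le> 0"
    by (rule continuous_AE_le[OF continuous_on_diff[OF g] _ t T]) (use ae in \<open>eventually_elim, simp\<close>)
  moreover have "h t - g t \<le> 0"
    by (rule continuous_AE_le[OF continuous_on_diff[OF g(2,1)] _ t T]) (use ae in \<open>eventually_elim, simp\<close>)
  ultimately show ?thesis by simp
qed

lemma borel_measurable_AE_lebesgue_on:
  fixes f g :: "real \<Rightarrow> real"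
  assumes f: "f \<in> borel_measurable (lebesgue_on S)" and S: "S \<in> sets lebesgue"
    and ae: "AE s in lebesgue_on S. f s = g s"
  shows "g \<in> borel_measurable (lebesgue_on S)"
proof -
  have "(\<lambda>x. if x \<in> S then f x else 0) \<in> borel_measurable lebesgue"
    using f S by (simp add: borel_measurable_if)
  moreover have "AE x in lebesgue. (if x \<in> S then f x else 0) = (if x \<in> S then g x else 0)"
    using ae S by (auto simp: AE_restrict_space_iff elim!: eventually_mono)
  ultimately have "(\<lambda>x. if x \<in> S then g x else 0) \<in> borel_measurable lebesgue"
    by (rule borel_measurable_AE)
  then show ?thesis using S by (simp add: borel_measurable_if)
qed

section \<open>Function spaces and coefficients\<close>

context periodic_box
begin

lemma L2_iff: "u \<in> fst (L2 a b) \<longleftrightarrow> sqint \<mu> u"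
  by (simp add: L2_def sqint_def)

lemma norm2_square: "(norm2 a b u)\<^sup>2 = (LINT x|\<mu>. (u x)\<^sup>2)"
  by (simp add: L2_def)

lemma norm2_eq: "norm2 a b u = sqrt (LINT x|\<mu>. (u x)\<^sup>2)"
  by (simp add: L2_def)

lemma Hk_wgrad:
  assumes u: "u \<in> fst (Hk a b k)" and k: "1 \<le> k"
  shows "sqint \<mu> u" "i \<in> Basis \<Longrightarrow> \<exists>g. sqint \<mu> g \<and> wgrad i u g"
proof -
  have *: "\<exists>g. sqint \<mu> g \<and> weak_deriv a b is u g" if "set is \<subseteq> Basis" "length is \<le> k" for "is"
  proof -
    have "\<exists>g\<in>fst (L2 a b). weak_deriv a b is u g" using u that by (auto simp: sobolev_def)
    then show ?thesis using L2_iff by blast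
  qed
  obtain g where g: "sqint \<mu> g" "weak_deriv a b [] u g" using *[of "[]"] by auto
  then have "AE x in \<mu>. g x = u x" using weak_deriv_Nil_AE by fastforce
  moreover have "u \<in> borel_measurable \<mu>" using g(2) by (auto simp: weak_deriv_def)
  ultimately show "sqint \<mu> u" using sqint_cong_AE[OF g(1)] by blast
  show "i \<in> Basis \<Longrightarrow> \<exists>g. sqint \<mu> g \<and> wgrad i u g"
    using *[of "[i]"] k weak_deriv_imp_wgrad by auto
qed

lemma gsum_bounded:
  assumes "sqint \<mu> u" "\<And>i. i \<in> Basis \<Longrightarrow> \<exists>g. sqint \<mu> g \<and> wgrad i u g"
  obtains Q where "\<And>j. gsum u j \<le> Q"
proof -
  obtain g where "\<And>i. i \<in> Basis \<Longrightarrow> sqint \<mu> (g i) \<and> wgrad i u (g i)" using assms(2) by metis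
  then show ?thesis using gsum_le[of u g] that by blast
qed

lemma finite_multi_indices: "finite {is. set is \<subseteq> (Basis::'a set) \<and> length is \<le> k}"
  by (rule finite_lists_length_le) simp

text \<open>
  The sum of the norms of the first derivatives, squared, dominates the sum of their squares.
\<close>

lemma gsum_le_Hk:
  assumes u: "u \<in> fst (Hk a b 1)"
  shows "gsum u j \<le> (snd (Hk a b 1) u) ^ 2"
proof -
  let ?I = "{is. set is \<subseteq> (Basis::'a set) \<and> length is \<le> 1}"
  let ?n = "\<lambda>is. norm2 a b (wderiv a b is u)"
  have n0: "0 \<le> ?n is" for "is" by (simp add: norm2_eq)
  have w: "sqint \<mu> (wderiv a b [i] u)" "wgrad i u (wderiv a b [i] u)" if "i \<in> Basis" for i
    using Hk_wgrad[OF u] wderiv_sqint[OF that] that by blast+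
  have "gsum u j \<le> (\<Sum>i\<in>Basis. LINT x|\<mu>. (wderiv a b [i] u x)\<^sup>2)"
    by (rule gsum_le) (use w in auto)
  also have "\<dots> = (\<Sum>i\<in>Basis. (?n [i])\<^sup>2)" by (simp only: norm2_square)
  also have "\<dots> \<le> (\<Sum>i\<in>Basis. ?n [i])\<^sup>2"
  proof -
    have "(\<Sum>i\<in>Basis. (?n [i])\<^sup>2) \<le> (\<Sum>i\<in>(Basis::'a set). ?n [i] * (\<Sum>i\<in>Basis. ?n [i]))"
    proof (rule sum_mono)
      fix i :: 'a assume "i \<in> Basis"
      then have "?n [i] \<le> (\<Sum>i\<in>Basis. ?n [i])" by (intro member_le_sum) (auto intro: n0)
      then show "(?n [i])\<^sup>2 \<le> ?n [i] * (\<Sum>i\<in>Basis. ?n [i])"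
        unfolding power2_eq_square by (rule mult_left_mono[OF _ n0])
    qed
    then show ?thesis by (simp add: power2_eq_square sum_distrib_right)
  qed
  also have "\<dots> \<le> (\<Sum>is\<in>?I. ?n is)\<^sup>2"
  proof (rule power_mono)
    have "(\<Sum>i\<in>Basis. ?n [i]) = (\<Sum>is\<in>(\<lambda>i. [i]) ` Basis. ?n is)"
      by (subst sum.reindex) (auto simp: inj_on_def)
    also have "\<dots> \<le> (\<Sum>is\<in>?I. ?n is)"
      by (rule sum_mono2[OF finite_multi_indices]) (auto intro: n0)
    finally show "(\<Sum>i\<in>Basis. ?n [i]) \<le> (\<Sum>is\<in>?I. ?n is)" .
  qed (auto intro: sum_nonneg n0)
  finally show ?thesis by (simp add: sobolev_def)
qed

text \<open>
  The essential supremum of a modulus is not negative because the box has positive measure, so passing to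
  real numbers loses nothing.
\<close>

lemma Linf_bound:
  assumes "u \<in> fst (Linf a b)"
  shows "AE x in \<mu>. \<bar>u x\<bar> \<le> snd (Linf a b) u" "0 \<le> snd (Linf a b) u"
proof -
  let ?e = "esssup \<mu> (\<lambda>x. ereal \<bar>u x\<bar>)"
  have fin: "?e < \<infinity>" using assms by (simp add: Linf_def)
  have ae: "AE x in \<mu>. ereal \<bar>u x\<bar> \<le> ?e" by (rule esssup_AE)
  have nn: "0 \<le> ?e"
  proof (rule ccontr)
    assume "\<not> 0 \<le> ?e"
    have "AE x in \<mu>. False"
      using ae by eventually_elim (metis \<open>\<not> 0 \<le> ?e\<close> abs_ge_zero ereal_less_eq(5) order_trans)
    then have "(LINT x|\<mu>. 1 :: real) = (LINT x|\<mu>. 0)"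
      by (intro integral_cong_AE) (auto elim: eventually_mono)
    then show False using vol_pos measure_box_total by simp
  qed
  have e: "?e = ereal (real_of_ereal ?e)" using fin nn by (simp add: ereal_real)
  show "0 \<le> snd (Linf a b) u" using nn by (simp add: Linf_def real_of_ereal_pos)
  show "AE x in \<mu>. \<bar>u x\<bar> \<le> snd (Linf a b) u"
    using ae by eventually_elim (subst (asm) e, simp add: Linf_def)
qed

lemma Linf_cong:
  assumes "v \<in> fst (Linf a b)" "u \<in> borel_measurable \<mu>" "AE x in \<mu>. u x = v x"
  shows "u \<in> fst (Linf a b)"
proof -
  have "esssup \<mu> (\<lambda>x. ereal \<bar>u x\<bar>) = esssup \<mu> (\<lambda>x. ereal \<bar>v x\<bar>)"
    by (rule esssup_AE_cong) (use assms in \<open>auto simp: Linf_def elim: eventually_mono\<close>)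
  then show ?thesis using assms by (simp add: Linf_def)
qed

lemma Wkinf_bound:
  assumes u: "u \<in> fst (Wkinf a b 1)"
  shows "AE x in \<mu>. \<bar>u x\<bar> \<le> snd (Wkinf a b 1) u"
    "i \<in> Basis \<Longrightarrow> \<exists>g. g \<in> borel_measurable \<mu> \<and> wgrad i u g \<and> (AE x in \<mu>. \<bar>g x\<bar> \<le> snd (Wkinf a b 1) u)"
proof -
  let ?I = "{is. set is \<subseteq> (Basis::'a set) \<and> length is \<le> 1}"
  let ?d = "\<lambda>is. wderiv a b is u"
  have ex: "\<exists>g. g \<in> fst (Linf a b) \<and> weak_deriv a b is u g" if "is \<in> ?I" for "is"
    using u that by (auto simp: sobolev_def)
  have wd: "weak_deriv a b is u (?d is)" if "is \<in> ?I" for "is"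
    unfolding wderiv_def using someI_ex[of "weak_deriv a b is u"] ex[OF that] by blast
  have Li: "?d is \<in> fst (Linf a b)" if I: "is \<in> ?I" for "is"
  proof -
    obtain g where g: "g \<in> fst (Linf a b)" "weak_deriv a b is u g" using ex[OF I] by blast
    have "AE x in \<mu>. ?d is x = g x"
    proof (cases "is")
      case Nil
      have "AE x in \<mu>. u x = ?d is x" "AE x in \<mu>. u x = g x"
        using weak_deriv_Nil_AE wd[OF I] g(2) Nil by auto
      then show ?thesis by eventually_elim simp
    next
      case (Cons i js)
      then have "is = [i]" using I by auto
      then show ?thesis using wd[OF I] g(2) weak_deriv_imp_wgrad wgrad_unique by blast
    qed
    moreover have "?d is \<in> borel_measurable \<mu>" using wd[OF I] by (auto simp: weak_deriv_def)
    ultimately show ?thesis using Linf_cong[OF g(1)] by blast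
  qed
  have le: "snd (Linf a b) (?d is) \<le> snd (Wkinf a b 1) u" if "is \<in> ?I" for "is"
  proof -
    have "snd (Linf a b) (?d is) \<le> (\<Sum>is\<in>?I. snd (Linf a b) (?d is))"
      by (rule member_le_sum[OF that _ finite_multi_indices]) (use Linf_bound(2)[OF Li] in auto)
    then show ?thesis by (simp add: sobolev_def)
  qed
  have bnd: "AE x in \<mu>. \<bar>?d is x\<bar> \<le> snd (Wkinf a b 1) u" if "is \<in> ?I" for "is"
    using Linf_bound(1)[OF Li[OF that]] by eventually_elim (use le[OF that] in linarith)
  have "[] \<in> ?I" by simp
  from bnd[OF this] weak_deriv_Nil_AE[OF wd[OF this]]
  show "AE x in \<mu>. \<bar>u x\<bar> \<le> snd (Wkinf a b 1) u" by eventually_elim simp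
  assume "i \<in> Basis"
  then have I: "[i] \<in> ?I" by simp
  show "\<exists>g. g \<in> borel_measurable \<mu> \<and> wgrad i u g \<and> (AE x in \<mu>. \<bar>g x\<bar> \<le> snd (Wkinf a b 1) u)"
    using bnd[OF I] weak_deriv_imp_wgrad[OF wd[OF I]]
    by (intro exI[of _ "?d [i]"]) (auto simp: wgrad_def)
qed

text \<open>
  A bound on the gradient survives passage to a limit of the coefficients: test with partial sums,
  for which only finitely many coefficients matter, then let these partial sums converge.
\<close>

lemma wgrad_bound_closed:
  assumes i: "i \<in> Basis"
    and fr: "\<exists>\<^sub>F s in F. \<exists>g. g \<in> borel_measurable \<mu> \<and> wgrad i (u s) g \<and> (AE x in \<mu>. \<bar>g x\<bar> \<le> K)"
    and lim: "\<And>k. k \<in> freqs \<Longrightarrow> ((\<lambda>s. coef (u s) k) \<longlongrightarrow> coef v k) F"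
    and w: "wgrad i v g" "sqint \<mu> g" and K: "0 \<le> K"
  shows "AE x in \<mu>. \<bar>g x\<bar> \<le> K"
proof (rule AE_bound_by_duality[OF w(2) K])
  fix z assume z: "sqint \<mu> z"
  have le: "(LINT x|\<mu>. g x * psum z j x) \<le> K * (LINT x|\<mu>. \<bar>psum z j x\<bar>)" for j
  proof (rule ccontr)
    assume neg: "\<not> ?thesis"
    define c where "c = (\<lambda>s. \<Sum>k\<in>blk j. coef z k * (- (k \<bullet> i) * coef (u s) (- k)))"
    have c: "(LINT x|\<mu>. g' x * psum z j x) = (\<Sum>k\<in>blk j. coef z k * (- (k \<bullet> i) * coef u' (- k)))"
      if "wgrad i u' g'" for u' g'
      unfolding psum_def using that
      by (subst integral_mult_mode_sum) (auto simp: wgrad_def blk_in_freqs intro!: sum.cong)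
    have "(c \<longlongrightarrow> (LINT x|\<mu>. g x * psum z j x)) F"
      unfolding c[OF w(1)] c_def by (intro tendsto_sum tendsto_mult tendsto_const lim) (auto dest: blk_in_freqs)
    then have ev: "\<forall>\<^sub>F s in F. K * (LINT x|\<mu>. \<bar>psum z j x\<bar>) < c s"
      by (rule order_tendstoD(1)) (use neg in simp)
    have "\<forall>\<^sub>F s in F. \<not> (\<exists>g. g \<in> borel_measurable \<mu> \<and> wgrad i (u s) g \<and> (AE x in \<mu>. \<bar>g x\<bar> \<le> K))"
      using ev
    proof eventually_elim
      case (elim s)
      show ?case
      proof
        assume "\<exists>g. g \<in> borel_measurable \<mu> \<and> wgrad i (u s) g \<and> (AE x in \<mu>. \<bar>g x\<bar> \<le> K)"
        then obtain g' where g': "g' \<in> borel_measurable \<mu>" "wgrad i (u s) g'" "AE x in \<mu>. \<bar>g' x\<bar> \<le> K" by blast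
        have s: "sqint \<mu> g'" using g'(1,3) by (rule sqint_bounded)
        have "c s = (LINT x|\<mu>. g' x * psum z j x)" unfolding c[OF g'(2)] c_def ..
        also have "\<dots> \<le> (LINT x|\<mu>. K * \<bar>psum z j x\<bar>)"
        proof (rule integral_mono_AE)
          show "integrable \<mu> (\<lambda>x. g' x * psum z j x)" by (rule sqint_mult_integrable[OF s sqint_psum])
          show "integrable \<mu> (\<lambda>x. K * \<bar>psum z j x\<bar>)"
            using sqint_integrable[OF sqint_abs[OF sqint_psum]] by simp
          show "AE x in \<mu>. g' x * psum z j x \<le> K * \<bar>psum z j x\<bar>"
            using g'(3)
          proof eventually_elim
            case (elim x)
            have "g' x * psum z j x \<le> \<bar>g' x\<bar> * \<bar>psum z j x\<bar>" by (metis abs_ge_self abs_mult)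
            also have "\<dots> \<le> K * \<bar>psum z j x\<bar>" using elim by (intro mult_right_mono) auto
            finally show ?case .
          qed
        qed
        finally show False using elim by simp
      qed
    qed
    then show False using fr by (simp add: frequently_def)
  qed
  have one: "sqint \<mu> (\<lambda>_. 1)" by (simp add: sqint_def)
  have "(\<lambda>j. LINT x|\<mu>. psum z j x * g x) \<longlonglongrightarrow> (LINT x|\<mu>. z x * g x)"
    by (rule L2_tendsto_imp_weak[OF sqint_psum z w(2) psum_tendsto_L2[OF z]])
  then have l1: "(\<lambda>j. LINT x|\<mu>. g x * psum z j x) \<longlonglongrightarrow> (LINT x|\<mu>. g x * z x)" by (simp add: mult.commute)
  have "(\<lambda>j. LINT x|\<mu>. (\<bar>psum z j x\<bar> - \<bar>z x\<bar>)\<^sup>2) \<longlonglongrightarrow> 0"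
  proof (rule real_tendsto_sandwich[where f="\<lambda>_. 0" and h="\<lambda>j. LINT x|\<mu>. (psum z j x - z x)\<^sup>2"])
    show "\<forall>\<^sub>F j in sequentially. (LINT x|\<mu>. (\<bar>psum z j x\<bar> - \<bar>z x\<bar>)\<^sup>2) \<le> (LINT x|\<mu>. (psum z j x - z x)\<^sup>2)"
      using z by (intro always_eventually allI integral_square_mono sqint_diff sqint_abs sqint_psum AE_I2) auto
  qed (use psum_tendsto_L2[OF z] in auto)
  from L2_tendsto_imp_weak[OF sqint_abs[OF sqint_psum] sqint_abs[OF z] one this]
  have l2: "(\<lambda>j. LINT x|\<mu>. \<bar>psum z j x\<bar>) \<longlonglongrightarrow> (LINT x|\<mu>. \<bar>z x\<bar>)" by simp
  show "(LINT x|\<mu>. g x * z x) \<le> K * (LINT x|\<mu>. \<bar>z x\<bar>)"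
    by (rule LIMSEQ_le[OF l1 tendsto_mult[OF tendsto_const l2]]) (use le in auto)
qed

section \<open>Scalar products in time\<close>

text \<open>
  The scalar products of the approximating simple functions are simple; their limit is measurable
  because Lebesgue measure is complete.
\<close>

lemma strongly_measurable_inner:
  assumes u: "strongly_measurable a b T u" and v: "sqint \<mu> v"
  shows "(\<lambda>t. LINT x|\<mu>. u t x * v x) \<in> borel_measurable (lebesgue_on {0<..<T})"
    "AE t in lebesgue_on {0<..<T}. sqint \<mu> (u t)"
proof -
  let ?M = "lebesgue_on {0<..<T}"
  obtain s where s: "\<And>k. simple_function ?M (s k)" "\<And>k t. t \<in> {0<..<T} \<Longrightarrow> sqint \<mu> (s k t)"
    and lim: "AE t in ?M. sqint \<mu> (u t) \<and> (\<lambda>k. norm2 a b (\<lambda>x. s k t x - u t x)) \<longlonglongrightarrow> 0"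
    using u unfolding strongly_measurable_def L2_iff by blast
  show "AE t in ?M. sqint \<mu> (u t)" using lim by eventually_elim simp
  define G where "G = (\<lambda>k t. LINT x|\<mu>. s k t x * v x)"
  have Gm: "G k \<in> borel_measurable ?M" for k
    unfolding G_def
    by (rule borel_measurable_simple_function[OF simple_function_compose1[OF s(1), of "\<lambda>f. LINT x|\<mu>. f x * v x"]])
  have "AE t in ?M. lim (\<lambda>k. G k t) = (LINT x|\<mu>. u t x * v x)"
    using lim AE_space
  proof eventually_elim
    case (elim t)
    have "(\<lambda>k. (norm2 a b (\<lambda>x. s k t x - u t x))\<^sup>2) \<longlonglongrightarrow> 0\<^sup>2" using elim by (intro tendsto_power) auto
    then have "(\<lambda>k. G k t) \<longlonglongrightarrow> (LINT x|\<mu>. u t x * v x)"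
      unfolding G_def norm2_square using elim s(2) v by (intro L2_tendsto_imp_weak) auto
    then show ?case by (rule limI)
  qed
  then show "(\<lambda>t. LINT x|\<mu>. u t x * v x) \<in> borel_measurable ?M"
    by (rule borel_measurable_AE_lebesgue_on[OF borel_measurable_lim_metric[OF Gm], rotated]) simp
qed

lemma inner_time_integrable:
  assumes u: "u \<in> time_Lp a b T 1 (L2 a b)" and v: "sqint \<mu> v"
  shows "integrable (lebesgue_on {0<..<T}) (\<lambda>t. LINT x|\<mu>. u t x * v x)"
proof (rule Bochner_Integration.integrable_bound)
  have m: "strongly_measurable a b T u" and i: "integrable (lebesgue_on {0<..<T}) (\<lambda>t. norm2 a b (u t))"
    using u by (auto simp: time_Lp_def)
  show "integrable (lebesgue_on {0<..<T}) (\<lambda>t. norm2 a b (u t) * norm2 a b v)" using i by simp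
  show "(\<lambda>t. LINT x|\<mu>. u t x * v x) \<in> borel_measurable (lebesgue_on {0<..<T})"
    by (rule strongly_measurable_inner(1)[OF m v])
  show "AE t in lebesgue_on {0<..<T}. norm (LINT x|\<mu>. u t x * v x) \<le> norm (norm2 a b (u t) * norm2 a b v)"
    using strongly_measurable_inner(2)[OF m v]
  proof eventually_elim
    case (elim t)
    have "\<bar>LINT x|\<mu>. u t x * v x\<bar> \<le> norm2 a b (u t) * norm2 a b v"
      unfolding norm2_eq by (rule integral_Cauchy_Schwarz_abs[OF elim v])
    then show ?case by simp
  qed
qed

lemma coef_time_sqint:
  assumes u: "u \<in> time_Lp a b T 2 (L2 a b)" and k: "k \<in> freqs"
  shows "sqint (lebesgue_on {0<..<T}) (\<lambda>t. coef (u t) k)"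
proof -
  have m: "strongly_measurable a b T u" and i: "integrable (lebesgue_on {0<..<T}) (\<lambda>t. (norm2 a b (u t))\<^sup>2)"
    using u by (auto simp: time_Lp_def)
  have meas: "(\<lambda>t. coef (u t) k) \<in> borel_measurable (lebesgue_on {0<..<T})"
    unfolding coef_def by (rule strongly_measurable_inner(1)[OF m mode_sqint])
  have "integrable (lebesgue_on {0<..<T}) (\<lambda>t. (coef (u t) k)\<^sup>2)"
  proof (rule Bochner_Integration.integrable_bound[OF i])
    show "AE t in lebesgue_on {0<..<T}. norm ((coef (u t) k)\<^sup>2) \<le> norm ((norm2 a b (u t))\<^sup>2)"
      using strongly_measurable_inner(2)[OF m mode_sqint]
    proof eventually_elim
      case (elim t)
      show ?case using Bessel[OF elim, of "{k}"] k by (simp add: norm2_square)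
    qed
  qed (use meas in auto)
  then show ?thesis using meas by (simp add: sqint_def)
qed

lemma time_continuous_inner:
  assumes u: "time_continuous a b T u" and v: "sqint \<mu> v"
  shows "continuous_on {0..T} (\<lambda>t. LINT x|\<mu>. u t x * v x)"
  unfolding continuous_on_def
proof
  fix t assume t: "t \<in> {0..T}"
  have sq: "sqint \<mu> (u s)" if "s \<in> {0..T}" for s using u that by (simp add: time_continuous_def L2_iff)
  have "((\<lambda>s. norm2 a b (\<lambda>x. u s x - u t x)) \<longlongrightarrow> 0) (at t within {0..T})"
    using u t by (auto simp: time_continuous_def)
  from tendsto_power[OF this, of 2]
  have "((\<lambda>s. LINT x|\<mu>. (u s x - u t x)\<^sup>2) \<longlongrightarrow> 0) (at t within {0..T})" by (simp add: norm2_square)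
  moreover have "\<forall>\<^sub>F s in at t within {0..T}. sqint \<mu> (u s)"
    by (auto simp: eventually_at_filter sq)
  ultimately show "((\<lambda>s. LINT x|\<mu>. u s x * v x) \<longlongrightarrow> (LINT x|\<mu>. u t x * v x)) (at t within {0..T})"
    using sq[OF t] v by (intro L2_tendsto_imp_weak_eventually)
qed

lemma weak_time_deriv_increment:
  assumes d: "weak_time_deriv a b T u g" and c: "time_continuous a b T u" and v: "sqint \<mu> v"
    and rt: "0 \<le> r" "r \<le> t" "t \<le> T"
  shows "(LINT x|\<mu>. u t x * v x) - (LINT x|\<mu>. u r x * v x) = tint T r t (\<lambda>s. LINT x|\<mu>. g s x * v x)"
proof (rule weak_derivative_increment[OF time_continuous_inner[OF c v] inner_time_integrable[OF _ v] _ rt])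
  show "g \<in> time_Lp a b T 1 (L2 a b)" using d by (simp add: weak_time_deriv_def)
  fix \<eta> assume \<eta>: "time_test T \<eta>"
  have "v \<in> fst (L2 a b)" using v by (simp add: L2_iff)
  from d[unfolded weak_time_deriv_def, THEN conjunct2, THEN conjunct2, folded time_test_def, rule_format, OF \<eta> this]
  show "(LINT t|lebesgue_on {0<..<T}. deriv \<eta> t * (LINT x|\<mu>. u t x * v x)) =
      - (LINT t|lebesgue_on {0<..<T}. \<eta> t * (LINT x|\<mu>. g t x * v x))"
    .
qed

end

section \<open>The nonlinearity\<close>

text \<open>
  Used with the exponent \<open>-1/2\<close>; the induction changes the exponent.
\<close>

lemma smooth_upto_powr:
  "smooth_upto k f \<Longrightarrow> (\<And>x. f x > 0) \<Longrightarrow> smooth_upto k (\<lambda>x. f x powr p)"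
proof (induction k arbitrary: p)
  case 0
  then have "continuous_on UNIV (\<lambda>x. f x powr p)"
    by (intro continuous_intros) (auto simp: less_imp_neq[symmetric])
  then show ?case by simp
next
  case (Suc k)
  obtain f' where d: "\<And>x. (f has_real_derivative f' x) (at x)" "smooth_upto k f'" using Suc.prems(1) by auto
  have "((\<lambda>x. f x powr p) has_real_derivative p * (f x powr (p - 1) * f' x)) (at x)" for x
    using DERIV_fun_powr[OF d(1) Suc.prems(2), of p x] by (simp add: mult.assoc)
  moreover have "smooth_upto k (\<lambda>x. p * (f x powr (p - 1) * f' x))"
    by (intro smooth_upto_mult smooth_upto_const Suc.IH d smooth_upto_mono[OF Suc.prems(1)] Suc.prems(2))
  ultimately show ?case unfolding smooth_upto.simps
    by (intro exI[of _ "\<lambda>x. p * (f x powr (p - 1) * f' x)"] conjI allI)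
qed

lemma C_k_imp_smooth_upto: "C_k k g \<Longrightarrow> smooth_upto k g"
proof (induction k arbitrary: g)
  case 0 then show ?case by (simp add: C_k_def)
next
  case (Suc k)
  have "(deriv ^^ 0) g differentiable_on UNIV" using Suc.prems unfolding C_k_def by blast
  then have "(g has_real_derivative deriv g x) (at x)" for x
    by (simp add: differentiable_on_def DERIV_deriv_iff_real_differentiable)
  moreover have "C_k k (deriv g)"
    using Suc.prems unfolding C_k_def
    by (auto simp: funpow_Suc_right simp del: funpow.simps dest!: spec[of _ "Suc _"])
  ultimately show ?case unfolding smooth_upto.simps using Suc.IH by blast
qed

text \<open>
  On a bounded interval the nonlinearity agrees with a function whose derivative is bounded and
  Lipschitz on the whole line: freeze the derivative outside the interval and integrate.
\<close>

lemma Hfun_extension: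
  assumes F: "C_k 3 F" and pos: "\<And>x. F x + B > 0" and R: "R > 0"
  obtains h h' C L where "\<And>s. \<bar>s\<bar> \<le> R \<Longrightarrow> h s = Hfun F B s"
    "\<And>y. (h has_real_derivative h' y) (at y)" "\<And>y. \<bar>h' y\<bar> \<le> C"
    "\<And>p q. \<bar>h' p - h' q\<bar> \<le> L * \<bar>p - q\<bar>"
proof -
  have F3: "smooth_upto (Suc (Suc (Suc 0))) F" using C_k_imp_smooth_upto[OF F] by (simp add: numeral_3_eq_3)
  obtain F' where F': "\<And>x. (F has_real_derivative F' x) (at x)" "smooth_upto (Suc (Suc 0)) F'"
    using F3 unfolding smooth_upto.simps(2)[of "Suc (Suc 0)"] by blast
  have F2: "smooth_upto (Suc (Suc 0)) F" by (rule smooth_upto_mono[OF F3])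
  have Heq: "Hfun F B = (\<lambda>x. F' x * (F x + B) powr (- (1/2)))"
  proof (rule ext)
    fix x
    have "0 \<le> F x + B" using pos[of x] by simp
    then have "(F x + B) powr (- (1/2)) = inverse (sqrt (F x + B))"
      by (simp only: powr_minus powr_half_sqrt)
    then show "Hfun F B x = F' x * (F x + B) powr (- (1/2))"
      unfolding Hfun_def DERIV_imp_deriv[OF F'(1)] by (simp only: divide_inverse)
  qed
  have "smooth_upto (Suc (Suc 0)) (Hfun F B)"
    unfolding Heq by (rule smooth_upto_mult[OF F'(2) smooth_upto_powr[OF smooth_upto_add[OF F2 smooth_upto_const] pos]])
  then obtain H1 where H1: "\<And>x. (Hfun F B has_real_derivative H1 x) (at x)" "smooth_upto (Suc 0) H1"
    unfolding smooth_upto.simps(2)[of "Suc 0"] by blast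
  then obtain H2 where H2: "\<And>x. (H1 has_real_derivative H2 x) (at x)" "continuous_on UNIV H2"
    unfolding smooth_upto.simps by blast
  have "isCont H1 x" for x by (rule DERIV_isCont[OF H2(1)])
  then have H1c: "continuous_on UNIV H1" by (simp add: continuous_at_imp_continuous_on)
  have bdd: "\<exists>C. \<forall>x\<in>{-R..R}. \<bar>g x\<bar> \<le> C" if "continuous_on UNIV g" for g :: "real \<Rightarrow> real"
  proof -
    have "bounded (g ` {-R..R})"
      by (intro compact_imp_bounded compact_continuous_image continuous_on_subset[OF that]) auto
    then show ?thesis unfolding bounded_iff by auto
  qed
  obtain C where C: "\<forall>x\<in>{-R..R}. \<bar>H1 x\<bar> \<le> C" using bdd[OF H1c] by blast
  obtain L where L: "\<forall>x\<in>{-R..R}. \<bar>H2 x\<bar> \<le> L" using bdd[OF H2(2)] by blast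
  define cl where "cl = (\<lambda>y. max (-R) (min R y))"
  have cl: "cl y \<in> {-R..R}" for y using R by (auto simp: cl_def)
  have clL: "\<bar>cl p - cl q\<bar> \<le> \<bar>p - q\<bar>" for p q by (auto simp: cl_def)
  have clid: "cl y = y" if "\<bar>y\<bar> \<le> R" for y using that by (auto simp: cl_def)
  \<comment> \<open>the derivative, frozen outside the interval\<close>
  define h' where "h' = (\<lambda>y. H1 (cl y))"
  have L0: "L \<ge> 0" using L[rule_format, of 0] R by auto
  have H1L: "\<bar>H1 p - H1 q\<bar> \<le> L * \<bar>p - q\<bar>" if "p \<in> {-R..R}" "q \<in> {-R..R}" for p q
    using field_differentiable_bound[of "{-R..R}" H1 H2 L p q] that H2(1) L
    by (auto intro: has_field_derivative_at_within)
  have h'L: "\<bar>h' p - h' q\<bar> \<le> L * \<bar>p - q\<bar>" for p q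
    unfolding h'_def using order_trans[OF H1L[OF cl cl] mult_left_mono[OF clL L0]] .
  have h'b: "\<bar>h' y\<bar> \<le> C" for y using C cl by (auto simp: h'_def)
  have h'c: "continuous_on UNIV h'" by (rule Lipschitz_borel_measurable(1)[OF h'L])
  have "\<exists>G. \<forall>x :: real. - \<infinity> < ereal x \<longrightarrow> ereal x < \<infinity> \<longrightarrow> (G has_vector_derivative h' x) (at x)"
    by (rule einterval_antiderivative) (use h'c in \<open>auto simp: continuous_on_eq_continuous_at\<close>)
  then obtain G where G: "\<And>x. (G has_real_derivative h' x) (at x)"
    by (auto simp: has_real_derivative_iff_has_vector_derivative)
  define h where "h = (\<lambda>x. G x - G 0 + Hfun F B 0)"
  have h: "(h has_real_derivative h' y) (at y)" for y
    unfolding h_def by (auto intro!: derivative_eq_intros G)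
  have "h s = Hfun F B s" if s: "\<bar>s\<bar> \<le> R" for s
  proof -
    have d: "((\<lambda>x. h x - Hfun F B x) has_field_derivative 0) (at x within {-R..R})" if "x \<in> {-R..R}" for x
    proof -
      have "h' x = H1 x" using that clid[of x] by (auto simp: h'_def)
      then show ?thesis using DERIV_diff[OF h[of x] H1(1)[of x]] by (auto intro: has_field_derivative_at_within)
    qed
    obtain c where "\<And>x. x \<in> {-R..R} \<Longrightarrow> h x - Hfun F B x = c"
      using has_field_derivative_zero_constant[OF _ d] by auto
    from this[of s] this[of 0] show ?thesis using s R by (auto simp: h_def abs_le_iff)
  qed
  then show ?thesis using that h h'b h'L by blast
qed

section \<open>Properties of the exact solution at all times\<close>

locale sav_solution = periodic_box a b
  for a b :: "'a::euclidean_space" +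
  fixes M \<epsilon> B T :: real
    and F :: "real \<Rightarrow> real"
    and \<phi>0 :: "'a \<Rightarrow> real"
    and \<phi> w U \<phi>t \<phi>tt Ut :: "real \<Rightarrow> 'a \<Rightarrow> real"
  assumes M: "M > 0" and eps: "\<epsilon> > 0" and T: "T > 0"
    and Fpos: "\<And>x. F x + B > 0"
    and FC3: "C_k 3 F"
    and exact: "exact_solution a b M \<epsilon> B T F \<phi>0 \<phi> w U \<phi>t Ut"
    and phitt: "weak_time_deriv a b T \<phi>t \<phi>tt"
    and phi_reg: "\<phi> \<in> time_Linf a b T (Wkinf a b 1)"
    and U_reg: "U \<in> time_Linf a b T (Wkinf a b 1)"
    and w_reg: "w \<in> time_Linf a b T (Hk a b 1)"
    and phit_reg: "\<phi>t \<in> time_Lp a b T 2 (Hk a b 1)" "\<phi>t \<in> time_Linf a b T (Linf a b)"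
    and phitt_reg: "\<phi>tt \<in> time_Lp a b T 2 (L2 a b)"
begin

abbreviation \<tau> :: "real measure" where "\<tau> \<equiv> lebesgue_on {0<..<T}"

lemma continuity: "time_continuous a b T \<phi>" "time_continuous a b T w" "time_continuous a b T U"
  using exact by (auto simp: exact_solution_def)

lemma sqint_at:
  assumes "t \<in> {0..T}" shows "sqint \<mu> (\<phi> t)" "sqint \<mu> (w t)" "sqint \<mu> (U t)"
  using continuity assms by (auto simp: time_continuous_def L2_iff)

lemma coef_continuous:
  "continuous_on {0..T} (\<lambda>t. coef (\<phi> t) k)" "continuous_on {0..T} (\<lambda>t. coef (w t) k)"
  unfolding coef_def by (rule time_continuous_inner[OF continuity(1) mode_sqint] time_continuous_inner[OF continuity(2) mode_sqint])+

lemma L2_tendsto_at: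
  assumes "time_continuous a b T u" "t \<in> {0..T}"
  shows "((\<lambda>s. LINT x|\<mu>. (u s x - u t x)\<^sup>2) \<longlongrightarrow> 0) (at t within {0..T})"
proof -
  have "((\<lambda>s. norm2 a b (\<lambda>x. u s x - u t x)) \<longlongrightarrow> 0) (at t within {0..T})"
    using assms by (auto simp: time_continuous_def)
  from tendsto_power[OF this, of 2] show ?thesis by (simp add: norm2_square)
qed

text \<open>
  Membership in a ball of \<open>W\<^sup>1\<^sup>,\<^sup>\<infinity>\<close>, in a form that passes to limits in time.
\<close>

definition grad_bounded :: "real \<Rightarrow> ('a \<Rightarrow> real) \<Rightarrow> bool" where
  "grad_bounded K u \<longleftrightarrow> (AE x in \<mu>. \<bar>u x\<bar> \<le> K) \<and>
    (\<forall>i\<in>Basis. \<exists>g. g \<in> borel_measurable \<mu> \<and> wgrad i u g \<and> (AE x in \<mu>. \<bar>g x\<bar> \<le> K))"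

lemma grad_bounded_mono:
  assumes g: "grad_bounded K u" and K: "K \<le> K'" shows "grad_bounded K' u"
proof -
  have m: "AE x in \<mu>. \<bar>g x\<bar> \<le> K'" if "AE x in \<mu>. \<bar>g x\<bar> \<le> K" for g :: "'a \<Rightarrow> real"
    using that by eventually_elim (use K in linarith)
  then show ?thesis using g unfolding grad_bounded_def by blast
qed

lemma grad_bounded_gsum:
  assumes g: "grad_bounded K u" and K: "0 \<le> K" shows "gsum u j \<le> DIM('a) * (K\<^sup>2 * vol)"
proof -
  obtain g where g: "\<And>i. i \<in> Basis \<Longrightarrow> g i \<in> borel_measurable \<mu> \<and> wgrad i u (g i) \<and> (AE x in \<mu>. \<bar>g i x\<bar> \<le> K)"
    using g unfolding grad_bounded_def by metis
  have s: "sqint \<mu> (g i)" if "i \<in> Basis" for i using g[OF that] by (auto intro: sqint_bounded)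
  have k: "sqint \<mu> (\<lambda>_. K)" by (simp add: sqint_def)
  have "gsum u j \<le> (\<Sum>i\<in>Basis. LINT x|\<mu>. (g i x)\<^sup>2)" by (rule gsum_le) (use g s in auto)
  also have "\<dots> \<le> (\<Sum>i\<in>(Basis::'a set). LINT x|\<mu>. K\<^sup>2)"
    by (rule sum_mono, rule integral_square_mono[OF s k]) (use g K in auto)
  also have "\<dots> = DIM('a) * (K\<^sup>2 * vol)" using measure_box_total by (simp add: mult.commute)
  finally show ?thesis .
qed

lemma time_Linf_Wkinf:
  assumes "u \<in> time_Linf a b T (Wkinf a b 1)"
  obtains K where "AE t in \<tau>. grad_bounded K (u t)"
proof -
  obtain K where K: "AE t in \<tau>. u t \<in> fst (Wkinf a b 1)" "AE t in \<tau>. snd (Wkinf a b 1) (u t) \<le> K"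
    using assms by (auto simp: time_Linf_def)
  have "AE t in \<tau>. grad_bounded K (u t)"
    using K
  proof eventually_elim
    case (elim t)
    have "grad_bounded (snd (Wkinf a b 1) (u t)) (u t)"
      unfolding grad_bounded_def using Wkinf_bound[OF elim(1)] by blast
    then show ?case using elim(2) by (rule grad_bounded_mono)
  qed
  then show ?thesis using that by blast
qed

lemma uniform_bound:
  obtains K where "K > 0" "AE t in \<tau>. grad_bounded K (\<phi> t)" "AE t in \<tau>. grad_bounded K (U t)"
    "AE t in \<tau>. AE x in \<mu>. \<bar>\<phi>t t x\<bar> \<le> K" "AE t in \<tau>. \<forall>j. gsum (w t) j \<le> K"
proof -
  obtain K1 where K1: "AE t in \<tau>. grad_bounded K1 (\<phi> t)" using time_Linf_Wkinf[OF phi_reg] by blast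
  obtain K2 where K2: "AE t in \<tau>. grad_bounded K2 (U t)" using time_Linf_Wkinf[OF U_reg] by blast
  obtain K3 where K3: "AE t in \<tau>. \<phi>t t \<in> fst (Linf a b)" "AE t in \<tau>. snd (Linf a b) (\<phi>t t) \<le> K3"
    using phit_reg(2) by (auto simp: time_Linf_def)
  obtain K4 where K4: "AE t in \<tau>. w t \<in> fst (Hk a b 1)" "AE t in \<tau>. snd (Hk a b 1) (w t) \<le> K4"
    using w_reg by (auto simp: time_Linf_def)
  define K where "K = \<bar>K1\<bar> + \<bar>K2\<bar> + \<bar>K3\<bar> + K4\<^sup>2 + 1"
  have le: "K1 \<le> K" "K2 \<le> K" "K3 \<le> K" "K4\<^sup>2 \<le> K" "0 < K" unfolding K_def using zero_le_power2[of K4] by linarith+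
  have "AE t in \<tau>. AE x in \<mu>. \<bar>\<phi>t t x\<bar> \<le> K"
    using K3
  proof eventually_elim
    case (elim t)
    show ?case using Linf_bound(1)[OF elim(1)] by eventually_elim (use elim(2) le in linarith)
  qed
  moreover have "AE t in \<tau>. \<forall>j. gsum (w t) j \<le> K"
    using K4
  proof eventually_elim
    case (elim t)
    have "0 \<le> snd (Hk a b 1) (w t)" by (simp add: sobolev_def norm2_eq sum_nonneg)
    then have "(snd (Hk a b 1) (w t))\<^sup>2 \<le> K4\<^sup>2" using elim(2) by (intro power_mono)
    then show ?case using gsum_le_Hk[OF elim(1)] le(4) by (meson order_trans)
  qed
  moreover have "AE t in \<tau>. grad_bounded K (\<phi> t)"
    using K1 by eventually_elim (rule grad_bounded_mono[OF _ le(1)])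
  moreover have "AE t in \<tau>. grad_bounded K (U t)"
    using K2 by eventually_elim (rule grad_bounded_mono[OF _ le(2)])
  ultimately show ?thesis using that le(5) by blast
qed

lemma gsum_continuous:
  assumes "time_continuous a b T u" shows "continuous_on {0..T} (\<lambda>t. gsum (u t) j)"
  unfolding gsum_def coef_def
  by (intro continuous_intros time_continuous_inner[OF assms mode_sqint])

lemma grad_bounded_all_times:
  assumes u: "time_continuous a b T u" and K: "0 \<le> K" and ae: "AE t in \<tau>. grad_bounded K (u t)" and t: "t \<in> {0..T}"
  shows "grad_bounded K (u t)"
proof -
  let ?F = "at t within {0..T}"
  have sq: "sqint \<mu> (u s)" if "s \<in> {0..T}" for s using u that by (auto simp: time_continuous_def L2_iff)
  have fr: "\<exists>\<^sub>F s in ?F. s \<in> {0<..<T} \<and> grad_bounded K (u s)"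
    by (rule AE_time_frequently[OF ae t T])
  have b: "AE x in \<mu>. \<bar>u t x\<bar> \<le> K"
  proof (rule AE_bound_closed_L2[OF _ sq[OF t] L2_tendsto_at[OF u t]])
    show "\<exists>\<^sub>F s in ?F. sqint \<mu> (u s) \<and> (AE x in \<mu>. \<bar>u s x\<bar> \<le> K)"
      using fr by (rule frequently_elim1) (use sq in \<open>auto simp: grad_bounded_def\<close>)
  qed
  have G: "gsum (u t) j \<le> DIM('a) * (K\<^sup>2 * vol)" for j
    by (rule continuous_AE_le[OF gsum_continuous[OF u] _ t T])
      (use ae in eventually_elim, rule grad_bounded_gsum[OF _ K])
  have "\<exists>g. g \<in> borel_measurable \<mu> \<and> wgrad i (u t) g \<and> (AE x in \<mu>. \<bar>g x\<bar> \<le> K)" if i: "i \<in> Basis" for i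
  proof -
    obtain g where g: "sqint \<mu> g" "wgrad i (u t) g" using gsum_bounded_imp_wgrad[OF sq[OF t] G i] by blast
    have "AE x in \<mu>. \<bar>g x\<bar> \<le> K"
    proof (rule wgrad_bound_closed[OF i _ _ g(2,1) K])
      show "\<exists>\<^sub>F s in ?F. \<exists>g. g \<in> borel_measurable \<mu> \<and> wgrad i (u s) g \<and> (AE x in \<mu>. \<bar>g x\<bar> \<le> K)"
        using fr by (rule frequently_elim1) (use i in \<open>auto simp: grad_bounded_def\<close>)
      show "((\<lambda>s. coef (u s) k) \<longlongrightarrow> coef (u t) k) ?F" for k
        using time_continuous_inner[OF u mode_sqint] t by (auto simp: continuous_on_def coef_def)
    qed
    then show ?thesis using g by (auto simp: sqint_def)
  qed
  then show ?thesis using b by (simp add: grad_bounded_def)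
qed

end

section \<open>Increments and consistency of the exact solution\<close>

text \<open>
  The constant \<open>K\<close> bounds the exact solution; \<open>h\<close> replaces \<open>H\<close> and agrees with it as long as
  the argument exceeds the range of the exact solution by at most one, which is the margin that is left to
  the numerical solution.
\<close>

locale sav_bounded = sav_solution a b M \<epsilon> B T F \<phi>0 \<phi> w U \<phi>t \<phi>tt Ut
  for a b :: "'a::euclidean_space" and M \<epsilon> B T F \<phi>0 \<phi> w U \<phi>t \<phi>tt Ut +
  fixes K C L :: real and h h' :: "real \<Rightarrow> real"
  assumes K: "K > 0"
    and phi_gb: "AE t in lebesgue_on {0<..<T}. grad_bounded K (\<phi> t)"
    and U_gb: "AE t in lebesgue_on {0<..<T}. grad_bounded K (U t)"
    and phit_b: "AE t in lebesgue_on {0<..<T}. AE x in lebesgue_on (box a b). \<bar>\<phi>t t x\<bar> \<le> K"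
    and w_gsum: "AE t in lebesgue_on {0<..<T}. \<forall>j. gsum (w t) j \<le> K"
    and h_eq: "\<And>s. \<bar>s\<bar> \<le> K + 1 \<Longrightarrow> h s = Hfun F B s"
    and h_deriv: "\<And>y. (h has_real_derivative h' y) (at y)"
    and h'_bound: "\<And>y. \<bar>h' y\<bar> \<le> C"
    and h'_Lip: "\<And>p q. \<bar>h' p - h' q\<bar> \<le> L * \<bar>p - q\<bar>"
begin

lemma C_nonneg: "C \<ge> 0" using h'_bound[of 0] by simp

lemma h_Lip: "\<bar>h p - h q\<bar> \<le> C * \<bar>p - q\<bar>"
  using field_differentiable_bound[of UNIV h h' C p q] h_deriv h'_bound
  by (auto simp: has_field_derivative_at_within)

lemmas h_measurable = Lipschitz_borel_measurable(2)[OF h_Lip]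

definition Hsup :: real where "Hsup = \<bar>h 0\<bar> + C * (K + 1)"

lemma h_bound: assumes "\<bar>s\<bar> \<le> K + 1" shows "\<bar>h s\<bar> \<le> Hsup"
proof -
  have "\<bar>h s - h 0\<bar> \<le> C * \<bar>s\<bar>" using h_Lip[of s 0] by simp
  also have "\<dots> \<le> C * (K + 1)" using assms C_nonneg by (rule mult_left_mono)
  finally show ?thesis by (simp add: Hsup_def)
qed

lemma h_comp_measurable: "u \<in> borel_measurable \<mu> \<Longrightarrow> (\<lambda>x. h (u x)) \<in> borel_measurable \<mu>"
  using h_measurable by auto

lemma phi_gb_at: "t \<in> {0..T} \<Longrightarrow> grad_bounded K (\<phi> t)"
  using grad_bounded_all_times[OF continuity(1) _ phi_gb] K by simp

lemma U_gb_at: "t \<in> {0..T} \<Longrightarrow> grad_bounded K (U t)"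
  using grad_bounded_all_times[OF continuity(3) _ U_gb] K by simp

lemma phi_bound: "t \<in> {0..T} \<Longrightarrow> AE x in \<mu>. \<bar>\<phi> t x\<bar> \<le> K"
  using phi_gb_at by (simp add: grad_bounded_def)

lemma U_bound: "t \<in> {0..T} \<Longrightarrow> AE x in \<mu>. \<bar>U t x\<bar> \<le> K"
  using U_gb_at by (simp add: grad_bounded_def)

lemma h_phi:
  assumes t: "t \<in> {0..T}"
  shows "AE x in \<mu>. h (\<phi> t x) = Hfun F B (\<phi> t x) \<and> \<bar>h (\<phi> t x)\<bar> \<le> Hsup"
  using phi_bound[OF t]
proof eventually_elim
  case (elim x)
  then have "\<bar>\<phi> t x\<bar> \<le> K + 1" by simp
  then show ?case using h_eq h_bound by auto
qed

lemma h_phi_measurable: "t \<in> {0..T} \<Longrightarrow> (\<lambda>x. h (\<phi> t x)) \<in> borel_measurable \<mu>"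
  by (rule h_comp_measurable[OF sqintD(1)[OF sqint_at(1)]])

lemma sqint_h_phi_mult:
  assumes "t \<in> {0..T}" "sqint \<mu> v" shows "sqint \<mu> (\<lambda>x. h (\<phi> t x) * v x)"
  by (rule sqint_bounded_mult[OF assms(2) h_phi_measurable[OF assms(1)], of Hsup])
    (use h_phi[OF assms(1)] in \<open>auto elim: eventually_mono\<close>)

lemma phi_gsum: "t \<in> {0..T} \<Longrightarrow> gsum (\<phi> t) j \<le> DIM('a) * (K\<^sup>2 * vol)"
  using grad_bounded_gsum[OF phi_gb_at] K by simp

lemma w_gsum_at: "t \<in> {0..T} \<Longrightarrow> gsum (w t) j \<le> K"
  by (rule continuous_AE_le[OF gsum_continuous[OF continuity(2)] _ _ T])
    (use w_gsum in \<open>auto elim: eventually_mono\<close>)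

lemma phit_sqint: "AE t in \<tau>. sqint \<mu> (\<phi>t t)"
  using phit_reg(1) strongly_measurable_inner(2)[of T \<phi>t "\<lambda>_. 0"] by (auto simp: time_Lp_def)

lemma phit_integrable: "sqint \<mu> v \<Longrightarrow> integrable \<tau> (\<lambda>s. LINT x|\<mu>. \<phi>t s x * v x)"
  using phitt by (intro inner_time_integrable) (auto simp: weak_time_deriv_def)

lemma phi_increment:
  assumes v: "sqint \<mu> v" and rt: "0 \<le> r" "r \<le> t" "t \<le> T"
  shows "(LINT x|\<mu>. (\<phi> t x - \<phi> r x) * v x) = tint T r t (\<lambda>s. LINT x|\<mu>. \<phi>t s x * v x)"
proof -
  have d: "weak_time_deriv a b T \<phi> \<phi>t" using exact by (simp add: exact_solution_def)
  have "(LINT x|\<mu>. (\<phi> t x - \<phi> r x) * v x) = (LINT x|\<mu>. \<phi> t x * v x) - (LINT x|\<mu>. \<phi> r x * v x)"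
    using sqint_at(1)[of t] sqint_at(1)[of r] rt v
    by (simp add: left_diff_distrib sqint_mult_integrable)
  also have "\<dots> = tint T r t (\<lambda>s. LINT x|\<mu>. \<phi>t s x * v x)"
    by (rule weak_time_deriv_increment[OF d continuity(1) v rt])
  finally show ?thesis .
qed

text \<open>
  By duality, from the sup bound on \<open>\<phi>t\<close> at almost every time.
\<close>

lemma phi_increment_bound:
  assumes rt: "0 \<le> r" "r \<le> t" "t \<le> T"
  shows "AE x in \<mu>. \<bar>\<phi> t x - \<phi> r x\<bar> \<le> K * (t - r)"
proof (rule AE_bound_by_duality)
  show "sqint \<mu> (\<lambda>x. \<phi> t x - \<phi> r x)" using sqint_at(1) rt by auto
  show "0 \<le> K * (t - r)" using K rt by simp
  fix v assume v: "sqint \<mu> v"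
  have va: "integrable \<mu> (\<lambda>x. \<bar>v x\<bar>)" using sqint_integrable[OF sqint_abs[OF v]] .
  have "tint T r t (\<lambda>s. LINT x|\<mu>. \<phi>t s x * v x) \<le> tint T r t (\<lambda>_. K * (LINT x|\<mu>. \<bar>v x\<bar>))"
  proof (rule tint_mono)
    show "integrable \<tau> (\<lambda>s. LINT x|\<mu>. \<phi>t s x * v x)" by (rule phit_integrable[OF v])
    show "integrable \<tau> (\<lambda>_. K * (LINT x|\<mu>. \<bar>v x\<bar>))" by (rule continuous_time_sqint(2)) simp
    show "AE s in \<tau>. s \<in> {r<..t} \<longrightarrow> (LINT x|\<mu>. \<phi>t s x * v x) \<le> K * (LINT x|\<mu>. \<bar>v x\<bar>)"
      using phit_b phit_sqint
    proof eventually_elim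
      case (elim s)
      have "(LINT x|\<mu>. \<phi>t s x * v x) \<le> (LINT x|\<mu>. K * \<bar>v x\<bar>)"
      proof (rule integral_mono_AE)
        show "AE x in \<mu>. \<phi>t s x * v x \<le> K * \<bar>v x\<bar>"
          using elim(1)
        proof eventually_elim
          case (elim x)
          have "\<phi>t s x * v x \<le> \<bar>\<phi>t s x\<bar> * \<bar>v x\<bar>" by (metis abs_ge_self abs_mult)
          also have "\<dots> \<le> K * \<bar>v x\<bar>" using elim by (rule mult_right_mono) simp
          finally show ?case .
        qed
      qed (use va sqint_mult_integrable[OF elim(2) v] in auto)
      then show ?case by simp
    qed
  qed
  then show "(LINT x|\<mu>. (\<phi> t x - \<phi> r x) * v x) \<le> K * (t - r) * (LINT x|\<mu>. \<bar>v x\<bar>)"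
    using phi_increment[OF v rt] tint_const[OF rt] by (simp add: mult_ac)
qed

text \<open>
  By the equations, the coefficients of \<open>\<phi>t\<close> agree almost everywhere with those of \<open>M \<Delta> w\<close>,
  which are continuous in time.
\<close>

definition rate :: "'a \<Rightarrow> real \<Rightarrow> real" where "rate k t = - (M * (k \<bullet> k)) * coef (w t) k"

lemma rate_continuous: "continuous_on {0..T} (rate k)"
  unfolding rate_def by (intro continuous_intros coef_continuous)

lemma exact_equations:
  "AE t in \<tau>. \<exists>\<Delta>w \<Delta>\<phi>. weak_laplacian a b (w t) \<Delta>w \<and> weak_laplacian a b (\<phi> t) \<Delta>\<phi> \<and>
        (AE x in \<mu>. \<phi>t t x - M * \<Delta>w x = 0 \<and>
           w t x = - \<epsilon>\<^sup>2 * \<Delta>\<phi> x + Hfun F B (\<phi> t x) * U t x \<and>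
           Ut t x = 1/2 * Hfun F B (\<phi> t x) * \<phi>t t x)"
  using exact unfolding exact_solution_def by blast

lemma coef_phit: "AE t in \<tau>. \<forall>k\<in>freqs. coef (\<phi>t t) k = rate k t"
  using exact_equations phit_sqint
proof eventually_elim
  case (elim t)
  then obtain \<Delta>w where l: "weak_laplacian a b (w t) \<Delta>w" and e: "AE x in \<mu>. \<phi>t t x - M * \<Delta>w x = 0"
    by (auto elim: eventually_mono)
  have i: "integrable \<mu> \<Delta>w" using l by (simp add: weak_laplacian_def)
  show ?case
  proof
    fix k assume k: "k \<in> freqs"
    have "coef (\<phi>t t) k = coef (\<lambda>x. M * \<Delta>w x) k"
      by (rule coef_cong_AE) (use elim(2) i e in \<open>auto simp: sqint_def elim: eventually_mono\<close>)
    then show "coef (\<phi>t t) k = rate k t"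
      by (simp add: coef_cmult weak_laplacian_coef[OF l k] rate_def)
  qed
qed

lemma coef_phi_increment:
  assumes k: "k \<in> freqs" and rt: "0 \<le> r" "r \<le> t" "t \<le> T"
  shows "coef (\<phi> t) k - coef (\<phi> r) k = tint T r t (rate k)"
proof -
  have "coef (\<phi> t) k - coef (\<phi> r) k = coef (\<lambda>x. \<phi> t x - \<phi> r x) k"
    using sqint_at(1)[of t] sqint_at(1)[of r] rt by (intro coef_diff[symmetric] sqint_integrable) auto
  also have "\<dots> = tint T r t (\<lambda>s. coef (\<phi>t s) k)"
    unfolding coef_def by (rule phi_increment[OF mode_sqint rt])
  also have "\<dots> = tint T r t (rate k)"
  proof (rule order_antisym)
    have i: "integrable \<tau> (\<lambda>s. coef (\<phi>t s) k)" "integrable \<tau> (rate k)"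
      unfolding coef_def by (rule phit_integrable[OF mode_sqint] continuous_time_sqint(2)[OF rate_continuous])+
    show "tint T r t (\<lambda>s. coef (\<phi>t s) k) \<le> tint T r t (rate k)"
      by (rule tint_mono[OF i]) (use coef_phit k in \<open>auto elim: eventually_mono\<close>)
    show "tint T r t (rate k) \<le> tint T r t (\<lambda>s. coef (\<phi>t s) k)"
      by (rule tint_mono[OF i(2,1)]) (use coef_phit k in \<open>auto elim: eventually_mono\<close>)
  qed
  finally show ?thesis .
qed

text \<open>
  The second weak time derivative of \<open>\<phi>\<close> is tested against a single mode, where the coefficient of
  \<open>\<phi>t\<close> may be replaced by its continuous version.
\<close>

lemma rate_increment:
  assumes k: "k \<in> freqs" and rt: "0 \<le> r" "r \<le> t" "t \<le> T"
  shows "rate k t - rate k r = tint T r t (\<lambda>s. coef (\<phi>tt s) k)"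
proof (rule weak_derivative_increment[OF rate_continuous _ _ rt])
  have d: "weak_time_deriv a b T \<phi>t \<phi>tt" by (rule phitt)
  then show "integrable \<tau> (\<lambda>s. coef (\<phi>tt s) k)"
    unfolding coef_def by (intro inner_time_integrable mode_sqint) (simp add: weak_time_deriv_def)
  fix \<eta> assume \<eta>: "time_test T \<eta>"
  have "mode k \<in> fst (L2 a b)" by (simp add: L2_iff)
  from d[unfolded weak_time_deriv_def, THEN conjunct2, THEN conjunct2, folded time_test_def, rule_format, OF \<eta> this]
  have e: "(LINT t|\<tau>. deriv \<eta> t * coef (\<phi>t t) k) = - (LINT t|\<tau>. \<eta> t * coef (\<phi>tt t) k)"
    unfolding coef_def .
  have "C_k 1 \<eta>" using \<eta> by (simp add: time_test_def)
  then have "continuous_on UNIV (deriv \<eta>)" by (simp add: C_k_def)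
  then have dm: "deriv \<eta> \<in> borel_measurable \<tau>"
    by (intro continuous_time_measurable) (auto intro: continuous_on_subset)
  have "(LINT t|\<tau>. deriv \<eta> t * rate k t) = (LINT t|\<tau>. deriv \<eta> t * coef (\<phi>t t) k)"
  proof (rule integral_cong_AE)
    show "(\<lambda>t. deriv \<eta> t * rate k t) \<in> borel_measurable \<tau>"
      using dm continuous_time_measurable[OF rate_continuous] by auto
    have "(\<lambda>t. coef (\<phi>t t) k) \<in> borel_measurable \<tau>"
      using phit_integrable[OF mode_sqint] unfolding coef_def by auto
    then show "(\<lambda>t. deriv \<eta> t * coef (\<phi>t t) k) \<in> borel_measurable \<tau>" using dm by auto
    show "AE t in \<tau>. deriv \<eta> t * rate k t = deriv \<eta> t * coef (\<phi>t t) k"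
      using coef_phit by eventually_elim (use k in auto)
  qed
  then show "(LINT t|\<tau>. deriv \<eta> t * rate k t) = - (LINT t|\<tau>. \<eta> t * coef (\<phi>tt t) k)" using e by simp
qed

text \<open>
  The squared norms that \<open>\<phi>t\<close> and \<open>\<phi>tt\<close> are required to have integrable in time.
\<close>

definition beta :: "real \<Rightarrow> real" where "beta s = (snd (Hk a b 1) (\<phi>t s))\<^sup>2"
definition gamma :: "real \<Rightarrow> real" where "gamma s = (norm2 a b (\<phi>tt s))\<^sup>2"

lemma beta_gamma:
  "integrable \<tau> beta" "integrable \<tau> gamma" "0 \<le> beta s" "0 \<le> gamma s"
  using phit_reg(1) phitt_reg by (auto simp: time_Lp_def beta_def[abs_def] gamma_def[abs_def])

lemma rate_beta: "AE s in \<tau>. (\<Sum>k\<in>blk j. (k \<bullet> k) * (rate k s)\<^sup>2) \<le> beta s"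
proof -
  have "AE s in \<tau>. \<phi>t s \<in> fst (Hk a b 1)" using phit_reg(1) by (simp add: time_Lp_def)
  then show ?thesis
    using coef_phit
  proof eventually_elim
    case (elim s)
    have "(\<Sum>k\<in>blk j. (k \<bullet> k) * (rate k s)\<^sup>2) = gsum (\<phi>t s) j"
      unfolding gsum_def using elim(2) blk_in_freqs by (intro sum.cong) auto
    then show ?case using gsum_le_Hk[OF elim(1)] by (simp add: beta_def)
  qed
qed

lemma phi_increment_gsum:
  assumes rt: "0 \<le> r" "r \<le> t" "t \<le> T"
  shows "gsum (\<lambda>x. \<phi> t x - \<phi> r x) j \<le> (t - r) * tint T r t beta"
proof -
  have sq: "sqint \<tau> (rate k)" for k by (rule continuous_time_sqint(1)[OF rate_continuous])
  have int: "integrable \<tau> (\<lambda>s. (k \<bullet> k) * (rate k s)\<^sup>2)" for k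
    using sqintD(2)[OF sq] by simp
  have "gsum (\<lambda>x. \<phi> t x - \<phi> r x) j = (\<Sum>k\<in>blk j. (k \<bullet> k) * (tint T r t (rate k))\<^sup>2)"
    unfolding gsum_def
  proof (rule sum.cong[OF refl])
    fix k assume "k \<in> blk j"
    then have "coef (\<lambda>x. \<phi> t x - \<phi> r x) k = tint T r t (rate k)"
      using coef_phi_increment[OF blk_in_freqs rt] sqint_at(1)[of t] sqint_at(1)[of r] rt
      by (simp add: coef_diff sqint_integrable)
    then show "(k \<bullet> k) * (coef (\<lambda>x. \<phi> t x - \<phi> r x) k)\<^sup>2 = (k \<bullet> k) * (tint T r t (rate k))\<^sup>2" by simp
  qed
  also have "\<dots> \<le> (\<Sum>k\<in>blk j. (k \<bullet> k) * ((t - r) * tint T r t (\<lambda>s. (rate k s)\<^sup>2)))"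
    by (intro sum_mono mult_left_mono tint_square_le rt sq) auto
  also have "\<dots> = (t - r) * tint T r t (\<lambda>s. \<Sum>k\<in>blk j. (k \<bullet> k) * (rate k s)\<^sup>2)"
    using int by (simp add: tint_sum tint_cmult sum_distrib_left mult_ac)
  also have "\<dots> \<le> (t - r) * tint T r t beta"
  proof (intro mult_left_mono tint_mono Bochner_Integration.integrable_sum int beta_gamma)
    show "AE s in \<tau>. s \<in> {r<..t} \<longrightarrow> (\<Sum>k\<in>blk j. (k \<bullet> k) * (rate k s)\<^sup>2) \<le> beta s"
      using rate_beta[of j] by eventually_elim simp
  qed (use rt in simp)
  finally show ?thesis .
qed

text \<open>The truncation error that the backward Euler step makes in the first equation.\<close>

definition trunc :: "real \<Rightarrow> real \<Rightarrow> 'a \<Rightarrow> real" where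
  "trunc r t k = coef (\<phi> t) k - coef (\<phi> r) k - (t - r) * rate k t"

text \<open>
  Both equations conserve the mean of \<open>\<phi>\<close>. The sum over the modes therefore never has to estimate
  the product of the truncation error with the mean of \<open>W\<close>, which the dissipation does not control.
\<close>

lemma trunc_zero:
  assumes rt: "0 \<le> r" "r \<le> t" "t \<le> T" shows "trunc r t 0 = 0"
proof -
  have "rate 0 = (\<lambda>_. 0)" by (simp add: rate_def fun_eq_iff)
  then show ?thesis using coef_phi_increment[OF zero_in_freqs rt] by (simp add: trunc_def tint_def)
qed

text \<open>
  The rate differs from its value at \<open>t\<close> by at most the integral of the second derivative; the powers
  of \<open>t - r\<close> come from one integration and from Cauchy-Schwarz in time.
\<close>

lemma trunc_square_le:
  assumes k: "k \<in> freqs" and rt: "0 \<le> r" "r \<le> t" "t \<le> T"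
  shows "(trunc r t k)\<^sup>2 \<le> (t - r) ^ 3 * tint T r t (\<lambda>s. (coef (\<phi>tt s) k)\<^sup>2)"
proof -
  let ?F = "\<lambda>s. coef (\<phi>tt s) k"
  have Fs: "sqint \<tau> ?F" by (rule coef_time_sqint[OF phitt_reg k])
  interpret time: finite_measure \<tau> by (rule finite_measure_time)
  have Fi: "integrable \<tau> (\<lambda>s. \<bar>?F s\<bar>)" using time.sqint_integrable[OF sqint_abs[OF Fs]] .
  have Fi': "integrable \<tau> ?F" using time.sqint_integrable[OF Fs] .
  define J where "J = tint T r t (\<lambda>s. \<bar>?F s\<bar>)"
  have J0: "0 \<le> J" unfolding J_def by (rule tint_nonneg) simp
  have ri: "integrable \<tau> (rate k)" "integrable \<tau> (\<lambda>s. c)" for c :: real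
    by (rule continuous_time_sqint(2), rule rate_continuous) (rule continuous_time_sqint(2), simp)
  have "trunc r t k = tint T r t (\<lambda>s. rate k s - rate k t)"
    unfolding trunc_def coef_phi_increment[OF k rt] using tint_diff[OF ri] tint_const[OF rt] by simp
  also have "\<bar>\<dots>\<bar> \<le> tint T r t (\<lambda>_. J)"
  proof (rule tint_abs_le)
    show "AE s in \<tau>. s \<in> {r<..t} \<longrightarrow> \<bar>rate k s - rate k t\<bar> \<le> J"
    proof (rule AE_I2, rule impI)
      fix s assume s: "s \<in> {r<..t}"
      then have st: "0 \<le> s" "s \<le> t" using rt by auto
      have "\<bar>rate k s - rate k t\<bar> = \<bar>tint T s t ?F\<bar>"
        using rate_increment[OF k st rt(3)] by linarith
      also have "\<dots> \<le> tint T s t (\<lambda>s. \<bar>?F s\<bar>)" by (rule tint_abs_le[OF Fi' Fi]) simp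
      also have "\<dots> \<le> J"
        unfolding tint_def J_def using tint_integrable[OF Fi] s
        by (intro integral_mono) (auto simp: indicator_def)
      finally show "\<bar>rate k s - rate k t\<bar> \<le> J" .
    qed
  qed (use ri in auto)
  also have "\<dots> = (t - r) * J" by (rule tint_const[OF rt])
  finally have "(trunc r t k)\<^sup>2 \<le> ((t - r) * J)\<^sup>2" using abs_le_square_iff by fastforce
  also have "\<dots> = (t - r)\<^sup>2 * J\<^sup>2" by (simp add: power_mult_distrib)
  also have "\<dots> \<le> (t - r)\<^sup>2 * ((t - r) * tint T r t (\<lambda>s. (\<bar>?F s\<bar>)\<^sup>2))"
    unfolding J_def by (intro mult_left_mono tint_square_le rt sqint_abs Fs) auto
  finally show ?thesis by (simp add: power3_eq_cube power2_eq_square mult.assoc)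
qed

lemma sum_trunc_square_le:
  assumes rt: "0 \<le> r" "r \<le> t" "t \<le> T"
  shows "(\<Sum>k\<in>blk j. (trunc r t k)\<^sup>2) \<le> (t - r) ^ 3 * tint T r t gamma"
proof -
  have int: "integrable \<tau> (\<lambda>s. (coef (\<phi>tt s) k)\<^sup>2)" if "k \<in> blk j" for k
    using coef_time_sqint[OF phitt_reg blk_in_freqs[OF that]] by (simp add: sqint_def)
  have "(\<Sum>k\<in>blk j. (trunc r t k)\<^sup>2) \<le> (\<Sum>k\<in>blk j. (t - r) ^ 3 * tint T r t (\<lambda>s. (coef (\<phi>tt s) k)\<^sup>2))"
    by (intro sum_mono trunc_square_le rt) (rule blk_in_freqs)
  also have "\<dots> = (t - r) ^ 3 * tint T r t (\<lambda>s. \<Sum>k\<in>blk j. (coef (\<phi>tt s) k)\<^sup>2)"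
    using tint_sum[of "blk j" T "\<lambda>k s. (coef (\<phi>tt s) k)\<^sup>2" r t] int by (simp add: sum_distrib_left)
  also have "\<dots> \<le> (t - r) ^ 3 * tint T r t gamma"
  proof (intro mult_left_mono tint_mono Bochner_Integration.integrable_sum int beta_gamma)
    have "AE s in \<tau>. sqint \<mu> (\<phi>tt s)"
      using phitt_reg strongly_measurable_inner(2)[of T \<phi>tt "\<lambda>_. 0"] by (auto simp: time_Lp_def)
    then show "AE s in \<tau>. s \<in> {r<..t} \<longrightarrow> (\<Sum>k\<in>blk j. (coef (\<phi>tt s) k)\<^sup>2) \<le> gamma s"
      by eventually_elim (use Bessel[OF _ finite_blk blk_subset] in \<open>auto simp: gamma_def norm2_square\<close>)
  qed (use rt in auto)
  finally show ?thesis .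
qed

text \<open>
  The truncation error of the third equation. In its integrated form the argument of \<open>H\<close> differs from
  the one at the old time by \<open>O(t - r)\<close>, and so does the integrated rate, which makes two powers.
\<close>

lemma U_consistency:
  assumes rt: "0 \<le> r" "r \<le> t" "t \<le> T"
  shows "(LINT x|\<mu>. (U t x - U r x - 1/2 * h (\<phi> r x) * (\<phi> t x - \<phi> r x))\<^sup>2) \<le> (C * K\<^sup>2 * sqrt vol * (t - r)\<^sup>2)\<^sup>2"
proof (rule integral_square_le_by_duality)
  have at: "r \<in> {0..T}" "t \<in> {0..T}" using rt by auto
  have hs: "sqint \<mu> (\<lambda>x. h (\<phi> s x) * v x)" if "s \<in> {0..T}" "sqint \<mu> v" for s v
    by (rule sqint_h_phi_mult[OF that])
  have ps: "sqint \<mu> (\<lambda>x. \<phi> t x - \<phi> r x)" and us: "sqint \<mu> (\<lambda>x. U t x - U r x)" using sqint_at at by auto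
  have e: "1/2 * h (\<phi> r x) * (\<phi> t x - \<phi> r x) = 1/2 * (h (\<phi> r x) * (\<phi> t x - \<phi> r x))" for x by simp
  show "sqint \<mu> (\<lambda>x. U t x - U r x - 1/2 * h (\<phi> r x) * (\<phi> t x - \<phi> r x))"
    unfolding e by (intro sqint_diff[OF us] sqint_cmult hs at ps)
  show "0 \<le> C * K\<^sup>2 * sqrt vol * (t - r)\<^sup>2" using C_nonneg vol_pos by simp
  fix v assume v: "sqint \<mu> v"
  define Z where "Z = C * K\<^sup>2 * (t - r) * (LINT x|\<mu>. \<bar>v x\<bar>)"
  have Ud: "weak_time_deriv a b T U Ut" using exact by (simp add: exact_solution_def)
  have Ui: "integrable \<tau> (\<lambda>s. LINT x|\<mu>. Ut s x * v x)"
    using Ud by (intro inner_time_integrable v) (simp add: weak_time_deriv_def)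
  have hv: "sqint \<mu> (\<lambda>x. 1/2 * (h (\<phi> r x) * v x))" by (intro sqint_cmult hs at v)
  have "(LINT x|\<mu>. (U t x - U r x - 1/2 * h (\<phi> r x) * (\<phi> t x - \<phi> r x)) * v x)
      = (LINT x|\<mu>. U t x * v x - U r x * v x - (\<phi> t x - \<phi> r x) * (1/2 * (h (\<phi> r x) * v x)))"
    by (rule Bochner_Integration.integral_cong) (auto simp: algebra_simps)
  also have "\<dots> = (LINT x|\<mu>. U t x * v x) - (LINT x|\<mu>. U r x * v x) - (LINT x|\<mu>. (\<phi> t x - \<phi> r x) * (1/2 * (h (\<phi> r x) * v x)))"
    using sqint_mult_integrable[OF sqint_at(3)[OF at(2)] v] sqint_mult_integrable[OF sqint_at(3)[OF at(1)] v]
      sqint_mult_integrable[OF ps hv] by simp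
  also have "\<dots> = tint T r t (\<lambda>s. (LINT x|\<mu>. Ut s x * v x) - (LINT x|\<mu>. \<phi>t s x * (1/2 * (h (\<phi> r x) * v x))))"
    using tint_diff[OF Ui phit_integrable[OF hv]] phi_increment[OF hv rt]
      weak_time_deriv_increment[OF Ud continuity(3) v rt] by simp
  also have "\<dots> \<le> tint T r t (\<lambda>_. Z)"
  proof (rule tint_mono)
    show "integrable \<tau> (\<lambda>s. (LINT x|\<mu>. Ut s x * v x) - (LINT x|\<mu>. \<phi>t s x * (1/2 * (h (\<phi> r x) * v x))))"
      using Ui phit_integrable[OF hv] by simp
    show "integrable \<tau> (\<lambda>_. Z)" by (rule continuous_time_sqint(2)) simp
    have Uts: "AE s in \<tau>. sqint \<mu> (Ut s)"
      using Ud strongly_measurable_inner(2)[of T Ut "\<lambda>_. 0"] by (auto simp: time_Lp_def weak_time_deriv_def)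
    show "AE s in \<tau>. s \<in> {r<..t} \<longrightarrow> (LINT x|\<mu>. Ut s x * v x) - (LINT x|\<mu>. \<phi>t s x * (1/2 * (h (\<phi> r x) * v x))) \<le> Z"
      using exact_equations phit_b phit_sqint Uts
    proof (eventually_elim, intro impI)
      case (elim s)
      assume s: "s \<in> {r<..t}"
      then have st: "0 \<le> r" "r \<le> s" "s \<le> T" "s \<in> {0..T}" using rt by auto
      have Ue: "AE x in \<mu>. Ut s x = 1/2 * Hfun F B (\<phi> s x) * \<phi>t s x"
        using elim(1) by (auto elim: eventually_mono)
      have i1: "integrable \<mu> (\<lambda>x. Ut s x * v x)" "integrable \<mu> (\<lambda>x. \<phi>t s x * (1/2 * (h (\<phi> r x) * v x)))"
        using sqint_mult_integrable[OF elim(4) v] sqint_mult_integrable[OF elim(3) hv] by auto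
      have "(LINT x|\<mu>. Ut s x * v x) - (LINT x|\<mu>. \<phi>t s x * (1/2 * (h (\<phi> r x) * v x)))
          = (LINT x|\<mu>. Ut s x * v x - \<phi>t s x * (1/2 * (h (\<phi> r x) * v x)))"
        using i1 by simp
      also have "\<dots> \<le> (LINT x|\<mu>. C * K\<^sup>2 * (t - r) * \<bar>v x\<bar>)"
      proof (rule integral_mono_AE)
        show "integrable \<mu> (\<lambda>x. Ut s x * v x - \<phi>t s x * (1/2 * (h (\<phi> r x) * v x)))" using i1 by simp
        show "integrable \<mu> (\<lambda>x. C * K\<^sup>2 * (t - r) * \<bar>v x\<bar>)" using sqint_integrable[OF sqint_abs[OF v]] by simp
        show "AE x in \<mu>. Ut s x * v x - \<phi>t s x * (1/2 * (h (\<phi> r x) * v x)) \<le> C * K\<^sup>2 * (t - r) * \<bar>v x\<bar>"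
          using Ue elim(2) h_phi[OF st(4)] phi_increment_bound[OF st(1-3)]
        proof eventually_elim
          case (elim x)
          have "Ut s x * v x - \<phi>t s x * (1/2 * (h (\<phi> r x) * v x))
              = 1/2 * ((h (\<phi> s x) - h (\<phi> r x)) * \<phi>t s x * v x)"
            using elim by (simp add: algebra_simps)
          also have "\<dots> \<le> 1/2 * (\<bar>h (\<phi> s x) - h (\<phi> r x)\<bar> * \<bar>\<phi>t s x\<bar> * \<bar>v x\<bar>)"
            by (simp add: abs_mult[symmetric])
          also have "\<dots> \<le> \<bar>h (\<phi> s x) - h (\<phi> r x)\<bar> * \<bar>\<phi>t s x\<bar> * \<bar>v x\<bar>"
            by (simp add: mult_nonneg_nonneg)
          also have "\<dots> \<le> (C * (K * (t - r))) * K * \<bar>v x\<bar>"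
          proof (intro mult_right_mono mult_mono)
            have "\<bar>h (\<phi> s x) - h (\<phi> r x)\<bar> \<le> C * \<bar>\<phi> s x - \<phi> r x\<bar>" by (rule h_Lip)
            also have "\<dots> \<le> C * (K * (t - r))"
            proof (rule mult_left_mono[OF _ C_nonneg])
              have "K * (s - r) \<le> K * (t - r)" using s K by (intro mult_left_mono) auto
              then show "\<bar>\<phi> s x - \<phi> r x\<bar> \<le> K * (t - r)" using elim by linarith
            qed
            finally show "\<bar>h (\<phi> s x) - h (\<phi> r x)\<bar> \<le> C * (K * (t - r))" .
          qed (use elim K C_nonneg rt in auto)
          finally show ?case by (simp add: power2_eq_square mult_ac)
        qed
      qed
      finally show "(LINT x|\<mu>. Ut s x * v x) - (LINT x|\<mu>. \<phi>t s x * (1/2 * (h (\<phi> r x) * v x))) \<le> Z"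
        by (simp add: Z_def)
    qed
  qed
  also have "\<dots> = (t - r) * Z" by (rule tint_const[OF rt])
  also have "\<dots> \<le> C * K\<^sup>2 * sqrt vol * (t - r)\<^sup>2 * sqrt (LINT x|\<mu>. (v x)\<^sup>2)"
  proof -
    have "(LINT x|\<mu>. \<bar>v x\<bar>) \<le> sqrt vol * sqrt (LINT x|\<mu>. (v x)\<^sup>2)"
    proof -
      have o: "sqint \<mu> (\<lambda>_. 1)" by (simp add: sqint_def)
      have "\<bar>LINT x|\<mu>. 1 * \<bar>v x\<bar>\<bar> \<le> sqrt (LINT x|\<mu>. 1\<^sup>2) * sqrt (LINT x|\<mu>. \<bar>v x\<bar>\<^sup>2)"
        by (rule integral_Cauchy_Schwarz_abs[OF o sqint_abs[OF v]])
      then show ?thesis using measure_box_total by simp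
    qed
    then have "C * K\<^sup>2 * (t - r)\<^sup>2 * (LINT x|\<mu>. \<bar>v x\<bar>) \<le> C * K\<^sup>2 * (t - r)\<^sup>2 * (sqrt vol * sqrt (LINT x|\<mu>. (v x)\<^sup>2))"
      using C_nonneg by (intro mult_left_mono) auto
    then show ?thesis by (simp add: Z_def power2_eq_square mult_ac)
  qed
  finally show "(LINT x|\<mu>. (U t x - U r x - 1/2 * h (\<phi> r x) * (\<phi> t x - \<phi> r x)) * v x)
      \<le> C * K\<^sup>2 * sqrt vol * (t - r)\<^sup>2 * sqrt (LINT x|\<mu>. (v x)\<^sup>2)" .
qed

text \<open>
  The second equation holds at almost every time, but each of its coefficients is continuous in time, so
  it holds at all times.
\<close>

lemma coef_w:
  assumes k: "k \<in> freqs" and t: "t \<in> {0..T}"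
  shows "coef (w t) k = \<epsilon>\<^sup>2 * (k \<bullet> k) * coef (\<phi> t) k + coef (\<lambda>x. h (\<phi> t x) * U t x) k"
proof (rule continuous_AE_eq[OF coef_continuous(2) _ _ t T])
  show "continuous_on {0..T} (\<lambda>t. \<epsilon>\<^sup>2 * (k \<bullet> k) * coef (\<phi> t) k + coef (\<lambda>x. h (\<phi> t x) * U t x) k)"
  proof (intro continuous_intros coef_continuous)
    show "continuous_on {0..T} (\<lambda>t. coef (\<lambda>x. h (\<phi> t x) * U t x) k)"
      unfolding continuous_on_def
    proof
      fix t assume t: "t \<in> {0..T}"
      let ?F = "at t within {0..T}"
      have sq: "sqint \<mu> (\<lambda>x. h (\<phi> s x) * U s x)" if "s \<in> {0..T}" for s
        by (rule sqint_h_phi_mult[OF that sqint_at(3)[OF that]])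
      have le: "(LINT x|\<mu>. (h (\<phi> s x) * U s x - h (\<phi> t x) * U t x)\<^sup>2)
          \<le> 2 * (K\<^sup>2 * (C\<^sup>2 * (LINT x|\<mu>. (\<phi> s x - \<phi> t x)\<^sup>2))) + 2 * (Hsup\<^sup>2 * (LINT x|\<mu>. (U s x - U t x)\<^sup>2))"
        if s: "s \<in> {0..T}" for s
      proof -
        note d = Lipschitz_integral_square[OF h_Lip h_measurable sqint_at(1)[OF s] sqint_at(1)[OF t]]
        have Um: "U s \<in> borel_measurable \<mu>" using sqint_at(3)[OF s] by (simp add: sqint_def)
        have hb: "AE x in \<mu>. \<bar>h (\<phi> t x)\<bar> \<le> Hsup" using h_phi[OF t] by (auto elim: eventually_mono)
        have ud: "sqint \<mu> (\<lambda>x. U s x - U t x)" using sqint_at(3) s t by auto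
        have "(LINT x|\<mu>. (h (\<phi> s x) * U s x - h (\<phi> t x) * U t x)\<^sup>2)
            = (LINT x|\<mu>. (U s x * (h (\<phi> s x) - h (\<phi> t x)) + h (\<phi> t x) * (U s x - U t x))\<^sup>2)"
          by (rule Bochner_Integration.integral_cong) (auto simp: algebra_simps)
        also have "\<dots> \<le> 2 * (LINT x|\<mu>. (U s x * (h (\<phi> s x) - h (\<phi> t x)))\<^sup>2) + 2 * (LINT x|\<mu>. (h (\<phi> t x) * (U s x - U t x))\<^sup>2)"
          by (rule integral_square_add_le[OF sqint_bounded_mult[OF d(1) Um U_bound[OF s]] sqint_h_phi_mult[OF t ud]])
        also have "\<dots> \<le> 2 * (K\<^sup>2 * (C\<^sup>2 * (LINT x|\<mu>. (\<phi> s x - \<phi> t x)\<^sup>2))) + 2 * (Hsup\<^sup>2 * (LINT x|\<mu>. (U s x - U t x)\<^sup>2))"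
          using order_trans[OF integral_square_bounded_mult_le[OF d(1) Um U_bound[OF s]] mult_left_mono[OF d(2), of "K\<^sup>2"]]
            integral_square_bounded_mult_le[OF ud h_phi_measurable[OF t] hb] by simp
        finally show ?thesis .
      qed
      have "((\<lambda>s. 2 * (K\<^sup>2 * (C\<^sup>2 * (LINT x|\<mu>. (\<phi> s x - \<phi> t x)\<^sup>2))) + 2 * (Hsup\<^sup>2 * (LINT x|\<mu>. (U s x - U t x)\<^sup>2)))
          \<longlongrightarrow> 2 * (K\<^sup>2 * (C\<^sup>2 * 0)) + 2 * (Hsup\<^sup>2 * 0)) ?F"
        by (intro tendsto_intros L2_tendsto_at continuity t)
      then have up: "((\<lambda>s. 2 * (K\<^sup>2 * (C\<^sup>2 * (LINT x|\<mu>. (\<phi> s x - \<phi> t x)\<^sup>2))) + 2 * (Hsup\<^sup>2 * (LINT x|\<mu>. (U s x - U t x)\<^sup>2))) \<longlongrightarrow> 0) ?F"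
        by simp
      have "((\<lambda>s. LINT x|\<mu>. (h (\<phi> s x) * U s x - h (\<phi> t x) * U t x)\<^sup>2) \<longlongrightarrow> 0) ?F"
        by (rule real_tendsto_sandwich[OF _ _ tendsto_const up])
          (use le in \<open>auto simp: eventually_at_filter\<close>)
      moreover have "\<forall>\<^sub>F s in ?F. sqint \<mu> (\<lambda>x. h (\<phi> s x) * U s x)"
        using sq by (auto simp: eventually_at_filter)
      ultimately show "((\<lambda>t. coef (\<lambda>x. h (\<phi> t x) * U t x) k) \<longlongrightarrow> coef (\<lambda>x. h (\<phi> t x) * U t x) k) ?F"
        unfolding coef_def using sq[OF t] by (intro L2_tendsto_imp_weak_eventually mode_sqint)
    qed
  qed
  show "AE s in \<tau>. coef (w s) k = \<epsilon>\<^sup>2 * (k \<bullet> k) * coef (\<phi> s) k + coef (\<lambda>x. h (\<phi> s x) * U s x) k"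
    using exact_equations AE_space
  proof eventually_elim
    case (elim s)
    then obtain \<Delta>\<phi> where l: "weak_laplacian a b (\<phi> s) \<Delta>\<phi>"
      and e: "AE x in \<mu>. w s x = - \<epsilon>\<^sup>2 * \<Delta>\<phi> x + Hfun F B (\<phi> s x) * U s x"
      by (auto elim: eventually_mono)
    have s: "s \<in> {0..T}" using elim(2) by auto
    have i: "integrable \<mu> \<Delta>\<phi>" using l by (simp add: weak_laplacian_def)
    have hu: "integrable \<mu> (\<lambda>x. h (\<phi> s x) * U s x)"
      by (rule sqint_integrable[OF sqint_h_phi_mult[OF s sqint_at(3)[OF s]]])
    have "coef (w s) k = coef (\<lambda>x. - \<epsilon>\<^sup>2 * \<Delta>\<phi> x + h (\<phi> s x) * U s x) k"
    proof (rule coef_cong_AE)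
      show "AE x in \<mu>. w s x = - \<epsilon>\<^sup>2 * \<Delta>\<phi> x + h (\<phi> s x) * U s x"
        using e h_phi[OF s] by eventually_elim simp
    qed (use sqint_at(2)[OF s] i hu in \<open>auto simp: sqint_def\<close>)
    also have "\<dots> = - \<epsilon>\<^sup>2 * coef \<Delta>\<phi> k + coef (\<lambda>x. h (\<phi> s x) * U s x) k"
    proof -
      have "integrable \<mu> (\<lambda>x. - \<epsilon>\<^sup>2 * \<Delta>\<phi> x)" using i by simp
      from coef_add[OF this hu] show ?thesis by (simp only: coef_cmult)
    qed
    finally show ?case by (simp add: weak_laplacian_coef[OF l k])
  qed
qed

section \<open>The energy estimate for one step\<close>

text \<open>
  Multiply the first equation by \<open>W\<close> and the second by \<open>a1 - a0\<close> and equate. In the term with \<open>D\<close> the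
  increment is replaced by means of the first equation. Half of the dissipation absorbs the two terms
  with \<open>W\<close>; the truncation error needs the spectral gap for this.
\<close>

lemma mode_energy_inequality:
  fixes a1 a0 W D R Q :: real
  assumes eq1: "a1 - a0 = - dt * M * l * W + R" and eq2: "W = e2 * l * a1 + D + Q"
    and pos: "dt > 0" "M > 0" "e2 \<ge> 0" "l \<ge> 0" "c > 0" and gap: "R = 0 \<or> c \<le> l"
  shows "e2 / 2 * (l * a1\<^sup>2 - l * a0\<^sup>2) + dt * M / 2 * (l * W\<^sup>2) + Q * (a1 - a0)
    \<le> (1 / (M * c) + 1/2) / dt * R\<^sup>2 + dt * M * (l * D\<^sup>2) + dt / 2 * D\<^sup>2"
proof -
  have t1: "e2 / 2 * (l * a1\<^sup>2 - l * a0\<^sup>2) \<le> e2 * l * a1 * (a1 - a0)"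
  proof -
    have "e2 * l * a1 * (a1 - a0) - e2 / 2 * (l * a1\<^sup>2 - l * a0\<^sup>2) = e2 * l / 2 * (a1 - a0)\<^sup>2"
      by (simp add: power2_eq_square field_simps)
    moreover have "0 \<le> e2 * l / 2 * (a1 - a0)\<^sup>2" using pos by simp
    ultimately show ?thesis by linarith
  qed
  have id: "e2 * l * a1 * (a1 - a0) + dt * M * l * W\<^sup>2 + Q * (a1 - a0) = R * W + dt * M * l * (D * W) - D * R"
  proof -
    have "W * (a1 - a0) = (e2 * l * a1 + D + Q) * (a1 - a0)" using eq2 by simp
    moreover have "W * (a1 - a0) = - dt * M * l * W\<^sup>2 + R * W" unfolding eq1 by (simp add: power2_eq_square algebra_simps)
    moreover have "D * (a1 - a0) = - dt * M * l * (D * W) + D * R" unfolding eq1 by (simp add: algebra_simps)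
    ultimately show ?thesis by (simp add: algebra_simps)
  qed
  have t2: "R * W \<le> dt * M / 4 * (l * W\<^sup>2) + 1 / (dt * M * c) * R\<^sup>2"
  proof (cases "R = 0")
    case False
    then have cl: "c \<le> l" using gap by simp
    \<comment> \<open>Young inequality, weighted so that a quarter of the dissipation is used\<close>
    have "0 \<le> (dt * M * c / 2 * W - R)\<^sup>2" by simp
    then have "dt * M * c * (R * W) \<le> dt * M * c * (dt * M / 4 * (c * W\<^sup>2)) + R\<^sup>2"
      by (simp add: power2_eq_square algebra_simps)
    then have "R * W \<le> dt * M / 4 * (c * W\<^sup>2) + 1 / (dt * M * c) * R\<^sup>2"
      using pos by (simp add: field_simps)
    also have "dt * M / 4 * (c * W\<^sup>2) \<le> dt * M / 4 * (l * W\<^sup>2)"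
      using cl pos by (intro mult_left_mono mult_right_mono) auto
    finally show ?thesis by simp
  qed (use pos in simp)
  have t3: "dt * M * l * (D * W) \<le> dt * M / 4 * (l * W\<^sup>2) + dt * M * (l * D\<^sup>2)"
  proof -
    have "0 \<le> (W / 2 - D)\<^sup>2" by simp
    then have "D * W \<le> W\<^sup>2 / 4 + D\<^sup>2" by (simp add: power2_eq_square algebra_simps)
    then have "dt * M * l * (D * W) \<le> dt * M * l * (W\<^sup>2 / 4 + D\<^sup>2)" using pos by (intro mult_left_mono) auto
    then show ?thesis by (simp add: algebra_simps)
  qed
  have t4: "- (D * R) \<le> dt / 2 * D\<^sup>2 + 1 / (2 * dt) * R\<^sup>2"
  proof -
    have "0 \<le> (dt * D + R)\<^sup>2" by simp
    then have "dt * (- (D * R)) \<le> dt * (dt / 2 * D\<^sup>2) + R\<^sup>2 / 2" by (simp add: power2_eq_square algebra_simps)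
    then show ?thesis using pos by (simp add: field_simps)
  qed
  have "(1 / (M * c) + 1/2) / dt * R\<^sup>2 = 1 / (dt * M * c) * R\<^sup>2 + 1 / (2 * dt) * R\<^sup>2"
    using pos by (simp add: field_simps)
  then show ?thesis using t1 t2 t3 t4 id by (simp add: algebra_simps)
qed

text \<open>
  Summation over the modes. The product of \<open>hf * Y\<close> with the increment keeps its sign; it cancels
  against the third equation.
\<close>

lemma energy_step:
  assumes sq: "sqint \<mu> E1" "sqint \<mu> E0" "sqint \<mu> D" "sqint \<mu> P"
    and eq1: "\<And>k. k \<in> freqs \<Longrightarrow> coef E1 k - coef E0 k = - dt * M * (k \<bullet> k) * coef W k + R k"
    and eq2: "\<And>k. k \<in> freqs \<Longrightarrow> coef W k = e2 * (k \<bullet> k) * coef E1 k + coef D k + coef P k"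
    and R: "R 0 = 0" "\<And>j. (\<Sum>k\<in>blk j. (R k)\<^sup>2) \<le> r"
    and lim: "gsum E1 \<longlonglongrightarrow> e1" "gsum E0 \<longlonglongrightarrow> e0" "gsum W \<longlonglongrightarrow> om" and d: "\<And>j. gsum D j \<le> d"
    and pos: "dt > 0" "M > 0" "e2 \<ge> 0" "c > 0" and gap: "\<And>k. k \<in> freqs \<Longrightarrow> k \<noteq> 0 \<Longrightarrow> c \<le> k \<bullet> k"
  shows "e2 / 2 * (e1 - e0) + dt * M / 2 * om + (LINT x|\<mu>. P x * (E1 x - E0 x))
    \<le> (1 / (M * c) + 1/2) / dt * r + dt * M * d + dt / 2 * (LINT x|\<mu>. (D x)\<^sup>2)"
proof (rule LIMSEQ_le_const2)
  let ?cd = "\<lambda>k. coef (\<lambda>x. E1 x - E0 x) k"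
  have cd: "?cd k = coef E1 k - coef E0 k" for k
    using sq by (simp add: coef_diff sqint_integrable)
  show "(\<lambda>j. e2 / 2 * (gsum E1 j - gsum E0 j) + dt * M / 2 * gsum W j + (\<Sum>k\<in>blk j. coef P k * ?cd k))
      \<longlonglongrightarrow> e2 / 2 * (e1 - e0) + dt * M / 2 * om + (LINT x|\<mu>. P x * (E1 x - E0 x))"
    by (intro tendsto_intros lim Parseval sq sqint_diff)
  have "e2 / 2 * (gsum E1 j - gsum E0 j) + dt * M / 2 * gsum W j + (\<Sum>k\<in>blk j. coef P k * ?cd k)
      \<le> (1 / (M * c) + 1/2) / dt * r + dt * M * d + dt / 2 * (LINT x|\<mu>. (D x)\<^sup>2)" for j
  proof -
    have "e2 / 2 * (gsum E1 j - gsum E0 j) + dt * M / 2 * gsum W j + (\<Sum>k\<in>blk j. coef P k * ?cd k)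
        = (\<Sum>k\<in>blk j. e2 / 2 * ((k \<bullet> k) * (coef E1 k)\<^sup>2 - (k \<bullet> k) * (coef E0 k)\<^sup>2)
            + dt * M / 2 * ((k \<bullet> k) * (coef W k)\<^sup>2) + coef P k * (coef E1 k - coef E0 k))"
      by (simp only: gsum_def cd sum_subtractf[symmetric] sum_distrib_left sum.distrib[symmetric])
    also have "\<dots> \<le> (\<Sum>k\<in>blk j. (1 / (M * c) + 1/2) / dt * (R k)\<^sup>2 + dt * M * ((k \<bullet> k) * (coef D k)\<^sup>2) + dt / 2 * (coef D k)\<^sup>2)"
    proof (rule sum_mono)
      fix k assume "k \<in> blk j"
      then have k: "k \<in> freqs" by (rule blk_in_freqs)
      have "R k = 0 \<or> c \<le> k \<bullet> k" using R(1) gap[OF k] by (cases "k = 0") auto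
      then show "e2 / 2 * ((k \<bullet> k) * (coef E1 k)\<^sup>2 - (k \<bullet> k) * (coef E0 k)\<^sup>2)
            + dt * M / 2 * ((k \<bullet> k) * (coef W k)\<^sup>2) + coef P k * (coef E1 k - coef E0 k)
          \<le> (1 / (M * c) + 1/2) / dt * (R k)\<^sup>2 + dt * M * ((k \<bullet> k) * (coef D k)\<^sup>2) + dt / 2 * (coef D k)\<^sup>2"
        by (intro mode_energy_inequality eq1[OF k] eq2[OF k] pos) auto
    qed
    also have "\<dots> = (1 / (M * c) + 1/2) / dt * (\<Sum>k\<in>blk j. (R k)\<^sup>2) + dt * M * gsum D j + dt / 2 * (\<Sum>k\<in>blk j. (coef D k)\<^sup>2)"
      by (simp add: gsum_def sum.distrib sum_distrib_left)
    also have "\<dots> \<le> (1 / (M * c) + 1/2) / dt * r + dt * M * d + dt / 2 * (LINT x|\<mu>. (D x)\<^sup>2)"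
      using pos by (intro add_mono mult_left_mono R d Bessel sq finite_blk blk_subset) auto
    finally show ?thesis .
  qed
  then show "\<exists>N. \<forall>j\<ge>N. e2 / 2 * (gsum E1 j - gsum E0 j) + dt * M / 2 * gsum W j + (\<Sum>k\<in>blk j. coef P k * ?cd k)
      \<le> (1 / (M * c) + 1/2) / dt * r + dt * M * d + dt / 2 * (LINT x|\<mu>. (D x)\<^sup>2)" by blast
qed

text \<open>
  Poincare inequality with a separate bound \<open>z\<close> for the mean.
\<close>

lemma integral_square_le_gradient:
  assumes u: "sqint \<mu> u" and lim: "gsum u \<longlonglongrightarrow> e" and z: "(coef u 0)\<^sup>2 \<le> z"
    and c: "c > 0" "\<And>k. k \<in> freqs \<Longrightarrow> k \<noteq> 0 \<Longrightarrow> c \<le> k \<bullet> k"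
  shows "(LINT x|\<mu>. (u x)\<^sup>2) \<le> e / c + z"
proof (rule LIMSEQ_le[OF Parseval_square[OF u]])
  show "(\<lambda>j. gsum u j / c + z) \<longlonglongrightarrow> e / c + z"
    using c by (intro tendsto_intros lim) auto
  have z0: "0 \<in> blk j" for j by (simp add: blk_def)
  have "(\<Sum>k\<in>blk j. (coef u k)\<^sup>2) \<le> gsum u j / c + z" for j
  proof -
    have "(\<Sum>k\<in>blk j. (coef u k)\<^sup>2) = (\<Sum>k\<in>blk j - {0}. (coef u k)\<^sup>2) + (coef u 0)\<^sup>2"
      using sum.remove[OF finite_blk z0, of "\<lambda>k. (coef u k)\<^sup>2"] by simp
    also have "(\<Sum>k\<in>blk j - {0}. (coef u k)\<^sup>2) \<le> (\<Sum>k\<in>blk j - {0}. (k \<bullet> k) * (coef u k)\<^sup>2 / c)"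
    proof (rule sum_mono)
      fix k assume "k \<in> blk j - {0}"
      then have "c * (coef u k)\<^sup>2 \<le> (k \<bullet> k) * (coef u k)\<^sup>2"
        using c(2)[of k] blk_in_freqs by (intro mult_right_mono) auto
      then show "(coef u k)\<^sup>2 \<le> (k \<bullet> k) * (coef u k)\<^sup>2 / c" using c(1) by (simp add: field_simps)
    qed
    also have "\<dots> \<le> (\<Sum>k\<in>blk j. (k \<bullet> k) * (coef u k)\<^sup>2 / c)"
      using c(1) by (intro sum_mono2) auto
    also have "\<dots> = gsum u j / c" by (simp add: gsum_def sum_divide_distrib)
    finally show ?thesis using z by simp
  qed
  then show "\<exists>N. \<forall>j\<ge>N. (\<Sum>k\<in>blk j. (coef u k)\<^sup>2) \<le> gsum u j / c + z" by blast
qed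

lemma gsum_add_le:
  assumes "sqint \<mu> u" "sqint \<mu> v"
  shows "gsum (\<lambda>x. u x + v x) j \<le> 2 * gsum u j + 2 * gsum v j"
proof -
  have "gsum (\<lambda>x. u x + v x) j \<le> (\<Sum>k\<in>blk j. (k \<bullet> k) * (2 * (coef u k)\<^sup>2 + 2 * (coef v k)\<^sup>2))"
    unfolding gsum_def using assms
    by (intro sum_mono mult_left_mono) (auto simp: coef_add sqint_integrable power2_sum_le)
  then show ?thesis by (simp add: gsum_def sum.distrib sum_distrib_left algebra_simps)
qed

lemma gsum_uminus: "gsum (\<lambda>x. - u x) j = gsum u j"
  using coef_cmult[of "-1" u] by (simp add: gsum_def)

lemma gsum_diff_le:
  assumes "sqint \<mu> u" "sqint \<mu> v"
  shows "gsum (\<lambda>x. u x - v x) j \<le> 2 * gsum u j + 2 * gsum v j"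
  using gsum_add_le[OF assms(1) sqint_uminus[OF assms(2)]] by (simp add: gsum_uminus)

end

section \<open>Discrete Gronwall inequality\<close>

text \<open>
  The term at the new time on the right is absorbed on the left, which costs a bound on \<open>y\<close>.
\<close>

lemma discrete_Gronwall:
  fixes x v p :: "nat \<Rightarrow> real"
  assumes step: "\<And>k. k < n \<Longrightarrow> x (Suc k) + v k \<le> x k + y * (x k + x (Suc k)) + p k"
    and nn: "\<And>k. k \<le> n \<Longrightarrow> 0 \<le> x k" "\<And>k. k < n \<Longrightarrow> 0 \<le> v k" "\<And>k. k < n \<Longrightarrow> 0 \<le> p k" and y: "0 \<le> y" "y \<le> 1/2"
  shows "x n + (\<Sum>k<n. v k) \<le> exp (4 * y * real n) * (x 0 + 2 * (\<Sum>k<n. p k))"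
  using step nn(1-3)
proof (induction n)
  case (Suc n)
  define s where "s = x n + (\<Sum>k<n. v k)"
  define s' where "s' = x (Suc n) + (\<Sum>k<Suc n. v k)"
  define q where "q = x 0 + 2 * (\<Sum>k<n. p k)"
  have IH: "s \<le> exp (4 * y * real n) * q" unfolding s_def q_def by (rule Suc.IH) (use Suc.prems in auto)
  have V: "0 \<le> (\<Sum>k<n. v k)" using Suc.prems by (intro sum_nonneg) auto
  have s0: "0 \<le> s" using V Suc.prems(2)[of n] by (simp add: s_def)
  have pn: "0 \<le> p n" using Suc.prems by simp
  have "s' \<le> s + y * (x n + x (Suc n)) + p n"
    using Suc.prems(1)[of n] by (simp add: s'_def s_def)
  also have "x n + x (Suc n) \<le> s + s'" using V Suc.prems(3)[of n] by (simp add: s_def s'_def)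
  then have "y * (x n + x (Suc n)) \<le> y * (s + s')" using y by (intro mult_left_mono) auto
  finally have le: "(1 - y) * s' \<le> (1 + y) * s + p n" by (simp add: algebra_simps)
  \<comment> \<open>the factor 4 is what the quotient \<open>(1 + y) / (1 - y)\<close> costs for \<open>y \<le> 1/2\<close>\<close>
  have f: "(1 + y) \<le> (1 - y) * (1 + 4 * y)"
  proof -
    have "y * y \<le> y * (1/2)" using y by (intro mult_left_mono) auto
    then show ?thesis by (simp add: algebra_simps)
  qed
  have "(1 - y) * s' \<le> (1 - y) * ((1 + 4 * y) * s + 2 * p n)"
  proof -
    have "(1 + y) * s \<le> (1 - y) * (1 + 4 * y) * s" by (rule mult_right_mono[OF f s0])
    moreover have "p n \<le> (1 - y) * (2 * p n)" using mult_right_mono[of "1/2" "1 - y" "2 * p n"] y pn by simp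
    ultimately show ?thesis using le by (simp add: algebra_simps)
  qed
  then have "s' \<le> (1 + 4 * y) * s + 2 * p n" using y by (simp add: mult_le_cancel_left)
  also have "(1 + 4 * y) * s \<le> exp (4 * y) * s" by (intro mult_right_mono s0 exp_ge_add_one_self)
  also have "exp (4 * y) * s \<le> exp (4 * y) * (exp (4 * y * real n) * q)" by (intro mult_left_mono IH) simp
  also have "\<dots> = exp (4 * y * real (Suc n)) * q" by (simp add: exp_add[symmetric] algebra_simps)
  also have "2 * p n \<le> exp (4 * y * real (Suc n)) * (2 * p n)"
    using pn y mult_right_mono[of 1 "exp (4 * y * real (Suc n))" "2 * p n"] by simp
  finally show ?case unfolding s'_def[symmetric] q_def by (simp add: algebra_simps)
qed simp

section \<open>Error estimate\<close>

locale sav_constants = sav_bounded a b M \<epsilon> B T F \<phi>0 \<phi> w U \<phi>t \<phi>tt Ut K C L h h'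
  for a b :: "'a::euclidean_space" and M \<epsilon> B T F \<phi>0 \<phi> w U \<phi>t \<phi>tt Ut K C L h h' +
  fixes gap emb :: real
  assumes gap: "gap > 0" "\<And>k. k \<in> freqs \<Longrightarrow> k \<noteq> 0 \<Longrightarrow> gap \<le> k \<bullet> k"
    and emb: "emb > 0" "\<And>u Q. sqint (lebesgue_on (box a b)) u \<Longrightarrow>
      (\<And>j. (\<Sum>k\<in>blk j. ((1 + k \<bullet> k) * coef u k)\<^sup>2) \<le> Q) \<Longrightarrow> AE x in lebesgue_on (box a b). \<bar>u x\<bar> \<le> emb * sqrt Q"
begin

text \<open>
  The constants of the error estimate, in the order in which they arise: \<open>c1\<close>, \<open>c2\<close> from the gradient
  of \<open>D\<close>, \<open>c3\<close> from the truncation error, \<open>cE\<close> collects the factors of \<open>|grad E|\<^sup>2\<close>, \<open>cA\<close> and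
  \<open>cB\<close> are the Gronwall rate and the factor of the source, \<open>cS\<close> bounds the energy, \<open>cG\<close> the error
  in the nonlinear term of the second equation, \<open>cQ\<close> the squared \<open>H\<^sup>2\<close> norm of \<open>E\<close>. They are defined
  before the step size and the discrete solution are fixed and so cannot depend on them.
\<close>

definition c1 :: real where "c1 = 2 * (K\<^sup>2 * L + C * K)\<^sup>2 * DIM('a)"
definition c2 :: real where "c2 = 2 * (K * C)\<^sup>2"
definition c3 :: real where "c3 = 1 / (M * gap) + 1/2"
definition cE :: real where "cE = 2 * M * c1 / gap + 2 * M * c2 + K\<^sup>2 * C\<^sup>2 / gap + (C * K)\<^sup>2 / gap"
definition cA :: real where "cA = 1 + 2 / \<epsilon>\<^sup>2 * cE"
definition cB :: real where "cB = c3 + 2 * M * c2 + (2 * M * c1 * K\<^sup>2 * vol + K ^ 4 * C\<^sup>2 * vol + 2 * C\<^sup>2 * K ^ 4 * vol)"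
definition total :: real where "total = (LINT s|\<tau>. gamma s) + (LINT s|\<tau>. beta s) + T"
definition cS :: real where "cS = exp (4 * cA * T) * (2 * cB * total)"
definition cG :: real where "cG = 2 * (K\<^sup>2 * C\<^sup>2) * (2 * K\<^sup>2 * vol + 2 * (2 / (gap * \<epsilon>\<^sup>2) * cS)) + 2 * Hsup\<^sup>2 * cS"
definition cQ :: real where "cQ = 2 * (2 / (gap * \<epsilon>\<^sup>2) * cS) + 4 / \<epsilon> ^ 4 * (2 / (M * gap) * cS + 2 * cG)"

lemma constants_nonneg: "0 \<le> c1" "0 \<le> c2" "0 < c3" "0 \<le> cE" "1 \<le> cA" "0 \<le> cB" "0 \<le> total" "0 \<le> cS" "0 \<le> cG" "0 \<le> cQ"
proof -
  show 1: "0 \<le> c1" and 2: "0 \<le> c2" by (simp_all add: c1_def c2_def)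
  show 3: "0 < c3" using M gap by (simp add: c3_def add_pos_pos)
  show E: "0 \<le> cE" using 1 2 M gap by (simp add: cE_def)
  then show "1 \<le> cA" by (simp add: cA_def)
  show B: "0 \<le> cB" using 1 2 3 M vol_pos by (simp add: cB_def less_imp_le)
  show t: "0 \<le> total" using T beta_gamma by (simp add: total_def Bochner_Integration.integral_nonneg)
  show S: "0 \<le> cS" using B t by (simp add: cS_def)
  show G: "0 \<le> cG" using S vol_pos gap by (simp add: cG_def)
  show "0 \<le> cQ" using S G M gap by (simp add: cQ_def)
qed

end

locale sav_scheme = sav_constants a b M \<epsilon> B T F \<phi>0 \<phi> w U \<phi>t \<phi>tt Ut K C L h h' gap emb
  for a b :: "'a::euclidean_space" and M \<epsilon> B T F \<phi>0 \<phi> w U \<phi>t \<phi>tt Ut K C L h h' gap emb +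
  fixes dt :: real and N :: nat and \<phi>s ws Us :: "nat \<Rightarrow> 'a \<Rightarrow> real"
  assumes dt: "dt > 0" "T = real N * dt"
    and scheme: "scheme_solution a b M \<epsilon> B F \<phi>0 dt N \<phi>s ws Us"
begin

definition E :: "nat \<Rightarrow> 'a \<Rightarrow> real" where "E n x = \<phi> (real n * dt) x - \<phi>s n x"
definition W :: "nat \<Rightarrow> 'a \<Rightarrow> real" where "W n x = w (real n * dt) x - ws n x"
definition Y :: "nat \<Rightarrow> 'a \<Rightarrow> real" where "Y n x = U (real n * dt) x - Us n x"

lemma time_in: "n \<le> N \<Longrightarrow> real n * dt \<in> {0..T}"
  using dt by (auto intro!: mult_right_mono)

lemma time_step: "n < N \<Longrightarrow> 0 \<le> real n * dt \<and> real n * dt \<le> real (Suc n) * dt \<and> real (Suc n) * dt \<le> T"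
  using time_in[of n] time_in[of "Suc n"] dt by auto

lemma step_length: "real (Suc n) * dt - real n * dt = dt"
  by (simp add: algebra_simps)

lemma phis_Hk: "n \<le> N \<Longrightarrow> \<phi>s n \<in> fst (Hk a b 2)"
  and Us_sqint: "n \<le> N \<Longrightarrow> sqint \<mu> (Us n)"
  and ws_Hk: "1 \<le> n \<Longrightarrow> n \<le> N \<Longrightarrow> ws n \<in> fst (Hk a b 2)"
  using scheme by (auto simp: scheme_solution_def L2_iff)

lemma phis_sqint: "n \<le> N \<Longrightarrow> sqint \<mu> (\<phi>s n)"
  by (rule Hk_wgrad(1)[OF phis_Hk]) auto

lemma ws_sqint: "1 \<le> n \<Longrightarrow> n \<le> N \<Longrightarrow> sqint \<mu> (ws n)"
  by (rule Hk_wgrad(1)[OF ws_Hk]) auto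

lemma E_sqint: "n \<le> N \<Longrightarrow> sqint \<mu> (E n)"
  unfolding E_def using sqint_at(1)[OF time_in] phis_sqint by auto

lemma Y_sqint: "n \<le> N \<Longrightarrow> sqint \<mu> (Y n)"
  unfolding Y_def using sqint_at(3)[OF time_in] Us_sqint by auto

lemma W_sqint: "1 \<le> n \<Longrightarrow> n \<le> N \<Longrightarrow> sqint \<mu> (W n)"
  unfolding W_def using sqint_at(2)[OF time_in] ws_sqint by auto

lemma E_gsum:
  assumes n: "n \<le> N"
  shows "gsum (E n) \<longlonglongrightarrow> (grad_norm2 a b (E n))\<^sup>2" "gsum (E n) j \<le> (grad_norm2 a b (E n))\<^sup>2"
proof -
  obtain Q where Q: "\<And>j. gsum (\<phi>s n) j \<le> Q"
    using gsum_bounded[OF phis_sqint[OF n] Hk_wgrad(2)[OF phis_Hk[OF n]]] by auto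
  have "gsum (E n) j \<le> 2 * (DIM('a) * (K\<^sup>2 * vol)) + 2 * Q" for j
    using gsum_diff_le[OF sqint_at(1)[OF time_in[OF n]] phis_sqint[OF n], of j]
      phi_gsum[OF time_in[OF n], of j] Q[of j] unfolding E_def by linarith
  note bd = this
  show "gsum (E n) \<longlonglongrightarrow> (grad_norm2 a b (E n))\<^sup>2" by (rule gsum_tendsto_grad_norm2[OF E_sqint[OF n] bd])
  show "gsum (E n) j \<le> (grad_norm2 a b (E n))\<^sup>2" by (rule gsum_le_grad_norm2[OF E_sqint[OF n] bd])
qed

lemma W_gsum:
  assumes n: "1 \<le> n" "n \<le> N"
  shows "gsum (W n) \<longlonglongrightarrow> (grad_norm2 a b (W n))\<^sup>2"
proof -
  obtain Q where Q: "\<And>j. gsum (ws n) j \<le> Q"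
    using gsum_bounded[OF ws_sqint[OF n] Hk_wgrad(2)[OF ws_Hk[OF n]]] by auto
  have "gsum (W n) j \<le> 2 * K + 2 * Q" for j
    using gsum_diff_le[OF sqint_at(2)[OF time_in[OF n(2)]] ws_sqint[OF n], of j]
      w_gsum_at[OF time_in[OF n(2)], of j] Q[of j] unfolding W_def by linarith
  then show ?thesis by (rule gsum_tendsto_grad_norm2[OF W_sqint[OF n]])
qed

lemma initial_error: "AE x in \<mu>. E 0 x = 0 \<and> Y 0 x = 0"
proof -
  have "AE x in \<mu>. \<phi> 0 x = \<phi>0 x \<and> U 0 x = sqrt (F (\<phi>0 x) + B)" using exact unfolding exact_solution_def by blast
  moreover have "AE x in \<mu>. \<phi>s 0 x = \<phi>0 x \<and> Us 0 x = sqrt (F (\<phi>0 x) + B)" using scheme unfolding scheme_solution_def by blast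
  ultimately show ?thesis by eventually_elim (simp add: E_def Y_def)
qed

lemma initial_error_zero:
  "coef (E 0) k = 0" "(grad_norm2 a b (E 0))\<^sup>2 = 0" "(LINT x|\<mu>. (Y 0 x)\<^sup>2) = 0"
proof -
  show c: "coef (E 0) k = 0" for k
  proof -
    have "coef (E 0) k = coef (\<lambda>x. 0) k"
      by (rule coef_cong_AE) (use E_sqint[of 0] initial_error in \<open>auto simp: sqint_def elim: eventually_mono\<close>)
    then show ?thesis by (simp add: coef_def)
  qed
  then have "gsum (E 0) = (\<lambda>j. 0)" by (simp add: gsum_def fun_eq_iff)
  then show "(grad_norm2 a b (E 0))\<^sup>2 = 0" using E_gsum(1)[of 0] by (simp add: LIMSEQ_const_iff)
  have "(LINT x|\<mu>. (Y 0 x)\<^sup>2) = (LINT x|\<mu>. 0)"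
    by (rule integral_cong_AE) (use Y_sqint[of 0] initial_error in \<open>auto simp: sqint_def elim: eventually_mono\<close>)
  then show "(LINT x|\<mu>. (Y 0 x)\<^sup>2) = 0" by simp
qed

lemma scheme_equations:
  assumes n: "n < N"
  obtains \<Delta>w \<Delta>\<phi> where "weak_laplacian a b (ws (Suc n)) \<Delta>w" "weak_laplacian a b (\<phi>s (Suc n)) \<Delta>\<phi>"
    "AE x in \<mu>. (\<phi>s (Suc n) x - \<phi>s n x) / dt - M * \<Delta>w x = 0 \<and>
       ws (Suc n) x = - \<epsilon>\<^sup>2 * \<Delta>\<phi> x + Hfun F B (\<phi>s n x) * Us (Suc n) x \<and>
       Us (Suc n) x - Us n x = 1/2 * Hfun F B (\<phi>s n x) * (\<phi>s (Suc n) x - \<phi>s n x)"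
proof -
  have "\<exists>\<Delta>w \<Delta>\<phi>. weak_laplacian a b (ws (Suc n)) \<Delta>w \<and> weak_laplacian a b (\<phi>s (Suc n)) \<Delta>\<phi> \<and>
    (AE x in \<mu>. (\<phi>s (Suc n) x - \<phi>s n x) / dt - M * \<Delta>w x = 0 \<and>
       ws (Suc n) x = - \<epsilon>\<^sup>2 * \<Delta>\<phi> x + Hfun F B (\<phi>s n x) * Us (Suc n) x \<and>
       Us (Suc n) x - Us n x = 1/2 * Hfun F B (\<phi>s n x) * (\<phi>s (Suc n) x - \<phi>s n x))"
    using scheme n unfolding scheme_solution_def Suc_eq_plus1 by blast
  then show ?thesis using that by blast
qed

lemma E_equation:
  assumes n: "n < N" and k: "k \<in> freqs"
  shows "coef (E (Suc n)) k - coef (E n) k = - dt * M * (k \<bullet> k) * coef (W (Suc n)) k + trunc (real n * dt) (real (Suc n) * dt) k"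
proof -
  have nN: "n \<le> N" "Suc n \<le> N" "1 \<le> Suc n" using n by auto
  obtain \<Delta>w where l: "weak_laplacian a b (ws (Suc n)) \<Delta>w"
    and e: "AE x in \<mu>. (\<phi>s (Suc n) x - \<phi>s n x) / dt - M * \<Delta>w x = 0"
    using scheme_equations[OF n] by (auto elim: eventually_mono)
  have i: "integrable \<mu> \<Delta>w" using l by (simp add: weak_laplacian_def)
  have "coef (\<lambda>x. \<phi>s (Suc n) x - \<phi>s n x) k = coef (\<lambda>x. (dt * M) * \<Delta>w x) k"
  proof (rule coef_cong_AE)
    show "AE x in \<mu>. \<phi>s (Suc n) x - \<phi>s n x = dt * M * \<Delta>w x"
      using e by eventually_elim (use dt in \<open>simp add: field_simps\<close>)
  qed (use sqint_diff[OF phis_sqint[OF nN(2)] phis_sqint[OF nN(1)]] i in \<open>auto simp: sqint_def\<close>)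
  then have s: "coef (\<phi>s (Suc n)) k - coef (\<phi>s n) k = - dt * M * (k \<bullet> k) * coef (ws (Suc n)) k"
    using phis_sqint nN by (simp add: coef_diff sqint_integrable coef_cmult weak_laplacian_coef[OF l k])
  have E: "coef (E m) k = coef (\<phi> (real m * dt)) k - coef (\<phi>s m) k" if "m \<le> N" for m
    unfolding E_def using sqint_at(1)[OF time_in[OF that]] phis_sqint[OF that] by (intro coef_diff sqint_integrable)
  have W: "coef (W (Suc n)) k = coef (w (real (Suc n) * dt)) k - coef (ws (Suc n)) k"
    unfolding W_def using sqint_at(2)[OF time_in[OF nN(2)]] ws_sqint[OF nN(3,2)] by (intro coef_diff sqint_integrable)
  show ?thesis
    using s unfolding E[OF nN(1)] E[OF nN(2)] W trunc_def rate_def step_length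
    by (simp add: algebra_simps)
qed

text \<open>
  The error in the nonlinear term of the second equation is \<open>D + P\<close>: in \<open>D\<close> the argument of \<open>H\<close>
  changes, in \<open>P\<close> the auxiliary variable.
\<close>

definition D :: "nat \<Rightarrow> 'a \<Rightarrow> real" where
  "D n x = (h (\<phi> (real (Suc n) * dt) x) - h (\<phi>s n x)) * U (real (Suc n) * dt) x"
definition P :: "nat \<Rightarrow> 'a \<Rightarrow> real" where "P n x = h (\<phi>s n x) * Y (Suc n) x"

abbreviation bounded_at :: "nat \<Rightarrow> bool" where "bounded_at n \<equiv> AE x in \<mu>. \<bar>\<phi>s n x\<bar> \<le> K + 1"

lemma h_phis:
  assumes n: "n \<le> N" and b: "bounded_at n"
  shows "(\<lambda>x. h (\<phi>s n x)) \<in> borel_measurable \<mu>" "AE x in \<mu>. \<bar>h (\<phi>s n x)\<bar> \<le> Hsup"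
    "AE x in \<mu>. h (\<phi>s n x) = Hfun F B (\<phi>s n x)"
proof -
  show "(\<lambda>x. h (\<phi>s n x)) \<in> borel_measurable \<mu>" by (rule h_comp_measurable[OF sqintD(1)[OF phis_sqint[OF n]]])
  show "AE x in \<mu>. \<bar>h (\<phi>s n x)\<bar> \<le> Hsup" using b by eventually_elim (rule h_bound)
  show "AE x in \<mu>. h (\<phi>s n x) = Hfun F B (\<phi>s n x)" using b by eventually_elim (rule h_eq)
qed

lemma D_bound:
  assumes n: "n < N"
  shows "sqint \<mu> (D n)" "(LINT x|\<mu>. (D n x)\<^sup>2) \<le> K\<^sup>2 * C\<^sup>2 * (LINT x|\<mu>. (\<phi> (real (Suc n) * dt) x - \<phi>s n x)\<^sup>2)"
proof -
  have nN: "n \<le> N" "Suc n \<le> N" using n by auto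
  note t1 = time_in[OF nN(2)]
  note d = Lipschitz_integral_square[OF h_Lip h_measurable sqint_at(1)[OF t1] phis_sqint[OF nN(1)]]
  have D: "D n = (\<lambda>x. U (real (Suc n) * dt) x * (h (\<phi> (real (Suc n) * dt) x) - h (\<phi>s n x)))"
    by (auto simp: D_def mult.commute)
  have Um: "U (real (Suc n) * dt) \<in> borel_measurable \<mu>" by (rule sqintD(1)[OF sqint_at(3)[OF t1]])
  show "sqint \<mu> (D n)" unfolding D by (rule sqint_bounded_mult[OF d(1) Um U_bound[OF t1]])
  have "(LINT x|\<mu>. (D n x)\<^sup>2) \<le> K\<^sup>2 * (LINT x|\<mu>. (h (\<phi> (real (Suc n) * dt) x) - h (\<phi>s n x))\<^sup>2)"
    unfolding D by (rule integral_square_bounded_mult_le[OF d(1) Um U_bound[OF t1]])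
  also have "\<dots> \<le> K\<^sup>2 * (C\<^sup>2 * (LINT x|\<mu>. (\<phi> (real (Suc n) * dt) x - \<phi>s n x)\<^sup>2))"
    by (rule mult_left_mono[OF d(2)]) simp
  finally show "(LINT x|\<mu>. (D n x)\<^sup>2) \<le> K\<^sup>2 * C\<^sup>2 * (LINT x|\<mu>. (\<phi> (real (Suc n) * dt) x - \<phi>s n x)\<^sup>2)"
    by (simp add: mult.assoc)
qed

lemma P_bound:
  assumes n: "n < N" and b: "bounded_at n"
  shows "sqint \<mu> (P n)" "(LINT x|\<mu>. (P n x)\<^sup>2) \<le> Hsup\<^sup>2 * (LINT x|\<mu>. (Y (Suc n) x)\<^sup>2)"
proof -
  have nN: "n \<le> N" "Suc n \<le> N" using n by auto
  note hb = h_phis[OF nN(1) b]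
  show "sqint \<mu> (P n)" unfolding P_def by (rule sqint_bounded_mult[OF Y_sqint[OF nN(2)] hb(1,2)])
  show "(LINT x|\<mu>. (P n x)\<^sup>2) \<le> Hsup\<^sup>2 * (LINT x|\<mu>. (Y (Suc n) x)\<^sup>2)"
    unfolding P_def by (rule integral_square_bounded_mult_le[OF Y_sqint[OF nN(2)] hb(1,2)])
qed

lemma W_equation:
  assumes n: "n < N" and b: "bounded_at n" and k: "k \<in> freqs"
  shows "coef (W (Suc n)) k = \<epsilon>\<^sup>2 * (k \<bullet> k) * coef (E (Suc n)) k + coef (D n) k + coef (P n) k"
proof -
  have nN: "n \<le> N" "Suc n \<le> N" "1 \<le> Suc n" using n by auto
  note t1 = time_in[OF nN(2)]
  let ?t = "real (Suc n) * dt"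
  note hb = h_phis[OF nN(1) b]
  obtain \<Delta>\<phi> where l: "weak_laplacian a b (\<phi>s (Suc n)) \<Delta>\<phi>"
    and e: "AE x in \<mu>. ws (Suc n) x = - \<epsilon>\<^sup>2 * \<Delta>\<phi> x + Hfun F B (\<phi>s n x) * Us (Suc n) x"
    using scheme_equations[OF n] by (auto elim: eventually_mono)
  have i: "integrable \<mu> \<Delta>\<phi>" using l by (simp add: weak_laplacian_def)
  have hU: "sqint \<mu> (\<lambda>x. h (\<phi>s n x) * Us (Suc n) x)" by (rule sqint_bounded_mult[OF Us_sqint[OF nN(2)] hb(1,2)])
  have "coef (ws (Suc n)) k = coef (\<lambda>x. - \<epsilon>\<^sup>2 * \<Delta>\<phi> x + h (\<phi>s n x) * Us (Suc n) x) k"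
  proof (rule coef_cong_AE)
    show "AE x in \<mu>. ws (Suc n) x = - \<epsilon>\<^sup>2 * \<Delta>\<phi> x + h (\<phi>s n x) * Us (Suc n) x"
      using e hb(3) by eventually_elim simp
  qed (use ws_sqint[OF nN(3,2)] i hU in \<open>auto simp: sqint_def\<close>)
  also have "\<dots> = - \<epsilon>\<^sup>2 * coef \<Delta>\<phi> k + coef (\<lambda>x. h (\<phi>s n x) * Us (Suc n) x) k"
  proof -
    have "integrable \<mu> (\<lambda>x. - \<epsilon>\<^sup>2 * \<Delta>\<phi> x)" using i by simp
    from coef_add[OF this sqint_integrable[OF hU]] show ?thesis by (simp only: coef_cmult)
  qed
  finally have s: "coef (ws (Suc n)) k = \<epsilon>\<^sup>2 * (k \<bullet> k) * coef (\<phi>s (Suc n)) k + coef (\<lambda>x. h (\<phi>s n x) * Us (Suc n) x) k"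
    by (simp add: weak_laplacian_coef[OF l k])
  have hu: "sqint \<mu> (\<lambda>x. h (\<phi> ?t x) * U ?t x)" by (rule sqint_h_phi_mult[OF t1 sqint_at(3)[OF t1]])
  have "(\<lambda>x. h (\<phi> ?t x) * U ?t x - h (\<phi>s n x) * Us (Suc n) x) = (\<lambda>x. D n x + P n x)"
    by (simp add: D_def P_def Y_def fun_eq_iff algebra_simps)
  then have "coef (\<lambda>x. h (\<phi> ?t x) * U ?t x) k - coef (\<lambda>x. h (\<phi>s n x) * Us (Suc n) x) k = coef (D n) k + coef (P n) k"
    using coef_diff[OF sqint_integrable[OF hu] sqint_integrable[OF hU]]
      coef_add[OF sqint_integrable[OF D_bound(1)[OF n]] sqint_integrable[OF P_bound(1)[OF n b]]] by simp
  moreover have Ee: "coef (E (Suc n)) k = coef (\<phi> ?t) k - coef (\<phi>s (Suc n)) k"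
    unfolding E_def using sqint_at(1)[OF t1] phis_sqint[OF nN(2)] by (intro coef_diff sqint_integrable)
  moreover have "coef (W (Suc n)) k = coef (w ?t) k - coef (ws (Suc n)) k"
    unfolding W_def using sqint_at(2)[OF t1] ws_sqint[OF nN(3,2)] by (intro coef_diff sqint_integrable)
  ultimately show ?thesis
    using s coef_w[OF k t1] unfolding Ee right_diff_distrib by linarith
qed

text \<open>The mean of the error in \<open>\<phi>\<close> vanishes, so it is controlled by its gradient.\<close>

lemma E_mean: "n \<le> N \<Longrightarrow> coef (E n) 0 = 0"
proof (induction n)
  case (Suc n)
  then have "n < N" by simp
  from E_equation[OF this zero_in_freqs] show ?case
    using Suc trunc_zero time_step[OF \<open>n < N\<close>] by simp
qed (rule initial_error_zero)

lemma E_le_gradient: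
  assumes "n \<le> N" shows "(LINT x|\<mu>. (E n x)\<^sup>2) \<le> (grad_norm2 a b (E n))\<^sup>2 / gap"
  using integral_square_le_gradient[OF E_sqint[OF assms] E_gsum(1)[OF assms] _ gap, of 0] E_mean[OF assms] by simp

lemma X_bound:
  assumes n: "n < N"
  shows "(LINT x|\<mu>. (\<phi> (real (Suc n) * dt) x - \<phi>s n x)\<^sup>2) \<le> 2 * K\<^sup>2 * vol * dt\<^sup>2 + 2 * (LINT x|\<mu>. (E n x)\<^sup>2)"
    "gsum (\<lambda>x. \<phi> (real (Suc n) * dt) x - \<phi>s n x) j
      \<le> 2 * (dt * tint T (real n * dt) (real (Suc n) * dt) beta) + 2 * (grad_norm2 a b (E n))\<^sup>2"
proof -
  have nN: "n \<le> N" "Suc n \<le> N" using n by auto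
  let ?r = "real n * dt" and ?t = "real (Suc n) * dt"
  have rt: "0 \<le> ?r" "?r \<le> ?t" "?t \<le> T" using time_step[OF n] by auto
  have th: "sqint \<mu> (\<lambda>x. \<phi> ?t x - \<phi> ?r x)"
    by (rule sqint_diff[OF sqint_at(1)[OF time_in[OF nN(2)]] sqint_at(1)[OF time_in[OF nN(1)]]])
  have X: "(\<lambda>x. \<phi> ?t x - \<phi>s n x) = (\<lambda>x. (\<phi> ?t x - \<phi> ?r x) + E n x)" by (simp add: E_def fun_eq_iff)
  have k: "sqint \<mu> (\<lambda>_. K * dt)" by (simp add: sqint_def)
  have "(LINT x|\<mu>. (\<phi> ?t x - \<phi> ?r x)\<^sup>2) \<le> (LINT x|\<mu>. (K * dt)\<^sup>2)"
  proof (rule integral_square_mono[OF th k])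
    show "AE x in \<mu>. \<bar>\<phi> ?t x - \<phi> ?r x\<bar> \<le> \<bar>K * dt\<bar>"
      using phi_increment_bound[OF rt, unfolded step_length] by eventually_elim linarith
  qed
  also have "\<dots> = K\<^sup>2 * vol * dt\<^sup>2" using measure_box_total by (simp add: power_mult_distrib mult_ac)
  finally have "(LINT x|\<mu>. (\<phi> ?t x - \<phi> ?r x)\<^sup>2) \<le> K\<^sup>2 * vol * dt\<^sup>2" .
  then show "(LINT x|\<mu>. (\<phi> ?t x - \<phi>s n x)\<^sup>2) \<le> 2 * K\<^sup>2 * vol * dt\<^sup>2 + 2 * (LINT x|\<mu>. (E n x)\<^sup>2)"
    using integral_square_add_le[OF th E_sqint[OF nN(1)]] unfolding X[THEN fun_cong] by linarith
  show "gsum (\<lambda>x. \<phi> ?t x - \<phi>s n x) j \<le> 2 * (dt * tint T ?r ?t beta) + 2 * (grad_norm2 a b (E n))\<^sup>2"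
    using gsum_add_le[OF th E_sqint[OF nN(1)], of j] phi_increment_gsum[OF rt, of j] E_gsum(2)[OF nN(1), of j]
    unfolding X step_length by linarith
qed

text \<open>
  The gradient of \<open>\<phi>\<^sup>n\<close> enters only through its difference to the gradient of \<open>\<phi>\<close>, which
  the energy controls.
\<close>

lemma D_gsum:
  assumes n: "n < N"
  shows "gsum (D n) j \<le> c1 * (LINT x|\<mu>. (\<phi> (real (Suc n) * dt) x - \<phi>s n x)\<^sup>2)
    + c2 * (2 * (dt * tint T (real n * dt) (real (Suc n) * dt) beta) + 2 * (grad_norm2 a b (E n))\<^sup>2)"
proof -
  have nN: "n \<le> N" "Suc n \<le> N" using n by auto
  note t1 = time_in[OF nN(2)]
  let ?t = "real (Suc n) * dt"
  obtain gx where gx: "\<And>i. i \<in> Basis \<Longrightarrow> gx i \<in> borel_measurable \<mu> \<and> wgrad i (\<phi> ?t) (gx i) \<and> (AE x in \<mu>. \<bar>gx i x\<bar> \<le> K)"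
    using phi_gb_at[OF t1] unfolding grad_bounded_def by metis
  obtain gU where gU: "\<And>i. i \<in> Basis \<Longrightarrow> gU i \<in> borel_measurable \<mu> \<and> wgrad i (U ?t) (gU i) \<and> (AE x in \<mu>. \<bar>gU i x\<bar> \<le> K)"
    using U_gb_at[OF t1] unfolding grad_bounded_def by metis
  have "\<forall>i\<in>Basis. \<exists>g. sqint \<mu> g \<and> wgrad i (\<phi>s n) g"
    using Hk_wgrad(2)[OF phis_Hk[OF nN(1)]] by auto
  then obtain gy where gy: "\<And>i. i \<in> Basis \<Longrightarrow> sqint \<mu> (gy i) \<and> wgrad i (\<phi>s n) (gy i)" by metis
  show ?thesis
    unfolding D_def c1_def c2_def
    by (rule gsum_nonlinear_difference[where gx=gx and gy=gy and gU=gU and h'=h', OF sqint_at(1)[OF t1] _ _ _ phis_sqint[OF nN(1)] _ _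
          sqintD(1)[OF sqint_at(3)[OF t1]] U_bound[OF t1] _ _ _ h_deriv h'_bound h'_Lip X_bound(2)[OF n]])
      (use gx gy gU in auto)
qed

text \<open>
  The remainder \<open>Z\<close> is the consistency error of the exact solution plus the effect of evaluating
  \<open>H\<close> at \<open>\<phi>\<^sup>n\<close>; the latter carries a factor \<open>dt\<close> because \<open>\<phi>\<close> is Lipschitz in time.
\<close>

lemma third_equation:
  assumes n: "n < N" and b: "bounded_at n"
  obtains Z where "sqint \<mu> Z"
    "(LINT x|\<mu>. (Z x)\<^sup>2) \<le> 2 * (C * K\<^sup>2 * sqrt vol * dt\<^sup>2)\<^sup>2 + (C * K * dt)\<^sup>2 * (LINT x|\<mu>. (E n x)\<^sup>2)"
    "(LINT x|\<mu>. (Y (Suc n) x)\<^sup>2) - (LINT x|\<mu>. (Y n x)\<^sup>2)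
      \<le> (LINT x|\<mu>. P n x * (E (Suc n) x - E n x)) + 2 * (LINT x|\<mu>. Z x * Y (Suc n) x)"
proof -
  have nN: "n \<le> N" "Suc n \<le> N" using n by auto
  let ?r = "real n * dt" and ?t = "real (Suc n) * dt"
  have rt: "0 \<le> ?r" "?r \<le> ?t" "?t \<le> T" using time_step[OF n] by auto
  note r1 = time_in[OF nN(1)] and t1 = time_in[OF nN(2)]
  note hb = h_phis[OF nN(1) b]
  have th: "sqint \<mu> (\<lambda>x. \<phi> ?t x - \<phi> ?r x)" and us: "sqint \<mu> (\<lambda>x. U ?t x - U ?r x)"
    using sqint_at(1,3)[OF r1] sqint_at(1,3)[OF t1] by auto
  define Z1 where "Z1 = (\<lambda>x. U ?t x - U ?r x - 1/2 * h (\<phi> ?r x) * (\<phi> ?t x - \<phi> ?r x))"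
  define Z2 where "Z2 = (\<lambda>x. 1/2 * (h (\<phi> ?r x) - h (\<phi>s n x)) * (\<phi> ?t x - \<phi> ?r x))"
  have Z1s: "sqint \<mu> Z1"
  proof -
    have "sqint \<mu> (\<lambda>x. (U ?t x - U ?r x) - 1/2 * (h (\<phi> ?r x) * (\<phi> ?t x - \<phi> ?r x)))"
      by (intro sqint_diff[OF us] sqint_cmult sqint_h_phi_mult r1 th)
    then show ?thesis by (simp add: Z1_def)
  qed
  have CK: "sqint \<mu> (\<lambda>x. (C * K * dt / 2) * E n x)" by (rule sqint_cmult[OF E_sqint[OF nN(1)]])
  have Z2le: "AE x in \<mu>. \<bar>Z2 x\<bar> \<le> \<bar>(C * K * dt / 2) * E n x\<bar>"
    using phi_increment_bound[OF rt]
  proof eventually_elim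
    case (elim x)
    have "\<bar>h (\<phi> ?r x) - h (\<phi>s n x)\<bar> * \<bar>\<phi> ?t x - \<phi> ?r x\<bar> \<le> (C * \<bar>E n x\<bar>) * (K * dt)"
      using elim h_Lip[of "\<phi> ?r x" "\<phi>s n x"] C_nonneg unfolding step_length E_def by (intro mult_mono) auto
    then show ?case using C_nonneg K dt by (simp add: Z2_def abs_mult mult_ac)
  qed
  have Z2m: "Z2 \<in> borel_measurable \<mu>"
    unfolding Z2_def using h_phi_measurable[OF r1] hb(1) th by (auto simp: sqint_def)
  have Z2s: "sqint \<mu> Z2" by (rule sqint_dominated[OF CK Z2m Z2le])
  define Z where "Z = (\<lambda>x. Z1 x + Z2 x)"
  have Zs: "sqint \<mu> Z" unfolding Z_def using Z1s Z2s by auto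
  have "(LINT x|\<mu>. (Z x)\<^sup>2) \<le> 2 * (LINT x|\<mu>. (Z1 x)\<^sup>2) + 2 * (LINT x|\<mu>. (Z2 x)\<^sup>2)"
    unfolding Z_def by (rule integral_square_add_le[OF Z1s Z2s])
  moreover have "(LINT x|\<mu>. (Z1 x)\<^sup>2) \<le> (C * K\<^sup>2 * sqrt vol * dt\<^sup>2)\<^sup>2"
    using U_consistency[OF rt] unfolding Z1_def step_length .
  moreover have "(LINT x|\<mu>. (Z2 x)\<^sup>2) \<le> (C * K * dt / 2)\<^sup>2 * (LINT x|\<mu>. (E n x)\<^sup>2)"
    using integral_square_mono[OF Z2s CK Z2le]
    by (simp only: power_mult_distrib Bochner_Integration.integral_mult_right_zero)
  moreover have "2 * ((C * K * dt / 2)\<^sup>2 * (LINT x|\<mu>. (E n x)\<^sup>2)) \<le> (C * K * dt)\<^sup>2 * (LINT x|\<mu>. (E n x)\<^sup>2)"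
    by (simp add: power_divide)
  ultimately have Zb: "(LINT x|\<mu>. (Z x)\<^sup>2) \<le> 2 * (C * K\<^sup>2 * sqrt vol * dt\<^sup>2)\<^sup>2 + (C * K * dt)\<^sup>2 * (LINT x|\<mu>. (E n x)\<^sup>2)"
    by linarith
  have Us: "AE x in \<mu>. Us (Suc n) x - Us n x = 1/2 * Hfun F B (\<phi>s n x) * (\<phi>s (Suc n) x - \<phi>s n x)"
    using scheme_equations[OF n] by (auto elim: eventually_mono)
  have ptw: "AE x in \<mu>. (Y (Suc n) x)\<^sup>2 - (Y n x)\<^sup>2 \<le> P n x * (E (Suc n) x - E n x) + 2 * (Z x * Y (Suc n) x)"
    using Us hb(3)
  proof eventually_elim
    case (elim x)
    have inc: "Y (Suc n) x - Y n x = 1/2 * h (\<phi>s n x) * (E (Suc n) x - E n x) + Z x"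
      using elim by (simp add: Y_def E_def Z_def Z1_def Z2_def algebra_simps)
    have "(Y (Suc n) x)\<^sup>2 - (Y n x)\<^sup>2 \<le> 2 * ((Y (Suc n) x - Y n x) * Y (Suc n) x)"
      using zero_le_power2[of "Y (Suc n) x - Y n x"] by (simp add: power2_eq_square algebra_simps)
    also have "\<dots> = P n x * (E (Suc n) x - E n x) + 2 * (Z x * Y (Suc n) x)"
      unfolding inc by (simp add: P_def algebra_simps)
    finally show ?case .
  qed
  have i: "integrable \<mu> (\<lambda>x. P n x * (E (Suc n) x - E n x))" "integrable \<mu> (\<lambda>x. Z x * Y (Suc n) x)"
    "integrable \<mu> (\<lambda>x. (Y (Suc n) x)\<^sup>2)" "integrable \<mu> (\<lambda>x. (Y n x)\<^sup>2)"
    using sqint_mult_integrable[OF P_bound(1)[OF n b] sqint_diff[OF E_sqint[OF nN(2)] E_sqint[OF nN(1)]]]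
      sqint_mult_integrable[OF Zs Y_sqint[OF nN(2)]] Y_sqint[OF nN(1)] Y_sqint[OF nN(2)] by (auto simp: sqint_def)
  have "(LINT x|\<mu>. (Y (Suc n) x)\<^sup>2 - (Y n x)\<^sup>2) \<le> (LINT x|\<mu>. P n x * (E (Suc n) x - E n x) + 2 * (Z x * Y (Suc n) x))"
    by (rule integral_mono_AE[OF _ _ ptw]) (use i in auto)
  then have "(LINT x|\<mu>. (Y (Suc n) x)\<^sup>2) - (LINT x|\<mu>. (Y n x)\<^sup>2)
      \<le> (LINT x|\<mu>. P n x * (E (Suc n) x - E n x)) + 2 * (LINT x|\<mu>. Z x * Y (Suc n) x)"
    using i by simp
  then show ?thesis by (rule that[OF Zs Zb])
qed


text \<open>
  The discrete energy of the error and the source that feeds it in one step, up to the factor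
  \<open>dt\<^sup>2 * cB\<close>.
\<close>

definition energy :: "nat \<Rightarrow> real" where
  "energy n = \<epsilon>\<^sup>2 / 2 * (grad_norm2 a b (E n))\<^sup>2 + (LINT x|\<mu>. (Y n x)\<^sup>2)"

definition source :: "nat \<Rightarrow> real" where
  "source n = tint T (real n * dt) (real (Suc n) * dt) gamma + tint T (real n * dt) (real (Suc n) * dt) beta + dt"

lemma energy_parts:
  "0 \<le> energy n" "(LINT x|\<mu>. (Y n x)\<^sup>2) \<le> energy n" "(grad_norm2 a b (E n))\<^sup>2 \<le> 2 / \<epsilon>\<^sup>2 * energy n"
proof -
  have y: "0 \<le> (LINT x|\<mu>. (Y n x)\<^sup>2)" by simp
  have e: "0 \<le> \<epsilon>\<^sup>2 / 2 * (grad_norm2 a b (E n))\<^sup>2" by simp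
  show "0 \<le> energy n" "(LINT x|\<mu>. (Y n x)\<^sup>2) \<le> energy n" using y e unfolding energy_def by linarith+
  have "\<epsilon>\<^sup>2 / 2 * (grad_norm2 a b (E n))\<^sup>2 \<le> energy n" using y unfolding energy_def by linarith
  then show "(grad_norm2 a b (E n))\<^sup>2 \<le> 2 / \<epsilon>\<^sup>2 * energy n" using eps by (simp add: field_simps)
qed

lemma source_nonneg: "0 \<le> source n"
  unfolding source_def using tint_nonneg beta_gamma dt by (intro add_nonneg_nonneg) auto

text \<open>
  Adding \<open>energy_step\<close> and \<open>third_equation\<close> cancels the scalar product of \<open>P\<close> with the increment of
  \<open>E\<close>; everything else is a multiple of the energy or of the source.
\<close>

lemma energy_increment:
  assumes n: "n < N" and b: "bounded_at n"
  shows "energy (Suc n) + dt * M / 2 * (grad_norm2 a b (W (Suc n)))\<^sup>2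
    \<le> energy n + cA * dt * (energy n + energy (Suc n)) + dt\<^sup>2 * (cB * source n)"
proof -
  have nN: "n \<le> N" "Suc n \<le> N" "1 \<le> Suc n" using n by auto
  let ?r = "real n * dt" and ?t = "real (Suc n) * dt"
  define g where "g = tint T ?r ?t gamma"
  define bt where "bt = tint T ?r ?t beta"
  define e0 where "e0 = (grad_norm2 a b (E n))\<^sup>2"
  define e1 where "e1 = (grad_norm2 a b (E (Suc n)))\<^sup>2"
  define om where "om = (grad_norm2 a b (W (Suc n)))\<^sup>2"
  define y0 where "y0 = (LINT x|\<mu>. (Y n x)\<^sup>2)"
  define y1 where "y1 = (LINT x|\<mu>. (Y (Suc n) x)\<^sup>2)"
  define X where "X = (LINT x|\<mu>. (\<phi> ?t x - \<phi>s n x)\<^sup>2)"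
  define V where "V = (LINT x|\<mu>. (E n x)\<^sup>2)"
  define DD where "DD = (LINT x|\<mu>. (D n x)\<^sup>2)"
  define S where "S = (LINT x|\<mu>. P n x * (E (Suc n) x - E n x))"
  have nn: "0 \<le> g" "0 \<le> bt" "0 \<le> e0" "0 \<le> y1" "0 \<le> V"
    unfolding g_def bt_def e0_def y1_def V_def using tint_nonneg beta_gamma by auto
  have rt: "0 \<le> ?r" "?r \<le> ?t" "?t \<le> T" using time_step[OF n] by auto
  have main: "\<epsilon>\<^sup>2 / 2 * (e1 - e0) + dt * M / 2 * om + S
      \<le> c3 / dt * (dt ^ 3 * g) + dt * M * (c1 * X + c2 * (2 * (dt * bt) + 2 * e0)) + dt / 2 * DD"
    unfolding e0_def e1_def om_def S_def g_def X_def bt_def DD_def c3_def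
  proof (rule energy_step[where W="W (Suc n)" and R="trunc ?r ?t"])
    show "(\<Sum>k\<in>blk j. (trunc ?r ?t k)\<^sup>2) \<le> dt ^ 3 * tint T ?r ?t gamma" for j
      using sum_trunc_square_le[OF rt, of j] unfolding step_length .
  qed (use E_sqint nN D_bound(1)[OF n] P_bound(1)[OF n b] E_equation[OF n] W_equation[OF n b] trunc_zero[OF rt]
        E_gsum(1) W_gsum D_gsum[OF n] dt M gap in auto)
  obtain Z where Z: "sqint \<mu> Z"
    "(LINT x|\<mu>. (Z x)\<^sup>2) \<le> 2 * (C * K\<^sup>2 * sqrt vol * dt\<^sup>2)\<^sup>2 + (C * K * dt)\<^sup>2 * V"
    "y1 - y0 \<le> S + 2 * (LINT x|\<mu>. Z x * Y (Suc n) x)"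
    using third_equation[OF n b] unfolding V_def y1_def y0_def S_def by blast
  have zy: "2 * (LINT x|\<mu>. Z x * Y (Suc n) x) \<le> (LINT x|\<mu>. (Z x)\<^sup>2) / dt + dt * y1"
  proof -
    note Ys = Y_sqint[OF nN(2)]
    have "(LINT x|\<mu>. 2 * (Z x * Y (Suc n) x)) \<le> (LINT x|\<mu>. (Z x)\<^sup>2 / dt + dt * (Y (Suc n) x)\<^sup>2)"
    proof (rule integral_mono)
      show "integrable \<mu> (\<lambda>x. 2 * (Z x * Y (Suc n) x))" using sqint_mult_integrable[OF Z(1) Ys] by simp
      show "integrable \<mu> (\<lambda>x. (Z x)\<^sup>2 / dt + dt * (Y (Suc n) x)\<^sup>2)" using Z(1) Ys by (simp add: sqint_def)
      fix x
      have "0 \<le> (Z x - dt * Y (Suc n) x)\<^sup>2 / dt" using dt by simp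
      also have "\<dots> = (Z x)\<^sup>2 / dt + dt * (Y (Suc n) x)\<^sup>2 - 2 * (Z x * Y (Suc n) x)"
        using dt by (simp add: power2_eq_square field_simps)
      finally show "2 * (Z x * Y (Suc n) x) \<le> (Z x)\<^sup>2 / dt + dt * (Y (Suc n) x)\<^sup>2" by simp
    qed
    then show ?thesis using Z(1) Ys by (simp add: sqint_def y1_def)
  qed
  have Vb: "V \<le> e0 / gap" using E_le_gradient[OF nN(1)] by (simp add: V_def e0_def)
  have Xb: "X \<le> 2 * K\<^sup>2 * vol * dt\<^sup>2 + 2 * (e0 / gap)"
    using X_bound(1)[OF n] Vb unfolding X_def V_def by linarith
  have Zb: "(LINT x|\<mu>. (Z x)\<^sup>2) / dt \<le> dt\<^sup>2 * (dt * (2 * C\<^sup>2 * K ^ 4 * vol)) + dt * ((C * K)\<^sup>2 / gap * e0)"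
  proof -
    have "(LINT x|\<mu>. (Z x)\<^sup>2) \<le> 2 * (C * K\<^sup>2 * sqrt vol * dt\<^sup>2)\<^sup>2 + (C * K * dt)\<^sup>2 * (e0 / gap)"
      using Z(2) mult_left_mono[OF Vb, of "(C * K * dt)\<^sup>2"] by simp
    also have "\<dots> = dt * (dt\<^sup>2 * (dt * (2 * C\<^sup>2 * K ^ 4 * vol)) + dt * ((C * K)\<^sup>2 / gap * e0))"
      using vol_pos by (simp add: power_mult_distrib power2_eq_square power4_eq_xxxx algebra_simps)
    finally show ?thesis using dt by (simp add: divide_le_eq mult.commute)
  qed
  have DX: "dt * M * (c1 * X) \<le> dt\<^sup>2 * (dt * (2 * M * c1 * K\<^sup>2 * vol)) + dt * (2 * M * c1 / gap * e0)"
  proof -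
    have "dt * M * (c1 * X) \<le> dt * M * (c1 * (2 * K\<^sup>2 * vol * dt\<^sup>2 + 2 * (e0 / gap)))"
      using Xb dt M constants_nonneg by (intro mult_left_mono) auto
    then show ?thesis by (simp add: algebra_simps power2_eq_square)
  qed
  have DD: "dt / 2 * DD \<le> dt\<^sup>2 * (dt * (K ^ 4 * C\<^sup>2 * vol)) + dt * (K\<^sup>2 * C\<^sup>2 / gap * e0)"
  proof -
    have "DD \<le> K\<^sup>2 * C\<^sup>2 * X" using D_bound(2)[OF n] by (simp add: DD_def X_def)
    also have "\<dots> \<le> K\<^sup>2 * C\<^sup>2 * (2 * K\<^sup>2 * vol * dt\<^sup>2 + 2 * (e0 / gap))" using Xb by (intro mult_left_mono) auto
    finally have "dt / 2 * DD \<le> dt / 2 * (K\<^sup>2 * C\<^sup>2 * (2 * K\<^sup>2 * vol * dt\<^sup>2 + 2 * (e0 / gap)))"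
      using dt by (intro mult_left_mono) auto
    then show ?thesis by (simp add: algebra_simps power2_eq_square power4_eq_xxxx)
  qed
  have c3e: "c3 / dt * (dt ^ 3 * g) = dt\<^sup>2 * (c3 * g)"
    using dt by (simp add: power2_eq_square power3_eq_cube)
  define q where "q = 2 * M * c1 * K\<^sup>2 * vol + K ^ 4 * C\<^sup>2 * vol + 2 * C\<^sup>2 * K ^ 4 * vol"
  have q0: "0 \<le> q" unfolding q_def using constants_nonneg M vol_pos by simp
  have tot: "\<epsilon>\<^sup>2 / 2 * (e1 - e0) + dt * M / 2 * om + (y1 - y0)
      \<le> dt * (cE * e0) + dt * y1 + dt\<^sup>2 * (c3 * g + 2 * M * c2 * bt + dt * q)"
  proof -
    have "dt * M * (c2 * (2 * (dt * bt) + 2 * e0)) = dt\<^sup>2 * (2 * M * c2 * bt) + dt * (2 * M * c2 * e0)"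
      by (simp add: algebra_simps power2_eq_square)
    moreover have "dt * (cE * e0) = dt * (2 * M * c1 / gap * e0) + dt * (2 * M * c2 * e0) + dt * (K\<^sup>2 * C\<^sup>2 / gap * e0) + dt * ((C * K)\<^sup>2 / gap * e0)"
      unfolding cE_def by (simp add: algebra_simps)
    moreover have "dt\<^sup>2 * (c3 * g + 2 * M * c2 * bt + dt * q) = dt\<^sup>2 * (c3 * g) + dt\<^sup>2 * (2 * M * c2 * bt)
        + dt\<^sup>2 * (dt * (2 * M * c1 * K\<^sup>2 * vol)) + dt\<^sup>2 * (dt * (K ^ 4 * C\<^sup>2 * vol)) + dt\<^sup>2 * (dt * (2 * C\<^sup>2 * K ^ 4 * vol))"
      unfolding q_def by (simp only: distrib_left add.assoc)
    moreover have "dt * M * (c1 * X + c2 * (2 * (dt * bt) + 2 * e0)) = dt * M * (c1 * X) + dt * M * (c2 * (2 * (dt * bt) + 2 * e0))"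
      by (rule distrib_left)
    ultimately show ?thesis using main c3e Z(3) zy Zb DX DD by linarith
  qed
  have "c3 * g + 2 * M * c2 * bt + dt * q \<le> cB * source n"
  proof -
    have le: "c3 \<le> cB" "2 * M * c2 \<le> cB" "q \<le> cB"
      using constants_nonneg q0 M unfolding cB_def q_def[symmetric] by (simp_all add: add_nonneg_nonneg less_imp_le)
    have "c3 * g \<le> cB * g" "2 * M * c2 * bt \<le> cB * bt" "q * dt \<le> cB * dt"
      using le nn dt by (auto intro: mult_right_mono)
    moreover have "cB * source n = cB * g + cB * bt + cB * dt"
      unfolding source_def g_def bt_def by (simp only: distrib_left)
    ultimately show ?thesis by (simp add: mult.commute)
  qed
  then have src: "dt\<^sup>2 * (c3 * g + 2 * M * c2 * bt + dt * q) \<le> dt\<^sup>2 * (cB * source n)" by (rule mult_left_mono) simp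
  have en: "dt * (cE * e0) + dt * y1 \<le> cA * dt * (energy n + energy (Suc n))"
  proof -
    have "cE * e0 \<le> cE * (2 / \<epsilon>\<^sup>2 * energy n)"
      using energy_parts(3)[of n] constants_nonneg unfolding e0_def by (intro mult_left_mono) auto
    also have "\<dots> = (cA - 1) * energy n" by (simp add: cA_def)
    also have "\<dots> \<le> cA * energy n" using energy_parts(1)[of n] by (intro mult_right_mono) auto
    finally have 1: "cE * e0 \<le> cA * energy n" .
    have "y1 \<le> energy (Suc n)" using energy_parts(2) by (simp add: y1_def)
    also have "\<dots> \<le> cA * energy (Suc n)" using mult_right_mono[OF constants_nonneg(5) energy_parts(1)[of "Suc n"]] by simp
    finally have "cE * e0 + y1 \<le> cA * (energy n + energy (Suc n))" using 1 by (simp add: distrib_left)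
    from mult_left_mono[OF this, of dt] show ?thesis using dt by (simp add: algebra_simps)
  qed
  show ?thesis
    using tot src en unfolding energy_def e0_def e1_def y0_def y1_def om_def right_diff_distrib by linarith
qed

text \<open>
  The sources add up to a quantity independent of the number of steps, so two powers of \<open>dt\<close>
  survive.
\<close>

lemma energy_bound:
  assumes n: "n \<le> N" and b: "\<And>k. k < n \<Longrightarrow> bounded_at k" and small: "cA * dt \<le> 1/2"
  shows "energy n + (\<Sum>k<n. dt * M / 2 * (grad_norm2 a b (W (Suc k)))\<^sup>2) \<le> cS * dt\<^sup>2"
proof -
  have A0: "0 \<le> cA * dt" using constants_nonneg dt by simp
  have "energy n + (\<Sum>k<n. dt * M / 2 * (grad_norm2 a b (W (Suc k)))\<^sup>2)
      \<le> exp (4 * (cA * dt) * real n) * (energy 0 + 2 * (\<Sum>k<n. dt\<^sup>2 * (cB * source k)))"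
    by (rule discrete_Gronwall)
      (use n b small A0 energy_increment energy_parts(1) source_nonneg constants_nonneg dt M in auto)
  also have "energy 0 = 0" using initial_error_zero by (simp add: energy_def)
  also have "exp (4 * (cA * dt) * real n) * (0 + 2 * (\<Sum>k<n. dt\<^sup>2 * (cB * source k))) \<le> exp (4 * cA * T) * (2 * (dt\<^sup>2 * (cB * total)))"
  proof (intro mult_mono)
    have "real n * dt \<le> T" using time_in[OF n] by simp
    then have "4 * cA * (real n * dt) \<le> 4 * cA * T" using constants_nonneg by (intro mult_left_mono) auto
    then show "exp (4 * (cA * dt) * real n) \<le> exp (4 * cA * T)" by (simp add: mult_ac)
    have "(\<Sum>k<n. source k) \<le> total"
    proof -
      have "(\<Sum>k<n. source k) = (\<Sum>k<n. tint T (real k * dt) (real (Suc k) * dt) gamma)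
          + (\<Sum>k<n. tint T (real k * dt) (real (Suc k) * dt) beta) + real n * dt"
        unfolding source_def by (simp add: sum.distrib)
      then show ?thesis
        using sum_tint_le[OF beta_gamma(2,4) dt(1), of n] sum_tint_le[OF beta_gamma(1,3) dt(1), of n] \<open>real n * dt \<le> T\<close>
        unfolding total_def by linarith
    qed
    then have "dt\<^sup>2 * (cB * (\<Sum>k<n. source k)) \<le> dt\<^sup>2 * (cB * total)"
      using constants_nonneg by (intro mult_left_mono) auto
    then show "0 + 2 * (\<Sum>k<n. dt\<^sup>2 * (cB * source k)) \<le> 2 * (dt\<^sup>2 * (cB * total))"
      by (simp only: sum_distrib_left[symmetric])
    show "0 \<le> 0 + 2 * (\<Sum>k<n. dt\<^sup>2 * (cB * source k))"
      using source_nonneg constants_nonneg by (auto intro!: sum_nonneg)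
  qed auto
  also have "\<dots> = cS * dt\<^sup>2" by (simp add: cS_def mult_ac)
  finally show ?thesis .
qed

lemma errors_from_energy:
  assumes "n \<le> N" "energy n \<le> cS * dt\<^sup>2"
  shows "(LINT x|\<mu>. (E n x)\<^sup>2) \<le> 2 / (gap * \<epsilon>\<^sup>2) * cS * dt\<^sup>2"
    "(grad_norm2 a b (E n))\<^sup>2 \<le> 2 / \<epsilon>\<^sup>2 * cS * dt\<^sup>2" "(LINT x|\<mu>. (Y n x)\<^sup>2) \<le> cS * dt\<^sup>2"
proof -
  have "2 / \<epsilon>\<^sup>2 * energy n \<le> 2 / \<epsilon>\<^sup>2 * (cS * dt\<^sup>2)" using assms(2) by (intro mult_left_mono) auto
  then show g: "(grad_norm2 a b (E n))\<^sup>2 \<le> 2 / \<epsilon>\<^sup>2 * cS * dt\<^sup>2"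
    using energy_parts(3)[of n] unfolding mult.assoc by linarith
  have "(LINT x|\<mu>. (E n x)\<^sup>2) \<le> (grad_norm2 a b (E n))\<^sup>2 / gap" by (rule E_le_gradient[OF assms(1)])
  also have "\<dots> \<le> 2 / \<epsilon>\<^sup>2 * cS * dt\<^sup>2 / gap" using g gap by (intro divide_right_mono) auto
  finally show "(LINT x|\<mu>. (E n x)\<^sup>2) \<le> 2 / (gap * \<epsilon>\<^sup>2) * cS * dt\<^sup>2" by (simp add: mult.commute)
  show "(LINT x|\<mu>. (Y n x)\<^sup>2) \<le> cS * dt\<^sup>2" using energy_parts(2)[of n] assms(2) by linarith
qed

lemma potential_error:
  assumes n: "n < N" and b: "bounded_at n" and e: "energy n \<le> cS * dt\<^sup>2" "energy (Suc n) \<le> cS * dt\<^sup>2"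
  shows "sqint \<mu> (\<lambda>x. D n x + P n x)" "(LINT x|\<mu>. (D n x + P n x)\<^sup>2) \<le> cG * dt\<^sup>2"
proof -
  have nN: "n \<le> N" "Suc n \<le> N" using n by auto
  let ?X = "LINT x|\<mu>. (\<phi> (real (Suc n) * dt) x - \<phi>s n x)\<^sup>2"
  show "sqint \<mu> (\<lambda>x. D n x + P n x)" using D_bound(1)[OF n] P_bound(1)[OF n b] by auto
  have X: "?X \<le> (2 * K\<^sup>2 * vol + 2 * (2 / (gap * \<epsilon>\<^sup>2) * cS)) * dt\<^sup>2"
    using X_bound(1)[OF n] errors_from_energy(1)[OF nN(1) e(1)] by (simp add: distrib_right mult.assoc)
  have "(LINT x|\<mu>. (D n x)\<^sup>2) \<le> K\<^sup>2 * C\<^sup>2 * ((2 * K\<^sup>2 * vol + 2 * (2 / (gap * \<epsilon>\<^sup>2) * cS)) * dt\<^sup>2)"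
    using D_bound(2)[OF n] mult_left_mono[OF X, of "K\<^sup>2 * C\<^sup>2"] by simp
  moreover have "(LINT x|\<mu>. (P n x)\<^sup>2) \<le> Hsup\<^sup>2 * (cS * dt\<^sup>2)"
    using P_bound(2)[OF n b] mult_left_mono[OF errors_from_energy(3)[OF nN(2) e(2)], of "Hsup\<^sup>2"] by simp
  moreover have "(LINT x|\<mu>. (D n x + P n x)\<^sup>2) \<le> 2 * (LINT x|\<mu>. (D n x)\<^sup>2) + 2 * (LINT x|\<mu>. (P n x)\<^sup>2)"
    by (rule integral_square_add_le[OF D_bound(1)[OF n] P_bound(1)[OF n b]])
  moreover have "cG * dt\<^sup>2 = 2 * (K\<^sup>2 * C\<^sup>2 * ((2 * K\<^sup>2 * vol + 2 * (2 / (gap * \<epsilon>\<^sup>2) * cS)) * dt\<^sup>2)) + 2 * (Hsup\<^sup>2 * (cS * dt\<^sup>2))"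
    unfolding cG_def by (simp only: distrib_right mult.assoc)
  ultimately show "(LINT x|\<mu>. (D n x + P n x)\<^sup>2) \<le> cG * dt\<^sup>2" by linarith
qed

lemma coef_DP:
  assumes n: "n < N" and b: "bounded_at n"
  shows "coef (\<lambda>x. D n x + P n x) k = coef (D n) k + coef (P n) k"
  by (rule coef_add) (auto intro: sqint_integrable D_bound(1)[OF n] P_bound(1)[OF n b])

text \<open>
  The mean of \<open>W\<close> is not seen by the dissipation, but by the second equation it is the mean of \<open>D + P\<close>.
\<close>

lemma W_error:
  assumes n: "n < N" and b: "bounded_at n" and e: "energy n \<le> cS * dt\<^sup>2" "energy (Suc n) \<le> cS * dt\<^sup>2"
  shows "(LINT x|\<mu>. (W (Suc n) x)\<^sup>2) \<le> (grad_norm2 a b (W (Suc n)))\<^sup>2 / gap + cG * dt\<^sup>2"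
proof (rule integral_square_le_gradient[OF W_sqint W_gsum _ gap])
  note G = potential_error[OF n b e]
  have "coef (W (Suc n)) 0 = coef (\<lambda>x. D n x + P n x) 0"
    using W_equation[OF n b zero_in_freqs] coef_DP[OF n b] by simp
  then show "(coef (W (Suc n)) 0)\<^sup>2 \<le> cG * dt\<^sup>2"
    using Bessel[OF G(1), of "{0}"] G(2) by simp
qed (use n in auto)

text \<open>
  The second equation, solved for the Laplacian of \<open>E\<close>. A single term of the dissipation sum is only
  \<open>O(dt)\<close> after division by \<open>dt\<close>, hence the square root.
\<close>

lemma E_sup_bound:
  assumes n: "n < N" and b: "bounded_at n" and e: "energy n \<le> cS * dt\<^sup>2" "energy (Suc n) \<le> cS * dt\<^sup>2"
    and om: "dt * M / 2 * (grad_norm2 a b (W (Suc n)))\<^sup>2 \<le> cS * dt\<^sup>2" and small: "dt \<le> 1"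
  shows "AE x in \<mu>. \<bar>E (Suc n) x\<bar> \<le> emb * sqrt (cQ * dt)"
proof (rule emb(2))
  have nN: "Suc n \<le> N" "1 \<le> Suc n" using n by auto
  show "sqint \<mu> (E (Suc n))" by (rule E_sqint[OF nN(1)])
  fix j
  note G = potential_error[OF n b e]
  have d2: "dt\<^sup>2 \<le> dt" using dt small by (simp add: power2_eq_square mult_left_le)
  have "(\<Sum>k\<in>blk j. ((1 + k \<bullet> k) * coef (E (Suc n)) k)\<^sup>2)
      \<le> (\<Sum>k\<in>blk j. 2 * (coef (E (Suc n)) k)\<^sup>2 + 4 / \<epsilon> ^ 4 * ((coef (W (Suc n)) k)\<^sup>2 + (coef (\<lambda>x. D n x + P n x) k)\<^sup>2))"
  proof (rule sum_mono)
    fix k assume "k \<in> blk j"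
    then have k: "k \<in> freqs" by (rule blk_in_freqs)
    let ?E = "coef (E (Suc n)) k" and ?W = "coef (W (Suc n)) k" and ?G = "coef (\<lambda>x. D n x + P n x) k"
    have "(k \<bullet> k) * ?E = (?W + - ?G) / \<epsilon>\<^sup>2"
      using W_equation[OF n b k] coef_DP[OF n b, of k] eps by (simp add: field_simps)
    then have "((k \<bullet> k) * ?E)\<^sup>2 = (?W + - ?G)\<^sup>2 / \<epsilon> ^ 4" by (simp add: power_divide)
    also have "\<dots> \<le> (2 * ?W\<^sup>2 + 2 * (- ?G)\<^sup>2) / \<epsilon> ^ 4" by (intro divide_right_mono power2_sum_le) simp
    finally have "((k \<bullet> k) * ?E)\<^sup>2 \<le> (2 * ?W\<^sup>2 + 2 * ?G\<^sup>2) / \<epsilon> ^ 4" by simp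
    moreover have "((1 + k \<bullet> k) * ?E)\<^sup>2 \<le> 2 * ?E\<^sup>2 + 2 * ((k \<bullet> k) * ?E)\<^sup>2"
      using power2_sum_le[of ?E "(k \<bullet> k) * ?E"] by (simp add: distrib_right)
    moreover have "2 * ((2 * ?W\<^sup>2 + 2 * ?G\<^sup>2) / \<epsilon> ^ 4) = 4 / \<epsilon> ^ 4 * (?W\<^sup>2 + ?G\<^sup>2)" by (simp add: algebra_simps add_divide_distrib)
    ultimately show "((1 + k \<bullet> k) * ?E)\<^sup>2 \<le> 2 * ?E\<^sup>2 + 4 / \<epsilon> ^ 4 * (?W\<^sup>2 + ?G\<^sup>2)" by linarith
  qed
  also have "\<dots> = 2 * (\<Sum>k\<in>blk j. (coef (E (Suc n)) k)\<^sup>2)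
      + 4 / \<epsilon> ^ 4 * ((\<Sum>k\<in>blk j. (coef (W (Suc n)) k)\<^sup>2) + (\<Sum>k\<in>blk j. (coef (\<lambda>x. D n x + P n x) k)\<^sup>2))"
    by (simp only: sum.distrib sum_distrib_left[symmetric])
  also have "\<dots> \<le> 2 * (2 / (gap * \<epsilon>\<^sup>2) * cS * dt) + 4 / \<epsilon> ^ 4 * ((2 / (M * gap) * cS * dt + cG * dt) + cG * dt)"
  proof (intro add_mono mult_left_mono)
    have S2: "2 / (gap * \<epsilon>\<^sup>2) * cS * dt\<^sup>2 \<le> 2 / (gap * \<epsilon>\<^sup>2) * cS * dt"
      using d2 constants_nonneg gap by (intro mult_left_mono) auto
    show "(\<Sum>k\<in>blk j. (coef (E (Suc n)) k)\<^sup>2) \<le> 2 / (gap * \<epsilon>\<^sup>2) * cS * dt"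
      using Bessel[OF E_sqint[OF nN(1)] finite_blk blk_subset, of j] errors_from_energy(1)[OF nN(1) e(2)] S2 by linarith
    have G2: "cG * dt\<^sup>2 \<le> cG * dt" using d2 constants_nonneg by (intro mult_left_mono) auto
    show "(\<Sum>k\<in>blk j. (coef (\<lambda>x. D n x + P n x) k)\<^sup>2) \<le> cG * dt"
      using Bessel[OF G(1) finite_blk blk_subset, of j] G(2) G2 by linarith
    have "(grad_norm2 a b (W (Suc n)))\<^sup>2 \<le> 2 / M * cS * dt"
      using om dt M by (simp add: power2_eq_square field_simps)
    then have "(grad_norm2 a b (W (Suc n)))\<^sup>2 / gap \<le> 2 / (M * gap) * cS * dt"
      using gap divide_right_mono[of _ "2 / M * cS * dt" gap] by simp
    then show "(\<Sum>k\<in>blk j. (coef (W (Suc n)) k)\<^sup>2) \<le> 2 / (M * gap) * cS * dt + cG * dt"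
      using Bessel[OF W_sqint[OF nN(2,1)] finite_blk blk_subset, of j] W_error[OF n b e] G2 by linarith
  qed auto
  also have "\<dots> = cQ * dt" unfolding cQ_def by (simp add: algebra_simps)
  finally show "(\<Sum>k\<in>blk j. ((1 + k \<bullet> k) * coef (E (Suc n)) k)\<^sup>2) \<le> cQ * dt" .
qed

text \<open>
  The sup bound on the discrete solution is propagated step by step: the error estimate up to
  step \<open>n\<close> needs the bound only before step \<open>n\<close>, and returns it at step \<open>n\<close>.
\<close>

lemma bounded_at_all:
  assumes small: "cA * dt \<le> 1/2" "dt \<le> 1" "emb * sqrt (cQ * dt) \<le> 1" and n: "n \<le> N"
  shows "bounded_at n"
  using n
proof (induction n rule: less_induct)
  case (less n)
  show ?case
  proof (cases n)
    case 0
    have "0 \<in> {0..T}" using T by simp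
    from phi_bound[OF this] initial_error show ?thesis
      unfolding 0 by eventually_elim (simp add: E_def)
  next
    case (Suc m)
    have m: "m < N" using less.prems Suc by simp
    have bnd: "bounded_at k" if "k \<le> m" for k using less that Suc by auto
    have b1: "energy m \<le> cS * dt\<^sup>2"
    proof -
      have "energy m + (\<Sum>k<m. dt * M / 2 * (grad_norm2 a b (W (Suc k)))\<^sup>2) \<le> cS * dt\<^sup>2"
        by (rule energy_bound[OF _ _ small(1)]) (use m bnd in auto)
      moreover have "0 \<le> (\<Sum>k<m. dt * M / 2 * (grad_norm2 a b (W (Suc k)))\<^sup>2)"
        using dt M by (intro sum_nonneg) auto
      ultimately show ?thesis by linarith
    qed
    have "energy (Suc m) + (\<Sum>k<Suc m. dt * M / 2 * (grad_norm2 a b (W (Suc k)))\<^sup>2) \<le> cS * dt\<^sup>2"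
      by (rule energy_bound[OF _ _ small(1)]) (use m bnd in auto)
    moreover have "0 \<le> (\<Sum>k<m. dt * M / 2 * (grad_norm2 a b (W (Suc k)))\<^sup>2)"
      using dt M by (intro sum_nonneg) auto
    moreover have "0 \<le> dt * M / 2 * (grad_norm2 a b (W (Suc m)))\<^sup>2" using dt M by simp
    ultimately have b2: "energy (Suc m) \<le> cS * dt\<^sup>2" "dt * M / 2 * (grad_norm2 a b (W (Suc m)))\<^sup>2 \<le> cS * dt\<^sup>2"
      using energy_parts(1)[of "Suc m"] unfolding sum.lessThan_Suc by linarith+
    have "AE x in \<mu>. \<bar>E (Suc m) x\<bar> \<le> emb * sqrt (cQ * dt)"
      by (rule E_sup_bound[OF m bnd b1 b2 small(2)]) simp
    moreover have "AE x in \<mu>. \<bar>\<phi> (real (Suc m) * dt) x\<bar> \<le> K"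
      by (rule phi_bound[OF time_in]) (use m in simp)
    ultimately show ?thesis
      unfolding Suc
    proof eventually_elim
      case (elim x)
      then show ?case using small(3) unfolding E_def by linarith
    qed
  qed
qed

theorem error_estimate:
  assumes small: "cA * dt \<le> 1/2" "dt \<le> 1" "emb * sqrt (cQ * dt) \<le> 1" and m: "Suc m \<le> N"
  shows "(norm2 a b (E (Suc m)))\<^sup>2 + (grad_norm2 a b (E (Suc m)))\<^sup>2 + (norm2 a b (Y (Suc m)))\<^sup>2
      + dt * (\<Sum>n=0..m. (norm2 a b (W (Suc n)))\<^sup>2 + (grad_norm2 a b (W (Suc n)))\<^sup>2)
    \<le> (2 / (gap * \<epsilon>\<^sup>2) * cS + 2 / \<epsilon>\<^sup>2 * cS + cS + (1 / gap + 1) * (2 / M) * cS + T * cG + 1) * dt\<^sup>2"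
proof -
  note bnd = bounded_at_all[OF small]
  let ?om = "\<lambda>k. (grad_norm2 a b (W (Suc k)))\<^sup>2"
  have en: "energy n + dt * M / 2 * (\<Sum>k<n. ?om k) \<le> cS * dt\<^sup>2" if "n \<le> N" for n
    using energy_bound[OF that _ small(1)] bnd that by (simp add: sum_distrib_left)
  have pos: "0 \<le> dt * M / 2 * (\<Sum>k<n. ?om k)" for n using dt M by (intro mult_nonneg_nonneg sum_nonneg) auto
  have e: "energy n \<le> cS * dt\<^sup>2" if "n \<le> N" for n using en[OF that] pos[of n] by linarith
  have om: "dt * (\<Sum>k<Suc m. ?om k) \<le> 2 / M * cS * dt\<^sup>2"
  proof -
    have "dt * M / 2 * (\<Sum>k<Suc m. ?om k) \<le> cS * dt\<^sup>2" using en[OF m] energy_parts(1)[of "Suc m"] by linarith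
    then have "2 / M * (dt * M / 2 * (\<Sum>k<Suc m. ?om k)) \<le> 2 / M * (cS * dt\<^sup>2)" using M by (intro mult_left_mono) auto
    then show ?thesis using M by simp
  qed
  have Ws: "(norm2 a b (W (Suc n)))\<^sup>2 \<le> ?om n / gap + cG * dt\<^sup>2" if "n < Suc m" for n
    unfolding norm2_square by (rule W_error[OF _ bnd e e]) (use that m in auto)
  have "dt * (\<Sum>n=0..m. (norm2 a b (W (Suc n)))\<^sup>2 + ?om n) \<le> (1 / gap + 1) * (2 / M) * cS * dt\<^sup>2 + T * cG * dt\<^sup>2"
  proof -
    have "(\<Sum>n=0..m. (norm2 a b (W (Suc n)))\<^sup>2 + ?om n) = (\<Sum>n<Suc m. (norm2 a b (W (Suc n)))\<^sup>2 + ?om n)"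
      by (simp add: atLeast0AtMost lessThan_Suc_atMost)
    also have "\<dots> \<le> (\<Sum>n<Suc m. (1 / gap + 1) * ?om n + cG * dt\<^sup>2)"
      by (rule sum_mono) (use Ws in \<open>fastforce simp: distrib_right\<close>)
    also have "\<dots> = (1 / gap + 1) * (\<Sum>n<Suc m. ?om n) + real (Suc m) * (cG * dt\<^sup>2)"
      by (simp only: sum.distrib sum_distrib_left sum_constant card_lessThan)
    finally have "dt * (\<Sum>n=0..m. (norm2 a b (W (Suc n)))\<^sup>2 + ?om n)
        \<le> dt * ((1 / gap + 1) * (\<Sum>n<Suc m. ?om n) + real (Suc m) * (cG * dt\<^sup>2))"
      by (rule mult_left_mono) (use dt in simp)
    also have "\<dots> = (1 / gap + 1) * (dt * (\<Sum>n<Suc m. ?om n)) + (real (Suc m) * dt) * (cG * dt\<^sup>2)"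
      by (simp only: distrib_left mult_ac)
    also have "\<dots> \<le> (1 / gap + 1) * (2 / M * cS * dt\<^sup>2) + T * (cG * dt\<^sup>2)"
      using om gap time_in[OF m] constants_nonneg by (intro add_mono mult_left_mono mult_right_mono) auto
    finally show ?thesis by (simp only: mult.assoc)
  qed
  moreover have "(norm2 a b (E (Suc m)))\<^sup>2 \<le> 2 / (gap * \<epsilon>\<^sup>2) * cS * dt\<^sup>2"
    unfolding norm2_square by (rule errors_from_energy(1)[OF m e[OF m]])
  moreover have "(norm2 a b (Y (Suc m)))\<^sup>2 \<le> cS * dt\<^sup>2"
    unfolding norm2_square by (rule errors_from_energy(3)[OF m e[OF m]])
  moreover note errors_from_energy(2)[OF m e[OF m]]
  moreover have "0 \<le> dt\<^sup>2" by simp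
  ultimately show ?thesis unfolding distrib_right by linarith
qed

end

theorem theorem3p3:
  fixes a b :: "'a::euclidean_space"
    and M \<epsilon> A B T :: real
    and F :: "real \<Rightarrow> real"
    and \<phi>0 :: "'a \<Rightarrow> real"
    and \<phi> w U \<phi>t \<phi>tt Ut Utt :: "real \<Rightarrow> 'a \<Rightarrow> real"
  assumes "DIM('a) = 2 \<or> DIM('a) = 3" and "box a b \<noteq> {}"
    and "M > 0" and "\<epsilon> > 0" and "A > 0" and "B > A" and "T > 0"
    and "\<forall>x. F x > - A"
    and "C_k 3 F"
    and "exact_solution a b M \<epsilon> B T F \<phi>0 \<phi> w U \<phi>t Ut"
    and "weak_time_deriv a b T \<phi>t \<phi>tt" and "weak_time_deriv a b T Ut Utt"
    and "\<phi> \<in> time_Linf a b T (Hk a b 2) \<inter> time_Linf a b T (Wkinf a b 1)"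
    and "U \<in> time_Linf a b T (Wkinf a b 1)"
    and "w \<in> time_Linf a b T (Hk a b 1)"
    and "\<phi>t \<in> time_Lp a b T 2 (Hk a b 1) \<inter> time_Linf a b T (Linf a b)"
    and "\<phi>tt \<in> time_Lp a b T 2 (L2 a b)" and "Utt \<in> time_Lp a b T 2 (L2 a b)"
  shows "\<exists>s0>0. \<exists>C>0. \<forall>dt N \<phi>s ws Us.
    dt > 0 \<and> T = real N * dt \<and> dt \<le> s0 \<and> scheme_solution a b M \<epsilon> B F \<phi>0 dt N \<phi>s ws Us \<longrightarrow>
    (\<forall>m::nat. real m \<le> T / dt - 1 \<longrightarrow>
      (let e\<phi> = (\<lambda>n x. \<phi> (real n * dt) x - \<phi>s n x);
           ew = (\<lambda>n x. w (real n * dt) x - ws n x);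
           eu = (\<lambda>n x. U (real n * dt) x - Us n x)
       in (norm2 a b (e\<phi> (m+1)))\<^sup>2 + (grad_norm2 a b (e\<phi> (m+1)))\<^sup>2 + (norm2 a b (eu (m+1)))\<^sup>2
          + dt * (\<Sum>n=0..m. (norm2 a b (ew (n+1)))\<^sup>2 + (grad_norm2 a b (ew (n+1)))\<^sup>2)
          \<le> C * dt\<^sup>2))"
proof -
  have Fpos: "F x + B > 0" for x using assms(6,8) by (metis add.commute diff_gt_0_iff_gt diff_minus_eq_add less_trans neg_less_iff_less)
  interpret sav_solution a b M \<epsilon> B T F \<phi>0 \<phi> w U \<phi>t \<phi>tt Ut
    by unfold_locales (use assms Fpos in auto)
  obtain K where K: "K > 0" "AE t in \<tau>. grad_bounded K (\<phi> t)" "AE t in \<tau>. grad_bounded K (U t)"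
    "AE t in \<tau>. AE x in \<mu>. \<bar>\<phi>t t x\<bar> \<le> K" "AE t in \<tau>. \<forall>j. gsum (w t) j \<le> K"
    using uniform_bound by blast
  have "K + 1 > 0" using K by simp
  then obtain h h' C L where h: "\<And>s. \<bar>s\<bar> \<le> K + 1 \<Longrightarrow> h s = Hfun F B s"
    "\<And>y. (h has_real_derivative h' y) (at y)" "\<And>y. \<bar>h' y\<bar> \<le> C"
    "\<And>p q. \<bar>h' p - h' q\<bar> \<le> L * \<bar>p - q\<bar>"
    using Hfun_extension[OF FC3 Fpos] by metis
  obtain gap where gap: "gap > 0" "\<And>k. k \<in> freqs \<Longrightarrow> k \<noteq> 0 \<Longrightarrow> gap \<le> k \<bullet> k"
    using spectral_gap by blast
  have "DIM('a) \<le> 3" using assms(1) by auto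
  then obtain emb where emb: "emb > 0" "\<And>u Q. sqint \<mu> u \<Longrightarrow>
      (\<And>j. (\<Sum>k\<in>blk j. ((1 + k \<bullet> k) * coef u k)\<^sup>2) \<le> Q) \<Longrightarrow> AE x in \<mu>. \<bar>u x\<bar> \<le> emb * sqrt Q"
    using sup_bound_H2 by blast
  interpret sav_constants a b M \<epsilon> B T F \<phi>0 \<phi> w U \<phi>t \<phi>tt Ut K C L h h' gap emb
    by unfold_locales (fact K h gap emb)+
  note c = constants_nonneg
  \<comment> \<open>the three bounds that the Gronwall argument and the propagation of the sup bound require\<close>
  define s0 where "s0 = min 1 (min (1 / (2 * cA)) (1 / (emb\<^sup>2 * (cQ + 1))))"
  define Cf where "Cf = 2 / (gap * \<epsilon>\<^sup>2) * cS + 2 / \<epsilon>\<^sup>2 * cS + cS + (1 / gap + 1) * (2 / M) * cS + T * cG + 1"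
  have s0: "s0 > 0" using c emb by (simp add: s0_def)
  have Cf: "Cf > 0" using c gap M T by (simp add: Cf_def add_nonneg_pos)
  have est: "let e\<phi> = (\<lambda>n x. \<phi> (real n * dt) x - \<phi>s n x);
           ew = (\<lambda>n x. w (real n * dt) x - ws n x);
           eu = (\<lambda>n x. U (real n * dt) x - Us n x)
       in (norm2 a b (e\<phi> (m+1)))\<^sup>2 + (grad_norm2 a b (e\<phi> (m+1)))\<^sup>2 + (norm2 a b (eu (m+1)))\<^sup>2
          + dt * (\<Sum>n=0..m. (norm2 a b (ew (n+1)))\<^sup>2 + (grad_norm2 a b (ew (n+1)))\<^sup>2)
          \<le> Cf * dt\<^sup>2"
    if dt: "dt > 0" "T = real N * dt" "dt \<le> s0" and sch: "scheme_solution a b M \<epsilon> B F \<phi>0 dt N \<phi>s ws Us"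
      and m: "real m \<le> T / dt - 1" for dt N \<phi>s ws Us m
  proof -
    interpret sc: sav_scheme a b M \<epsilon> B T F \<phi>0 \<phi> w U \<phi>t \<phi>tt Ut K C L h h' gap emb dt N \<phi>s ws Us
      by unfold_locales (fact dt sch)+
    have le: "dt \<le> 1" "dt \<le> 1 / (2 * cA)" "dt \<le> 1 / (emb\<^sup>2 * (cQ + 1))" using dt(3) by (auto simp: s0_def)
    have s1: "cA * dt \<le> 1/2" using le(2) c by (simp add: field_simps)
    have "0 < emb\<^sup>2 * (cQ + 1)" using c emb by simp
    then have "emb\<^sup>2 * (cQ + 1) * dt \<le> 1" using le(3) by (simp only: pos_le_divide_eq mult.commute)
    then have "emb\<^sup>2 * (cQ * dt) \<le> 1"
    proof -
      have "emb\<^sup>2 * (cQ * dt) \<le> emb\<^sup>2 * (cQ + 1) * dt" using dt by (simp add: algebra_simps)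
      then show ?thesis using \<open>emb\<^sup>2 * (cQ + 1) * dt \<le> 1\<close> by linarith
    qed
    then have "sqrt (emb\<^sup>2 * (cQ * dt)) \<le> sqrt 1" by (rule real_sqrt_le_mono)
    then have s3: "emb * sqrt (cQ * dt) \<le> 1" using emb by (simp add: real_sqrt_mult)
    have "T / dt = real N" using dt by simp
    then have "Suc m \<le> N" using m by linarith
    from sc.error_estimate[OF s1 le(1) s3 this]
    show ?thesis by (simp add: sc.E_def[abs_def] sc.W_def[abs_def] sc.Y_def[abs_def] Cf_def Let_def)
  qed
  show ?thesis
    by (rule exI[of _ s0], rule conjI[OF s0], rule exI[of _ Cf], rule conjI[OF Cf]) (use est in blast)
qed

end
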